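(* Let $a,b$ satisfy the Lipschitz condition and the linear-growth bound stated in the context. For any $(\boldsymbol\varphi,\boldsymbol\xi)$, where $\boldsymbol\varphi\in\mathbb R^{R\times d}$ has orthonormal rows and the $\mathscr F_0$-measurable $\boldsymbol\xi\in L^2(\Omega;\mathbb R^R)$ satisfies $\|\boldsymbol\xi\|_{[L^2(\Omega)]^R}=\rho>0$ and $\|C_{\boldsymbol\xi}^{-1}\|_{\mathrm F}=\gamma>0$ (in particular $C_{\boldsymbol\xi}=\mathbb E[\boldsymbol\xi\boldsymbol\xi^\top]$ is invertible), the DO equations $$C_{\boldsymbol Y_t}\dot{\boldsymbol U}_t=\mathbb E[\boldsymbol Y_t a(t,\boldsymbol U_t^\top\boldsymbol Y_t)^\top](I_{d\times d}-P^{\mathrm{row}}_{\boldsymbol U_t}),\qquad d\boldsymbol Y_t=\boldsymbol U_t a(t,\boldsymbol U_t^\top\boldsymbol Y_t)\,dt+\boldsymbol U_t b(t,\boldsymbol U_t^\top\boldsymbol Y_t)\,dW_t$$ with the initial condition $(\boldsymbol U_0,\boldsymbol Y_0)=(\boldsymbol\varphi,\boldsymbol\xi)$ have a local (in time) strong DO solution $(\boldsymbol U,\boldsymbol Y)\in\mathbb D_{\mathrm{det}}\times\mathbb D_{\mathrm{sto}}$ on $[0,\delta]$, with $\delta$, $\mathbb D_{\mathrm{det}}$, $\mathbb D_{\mathrm{sto}}$ as defined in the context.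
   Context: Let $(\Omega,\mathscr F,\mathbb P;(\mathscr F_t)_{t\ge0})$ be a filtered complete probability space with the usual conditions and $W$ a standard $m$-dimensional $(\mathscr F_t)$-Brownian motion. $|\cdot|$ is the Euclidean norm, $\|\cdot\|_{\mathrm F}$ the Frobenius norm, and $R\le d$ are positive integers. $a:[0,\infty)\times\mathbb R^d\to\mathbb R^d$ and $b:[0,\infty)\times\mathbb R^d\to\mathbb R^{d\times m}$ are jointly measurable. Lipschitz condition: for some $C_{\mathrm{Lip}}>0$, $|a(s,x)-a(s,y)|\le C_{\mathrm{Lip}}|x-y|$ and $\|b(s,x)-b(s,y)\|_{\mathrm F}\le C_{\mathrm{Lip}}|x-y|$ for all $s\geq 0$, $x,y\in\mathbb R^d$. Linear-growth bound: for some $C_{\mathrm{lgb}}>0$, $|a(s,x)|^2+\|b(s,x)\|_{\mathrm F}^2\le C_{\mathrm{lgb}}(1+|x|^2)$ for all $s\geq 0$, $x\in\mathbb R^d$. Strong DO solution. Write $C_{\boldsymbol Y_t}=\mathbb E[\boldsymbol Y_t\boldsymbol Y_t^\top]\in\mathbb R^{R\times R}$ and let $P^{\mathrm{row}}_{\boldsymbol U_t}\in\mathbb R^{d\times d}$ be the orthogonal projection onto the span of the rows of $\boldsymbol U_t$. $(\boldsymbol U,\boldsymbol Y):[0,T]\to\mathbb R^{R\times d}\times L^2(\Omega;\mathbb R^R)$ is a strong DO solution on $[0,T]$ if (1) $\boldsymbol U_0$ has orthonormal rows and $\boldsymbol Y_0\in L^2(\Omega;\mathbb R^R)$ has linearly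 independent components; (2) $t\mapsto\boldsymbol U_t$ is absolutely continuous on $[0,T]$ and $\boldsymbol U_t\dot{\boldsymbol U}_t^\top=0$ for a.e. $t$; (3) $\boldsymbol Y$ has almost surely continuous paths, is $(\mathscr F_t)$-adapted, and for every $t\in[0,T]$ the components $Y^1_t,\dots,Y^R_t$ are linearly independent in $L^2(\Omega)$; (4) the first DO equation holds for a.e. $t\in[0,T]$ and $\boldsymbol Y$ is a strong solution of the second one on $[0,T]$. Constants and sets. Let $\eta(p,q):=-p+\sqrt{p^2+\frac1{2q}}$ for $p,q>0$ and $\eta:=\min\{\eta(\sqrt R,\sqrt R),\eta(\rho,\gamma)\}$. Let $$\delta:=\min\Big\{1,\frac{\min\{1,\eta^2\}}{36RC_{\mathrm{lgb}}(1+3R(3\rho^2+1))},\frac{\min\{\eta^2,R\}}{8\gamma^2(3\rho^2+1)C_{\mathrm{lgb}}(1+3R(3\rho^2+1))}\Big\}.$$ $B_\eta(\boldsymbol\varphi)$ is the open ball of radius $\eta$ around $\boldsymbol\varphi$ in $\mathbb R^{R\times d}$ (norm $\|\cdot\|_{\mathrm F}$), and $B_\eta(\boldsymbol\xi)$ the open ball of radius $\eta$ around $\boldsymbol\xi$ in $[L^2(\Omega)]^R$, with norm $\|\boldsymbol Z\|_{[L^2(\Omega)]^R}^2=\mathbb E[|\boldsymbol Z|^2]$. $\mathbb D_{\mathrm{det}}$ is the set of $\boldsymbol V\in C([0,\delta];\mathbb R^{R\times d})$ with $\sup_{0\le t\le\delta}\|\boldsymbol V_t\|_{\mathrm F}^2\le3R$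 and $\boldsymbol V_t\in B_\eta(\boldsymbol\varphi)$ for all $t\in[0,\delta]$. $\mathbb D_{\mathrm{sto}}$ is the set of $(\mathscr F_t)$-adapted $\boldsymbol Z\in L^2(\Omega;C([0,\delta];\mathbb R^R))$ with $\mathbb E[\sup_{0\le t\le\delta}|\boldsymbol Z_t|^2]\le3\rho^2+1$ and $\boldsymbol Z_t\in B_\eta(\boldsymbol\xi)$ for all $t\in[0,\delta]$. *)

theory Defs
  imports "HOL-Probability.Probability"
begin

section \<open>Filtered probability spaces and Brownian motion\<close>

text \<open>Time is \<open>{0..}\<close>; the values of time-indexed families at negative reals are irrelevant
  and unconstrained.\<close>

locale filtered_prob_space = prob_space M + complete_measure M for M :: "'w measure" +
  fixes F :: "real \<Rightarrow> 'w measure"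
  assumes subalg: "\<And>t. 0 \<le> t \<Longrightarrow> subalgebra M (F t)"
    and F_mono: "\<And>s t. 0 \<le> s \<Longrightarrow> s \<le> t \<Longrightarrow> sets (F s) \<subseteq> sets (F t)"
    and F_null: "null_sets M \<subseteq> sets (F 0)"
    and F_right_cont: "\<And>t. 0 \<le> t \<Longrightarrow> sets (F t) = (\<Inter>s\<in>{t<..}. sets (F s))"

locale brownian_motion = filtered_prob_space M F for M :: "'w measure" and F +
  fixes W :: "real \<Rightarrow> 'w \<Rightarrow> real ^ 'm"
  assumes W_adapted: "\<And>t. 0 \<le> t \<Longrightarrow> W t \<in> borel_measurable (F t)"
    and W_zero: "AE \<omega> in M. W 0 \<omega> = 0"
    and W_cont: "AE \<omega> in M. continuous_on {0..} (\<lambda>t. W t \<omega>)"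
    and W_indep: "\<And>s t. 0 \<le> s \<Longrightarrow> s < t \<Longrightarrow>
      indep_set (sets (F s)) (sets (vimage_algebra (space M) (\<lambda>\<omega>. W t \<omega> - W s \<omega>) borel))"
    and W_components_indep: "\<And>s t. 0 \<le> s \<Longrightarrow> s < t \<Longrightarrow>
      indep_vars (\<lambda>_. borel) (\<lambda>j \<omega>. (W t \<omega> - W s \<omega>) $ j) UNIV"
    and W_normal: "\<And>s t j. 0 \<le> s \<Longrightarrow> s < t \<Longrightarrow>
      distributed M lborel (\<lambda>\<omega>. (W t \<omega> - W s \<omega>) $ j)
        (\<lambda>x. ennreal (normal_density 0 (sqrt (t - s)) x))"

definition adapted_on :: "(real \<Rightarrow> 'w measure) \<Rightarrow> real set \<Rightarrow>
    (real \<Rightarrow> 'w \<Rightarrow> 'b::topological_space) \<Rightarrow> bool" where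
  "adapted_on F I X \<longleftrightarrow> (\<forall>t\<in>I. X t \<in> borel_measurable (F t))"

section \<open>The Ito integral\<close>

definition progressive :: "(real \<Rightarrow> 'w measure) \<Rightarrow> real \<Rightarrow> (real \<Rightarrow> 'w \<Rightarrow> real) \<Rightarrow> bool" where
  "progressive F T H \<longleftrightarrow>
    (\<forall>r\<in>{0..T}. (\<lambda>(s, \<omega>). H s \<omega>) \<in> borel_measurable (restrict_space borel {0..r} \<Otimes>\<^sub>M F r))"

text \<open>A simple process is the sum over \<open>i < n\<close> of \<open>\<zeta> i\<close> times the indicator of
  \<open>{\<tau> i<..\<tau> (Suc i)}\<close>.\<close>

definition simple_process ::
    "'w measure \<Rightarrow> (real \<Rightarrow> 'w measure) \<Rightarrow> nat \<Rightarrow> (nat \<Rightarrow> real) \<Rightarrow> (nat \<Rightarrow> 'w \<Rightarrow> real) \<Rightarrow> bool" where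
  "simple_process M F n \<tau> \<zeta> \<longleftrightarrow>
    0 \<le> \<tau> 0 \<and> (\<forall>i<n. \<tau> i \<le> \<tau> (Suc i)) \<and>
    (\<forall>i<n. \<zeta> i \<in> borel_measurable (F (\<tau> i)) \<and> bounded (\<zeta> i ` space M))"

definition simple_value :: "nat \<Rightarrow> (nat \<Rightarrow> real) \<Rightarrow> (nat \<Rightarrow> 'w \<Rightarrow> real) \<Rightarrow> real \<Rightarrow> 'w \<Rightarrow> real" where
  "simple_value n \<tau> \<zeta> s \<omega> = (\<Sum>i<n. \<zeta> i \<omega> * indicator {\<tau> i<..\<tau> (Suc i)} s)"

definition simple_integral ::
    "(real \<Rightarrow> 'w \<Rightarrow> real) \<Rightarrow> nat \<Rightarrow> (nat \<Rightarrow> real) \<Rightarrow> (nat \<Rightarrow> 'w \<Rightarrow> real) \<Rightarrow> real \<Rightarrow> 'w \<Rightarrow> real" where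
  "simple_integral w n \<tau> \<zeta> t \<omega> =
    (\<Sum>i<n. \<zeta> i \<omega> * (w (min (\<tau> (Suc i)) t) \<omega> - w (min (\<tau> i) t) \<omega>))"

definition null_in_prob :: "'w measure \<Rightarrow> (nat \<Rightarrow> 'w \<Rightarrow> ennreal) \<Rightarrow> bool" where
  "null_in_prob M X \<longleftrightarrow> (\<forall>n. X n \<in> borel_measurable M) \<and>
    (\<forall>\<epsilon>>0. (\<lambda>n. measure M {\<omega> \<in> space M. ennreal \<epsilon> < X n \<omega>}) \<longlonglongrightarrow> 0)"

text \<open>\<open>has_ito_integral M F w H t I\<close>: the random variable \<open>I\<close> is (a version of) the Ito integral
  of \<open>H\<close> over \<open>{0..t}\<close> with respect to the scalar Brownian motion \<open>w\<close>. As usual, integrands are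
  progressively measurable with almost surely square integrable paths, and the integral is the
  limit in probability of integrals of simple processes. The process \<open>K\<close> lets \<open>H\<close> be arbitrary
  on a null event, which is needed since solutions only have almost surely continuous paths.\<close>

definition has_ito_integral :: "'w measure \<Rightarrow> (real \<Rightarrow> 'w measure) \<Rightarrow> (real \<Rightarrow> 'w \<Rightarrow> real) \<Rightarrow>
    (real \<Rightarrow> 'w \<Rightarrow> real) \<Rightarrow> real \<Rightarrow> ('w \<Rightarrow> real) \<Rightarrow> bool" where
  "has_ito_integral M F w H t I \<longleftrightarrow> I \<in> borel_measurable M \<and>
    (\<exists>K. progressive F t K \<and> (AE \<omega> in M. \<forall>s\<in>{0..t}. K s \<omega> = H s \<omega>) \<and>
      (AE \<omega> in M. (\<integral>\<^sup>+s\<in>{0..t}. ennreal ((K s \<omega>)\<^sup>2) \<partial>lborel) < \<infinity>) \<and>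
      (\<exists>n \<tau> \<zeta>. (\<forall>k. simple_process M F (n k) (\<tau> k) (\<zeta> k)) \<and>
        null_in_prob M (\<lambda>k \<omega>. \<integral>\<^sup>+s\<in>{0..t}.
          ennreal ((simple_value (n k) (\<tau> k) (\<zeta> k) s \<omega> - K s \<omega>)\<^sup>2) \<partial>lborel) \<and>
        null_in_prob M (\<lambda>k \<omega>. ennreal \<bar>simple_integral w (n k) (\<tau> k) (\<zeta> k) t \<omega> - I \<omega>\<bar>)))"

definition has_matrix_ito_integral :: "'w measure \<Rightarrow> (real \<Rightarrow> 'w measure) \<Rightarrow>
    (real \<Rightarrow> 'w \<Rightarrow> real ^ 'm) \<Rightarrow> (real \<Rightarrow> 'w \<Rightarrow> real ^ 'm ^ 'k) \<Rightarrow> real \<Rightarrow> ('w \<Rightarrow> real ^ 'k) \<Rightarrow> bool" where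
  "has_matrix_ito_integral M F W B t I \<longleftrightarrow>
    (\<exists>J. (\<forall>i j. has_ito_integral M F (\<lambda>s \<omega>. W s \<omega> $ j) (\<lambda>s \<omega>. B s \<omega> $ i $ j) t (J i j)) \<and>
      (\<forall>\<omega>\<in>space M. I \<omega> = (\<chi> i. \<Sum>j\<in>UNIV. J i j \<omega>)))"

section \<open>Strong DO solutions\<close>

text \<open>Matrices of shape $p \times q$ have type \<open>real ^ 'q ^ 'p\<close>; the library norm on this type is
  the Frobenius norm.\<close>

definition orthonormal_rows :: "real ^ 'd ^ 'r \<Rightarrow> bool" where
  "orthonormal_rows U \<longleftrightarrow> (\<forall>i j. row i U \<bullet> row j U = (if i = j then 1 else 0))"

definition row_projection :: "real ^ 'd ^ 'r \<Rightarrow> real ^ 'd ^ 'd" where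
  "row_projection U = matrix (closest_point (span (rows U)))"

definition outer_prod :: "real ^ 'p \<Rightarrow> real ^ 'q \<Rightarrow> real ^ 'q ^ 'p" where
  "outer_prod x y = (\<chi> i j. x $ i * y $ j)"

definition in_L2 :: "'w measure \<Rightarrow> ('w \<Rightarrow> real ^ 'r) \<Rightarrow> bool" where
  "in_L2 M X \<longleftrightarrow> X \<in> borel_measurable M \<and> integrable M (\<lambda>\<omega>. (norm (X \<omega>))\<^sup>2)"

definition L2_norm :: "'w measure \<Rightarrow> ('w \<Rightarrow> real ^ 'r) \<Rightarrow> real" where
  "L2_norm M X = sqrt (\<integral>\<omega>. (norm (X \<omega>))\<^sup>2 \<partial>M)"

definition gram :: "'w measure \<Rightarrow> ('w \<Rightarrow> real ^ 'r) \<Rightarrow> real ^ 'r ^ 'r" where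
  "gram M X = (\<integral>\<omega>. outer_prod (X \<omega>) (X \<omega>) \<partial>M)"

definition components_independent :: "'w measure \<Rightarrow> ('w \<Rightarrow> real ^ 'r) \<Rightarrow> bool" where
  "components_independent M X \<longleftrightarrow>
    (\<forall>c. (AE \<omega> in M. (\<Sum>i\<in>UNIV. c $ i * X \<omega> $ i) = 0) \<longrightarrow> c = 0)"

definition abs_continuous_on :: "real \<Rightarrow> real \<Rightarrow> (real \<Rightarrow> 'b::real_normed_vector) \<Rightarrow> bool" where
  "abs_continuous_on A B f \<longleftrightarrow> (\<forall>\<epsilon>>0. \<exists>\<theta>>0. \<forall>(n::nat) x y.
    (\<forall>i<n. A \<le> x i \<and> x i \<le> y i \<and> y i \<le> B) \<and>
    (\<forall>i<n. \<forall>j<n. i \<noteq> j \<longrightarrow> {x i<..<y i} \<inter> {x j<..<y j} = {}) \<and>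
    (\<Sum>i<n. y i - x i) < \<theta> \<longrightarrow>
    (\<Sum>i<n. norm (f (y i) - f (x i))) < \<epsilon>)"

definition DO_first_equation :: "'w measure \<Rightarrow> (real \<Rightarrow> real ^ 'd \<Rightarrow> real ^ 'd) \<Rightarrow> real \<Rightarrow>
    (real \<Rightarrow> real ^ 'd ^ 'r) \<Rightarrow> (real \<Rightarrow> 'w \<Rightarrow> real ^ 'r) \<Rightarrow> bool" where
  "DO_first_equation M a T U Y \<longleftrightarrow> (AE t in lborel. t \<in> {0..T} \<longrightarrow>
    (\<exists>D. (U has_vector_derivative D) (at t within {0..T}) \<and>
      integrable M (\<lambda>\<omega>. outer_prod (Y t \<omega>) (a t (transpose (U t) *v Y t \<omega>))) \<and>
      gram M (Y t) ** D =
        (\<integral>\<omega>. outer_prod (Y t \<omega>) (a t (transpose (U t) *v Y t \<omega>)) \<partial>M)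
          ** (mat 1 - row_projection (U t))))"

definition DO_second_equation :: "'w measure \<Rightarrow> (real \<Rightarrow> 'w measure) \<Rightarrow> (real \<Rightarrow> 'w \<Rightarrow> real ^ 'm) \<Rightarrow>
    (real \<Rightarrow> real ^ 'd \<Rightarrow> real ^ 'd) \<Rightarrow> (real \<Rightarrow> real ^ 'd \<Rightarrow> real ^ 'm ^ 'd) \<Rightarrow> real \<Rightarrow>
    (real \<Rightarrow> real ^ 'd ^ 'r) \<Rightarrow> (real \<Rightarrow> 'w \<Rightarrow> real ^ 'r) \<Rightarrow> bool" where
  "DO_second_equation M F W a b T U Y \<longleftrightarrow>
    (AE \<omega> in M. set_integrable lborel {0..T}
      (\<lambda>s. U s *v a s (transpose (U s) *v Y s \<omega>))) \<and>
    (\<forall>t\<in>{0..T}. \<exists>I.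
      has_matrix_ito_integral M F W (\<lambda>s \<omega>. U s ** b s (transpose (U s) *v Y s \<omega>)) t I \<and>
      (AE \<omega> in M. Y t \<omega> = Y 0 \<omega> +
        (LINT s:{0..t}|lborel. U s *v a s (transpose (U s) *v Y s \<omega>)) + I \<omega>))"

definition strong_DO_solution :: "'w measure \<Rightarrow> (real \<Rightarrow> 'w measure) \<Rightarrow> (real \<Rightarrow> 'w \<Rightarrow> real ^ 'm) \<Rightarrow>
    (real \<Rightarrow> real ^ 'd \<Rightarrow> real ^ 'd) \<Rightarrow> (real \<Rightarrow> real ^ 'd \<Rightarrow> real ^ 'm ^ 'd) \<Rightarrow> real \<Rightarrow>
    (real \<Rightarrow> real ^ 'd ^ 'r) \<Rightarrow> (real \<Rightarrow> 'w \<Rightarrow> real ^ 'r) \<Rightarrow> bool" where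
  "strong_DO_solution M F W a b T U Y \<longleftrightarrow>
    (\<forall>t\<in>{0..T}. in_L2 M (Y t)) \<and>
    orthonormal_rows (U 0) \<and> components_independent M (Y 0) \<and>
    abs_continuous_on 0 T U \<and>
    (AE t in lborel. t \<in> {0..T} \<longrightarrow>
      (\<exists>D. (U has_vector_derivative D) (at t within {0..T}) \<and> U t ** transpose D = 0)) \<and>
    (AE \<omega> in M. continuous_on {0..T} (\<lambda>t. Y t \<omega>)) \<and>
    adapted_on F {0..T} Y \<and>
    (\<forall>t\<in>{0..T}. components_independent M (Y t)) \<and>
    DO_first_equation M a T U Y \<and>
    DO_second_equation M F W a b T U Y"

section \<open>Constants and solution sets\<close>

definition eta_fun :: "real \<Rightarrow> real \<Rightarrow> real" where
  "eta_fun p q = - p + sqrt (p\<^sup>2 + 1 / (2 * q))"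

definition DO_eta :: "nat \<Rightarrow> real \<Rightarrow> real \<Rightarrow> real" where
  "DO_eta R \<rho> \<gamma> = min (eta_fun (sqrt (real R)) (sqrt (real R))) (eta_fun \<rho> \<gamma>)"

definition DO_delta :: "nat \<Rightarrow> real \<Rightarrow> real \<Rightarrow> real \<Rightarrow> real" where
  "DO_delta R \<rho> \<gamma> C\<^sub>l\<^sub>g\<^sub>b = Min {1,
    min 1 ((DO_eta R \<rho> \<gamma>)\<^sup>2) / (36 * real R * C\<^sub>l\<^sub>g\<^sub>b * (1 + 3 * real R * (3 * \<rho>\<^sup>2 + 1))),
    min ((DO_eta R \<rho> \<gamma>)\<^sup>2) (real R) /
      (8 * \<gamma>\<^sup>2 * (3 * \<rho>\<^sup>2 + 1) * C\<^sub>l\<^sub>g\<^sub>b * (1 + 3 * real R * (3 * \<rho>\<^sup>2 + 1)))}"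

text \<open>Elements of the two sets are functions on all of \<open>real\<close>, constrained on \<open>{0..\<delta>}\<close> only.\<close>

definition D_det :: "real \<Rightarrow> real \<Rightarrow> real ^ 'd ^ 'r \<Rightarrow> (real \<Rightarrow> real ^ 'd ^ 'r) set" where
  "D_det \<delta> \<eta> \<phi> = {V. continuous_on {0..\<delta>} V \<and>
    (SUP t\<in>{0..\<delta>}. (norm (V t))\<^sup>2) \<le> 3 * real CARD('r) \<and>
    (\<forall>t\<in>{0..\<delta>}. V t \<in> ball \<phi> \<eta>)}"

text \<open>Membership in $L^2(\Omega; C([0,\delta]; \mathbb R^R))$ is almost sure path continuity, measurability
  (from adaptedness) and the finite second moment of the supremum implied by the stated bound.\<close>

definition D_sto :: "'w measure \<Rightarrow> (real \<Rightarrow> 'w measure) \<Rightarrow> real \<Rightarrow> real \<Rightarrow> real \<Rightarrow> ('w \<Rightarrow> real ^ 'r) \<Rightarrow>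
    (real \<Rightarrow> 'w \<Rightarrow> real ^ 'r) set" where
  "D_sto M F \<delta> \<eta> \<rho> \<xi> = {Z. adapted_on F {0..\<delta>} Z \<and>
    (AE \<omega> in M. continuous_on {0..\<delta>} (\<lambda>t. Z t \<omega>)) \<and>
    (\<integral>\<^sup>+\<omega>. (SUP t\<in>{0..\<delta>}. ennreal ((norm (Z t \<omega>))\<^sup>2)) \<partial>M) \<le> ennreal (3 * \<rho>\<^sup>2 + 1) \<and>
    (\<forall>t\<in>{0..\<delta>}. L2_norm M (\<lambda>\<omega>. Z t \<omega> - \<xi> \<omega>) < \<eta>)}"

end

theory Submission
  imports Defs
begin

text \<open>
  On matrices with orthonormal rows the row projection is \<open>transpose U ** U\<close>. With this substitution
  the DO equations become an Ito equation coupled to an ordinary differential equation whose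
  coefficients are bounded and Lipschitz on the balls of radius \<open>\<eta>\<close>: there the Gram matrix stays within
  \<open>1 / (2 * \<gamma>)\<close> of the initial one, so its inverse is bounded by \<open>2 * \<gamma>\<close>. The choice of \<open>\<delta>\<close> keeps Picard
  iterates in the balls, and an exponential weight makes them converge on all of \<open>{0..\<delta>}\<close>. For the
  limit the defect \<open>mat 1 - U ** transpose U\<close> satisfies a linear homogeneous Volterra inequality with
  initial value zero; hence the rows stay orthonormal and the substitution was legitimate.

  The Ito integral is built as the \<open>L\<^sup>2\<close> limit of dyadic step integrals, using a version of the Brownian
  motion all of whose paths are continuous; Doob's maximal inequality gives continuous paths of the
  integral.
\<close>

text \<open>The equations are of mean-field type: their coefficients contain the expectations
  \<open>gram\<close> and \<open>cross\<close>. The iteration therefore runs on pairs of a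
  deterministic path and a process, with distances in the Frobenius norm and in mean square. Picard
  iterates lose the orthonormality of the rows, but \<open>transpose V ** V\<close> is Lipschitz on
  the whole ball around \<open>\<phi>\<close>, and \<open>\<eta> \<le> 1 / 4\<close> keeps
  \<open>mat 1 - transpose V ** V\<close> a contraction there. The number \<open>eta_fun p q\<close>
  is the positive root of y^2 + 2 p y = 1 / (2 q); for p = \<rho> and q = \<gamma> the left side
  bounds the change of the Gram matrix over a mean square distance y. The balls of the theorem are
  open, whereas limits only stay in closed ones. The iteration therefore uses closed balls, the
  Picard map sends them into the open ones, and strictness is read off the Picard image of the
  limit. That image agrees with the limit process only almost surely at each time; path continuity
  and a countable dense set of times carry this over to the supremum.\<close>

section \<open>Differentiation of indefinite integrals\<close>

text \<open>The points at which the difference quotients stay away from the integrand are covered, by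
  Vitali's theorem, by disjoint intervals on which Henstock's lemma makes the total error small.\<close>

theorem lebesgue_differentiation:
  fixes f :: "real \<Rightarrow> 'b::euclidean_space"
  assumes intf: "f integrable_on {a..b}"
  obtains N where "negligible N"
    "\<And>x. x \<in> {a..b} - N \<Longrightarrow> ((\<lambda>t. integral {a..t} f) has_vector_derivative f x) (at x within {a..b})"
proof -
  define G where "G t = integral {a..t} f" for t
  define bad where "bad k x y \<longleftrightarrow> y \<in> {a..b} \<and> y \<noteq> x \<and>
    norm (G y - G x - (y - x) *\<^sub>R f x) > \<bar>y - x\<bar> / real (Suc k)" for k x y
  \<comment> \<open>Outside all \<open>E k\<close> the difference quotients of \<open>G\<close>
    converge to \<open>f x\<close>; so it is enough that each \<open>E k\<close> is
    negligible.\<close>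
  define E where "E k = {x\<in>{a..b}. \<forall>d>0. \<exists>y. bad k x y \<and> \<bar>y - x\<bar> < d}" for k
  \<comment> \<open>A pair stands for the interval between a tag \<open>fst p\<close> and a bad
    second endpoint on either side of it. The form as a ball is the one that the Vitali theorem
    takes.\<close>
  define seg where "seg p = {min (fst p) (snd p)..max (fst p) (snd p)}" for p :: "real \<times> real"
  have seg_cball: "seg p = cball ((fst p + snd p) / 2) (\<bar>snd p - fst p\<bar> / 2)" for p
    by (auto simp: seg_def cball_def dist_real_def field_simps split: if_splits abs_split)
  have GI: "integral {s..t} f = G t - G s" if "a \<le> s" "s \<le> t" "t \<le> b" for s t
  proof -
    have "f integrable_on {a..t}"
      using intf that by (auto intro: integrable_subinterval_real)
    from Henstock_Kurzweil_Integration.integral_combine[OF that(1,2) this] show ?thesis by (simp add: G_def algebra_simps)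
  qed
  have neg: "negligible (E k)" for k
    unfolding negligible_outer_le
  proof (intro allI impI)
    fix e :: real assume "e > 0"
    \<comment> \<open>The divisor \<open>Suc k\<close> cancels at the end: each bad interval
      contributes at least its length divided by \<open>Suc k\<close> to Henstock's sum.\<close>
    then have e': "e / real (Suc k) > 0" by simp
    from intf have "f integrable_on cbox a b" by simp
    from Henstock_lemma[OF this e'] obtain \<gamma> where g: "gauge \<gamma>"
      and \<gamma>: "\<And>p. p tagged_partial_division_of (cbox a b) \<Longrightarrow> \<gamma> fine p \<Longrightarrow>
             sum (\<lambda>(x,k). norm (measure lborel k *\<^sub>R f x - integral k f)) p < e / real (Suc k)"
      by blast
    define K where "K = {p. fst p \<in> E k \<and> bad k (fst p) (snd p) \<and> seg p \<subseteq> \<gamma> (fst p)}"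
    have Kne: "fst p \<noteq> snd p" if "p \<in> K" for p using that by (auto simp: K_def bad_def)
    have r: "0 < \<bar>snd p - fst p\<bar> / 2" if "p \<in> K" for p
      using Kne[OF that] by auto
    have S: "\<exists>p. p \<in> K \<and> x \<in> cball ((fst p + snd p) / 2) (\<bar>snd p - fst p\<bar> / 2) \<and> \<bar>snd p - fst p\<bar> / 2 < d"
      if x: "x \<in> E k" and d: "d > 0" for x d
    proof -
      have "x \<in> \<gamma> x" "open (\<gamma> x)" using g by (auto simp: gauge_def)
      then obtain d' where d': "d' > 0" "cball x d' \<subseteq> \<gamma> x" by (meson open_contains_cball)
      have "\<forall>d>0. \<exists>y. bad k x y \<and> \<bar>y - x\<bar> < d" using x by (simp add: E_def)
      moreover have "min d d' > 0" using d d' by simp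
      ultimately obtain y where y: "bad k x y" "\<bar>y - x\<bar> < min d d'" by blast
      have "seg (x, y) \<subseteq> cball x d'"
        using y(2) by (auto simp: seg_def dist_real_def min_def max_def split: if_splits)
      then have "(x, y) \<in> K" using x y d' by (auto simp: K_def)
      moreover have "x \<in> seg (x, y)" by (auto simp: seg_def)
      ultimately show ?thesis using y(2)
        by (intro exI[of _ "(x, y)"]) (auto simp: seg_cball)
    qed
    obtain C where C: "countable C" "C \<subseteq> K"
      "pairwise (\<lambda>i j. disjnt (cball ((fst i + snd i) / 2) (\<bar>snd i - fst i\<bar> / 2))
          (cball ((fst j + snd j) / 2) (\<bar>snd j - fst j\<bar> / 2))) C"
      "negligible (E k - (\<Union>i\<in>C. cball ((fst i + snd i) / 2) (\<bar>snd i - fst i\<bar> / 2)))"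
      using Vitali_covering_theorem_cballs[of K "\<lambda>p. \<bar>snd p - fst p\<bar> / 2" "E k" "\<lambda>p. (fst p + snd p) / 2", OF r S]
      by blast
    have disj: "seg p \<inter> seg q = {}" if "p \<in> C" "q \<in> C" "p \<noteq> q" for p q
      using C(3) that unfolding pairwise_def disjnt_def seg_cball by blast
    have fst_seg: "fst p \<in> seg p" for p by (auto simp: seg_def)
    \<comment> \<open>Finitely many of the disjoint intervals form a fine partial tagged division,
      so Henstock's lemma bounds their total length. A bound for all finite subfamilies passes to
      the countable union.\<close>
    have bnd: "measure lebesgue (\<Union>p\<in>I. seg p) \<le> e" if I: "I \<subseteq> C" "finite I" for I
    proof -
      define P where "P = (\<lambda>p. (fst p, seg p)) ` I"
      have inj: "inj_on (\<lambda>p. (fst p, seg p)) I"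
      proof (rule inj_onI)
        fix p q assume "p \<in> I" "q \<in> I" "(fst p, seg p) = (fst q, seg q)"
        then show "p = q" using disj[of p q] I(1) fst_seg by (metis disjoint_iff old.prod.inject subsetD)
      qed
      have sub: "seg p \<subseteq> {a..b}" if "p \<in> C" for p
        using that C(2) by (auto simp: K_def E_def bad_def seg_def)
      have "P tagged_partial_division_of cbox a b"
        unfolding tagged_partial_division_of_def
      proof (intro conjI allI impI)
        show "finite P" using I by (simp add: P_def)
        fix x S assume "(x, S) \<in> P"
        then obtain p where p: "p \<in> I" "x = fst p" "S = seg p" by (auto simp: P_def)
        show "x \<in> S" using p fst_seg by simp
        have "p \<in> C" using p(1) I(1) by blast
        then show "S \<subseteq> cbox a b" using p(3) sub[of p] by simp
        show "\<exists>a b. S = cbox a b" using p by (auto simp: seg_def)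
      next
        fix x1 K1 x2 K2 assume A: "(x1, K1) \<in> P \<and> (x2, K2) \<in> P \<and> (x1, K1) \<noteq> (x2, K2)"
        then obtain p q where "p \<in> I" "x1 = fst p" "K1 = seg p" "q \<in> I" "x2 = fst q" "K2 = seg q"
          by (auto simp: P_def)
        with A disj[of p q] I(1) show "interior K1 \<inter> interior K2 = {}"
          by (metis Int_mono bot.extremum_uniqueI interior_subset subsetD)
      qed
      moreover have "\<gamma> fine P"
        using C(2) I(1) by (auto simp: P_def fine_def K_def)
      ultimately have "sum (\<lambda>(x,k). norm (measure lborel k *\<^sub>R f x - integral k f)) P < e / real (Suc k)"
        by (rule \<gamma>)
      then have *: "(\<Sum>p\<in>I. norm (measure lborel (seg p) *\<^sub>R f (fst p) - integral (seg p) f)) < e / real (Suc k)"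
        unfolding P_def by (simp add: sum.reindex[OF inj])
      \<comment> \<open>Badness of the pair is a lower bound for its Henstock error; only the sign
        depends on which side of the tag the other endpoint lies.\<close>
      have le: "\<bar>snd p - fst p\<bar> / real (Suc k) \<le> norm (measure lborel (seg p) *\<^sub>R f (fst p) - integral (seg p) f)"
        if "p \<in> I" for p
      proof -
        obtain x y where p: "p = (x, y)" by (cases p)
        have K: "bad k x y" "x \<in> {a..b}" using that I C(2) p by (auto simp: K_def E_def)
        show ?thesis
        proof (cases "x \<le> y")
          case True
          then have "measure lborel (seg p) *\<^sub>R f x - integral (seg p) f = - (G y - G x - (y - x) *\<^sub>R f x)"
            using K GI[of x y] by (auto simp: p seg_def bad_def)
          then show ?thesis using K by (simp add: p bad_def norm_minus_commute)
        next
          case False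
          then have "measure lborel (seg p) *\<^sub>R f x - integral (seg p) f = (G y - G x - (y - x) *\<^sub>R f x)"
            using K GI[of y x] by (auto simp: p seg_def bad_def algebra_simps)
          then show ?thesis using K by (simp add: p bad_def)
        qed
      qed
      have "(\<Sum>p\<in>I. \<bar>snd p - fst p\<bar>) / real (Suc k) < e / real (Suc k)"
        using order.strict_trans1[OF sum_mono[OF le] *] by (simp only: sum_divide_distrib)
      then have "(\<Sum>p\<in>I. \<bar>snd p - fst p\<bar>) < e"
        using divide_right_mono[of e "\<Sum>p\<in>I. \<bar>snd p - fst p\<bar>" "real (Suc k)"] by linarith
      moreover have "measure lebesgue (seg p) = \<bar>snd p - fst p\<bar>" for p
        by (auto simp: seg_def)
      moreover have "measure lebesgue (\<Union>p\<in>I. seg p) \<le> (\<Sum>p\<in>I. measure lebesgue (seg p))"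
        using I by (intro measure_UNION_le) (auto simp: seg_def)
      ultimately show ?thesis by simp
    qed
    \<comment> \<open>Vitali's theorem covers \<open>E k\<close> up to a negligible set, which is
      added to the union of the intervals.\<close>
    define T where "T = (E k - (\<Union>p\<in>C. seg p)) \<union> (\<Union>p\<in>C. seg p)"
    have 1: "(\<Union>p\<in>C. seg p) \<in> lmeasurable" "measure lebesgue (\<Union>p\<in>C. seg p) \<le> e"
      using fmeasurable_UN_bound[OF C(1) _ bnd] measure_UN_bound[OF C(1) _ bnd] by (auto simp: seg_def)
    have 2: "negligible (E k - (\<Union>p\<in>C. seg p))"
      using C(4) by (simp add: seg_cball)
    have "measure lebesgue T \<le> measure lebesgue (E k - (\<Union>p\<in>C. seg p)) + measure lebesgue (\<Union>p\<in>C. seg p)"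
      unfolding T_def using 1 2 by (intro measure_Un_le) (auto dest: negligible_imp_measurable fmeasurableD)
    also have "\<dots> \<le> e" using 1 2 by (simp add: negligible_imp_measure0)
    finally have "measure lebesgue T \<le> e" .
    moreover have "T \<in> lmeasurable" using 1 2 unfolding T_def by (intro fmeasurable.Un) (auto intro: negligible_imp_measurable)
    moreover have "E k \<subseteq> T" by (auto simp: T_def)
    ultimately show "\<exists>T. E k \<subseteq> T \<and> T \<in> lmeasurable \<and> measure lebesgue T \<le> e" by blast
  qed
  show thesis
  proof (rule that[of "\<Union>k. E k"])
    show "negligible (\<Union>k. E k)" using neg by (rule negligible_Union_nat)
    fix x assume x: "x \<in> {a..b} - (\<Union>k. E k)"
    have "\<exists>d>0. \<forall>y\<in>{a..b}. norm (y - x) < d \<longrightarrow> norm (G y - G x - (y - x) *\<^sub>R f x) \<le> e * norm (y - x)"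
      if e: "e > 0" for e :: real
    proof -
      obtain k where k: "inverse (real (Suc k)) < e" using e reals_Archimedean by blast
      have "x \<in> {a..b}" "x \<notin> E k" using x by auto
      then obtain d where d: "d > 0" "\<And>y. \<bar>y - x\<bar> < d \<Longrightarrow> \<not> bad k x y"
        unfolding E_def by auto
      have "norm (G y - G x - (y - x) *\<^sub>R f x) \<le> e * norm (y - x)"
        if y: "y \<in> {a..b}" "norm (y - x) < d" for y
      proof (cases "y = x")
        case False
        have "norm (G y - G x - (y - x) *\<^sub>R f x) \<le> \<bar>y - x\<bar> / real (Suc k)"
          using d(2)[of y] y False by (auto simp: bad_def)
        also have "\<dots> \<le> e * norm (y - x)"
          using mult_right_mono[of "inverse (real (Suc k))" e "\<bar>y - x\<bar>"] k by (simp add: divide_inverse mult.commute)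
        finally show ?thesis .
      qed simp
      then show ?thesis using d(1) by blast
    qed
    then have "(G has_vector_derivative f x) (at x within {a..b})"
      unfolding has_vector_derivative_def has_derivative_within_alt
      by (auto intro: bounded_linear_scaleR_left)
    then show "((\<lambda>t. integral {a..t} f) has_vector_derivative f x) (at x within {a..b})"
      by (simp add: G_def[abs_def])
  qed
qed

corollary lebesgue_differentiation_AE:
  fixes f :: "real \<Rightarrow> 'b::euclidean_space"
  assumes "f integrable_on {a..b}"
  shows "AE x in lborel. x \<in> {a..b} \<longrightarrow>
    ((\<lambda>t. integral {a..t} f) has_vector_derivative f x) (at x within {a..b})"
proof -
  obtain N where N: "negligible N"
    "\<And>x. x \<in> {a..b} - N \<Longrightarrow> ((\<lambda>t. integral {a..t} f) has_vector_derivative f x) (at x within {a..b})"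
    using lebesgue_differentiation[OF assms] by blast
  then have "AE x in lebesgue. x \<in> {a..b} \<longrightarrow>
    ((\<lambda>t. integral {a..t} f) has_vector_derivative f x) (at x within {a..b})"
    by (intro AE_I'[of N]) (auto simp: negligible_iff_null_sets)
  then show ?thesis by (simp add: AE_completion_iff)
qed

section \<open>Integrals of bounded functions and a product rule\<close>

lemma set_integrable_bounded:
  fixes f :: "real \<Rightarrow> 'b::{banach, second_countable_topology}"
  assumes "(\<lambda>s. indicator {a..b} s *\<^sub>R f s) \<in> borel_measurable borel"
    and "\<And>s. s \<in> {a..b} \<Longrightarrow> norm (f s) \<le> B"
  shows "set_integrable lborel {a..b} f"
  unfolding set_integrable_def
proof (rule Bochner_Integration.integrable_bound)
  show "integrable lborel (\<lambda>s. indicator {a..b} s * B)" by (intro integrable_mult_left integrable_real_indicator) (auto simp: emeasure_lborel_Icc_eq)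
  show "AE s in lborel. norm (indicator {a..b} s *\<^sub>R f s) \<le> norm (indicator {a..b} s * B)"
    using assms(2) by (auto simp: indicator_def intro!: AE_I2 intro: order_trans[OF _ abs_ge_self])
qed (use assms in auto)

lemma continuous_on_Icc_bounded:
  fixes f :: "real \<Rightarrow> 'b::real_normed_vector"
  assumes "continuous_on {a..b} f"
  obtains B where "\<And>s. s \<in> {a..b} \<Longrightarrow> norm (f s) \<le> B"
proof -
  have "bounded (f ` {a..b})"
    using assms by (intro compact_imp_bounded compact_continuous_image) auto
  then obtain B where "\<forall>x\<in>f ` {a..b}. norm x \<le> B" unfolding bounded_iff by blast
  then show thesis using that by blast
qed

text \<open>Quadratic increments force derivative zero at every point. This gives the product rule
  below for integrals of merely measurable functions, where the factors need not be differentiable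
  everywhere.\<close>

lemma constant_if_quadratic_increments:
  fixes h :: "real \<Rightarrow> real"
  assumes "\<And>s t. 0 \<le> s \<Longrightarrow> s \<le> t \<Longrightarrow> t \<le> T \<Longrightarrow> \<bar>h t - h s\<bar> \<le> C * (t - s)\<^sup>2"
    and t: "t \<in> {0..T}"
  shows "h t = h 0"
proof -
  have C: "\<bar>h y - h x\<bar> \<le> \<bar>C\<bar> * (y - x)\<^sup>2" if "x \<in> {0..T}" "y \<in> {0..T}" for x y
  proof (cases "x \<le> y")
    case True
    then show ?thesis using assms(1)[of x y] that
      by (smt (verit) abs_ge_self atLeastAtMost_iff mult_right_mono zero_le_power2)
  next
    case False
    then have "\<bar>h x - h y\<bar> \<le> \<bar>C\<bar> * (x - y)\<^sup>2" using assms(1)[of y x] that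
      by (smt (verit) abs_ge_self atLeastAtMost_iff mult_right_mono zero_le_power2)
    then show ?thesis by (simp add: abs_minus_commute power2_commute)
  qed
  have "(h has_derivative (\<lambda>_. 0)) (at x within {0..T})" if x: "x \<in> {0..T}" for x
    unfolding has_derivative_within_alt
  proof (intro conjI allI impI)
    fix e :: real assume e: "e > 0"
    show "\<exists>d>0. \<forall>y\<in>{0..T}. norm (y - x) < d \<longrightarrow> norm (h y - h x - 0) \<le> e * norm (y - x)"
    proof (intro exI[of _ "e / (\<bar>C\<bar> + 1)"] conjI ballI impI)
      show "e / (\<bar>C\<bar> + 1) > 0" using e by auto
      fix y assume y: "y \<in> {0..T}" "norm (y - x) < e / (\<bar>C\<bar> + 1)"
      then have "(\<bar>C\<bar> + 1) * \<bar>y - x\<bar> < e" by (simp add: pos_less_divide_eq mult.commute)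
      then have "\<bar>C\<bar> * \<bar>y - x\<bar> \<le> e" by (simp add: algebra_simps)
      then have "\<bar>C\<bar> * \<bar>y - x\<bar> * \<bar>y - x\<bar> \<le> e * \<bar>y - x\<bar>" by (intro mult_right_mono) auto
      moreover have "\<bar>C\<bar> * (y - x)\<^sup>2 = \<bar>C\<bar> * \<bar>y - x\<bar> * \<bar>y - x\<bar>"
        by (metis abs_mult_self_eq mult.assoc power2_eq_square)
      ultimately show "norm (h y - h x - 0) \<le> e * norm (y - x)" using C[OF x y(1)]
        by (simp only: real_norm_def diff_0_right)
    qed
  qed simp
  then obtain c where "\<And>x. x \<in> {0..T} \<Longrightarrow> h x = c"
    using has_derivative_zero_constant[of "{0..T}" h] by auto
  then show ?thesis using t by auto
qed

lemma integral_lipschitz: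
  fixes f :: "real \<Rightarrow> 'b::euclidean_space"
  assumes f: "f integrable_on {0..T}" and B: "\<And>s. s \<in> {0..T} \<Longrightarrow> norm (f s) \<le> B"
    and st: "0 \<le> s" "s \<le> t" "t \<le> T"
  shows "integral {0..t} f - integral {0..s} f = integral {s..t} f"
    and "norm (integral {s..t} f) \<le> B * (t - s)"
    and "norm (integral {0..t} f - integral {0..s} f) \<le> B * (t - s)"
proof -
  have "f integrable_on {0..t}" using f st by (auto intro: integrable_subinterval_real)
  from Henstock_Kurzweil_Integration.integral_combine[OF st(1,2) this]
  show 1: "integral {0..t} f - integral {0..s} f = integral {s..t} f" by (simp add: algebra_simps)
  show 2: "norm (integral {s..t} f) \<le> B * (t - s)"
  proof (cases "s = t")
    case False
    then have "norm (f s) \<le> B" using B st by auto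
    then have "0 \<le> B" using norm_ge_zero order_trans by blast
    moreover have "f integrable_on cbox s t" using f st by (auto intro: integrable_subinterval_real)
    then have "(f has_integral integral {s..t} f) (cbox s t)" by (simp add: integrable_integral)
    from has_integral_bound[OF \<open>0 \<le> B\<close> this] show ?thesis using B st by auto
  qed simp
  show "norm (integral {0..t} f - integral {0..s} f) \<le> B * (t - s)" using 1 2 by simp
qed

text \<open>The difference of the two sides has increments of order \<open>(t - s)\<^sup>2\<close>.
  To see this, the factors are frozen at the left end of a short interval; what remains is a product
  of two small increments and an integral of bounded functions times small increments. The rule is
  applied to the entries of \<open>U ** transpose U\<close>.\<close>

lemma integral_product_rule:
  fixes f g u v :: "real \<Rightarrow> real"
  assumes f: "(\<lambda>s. indicator {0..T} s *\<^sub>R f s) \<in> borel_measurable borel" "\<And>s. s \<in> {0..T} \<Longrightarrow> \<bar>f s\<bar> \<le> B"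
    and g: "(\<lambda>s. indicator {0..T} s *\<^sub>R g s) \<in> borel_measurable borel" "\<And>s. s \<in> {0..T} \<Longrightarrow> \<bar>g s\<bar> \<le> B"
    and u: "\<And>t. t \<in> {0..T} \<Longrightarrow> u t = u 0 + integral {0..t} f"
    and v: "\<And>t. t \<in> {0..T} \<Longrightarrow> v t = v 0 + integral {0..t} g"
    and t: "t \<in> {0..T}"
  shows "(\<lambda>s. f s * v s + u s * g s) integrable_on {0..T}"
    and "u t * v t = u 0 * v 0 + integral {0..t} (\<lambda>s. f s * v s + u s * g s)"
proof -
  have B: "0 \<le> B" using f(2)[OF t] by linarith
  have f': "f integrable_on {0..T}" and g': "g integrable_on {0..T}"
    using f g by (auto intro!: set_borel_integral_eq_integral(1) set_integrable_bounded[where B=B])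
  have cu: "continuous_on {0..T} u"
  proof -
    have "continuous_on {0..T} (\<lambda>t. u 0 + integral {0..t} f)"
      by (intro continuous_intros indefinite_integral_continuous_1 f')
    then show ?thesis using u by (metis (no_types, lifting) continuous_on_eq)
  qed
  have cv: "continuous_on {0..T} v"
  proof -
    have "continuous_on {0..T} (\<lambda>t. v 0 + integral {0..t} g)"
      by (intro continuous_intros indefinite_integral_continuous_1 g')
    then show ?thesis using v by (metis (no_types, lifting) continuous_on_eq)
  qed
  obtain Bu where Bu: "\<And>s. s \<in> {0..T} \<Longrightarrow> \<bar>u s\<bar> \<le> Bu"
    using continuous_on_Icc_bounded[OF cu] by auto
  obtain Bv where Bv: "\<And>s. s \<in> {0..T} \<Longrightarrow> \<bar>v s\<bar> \<le> Bv"
    using continuous_on_Icc_bounded[OF cv] by auto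
  have mu: "(\<lambda>s. indicator {0..T} s *\<^sub>R u s) \<in> borel_measurable borel"
    and mv: "(\<lambda>s. indicator {0..T} s *\<^sub>R v s) \<in> borel_measurable borel"
    by (intro borel_measurable_continuous_on_indicator cu cv; simp)+
  have 1: "(\<lambda>s. f s * v s) integrable_on {0..T}"
  proof (intro set_borel_integral_eq_integral(1) set_integrable_bounded[where B="B * Bv"])
    have "(\<lambda>s. (indicator {0..T} s *\<^sub>R f s) * (indicator {0..T} s *\<^sub>R v s)) \<in> borel_measurable borel"
      using f(1) mv by measurable
    then show "(\<lambda>s. indicator {0..T} s *\<^sub>R (f s * v s)) \<in> borel_measurable borel"
      by (rule measurable_cong[THEN iffD1, rotated]) (auto simp: indicator_def)
  qed (use f(2) Bv B in \<open>auto simp: abs_mult intro!: mult_mono\<close>)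
  have 2: "(\<lambda>s. u s * g s) integrable_on {0..T}"
  proof (intro set_borel_integral_eq_integral(1) set_integrable_bounded[where B="Bu * B"])
    have "(\<lambda>s. (indicator {0..T} s *\<^sub>R u s) * (indicator {0..T} s *\<^sub>R g s)) \<in> borel_measurable borel"
      using g(1) mu by measurable
    then show "(\<lambda>s. indicator {0..T} s *\<^sub>R (u s * g s)) \<in> borel_measurable borel"
      by (rule measurable_cong[THEN iffD1, rotated]) (auto simp: indicator_def)
    fix s assume "s \<in> {0..T}"
    then show "norm (u s * g s) \<le> Bu * B" using g(2)[of s] Bu[of s]
      by (auto simp: abs_mult intro!: mult_mono)
  qed
  show fg: "(\<lambda>s. f s * v s + u s * g s) integrable_on {0..T}" using 1 2 by (rule integrable_add)
  define h where "h t = u t * v t - integral {0..t} (\<lambda>s. f s * v s + u s * g s)" for t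
  have "\<bar>h t - h s\<bar> \<le> (3 * B\<^sup>2) * (t - s)\<^sup>2" if st: "0 \<le> s" "s \<le> t" "t \<le> T" for s t
  proof -
    have sub: "k integrable_on {s..t}" if "k integrable_on {0..T}" for k :: "real \<Rightarrow> real"
      using that st by (auto intro: integrable_subinterval_real)
    have du: "u y - u x = integral {x..y} f" "\<bar>u y - u x\<bar> \<le> B * (y - x)"
      if "0 \<le> x" "x \<le> y" "y \<le> T" for x y
      using integral_lipschitz[OF f' _ that, of B] f(2) u[of x] u[of y] that by auto
    have dv: "v y - v x = integral {x..y} g" "\<bar>v y - v x\<bar> \<le> B * (y - x)"
      if "0 \<le> x" "x \<le> y" "y \<le> T" for x y
      using integral_lipschitz[OF g' _ that, of B] g(2) v[of x] v[of y] that by auto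
    have fgt: "(\<lambda>s. f s * v s + u s * g s) integrable_on {0..t}"
      using fg st by (auto intro: integrable_subinterval_real)
    from Henstock_Kurzweil_Integration.integral_combine[OF st(1,2) this]
    have eq0: "integral {0..t} (\<lambda>s. f s * v s + u s * g s) - integral {0..s} (\<lambda>s. f s * v s + u s * g s)
      = integral {s..t} (\<lambda>s. f s * v s + u s * g s)" by (simp add: algebra_simps)
    have iR: "(\<lambda>r. f r * (v s - v r) + (u s - u r) * g r) integrable_on {s..t}"
      unfolding left_diff_distrib right_diff_distrib
      by (intro integrable_add integrable_diff sub f' g' 1 2 integrable_on_mult_left integrable_on_mult_right)
    have "integral {s..t} (\<lambda>r. f r * (v s - v r) + (u s - u r) * g r) =
      integral {s..t} (\<lambda>r. (f r * v s + u s * g r) - (f r * v r + u r * g r))"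
      by (simp add: algebra_simps)
    also have "\<dots> = integral {s..t} (\<lambda>r. f r * v s + u s * g r) - integral {s..t} (\<lambda>r. f r * v r + u r * g r)"
      by (intro integral_diff integrable_add sub f' g' fg integrable_on_mult_left integrable_on_mult_right)
    also have "integral {s..t} (\<lambda>r. f r * v s + u s * g r) =
       integral {s..t} (\<lambda>r. f r * v s) + integral {s..t} (\<lambda>r. u s * g r)"
      by (intro integral_add sub f' g' integrable_on_mult_left integrable_on_mult_right)
    also have "\<dots> = (u t - u s) * v s + u s * (v t - v s)"
      using du(1) dv(1) st by simp
    \<comment> \<open>Freezing \<open>u\<close> and \<open>v\<close> at \<open>s\<close> leaves this
      exact remainder. The integral contributes \<open>2 * B\<^sup>2 * (t - s)\<^sup>2\<close> and
      the product half of that, hence the constant \<open>3 * B\<^sup>2\<close>.\<close>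
    finally have eq: "h t - h s = integral {s..t} (\<lambda>r. f r * (v s - v r) + (u s - u r) * g r)
       + (u t - u s) * (v t - v s)"
      using eq0 by (simp add: h_def algebra_simps)
    have "norm (integral {s..t} (\<lambda>r. f r * (v s - v r) + (u s - u r) * g r)) \<le> (2 * B\<^sup>2 * (t - s)) * (t - s)"
    proof -
      have "((\<lambda>r. f r * (v s - v r) + (u s - u r) * g r) has_integral
        integral {s..t} (\<lambda>r. f r * (v s - v r) + (u s - u r) * g r)) (cbox s t)"
        using iR by (simp add: integrable_integral)
      moreover have "norm (f r * (v s - v r) + (u s - u r) * g r) \<le> 2 * B\<^sup>2 * (t - s)" if "r \<in> cbox s t" for r
      proof -
        have r: "s \<le> r" "r \<le> t" using that by auto
        have "\<bar>v s - v r\<bar> \<le> B * (t - s)" "\<bar>u s - u r\<bar> \<le> B * (t - s)"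
          using dv(2)[of s r] du(2)[of s r] st r B mult_left_mono[of "r - s" "t - s" B]
          by (auto simp: abs_minus_commute)
        then have "\<bar>f r\<bar> * \<bar>v s - v r\<bar> \<le> B * (B * (t - s))" "\<bar>u s - u r\<bar> * \<bar>g r\<bar> \<le> (B * (t - s)) * B"
          using f(2)[of r] g(2)[of r] r st B by (auto intro!: mult_mono)
        moreover have "norm (f r * (v s - v r) + (u s - u r) * g r) \<le> \<bar>f r\<bar> * \<bar>v s - v r\<bar> + \<bar>u s - u r\<bar> * \<bar>g r\<bar>"
          by (metis abs_mult abs_triangle_ineq real_norm_def)
        ultimately show ?thesis by (simp add: power2_eq_square algebra_simps)
      qed
      ultimately have "norm (integral {s..t} (\<lambda>r. f r * (v s - v r) + (u s - u r) * g r)) \<le>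
          2 * B\<^sup>2 * (t - s) * measure lborel (cbox s t)"
        using st B by (intro has_integral_bound) auto
      then show ?thesis using st by simp
    qed
    moreover have "\<bar>(u t - u s) * (v t - v s)\<bar> \<le> (B * (t - s)) * (B * (t - s))"
      unfolding abs_mult using du(2)[OF st] dv(2)[OF st] st B by (intro mult_mono) auto
    ultimately show ?thesis unfolding eq by (simp add: power2_eq_square algebra_simps)
  qed
  from constant_if_quadratic_increments[of T h, OF this t]
  show "u t * v t = u 0 * v 0 + integral {0..t} (\<lambda>s. f s * v s + u s * g s)"
    by (simp add: h_def)
qed

lemma lipschitz_imp_abs_continuous_on:
  assumes "\<And>s t. A \<le> s \<Longrightarrow> s \<le> t \<Longrightarrow> t \<le> B \<Longrightarrow> norm (f t - f s) \<le> L * (t - s)"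
  shows "abs_continuous_on A B f"
  unfolding abs_continuous_on_def
proof (intro allI impI)
  fix e :: real assume e: "e > 0"
  have "(\<Sum>i<n. norm (f (y i) - f (x i))) < e"
    if H: "(\<forall>i<n. A \<le> x i \<and> x i \<le> y i \<and> y i \<le> B) \<and>
      (\<forall>i<n. \<forall>j<n. i \<noteq> j \<longrightarrow> {x i<..<y i} \<inter> {x j<..<y j} = {}) \<and> (\<Sum>i<n. y i - x i) < e / (\<bar>L\<bar> + 1)"
    for n :: nat and x y
  proof -
    have "(\<Sum>i<n. norm (f (y i) - f (x i))) \<le> (\<Sum>i<n. (\<bar>L\<bar> + 1) * (y i - x i))"
    proof (rule sum_mono)
      fix i assume i: "i \<in> {..<n}"
      then have "norm (f (y i) - f (x i)) \<le> L * (y i - x i)" using H assms by auto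
      also have "\<dots> \<le> (\<bar>L\<bar> + 1) * (y i - x i)" using H i by (intro mult_right_mono) auto
      finally show "norm (f (y i) - f (x i)) \<le> (\<bar>L\<bar> + 1) * (y i - x i)" .
    qed
    also have "\<dots> = (\<bar>L\<bar> + 1) * (\<Sum>i<n. y i - x i)" by (simp add: sum_distrib_left)
    also have "\<dots> < e" using H by (auto simp: pos_less_divide_eq mult.commute)
    finally show ?thesis .
  qed
  then show "\<exists>\<theta>>0. \<forall>(n::nat) x y.
    (\<forall>i<n. A \<le> x i \<and> x i \<le> y i \<and> y i \<le> B) \<and>
    (\<forall>i<n. \<forall>j<n. i \<noteq> j \<longrightarrow> {x i<..<y i} \<inter> {x j<..<y j} = {}) \<and>
    (\<Sum>i<n. y i - x i) < \<theta> \<longrightarrow> (\<Sum>i<n. norm (f (y i) - f (x i))) < e"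
    using e by (intro exI[of _ "e / (\<bar>L\<bar> + 1)"]) auto
qed

text \<open>The weight \<open>exp (4 * K * t)\<close> makes the Volterra operator a contraction with factor \<open>1/4\<close>.\<close>

lemma volterra_iteration_bound:
  fixes e :: "nat \<Rightarrow> real \<Rightarrow> ennreal"
  assumes K: "K > 0" and c: "c \<ge> 0"
    and step: "\<And>n t. t \<in> {0..T} \<Longrightarrow> e (Suc n) t \<le> ennreal K * (\<integral>\<^sup>+s\<in>{0..t}. e n s \<partial>lborel)"
    and init: "\<And>t. t \<in> {0..T} \<Longrightarrow> e 0 t \<le> ennreal c"
    and t: "t \<in> {0..T}"
  shows "e n t \<le> ennreal (c * (1/4) ^ n * exp (4 * K * t))"
  using t
proof (induction n arbitrary: t)
  case 0
  have "c * 1 \<le> c * exp (4 * K * t)" using 0 K c by (intro mult_left_mono) auto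
  then show ?case using init[OF 0] by (auto intro: order_trans ennreal_leI)
next
  case (Suc n)
  define q where "q = c * (1/4) ^ n"
  have q: "q \<ge> 0" using c by (simp add: q_def)
  have "(\<integral>\<^sup>+s\<in>{0..t}. e n s \<partial>lborel) \<le> (\<integral>\<^sup>+s. ennreal (q * exp (4 * K * s)) * indicator {0..t} s \<partial>lborel)"
    using Suc by (intro nn_integral_mono) (auto simp: indicator_def q_def)
  also have "\<dots> = ennreal (q * exp (4 * K * t) / (4 * K) - q * exp (4 * K * 0) / (4 * K))"
  proof (rule nn_integral_FTC_Icc)
    show "(\<lambda>s. q * exp (4 * K * s)) \<in> borel_measurable borel" by measurable
    show "0 \<le> t" using Suc.prems by simp
    show "0 \<le> q * exp (4 * K * x)" for x using q by simp
    fix x :: real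
    have "((\<lambda>s. q * exp (4 * K * s) / (4 * K)) has_real_derivative q * (exp (4 * K * x) * (4 * K)) / (4 * K)) (at x)"
      by (intro DERIV_cdivide DERIV_cmult DERIV_fun_exp DERIV_cmult_Id)
    moreover have "q * (exp (4 * K * x) * (4 * K)) / (4 * K) = q * exp (4 * K * x)" using K by simp
    ultimately show "((\<lambda>s. q * exp (4 * K * s) / (4 * K)) has_real_derivative q * exp (4 * K * x)) (at x)"
      by (simp only:)
  qed
  \<comment> \<open>The boundary term at 0 is dropped. The remaining divisor \<open>4 * K\<close>
    against the outer factor \<open>K\<close> leaves the \<open>1/4\<close> of the next
    power.\<close>
  also have "\<dots> \<le> ennreal (q * exp (4 * K * t) / (4 * K))"
    using q K by (intro ennreal_leI) auto
  finally have "ennreal K * (\<integral>\<^sup>+s\<in>{0..t}. e n s \<partial>lborel) \<le> ennreal K * ennreal (q * exp (4 * K * t) / (4 * K))"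
    by (intro mult_left_mono) auto
  also have "\<dots> = ennreal (c * (1/4) ^ Suc n * exp (4 * K * t))"
    using K q by (simp add: ennreal_mult[symmetric] q_def)
  finally show ?case using step[OF Suc.prems, of n] by (rule order_trans[rotated])
qed

section \<open>Mean square estimates\<close>

lemma norm_add_sq_le: "(norm (x + y))\<^sup>2 \<le> 2 * (norm x)\<^sup>2 + 2 * (norm y)\<^sup>2" for x y :: "'b::real_normed_vector"
proof -
  have "(norm (x + y))\<^sup>2 \<le> (norm x + norm y)\<^sup>2" by (intro power_mono norm_triangle_ineq) auto
  also have "\<dots> \<le> 2 * (norm x)\<^sup>2 + 2 * (norm y)\<^sup>2"
    using zero_le_power2[of "norm x - norm y"] by (simp add: power2_eq_square algebra_simps)
  finally show ?thesis .
qed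

lemma nn_integral_sq_add_le:
  fixes f g :: "'a \<Rightarrow> 'b::{second_countable_topology, real_normed_vector}"
  assumes [measurable]: "f \<in> borel_measurable M" "g \<in> borel_measurable M"
  shows "(\<integral>\<^sup>+x. ennreal ((norm (f x + g x))\<^sup>2) \<partial>M) \<le>
    2 * (\<integral>\<^sup>+x. ennreal ((norm (f x))\<^sup>2) \<partial>M) + 2 * (\<integral>\<^sup>+x. ennreal ((norm (g x))\<^sup>2) \<partial>M)"
proof -
  have "(\<integral>\<^sup>+x. ennreal ((norm (f x + g x))\<^sup>2) \<partial>M) \<le>
      (\<integral>\<^sup>+x. 2 * ennreal ((norm (f x))\<^sup>2) + 2 * ennreal ((norm (g x))\<^sup>2) \<partial>M)"
  proof (rule nn_integral_mono)
    fix x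
    have "ennreal ((norm (f x + g x))\<^sup>2) \<le> ennreal (2 * (norm (f x))\<^sup>2 + 2 * (norm (g x))\<^sup>2)"
      by (intro ennreal_leI norm_add_sq_le)
    then show "ennreal ((norm (f x + g x))\<^sup>2) \<le> 2 * ennreal ((norm (f x))\<^sup>2) + 2 * ennreal ((norm (g x))\<^sup>2)"
      by (simp add: ennreal_mult' ennreal_plus)
  qed
  also have "\<dots> = 2 * (\<integral>\<^sup>+x. ennreal ((norm (f x))\<^sup>2) \<partial>M) + 2 * (\<integral>\<^sup>+x. ennreal ((norm (g x))\<^sup>2) \<partial>M)"
    by (simp add: nn_integral_add nn_integral_cmult)
  finally show ?thesis .
qed

lemma nn_integral_sq_diff_le:
  fixes f g h :: "'a \<Rightarrow> 'b::{second_countable_topology, real_normed_vector}"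
  assumes [measurable]: "f \<in> borel_measurable M" "g \<in> borel_measurable M" "h \<in> borel_measurable M"
  shows "(\<integral>\<^sup>+x. ennreal ((norm (f x - h x))\<^sup>2) \<partial>M) \<le>
    2 * (\<integral>\<^sup>+x. ennreal ((norm (f x - g x))\<^sup>2) \<partial>M) + 2 * (\<integral>\<^sup>+x. ennreal ((norm (g x - h x))\<^sup>2) \<partial>M)"
  using nn_integral_sq_add_le[of "\<lambda>x. f x - g x" M "\<lambda>x. g x - h x"] by simp

text \<open>The weights \<open>1 + \<epsilon>\<close> and \<open>1 + 1 / \<epsilon>\<close> of Young's inequality give the sharp constant in the limit.\<close>

lemma nn_integral_sq_young:
  fixes f g :: "'a \<Rightarrow> 'b::{second_countable_topology, real_normed_vector}"
  assumes [measurable]: "f \<in> borel_measurable M" "g \<in> borel_measurable M" and e: "e > 0"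
  shows "(\<integral>\<^sup>+x. ennreal ((norm (f x))\<^sup>2) \<partial>M) \<le>
    ennreal (1 + e) * (\<integral>\<^sup>+x. ennreal ((norm (g x))\<^sup>2) \<partial>M)
      + ennreal (1 + 1 / e) * (\<integral>\<^sup>+x. ennreal ((norm (f x - g x))\<^sup>2) \<partial>M)"
proof -
  have *: "(norm (f x))\<^sup>2 \<le> (1 + e) * (norm (g x))\<^sup>2 + (1 + 1 / e) * (norm (f x - g x))\<^sup>2" for x
  proof -
    define a b where "a = norm (g x)" and "b = norm (f x - g x)"
    have "norm (f x) \<le> a + b" unfolding a_def b_def by (metis add.commute diff_add_cancel norm_triangle_ineq)
    then have "(norm (f x))\<^sup>2 \<le> (a + b)\<^sup>2" by (intro power_mono) auto
    also have "\<dots> \<le> (1 + e) * a\<^sup>2 + (1 + 1 / e) * b\<^sup>2"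
    proof -
      have "0 \<le> (e * a - b)\<^sup>2 / e" using e by simp
      also have "\<dots> = e * a\<^sup>2 - 2 * a * b + b\<^sup>2 / e" using e by (simp add: power2_eq_square field_simps)
      finally show ?thesis by (simp add: power2_eq_square algebra_simps)
    qed
    finally show ?thesis by (simp add: a_def b_def)
  qed
  have "(\<integral>\<^sup>+x. ennreal ((norm (f x))\<^sup>2) \<partial>M) \<le>
     (\<integral>\<^sup>+x. ennreal (1 + e) * ennreal ((norm (g x))\<^sup>2) + ennreal (1 + 1 / e) * ennreal ((norm (f x - g x))\<^sup>2) \<partial>M)"
    using e by (intro nn_integral_mono)
      (simp add: ennreal_mult'[symmetric] ennreal_plus[symmetric] * del: ennreal_plus)
  also have "\<dots> = ennreal (1 + e) * (\<integral>\<^sup>+x. ennreal ((norm (g x))\<^sup>2) \<partial>M)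
      + ennreal (1 + 1 / e) * (\<integral>\<^sup>+x. ennreal ((norm (f x - g x))\<^sup>2) \<partial>M)"
    by (simp add: nn_integral_add nn_integral_cmult)
  finally show ?thesis .
qed

lemma ennreal_tendsto_mult_0:
  assumes "(f \<longlongrightarrow> 0) F" "c < \<top>"
  shows "((\<lambda>x. c * f x :: ennreal) \<longlongrightarrow> 0) F"
  using ennreal_tendsto_cmult[OF assms(2,1)] by simp

text \<open>A comparison of second moments survives mean square limits, even between different
  spaces. This carries the isometry from step processes over to the integral.\<close>

lemma nn_integral_sq_limit_le:
  fixes f :: "'a \<Rightarrow> 'b::{second_countable_topology, real_normed_vector}"
    and g :: "'c \<Rightarrow> 'd::{second_countable_topology, real_normed_vector}"
  assumes [measurable]: "f \<in> borel_measurable M" "\<And>k. fs k \<in> borel_measurable M"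
    "g \<in> borel_measurable N" "\<And>k. gs k \<in> borel_measurable N"
    and le: "\<And>k. (\<integral>\<^sup>+x. ennreal ((norm (gs k x))\<^sup>2) \<partial>N) \<le> (\<integral>\<^sup>+x. ennreal ((norm (fs k x))\<^sup>2) \<partial>M)"
    and f: "(\<lambda>k. \<integral>\<^sup>+x. ennreal ((norm (fs k x - f x))\<^sup>2) \<partial>M) \<longlonglongrightarrow> 0"
    and g: "(\<lambda>k. \<integral>\<^sup>+x. ennreal ((norm (gs k x - g x))\<^sup>2) \<partial>N) \<longlonglongrightarrow> 0"
  shows "(\<integral>\<^sup>+x. ennreal ((norm (g x))\<^sup>2) \<partial>N) \<le> (\<integral>\<^sup>+x. ennreal ((norm (f x))\<^sup>2) \<partial>M)"
    (is "?g \<le> ?f")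
proof -
  \<comment> \<open>For fixed \<open>e\<close> the error terms vanish as \<open>k\<close> grows, at
    the price of two factors \<open>1 + e\<close>, one for each side. Only afterwards does
    \<open>e\<close> tend to zero.\<close>
  have 1: "?g \<le> ennreal (1 + e) * (ennreal (1 + e) * ?f)" if e: "e > 0" for e
  proof -
    define d where "d k = ennreal (1 + e) * (ennreal (1 + 1 / e) * (\<integral>\<^sup>+x. ennreal ((norm (fs k x - f x))\<^sup>2) \<partial>M))
       + ennreal (1 + 1 / e) * (\<integral>\<^sup>+x. ennreal ((norm (gs k x - g x))\<^sup>2) \<partial>N)" for k
    have "d \<longlonglongrightarrow> 0 + 0"
      unfolding d_def using f g by (intro tendsto_add ennreal_tendsto_mult_0) auto
    then have lim: "(\<lambda>k. ennreal (1 + e) * (ennreal (1 + e) * ?f) + d k) \<longlonglongrightarrow>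
        ennreal (1 + e) * (ennreal (1 + e) * ?f) + (0 + 0)"
      by (intro tendsto_add tendsto_const)
    have "?g \<le> ennreal (1 + e) * (ennreal (1 + e) * ?f) + d k" for k
    proof -
      have "?g \<le> ennreal (1 + e) * (\<integral>\<^sup>+x. ennreal ((norm (gs k x))\<^sup>2) \<partial>N)
          + ennreal (1 + 1 / e) * (\<integral>\<^sup>+x. ennreal ((norm (gs k x - g x))\<^sup>2) \<partial>N)"
        using nn_integral_sq_young[of g N "gs k" e] e by (simp add: norm_minus_commute)
      also have "\<dots> \<le> ennreal (1 + e) * (ennreal (1 + e) * ?f
            + ennreal (1 + 1 / e) * (\<integral>\<^sup>+x. ennreal ((norm (fs k x - f x))\<^sup>2) \<partial>M))
          + ennreal (1 + 1 / e) * (\<integral>\<^sup>+x. ennreal ((norm (gs k x - g x))\<^sup>2) \<partial>N)"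
        using e nn_integral_sq_young[of "fs k" M f e]
        by (intro add_right_mono mult_left_mono order_trans[OF le]) auto
      finally show ?thesis by (simp add: d_def distrib_left ac_simps)
    qed
    then show ?thesis using LIMSEQ_le_const[OF lim] by auto
  qed
  show ?thesis
  proof (cases "?f = \<top>")
    case False
    then obtain r where r: "?f = ennreal r" "0 \<le> r" using ennreal_cases by blast
    have 2: "?g \<le> ennreal ((1 + inverse (real (Suc n))) * ((1 + inverse (real (Suc n))) * r))" for n
      using 1[of "inverse (real (Suc n))"] r
      by (subst ennreal_mult, simp, simp)+ (simp del: of_nat_Suc)
    have "(\<lambda>n. (1 + inverse (real (Suc n))) * ((1 + inverse (real (Suc n))) * r)) \<longlonglongrightarrow> (1 + 0) * ((1 + 0) * r)"
      by (intro tendsto_intros LIMSEQ_inverse_real_of_nat)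
    then have "(\<lambda>n. ennreal ((1 + inverse (real (Suc n))) * ((1 + inverse (real (Suc n))) * r))) \<longlonglongrightarrow> ennreal r"
      by (intro tendsto_ennrealI) simp
    from LIMSEQ_le_const[OF this] 2 r show ?thesis by auto
  qed simp
qed

text \<open>The factor \<open>4\<close> is the fixed point of \<open>k = 2 + 2 * k / 4\<close>.\<close>

lemma geometric_cauchy_bound:
  fixes D :: "nat \<Rightarrow> nat \<Rightarrow> ennreal"
  assumes "c \<ge> 0" "\<And>n. D n n = 0"
    and "\<And>n m. D n m \<le> 2 * D n (Suc n) + 2 * D (Suc n) m"
    and step: "\<And>n. D n (Suc n) \<le> ennreal (c * (1/4) ^ n)"
    and "n \<le> m"
  shows "D n m \<le> ennreal (4 * c * (1/4) ^ n)"
  using \<open>n \<le> m\<close>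
proof (induction "m - n" arbitrary: n)
  case 0
  then show ?case using assms(2) by simp
next
  case (Suc k)
  have "k = m - Suc n" "Suc n \<le> m" using Suc.hyps(2) by auto
  then have IH: "D (Suc n) m \<le> ennreal (4 * c * (1/4) ^ Suc n)" by (rule Suc.hyps(1))
  have "D n m \<le> 2 * ennreal (c * (1/4) ^ n) + 2 * ennreal (4 * c * (1/4) ^ Suc n)"
    by (rule order_trans[OF assms(3)]) (intro add_mono mult_left_mono step IH; simp)
  also have "\<dots> = ennreal (2 * (c * (1/4) ^ n) + 2 * (4 * c * (1/4) ^ Suc n))"
  proof -
    have "2 * ennreal x = ennreal (2 * x)" if "x \<ge> 0" for x using that by (simp add: ennreal_mult)
    moreover have "0 \<le> c * (1/4) ^ n" "0 \<le> 4 * c * (1/4) ^ Suc n" using assms(1) by simp_all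
    ultimately show ?thesis by (simp only: ennreal_plus[symmetric] mult_nonneg_nonneg zero_le_numeral)
  qed
  also have "\<dots> = ennreal (4 * c * (1/4) ^ n)" by (simp add: mult.assoc)
  finally show ?case .
qed

text \<open>Fatou's lemma in \<open>m\<close> with \<open>n\<close> fixed: a Cauchy estimate becomes
  an estimate of the distance to the almost sure limit.\<close>

lemma nn_integral_sq_limit_bound:
  fixes Z :: "nat \<Rightarrow> 'a \<Rightarrow> 'b::{second_countable_topology, real_normed_vector}"
  assumes [measurable]: "\<And>n. Z n \<in> borel_measurable M"
    and lim: "AE x in M. (\<lambda>n. Z n x) \<longlonglongrightarrow> X x"
    and bound: "\<And>m. n \<le> m \<Longrightarrow> (\<integral>\<^sup>+x. ennreal ((norm (Z m x - Z n x))\<^sup>2) \<partial>M) \<le> b"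
  shows "(\<integral>\<^sup>+x. ennreal ((norm (X x - Z n x))\<^sup>2) \<partial>M) \<le> b"
proof -
  have "AE x in M. ennreal ((norm (X x - Z n x))\<^sup>2) = liminf (\<lambda>m. ennreal ((norm (Z m x - Z n x))\<^sup>2))"
    using lim
  proof eventually_elim
    case (elim x)
    then have "(\<lambda>m. ennreal ((norm (Z m x - Z n x))\<^sup>2)) \<longlonglongrightarrow> ennreal ((norm (X x - Z n x))\<^sup>2)"
      by (intro tendsto_ennrealI tendsto_power tendsto_norm tendsto_diff tendsto_const)
    then show ?case by (intro lim_imp_Liminf[symmetric]) auto
  qed
  then have "(\<integral>\<^sup>+x. ennreal ((norm (X x - Z n x))\<^sup>2) \<partial>M) =
     (\<integral>\<^sup>+x. liminf (\<lambda>m. ennreal ((norm (Z m x - Z n x))\<^sup>2)) \<partial>M)"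
    by (rule nn_integral_cong_AE)
  also have "\<dots> \<le> liminf (\<lambda>m. \<integral>\<^sup>+x. ennreal ((norm (Z m x - Z n x))\<^sup>2) \<partial>M)"
    by (intro nn_integral_liminf) measurable
  also have "\<dots> \<le> b"
    by (rule Liminf_le) (use bound in \<open>auto simp: eventually_sequentially\<close>)
  finally show ?thesis .
qed

section \<open>Products of square integrable functions\<close>

lemma integrable_mult_L2:
  fixes f g :: "'a \<Rightarrow> real"
  assumes [measurable]: "f \<in> borel_measurable M" "g \<in> borel_measurable M"
    and "integrable M (\<lambda>x. (f x)\<^sup>2)" "integrable M (\<lambda>x. (g x)\<^sup>2)"
  shows "integrable M (\<lambda>x. f x * g x)"
proof (rule Bochner_Integration.integrable_bound)
  show "integrable M (\<lambda>x. (f x)\<^sup>2 + (g x)\<^sup>2)" using assms by auto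
  have "norm (f x * g x) \<le> norm ((f x)\<^sup>2 + (g x)\<^sup>2)" for x
  proof -
    have "2 * (\<bar>f x\<bar> * \<bar>g x\<bar>) \<le> (f x)\<^sup>2 + (g x)\<^sup>2"
      using zero_le_power2[of "\<bar>f x\<bar> - \<bar>g x\<bar>"] by (simp add: power2_diff)
    moreover have "0 \<le> \<bar>f x\<bar> * \<bar>g x\<bar>" by simp
    ultimately have "\<bar>f x\<bar> * \<bar>g x\<bar> \<le> (f x)\<^sup>2 + (g x)\<^sup>2" by linarith
    then show ?thesis by (simp add: abs_mult)
  qed
  then show "AE x in M. norm (f x * g x) \<le> norm ((f x)\<^sup>2 + (g x)\<^sup>2)" by simp
qed measurable

lemma integrable_L2_add:
  fixes f g :: "'a \<Rightarrow> real"
  assumes [measurable]: "f \<in> borel_measurable M" "g \<in> borel_measurable M"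
    and "integrable M (\<lambda>x. (f x)\<^sup>2)" "integrable M (\<lambda>x. (g x)\<^sup>2)"
  shows "integrable M (\<lambda>x. (f x + g x)\<^sup>2)" "integrable M (\<lambda>x. (f x - g x)\<^sup>2)"
  using assms integrable_mult_L2[OF assms] unfolding power2_sum power2_diff by (auto simp: mult.assoc)

lemma integrable_L2_bounded_mult:
  fixes f g :: "'a \<Rightarrow> real"
  assumes [measurable]: "f \<in> borel_measurable M" "g \<in> borel_measurable M"
    and "integrable M (\<lambda>x. (g x)\<^sup>2)" and c: "\<And>x. x \<in> space M \<Longrightarrow> \<bar>f x\<bar> \<le> c"
  shows "integrable M (\<lambda>x. (f x * g x)\<^sup>2)"
proof (rule Bochner_Integration.integrable_bound)
  show "integrable M (\<lambda>x. c\<^sup>2 * (g x)\<^sup>2)" using assms by auto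
  show "AE x in M. norm ((f x * g x)\<^sup>2) \<le> norm (c\<^sup>2 * (g x)\<^sup>2)"
  proof (rule AE_I2)
    fix x assume "x \<in> space M"
    then have "\<bar>f x\<bar>\<^sup>2 \<le> c\<^sup>2" using c by (intro power_mono) auto
    then have "(f x)\<^sup>2 * (g x)\<^sup>2 \<le> c\<^sup>2 * (g x)\<^sup>2" by (intro mult_right_mono) auto
    then show "norm ((f x * g x)\<^sup>2) \<le> norm (c\<^sup>2 * (g x)\<^sup>2)" by (simp add: power_mult_distrib)
  qed
qed measurable

lemma cauchy_schwarz_integral:
  fixes f g :: "'a \<Rightarrow> real"
  assumes [measurable]: "f \<in> borel_measurable M" "g \<in> borel_measurable M"
    and f: "integrable M (\<lambda>x. (f x)\<^sup>2)" and g: "integrable M (\<lambda>x. (g x)\<^sup>2)"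
  shows "(\<integral>x. \<bar>f x\<bar> * \<bar>g x\<bar> \<partial>M) \<le> sqrt (\<integral>x. (f x)\<^sup>2 \<partial>M) * sqrt (\<integral>x. (g x)\<^sup>2 \<partial>M)"
proof -
  have fg: "integrable M (\<lambda>x. \<bar>f x\<bar> * \<bar>g x\<bar>)"
    using integrable_mult_L2[of "\<lambda>x. \<bar>f x\<bar>" M "\<lambda>x. \<bar>g x\<bar>"] f g by simp
  have "ennreal ((\<integral>x. \<bar>f x\<bar> * \<bar>g x\<bar> \<partial>M)\<^sup>2) = (\<integral>\<^sup>+x. ennreal \<bar>f x\<bar> * ennreal \<bar>g x\<bar> \<partial>M)\<^sup>2"
    using nn_integral_eq_integral[OF fg] by (simp add: ennreal_mult' ennreal_power[symmetric])
  also have "\<dots> \<le> (\<integral>\<^sup>+x. ennreal \<bar>f x\<bar> ^ 2 \<partial>M) * (\<integral>\<^sup>+x. ennreal \<bar>g x\<bar> ^ 2 \<partial>M)"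
    by (intro Cauchy_Schwarz_nn_integral) measurable
  also have "\<dots> = ennreal ((\<integral>x. (f x)\<^sup>2 \<partial>M) * (\<integral>x. (g x)\<^sup>2 \<partial>M))"
    using nn_integral_eq_integral[OF f] nn_integral_eq_integral[OF g]
    by (simp add: ennreal_power ennreal_mult')
  finally have "(\<integral>x. \<bar>f x\<bar> * \<bar>g x\<bar> \<partial>M)\<^sup>2 \<le> (\<integral>x. (f x)\<^sup>2 \<partial>M) * (\<integral>x. (g x)\<^sup>2 \<partial>M)"
    by (subst (asm) ennreal_le_iff) auto
  then show ?thesis
    using real_le_rsqrt by (simp add: real_sqrt_mult[symmetric])
qed

section \<open>Suprema and limits of continuous processes\<close>

definition dyadic :: "real \<Rightarrow> nat \<Rightarrow> nat \<Rightarrow> real" where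
  "dyadic T n i = T * real i / 2 ^ n"

lemma dyadic_mono: "0 \<le> T \<Longrightarrow> i \<le> j \<Longrightarrow> dyadic T n i \<le> dyadic T n j"
  by (auto simp: dyadic_def intro!: divide_right_mono mult_left_mono)

lemma dyadic_nonneg [simp]: "0 \<le> T \<Longrightarrow> 0 \<le> dyadic T n i"
  by (auto simp: dyadic_def)

lemma dyadic_0 [simp]: "dyadic T n 0 = 0"
  by (simp add: dyadic_def)

lemma dyadic_last [simp]: "dyadic T n (2 ^ n) = T"
  by (simp add: dyadic_def)

lemma dyadic_in: "0 \<le> T \<Longrightarrow> i \<le> 2 ^ n \<Longrightarrow> dyadic T n i \<in> {0..T}"
  using dyadic_mono[of T i "2 ^ n" n] by auto

definition dyadic_points :: "real \<Rightarrow> real set" where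
  "dyadic_points T = (\<Union>n. dyadic T n ` {..2 ^ n})"

lemma countable_dyadic_points [simp]: "countable (dyadic_points T)"
  by (auto simp: dyadic_points_def intro: countable_finite)

lemma dyadic_points_subset: "0 \<le> T \<Longrightarrow> dyadic_points T \<subseteq> {0..T}"
  unfolding dyadic_points_def using dyadic_in by blast

lemma dyadic_approx:
  assumes "t \<in> {0..T}"
  obtains i where "\<And>n. i n \<le> 2 ^ n" "(\<lambda>n. dyadic T n (i n)) \<longlonglongrightarrow> t"
proof -
  define i where "i n = nat \<lfloor>2 ^ n * (t / T)\<rfloor>" for n
  have T: "0 \<le> T" "0 \<le> t" "t \<le> T" using assms by auto
  \<comment> \<open>For \<open>T = 0\<close> the quotient is 0 by the convention on division, and
    then \<open>t = 0\<close> as well.\<close>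
  have tT: "0 \<le> t / T" "t / T \<le> 1" using T by (auto simp: divide_le_eq_1)
  have i1: "real (i n) \<le> 2 ^ n * (t / T)" "2 ^ n * (t / T) - 1 \<le> real (i n)" for n
  proof -
    have "real (i n) = real_of_int \<lfloor>2 ^ n * (t / T)\<rfloor>"
      using tT unfolding i_def by (intro of_nat_nat) (simp only: zero_le_floor, intro mult_nonneg_nonneg; simp)
    then show "real (i n) \<le> 2 ^ n * (t / T)" "2 ^ n * (t / T) - 1 \<le> real (i n)" by linarith+
  qed
  have "i n \<le> 2 ^ n" for n
  proof -
    have "real (i n) \<le> 2 ^ n" using order_trans[OF i1(1)[of n] mult_left_mono[OF tT(2), of "2 ^ n"]] by simp
    then show ?thesis by (metis of_nat_le_iff of_nat_numeral of_nat_power)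
  qed
  moreover have "(\<lambda>n. dyadic T n (i n)) \<longlonglongrightarrow> t"
  proof (rule tendsto_sandwich)
    have e: "T * (2 ^ n * (t / T)) / 2 ^ n = t" for n using T by (cases "T = 0") auto
    show "\<forall>\<^sub>F n in sequentially. t - T / 2 ^ n \<le> dyadic T n (i n)"
    proof (intro always_eventually allI)
      fix n
      have "t - T / 2 ^ n = T * (2 ^ n * (t / T) - 1) / 2 ^ n"
        using e[of n] by (simp add: algebra_simps diff_divide_distrib)
      also have "\<dots> \<le> dyadic T n (i n)"
        unfolding dyadic_def using i1(2)[of n] T by (intro divide_right_mono mult_left_mono) auto
      finally show "t - T / 2 ^ n \<le> dyadic T n (i n)" .
    qed
    show "\<forall>\<^sub>F n in sequentially. dyadic T n (i n) \<le> t"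
    proof (intro always_eventually allI)
      fix n
      have "dyadic T n (i n) \<le> T * (2 ^ n * (t / T)) / 2 ^ n"
        unfolding dyadic_def using i1(1)[of n] T by (intro divide_right_mono mult_left_mono) auto
      then show "dyadic T n (i n) \<le> t" using e[of n] by simp
    qed
    have "(\<lambda>n. T * (1 / 2) ^ n) \<longlonglongrightarrow> T * 0" by (intro tendsto_intros LIMSEQ_power_zero) auto
    then show "(\<lambda>n. t - T / 2 ^ n) \<longlonglongrightarrow> t"
      using tendsto_diff[OF tendsto_const[of t]] by (fastforce simp: power_one_over)
  qed simp
  ultimately show thesis using that by blast
qed

text \<open>By continuity the supremum over an interval is one over a countable set. Measurability
  of suprema of processes rests on this, and so does their comparison when two processes agree
  almost surely at each time.\<close>

lemma SUP_continuous_dyadic: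
  fixes f :: "real \<Rightarrow> ennreal"
  assumes f: "continuous_on {0..T} f" and T: "0 \<le> T"
  shows "(SUP t\<in>{0..T}. f t) = (SUP t\<in>dyadic_points T. f t)"
proof (rule antisym)
  show "(SUP t\<in>{0..T}. f t) \<le> (SUP t\<in>dyadic_points T. f t)"
  proof (rule SUP_least)
    fix t assume t: "t \<in> {0..T}"
    then obtain i where i: "\<And>n. i n \<le> 2 ^ n" "(\<lambda>n. dyadic T n (i n)) \<longlonglongrightarrow> t"
      using dyadic_approx by blast
    have "(\<lambda>n. f (dyadic T n (i n))) \<longlonglongrightarrow> f t"
      by (rule continuous_on_tendsto_compose[OF f i(2) t]) (use i T dyadic_in in auto)
    moreover have "f (dyadic T n (i n)) \<le> (SUP t\<in>dyadic_points T. f t)" for n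
      by (rule SUP_upper) (use i in \<open>auto simp: dyadic_points_def\<close>)
    ultimately show "f t \<le> (SUP t\<in>dyadic_points T. f t)"
      by (intro LIMSEQ_le_const2) auto
  qed
qed (use dyadic_points_subset[OF T] in \<open>rule SUP_subset_mono, auto\<close>)

lemma SUP_sq_measurable:
  fixes Z :: "real \<Rightarrow> 'w \<Rightarrow> 'b::{second_countable_topology, real_normed_vector}"
  assumes T: "0 \<le> T" and "\<And>t. t \<in> {0..T} \<Longrightarrow> Z t \<in> borel_measurable M"
    and c: "\<And>\<omega>. \<omega> \<in> space M \<Longrightarrow> continuous_on {0..T} (\<lambda>t. Z t \<omega>)"
  shows "(\<lambda>\<omega>. SUP t\<in>{0..T}. ennreal ((norm (Z t \<omega>))\<^sup>2)) \<in> borel_measurable M"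
proof -
  have "(\<lambda>\<omega>. SUP t\<in>dyadic_points T. ennreal ((norm (Z t \<omega>))\<^sup>2)) \<in> borel_measurable M"
    using assms dyadic_points_subset[OF T] by (intro borel_measurable_SUP) auto
  moreover have "(SUP t\<in>{0..T}. ennreal ((norm (Z t \<omega>))\<^sup>2)) = (SUP t\<in>dyadic_points T. ennreal ((norm (Z t \<omega>))\<^sup>2))"
    if "\<omega> \<in> space M" for \<omega>
    using c[OF that] T by (intro SUP_continuous_dyadic continuous_on_ennreal continuous_intros)
  ultimately show ?thesis by (subst measurable_cong) auto
qed

text \<open>A telescoping series and the Weierstrass test.\<close>

lemma uniform_limit_summable_steps:
  fixes f :: "nat \<Rightarrow> 'a \<Rightarrow> 'b::banach"
  assumes "\<And>n t. t \<in> S \<Longrightarrow> norm (f (Suc n) t - f n t) \<le> B n" "summable B"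
  shows "\<exists>g. uniform_limit S f g sequentially"
proof -
  have "uniform_limit S (\<lambda>n t. \<Sum>i<n. f (Suc i) t - f i t) (\<lambda>t. \<Sum>i. f (Suc i) t - f i t) sequentially"
    by (intro Weierstrass_m_test[where M=B] assms)
  then have "uniform_limit S (\<lambda>n t. f 0 t + (\<Sum>i<n. f (Suc i) t - f i t))
      (\<lambda>t. f 0 t + (\<Sum>i. f (Suc i) t - f i t)) sequentially"
    by (intro uniform_limit_add uniform_limit_const)
  moreover have "f 0 t + (\<Sum>i<n. f (Suc i) t - f i t) = f n t" for n t
    by (simp add: sum_lessThan_telescope[where f="\<lambda>i. f i t"])
  then have "(\<lambda>n t. f 0 t + (\<Sum>i<n. f (Suc i) t - f i t)) = f"
    by (intro ext)
  ultimately have "uniform_limit S f (\<lambda>t. f 0 t + (\<Sum>i. f (Suc i) t - f i t)) sequentially"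
    by (simp only:)
  then show ?thesis by (intro exI)
qed

section \<open>Null sets and limits of adapted processes\<close>

context filtered_prob_space
begin

lemma space_F [simp]: "0 \<le> t \<Longrightarrow> space (F t) = space M"
  using subalg by (auto simp: subalgebra_def)

lemma measurable_F_mono:
  assumes "X \<in> measurable (F s) N" "0 \<le> s" "s \<le> t"
  shows "X \<in> measurable (F t) N"
proof -
  have "subalgebra (F t) (F s)" unfolding subalgebra_def using assms F_mono by simp
  then show ?thesis using assms(1) by (rule measurable_from_subalg)
qed

lemma measurable_F_M: "X \<in> measurable (F s) N \<Longrightarrow> 0 \<le> s \<Longrightarrow> X \<in> measurable M N"
  by (rule measurable_from_subalg[OF subalg])

lemma null_sets_F: "0 \<le> t \<Longrightarrow> N \<in> null_sets M \<Longrightarrow> N \<in> sets (F t)"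
  using F_null F_mono[of 0 t] by auto

text \<open>Null sets lie in \<open>F 0\<close>, so an almost sure property holds on an event of
  \<open>F 0\<close> with full measure. Processes may be redefined off such an event without losing
  adaptedness.\<close>

lemma AE_F0_set:
  assumes "AE \<omega> in M. P \<omega>"
  obtains G where "G \<in> sets (F 0)" "\<And>\<omega>. \<omega> \<in> G \<Longrightarrow> \<omega> \<in> space M \<and> P \<omega>" "AE \<omega> in M. \<omega> \<in> G"
proof -
  obtain N where N: "{\<omega>\<in>space M. \<not> P \<omega>} \<subseteq> N" "N \<in> null_sets M"
    using assms by (metis AE_E null_setsI)
  show thesis
  proof (rule that[of "space M - N"])
    show "space M - N \<in> sets (F 0)"
      using null_sets_F[OF order_refl N(2)] sets.compl_sets[of N "F 0"] by simp
    show "AE \<omega> in M. \<omega> \<in> space M - N" using N(2) AE_not_in by auto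
  qed (use N in auto)
qed

text \<open>The rate \<open>(1/4) ^ n\<close> leaves room for weights \<open>2 ^ n\<close>: the
  weighted squared suprema of the steps still have a finite sum almost surely, so the paths converge
  uniformly. The limit is set to 0 off an event of \<open>F 0\<close> where this holds, which keeps
  every path continuous.\<close>

lemma continuous_process_limit:
  fixes Z :: "nat \<Rightarrow> real \<Rightarrow> 'w \<Rightarrow> 'b::euclidean_space"
  assumes T: "0 \<le> T"
    and ad: "\<And>n t. t \<in> {0..T} \<Longrightarrow> Z n t \<in> borel_measurable (F t)"
    and cont: "\<And>n \<omega>. \<omega> \<in> space M \<Longrightarrow> continuous_on {0..T} (\<lambda>t. Z n t \<omega>)"
    and c: "c \<ge> 0" and bound: "\<And>n. (\<integral>\<^sup>+\<omega>. (SUP t\<in>{0..T}. ennreal ((norm (Z (Suc n) t \<omega> - Z n t \<omega>))\<^sup>2)) \<partial>M)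
        \<le> ennreal (c * (1/4) ^ n)"
  obtains X where "\<And>t. t \<in> {0..T} \<Longrightarrow> X t \<in> borel_measurable (F t)"
    "\<And>\<omega>. \<omega> \<in> space M \<Longrightarrow> continuous_on {0..T} (\<lambda>t. X t \<omega>)"
    "AE \<omega> in M. uniform_limit {0..T} (\<lambda>n t. Z n t \<omega>) (\<lambda>t. X t \<omega>) sequentially"
proof -
  have adM: "Z n t \<in> borel_measurable M" if "t \<in> {0..T}" for n t
    using ad[OF that] that by (intro measurable_F_M[of _ t]) auto
  define S where "S n \<omega> = (SUP t\<in>{0..T}. ennreal ((norm (Z (Suc n) t \<omega> - Z n t \<omega>))\<^sup>2))" for n \<omega>
  have S_meas [measurable]: "S n \<in> borel_measurable M" for n
    unfolding S_def using T adM cont by (intro SUP_sq_measurable continuous_on_diff) auto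
  have "(\<integral>\<^sup>+\<omega>. (\<Sum>n. ennreal (2 ^ n) * S n \<omega>) \<partial>M) = (\<Sum>n. ennreal (2 ^ n) * (\<integral>\<^sup>+\<omega>. S n \<omega> \<partial>M))"
    by (simp add: nn_integral_suminf nn_integral_cmult)
  also have "\<dots> \<le> (\<Sum>n. ennreal (c * (1/2) ^ n))"
  proof (intro suminf_le)
    fix n
    have "ennreal (2 ^ n) * (\<integral>\<^sup>+\<omega>. S n \<omega> \<partial>M) \<le> ennreal (2 ^ n) * ennreal (c * (1/4) ^ n)"
      unfolding S_def by (intro mult_left_mono bound) auto
    also have "\<dots> = ennreal (c * (1/2) ^ n)"
      using c by (subst ennreal_mult[symmetric]) (auto simp: power_mult_distrib[symmetric] mult.left_commute)
    finally show "ennreal (2 ^ n) * (\<integral>\<^sup>+\<omega>. S n \<omega> \<partial>M) \<le> ennreal (c * (1/2) ^ n)" .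
  qed auto
  also have "\<dots> = ennreal (\<Sum>n. c * (1/2) ^ n)"
    using c by (intro suminf_ennreal2) (auto intro!: summable_mult summable_geometric)
  also have "\<dots> < \<top>" by simp
  finally have "AE \<omega> in M. (\<Sum>n. ennreal (2 ^ n) * S n \<omega>) \<noteq> \<infinity>"
    by (intro nn_integral_PInf_AE) auto
  then have "AE \<omega> in M. \<exists>g. uniform_limit {0..T} (\<lambda>n t. Z n t \<omega>) g sequentially"
  proof eventually_elim
    case (elim \<omega>)
    then obtain b where b: "(\<Sum>n. ennreal (2 ^ n) * S n \<omega>) = ennreal b" "b \<ge> 0"
      by (cases "\<Sum>n. ennreal (2 ^ n) * S n \<omega>") auto
    \<comment> \<open>Each weighted term is below the finite sum \<open>b\<close>, and the factor
      \<open>(1 / 2) ^ n\<close> gained from the weight has a summable square root.\<close>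
    have "norm (Z (Suc n) t \<omega> - Z n t \<omega>) \<le> sqrt b * (1 / sqrt 2) ^ n" if t: "t \<in> {0..T}" for n t
    proof -
      have "ennreal (2 ^ n * (norm (Z (Suc n) t \<omega> - Z n t \<omega>))\<^sup>2) \<le> ennreal (2 ^ n) * S n \<omega>"
        unfolding S_def using t by (subst ennreal_mult) (auto intro!: mult_left_mono SUP_upper)
      also have "\<dots> \<le> (\<Sum>n. ennreal (2 ^ n) * S n \<omega>)"
        using sum_le_suminf[of "\<lambda>n. ennreal (2 ^ n) * S n \<omega>" "{n}"] by simp
      finally have "2 ^ n * (norm (Z (Suc n) t \<omega> - Z n t \<omega>))\<^sup>2 \<le> b" using b by simp
      then have "(norm (Z (Suc n) t \<omega> - Z n t \<omega>))\<^sup>2 \<le> b * (1 / 2) ^ n"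
        by (simp add: field_simps)
      then have "norm (Z (Suc n) t \<omega> - Z n t \<omega>) \<le> sqrt (b * (1 / 2) ^ n)" by (rule real_le_rsqrt)
      then show ?thesis by (simp add: real_sqrt_mult real_sqrt_power real_sqrt_divide)
    qed
    moreover have "summable (\<lambda>n. sqrt b * (1 / sqrt 2) ^ n)"
      by (intro summable_mult summable_geometric) auto
    ultimately show ?case by (rule uniform_limit_summable_steps[of "{0..T}" "\<lambda>n t. Z n t \<omega>"])
  qed
  from AE_F0_set[OF this] obtain G where G: "G \<in> sets (F 0)"
    "\<And>\<omega>. \<omega> \<in> G \<Longrightarrow> \<omega> \<in> space M \<and> (\<exists>g. uniform_limit {0..T} (\<lambda>n t. Z n t \<omega>) g sequentially)"
    "AE \<omega> in M. \<omega> \<in> G" by blast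
  define X where "X t \<omega> = (if \<omega> \<in> G then lim (\<lambda>n. Z n t \<omega>) else 0)" for t \<omega>
  have ul: "uniform_limit {0..T} (\<lambda>n t. Z n t \<omega>) (\<lambda>t. X t \<omega>) sequentially" if "\<omega> \<in> G" for \<omega>
  proof -
    obtain g where g: "uniform_limit {0..T} (\<lambda>n t. Z n t \<omega>) g sequentially" using G(2) \<open>\<omega> \<in> G\<close> by blast
    have "X t \<omega> = g t" if "t \<in> {0..T}" for t
      using tendsto_uniform_limitI[OF g that] \<open>\<omega> \<in> G\<close> by (simp add: X_def limI)
    then show ?thesis using g by (metis (no_types, lifting) uniform_limit_cong')
  qed
  show thesis
  proof (rule that[of X])
    fix t assume t: "t \<in> {0..T}"
    have G': "G \<in> sets (F t)" using G(1) F_mono[of 0 t] t by auto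
    show "X t \<in> borel_measurable (F t)"
    proof (rule borel_measurable_LIMSEQ_metric)
      show "(\<lambda>\<omega>. indicator G \<omega> *\<^sub>R Z n t \<omega>) \<in> borel_measurable (F t)" for n
        using ad[OF t] G' by (intro borel_measurable_scaleR borel_measurable_indicator) auto
      fix \<omega> assume "\<omega> \<in> space (F t)"
      show "(\<lambda>n. indicator G \<omega> *\<^sub>R Z n t \<omega>) \<longlonglongrightarrow> X t \<omega>"
        using tendsto_uniform_limitI[OF ul t] by (cases "\<omega> \<in> G") (auto simp: X_def)
    qed
  next
    fix \<omega> assume "\<omega> \<in> space M"
    show "continuous_on {0..T} (\<lambda>t. X t \<omega>)"
    proof (cases "\<omega> \<in> G")
      case True
      then show ?thesis using uniform_limit_theorem[OF _ ul] cont G(2) by (auto intro: always_eventually)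
    qed (simp add: X_def)
  qed (use G(3) ul in auto)
qed

end

section \<open>Progressive processes\<close>

context filtered_prob_space
begin

text \<open>The scalar notion \<open>progressive\<close>, extended to the vector and matrix
  processes in the equations.\<close>

definition progressive_on :: "real \<Rightarrow> (real \<Rightarrow> 'w \<Rightarrow> 'b::topological_space) \<Rightarrow> bool" where
  "progressive_on T H \<longleftrightarrow>
    (\<forall>r\<in>{0..T}. (\<lambda>x. H (fst x) (snd x)) \<in> borel_measurable (restrict_space borel {0..r} \<Otimes>\<^sub>M F r))"

text \<open>Multiplication with an indicator replaces the restricted time interval by the whole
  line, so that Tonelli's theorem applies on \<open>lborel \<Otimes>\<^sub>M M\<close>.\<close>

definition cut :: "real \<Rightarrow> (real \<Rightarrow> 'w \<Rightarrow> 'b::real_normed_vector) \<Rightarrow> real \<times> 'w \<Rightarrow> 'b" where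
  "cut r H x = indicator {0..r} (fst x) *\<^sub>R H (fst x) (snd x)"

text \<open>The squared L2 norm over time and outcomes up to \<open>r\<close>. It takes values in
  \<open>ennreal\<close>, so estimates can be stated before finiteness is known.\<close>

definition energy :: "real \<Rightarrow> (real \<Rightarrow> 'w \<Rightarrow> 'b::real_normed_vector) \<Rightarrow> ennreal" where
  "energy r H = (\<integral>\<^sup>+x. ennreal ((norm (cut r H x))\<^sup>2) \<partial>(lborel \<Otimes>\<^sub>M M))"

text \<open>A function that is measurable on the times up to \<open>r\<close> becomes measurable on
  the full product after extension by 0.\<close>

lemma cut_measurable_F:
  assumes "progressive_on T H" and r: "r \<in> {0..T}"
  shows "cut r H \<in> borel_measurable (borel \<Otimes>\<^sub>M F r)"
proof -
  let ?R = "restrict_space (borel \<Otimes>\<^sub>M F r) ({0..r} \<times> space M)"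
  have "fst \<in> measurable ?R (restrict_space borel {0..r})"
    by (intro measurable_restrict_space2 measurable_restrict_space1 measurable_fst)
      (auto simp: space_restrict_space)
  moreover have "snd \<in> measurable ?R (F r)"
    by (intro measurable_restrict_space1 measurable_snd)
  ultimately have "(\<lambda>x. (fst x, snd x)) \<in> measurable ?R (restrict_space borel {0..r} \<Otimes>\<^sub>M F r)"
    by (rule measurable_Pair)
  moreover have "(\<lambda>x. H (fst x) (snd x)) \<in> borel_measurable (restrict_space borel {0..r} \<Otimes>\<^sub>M F r)"
    using assms unfolding progressive_on_def by blast
  ultimately have m: "(\<lambda>x. H (fst (fst x, snd x)) (snd (fst x, snd x))) \<in> borel_measurable ?R"
    by (rule measurable_compose)
  have "{0..r} \<times> space (F r) \<in> sets (borel \<Otimes>\<^sub>M F r)" by (intro pair_measureI sets.top) simp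
  then have s: "({0..r} \<times> space M) \<inter> space (borel \<Otimes>\<^sub>M F r) \<in> sets (borel \<Otimes>\<^sub>M F r)"
    using r by (intro sets.Int[OF _ sets.top]) (simp only: space_F[of r] atLeastAtMost_iff)
  have "(\<lambda>x. indicator ({0..r} \<times> space M) x *\<^sub>R H (fst x) (snd x)) \<in> borel_measurable (borel \<Otimes>\<^sub>M F r)"
    using borel_measurable_restrict_space_iff[OF s, THEN iffD1, OF m] by (simp only: fst_conv snd_conv)
  moreover have "cut r H x = indicator ({0..r} \<times> space M) x *\<^sub>R H (fst x) (snd x)"
    if "x \<in> space (borel \<Otimes>\<^sub>M F r)" for x
    using that r by (auto simp: cut_def space_pair_measure indicator_def)
  ultimately show ?thesis by (subst measurable_cong)
qed

lemma cut_measurable: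
  assumes "progressive_on T H" and r: "r \<in> {0..T}"
  shows "cut r H \<in> borel_measurable (lborel \<Otimes>\<^sub>M M)"
proof -
  have "snd \<in> measurable (lborel \<Otimes>\<^sub>M M) (F r)"
    by (rule measurable_compose[OF measurable_snd]) (use subalg[of r] r in \<open>auto simp: subalgebra_def measurable_def\<close>)
  then have "(\<lambda>x. (fst x, snd x)) \<in> measurable (lborel \<Otimes>\<^sub>M M) (borel \<Otimes>\<^sub>M F r)"
    by (intro measurable_Pair) auto
  from measurable_compose[OF this cut_measurable_F[OF assms]] show ?thesis by simp
qed

lemma cut_diff: "cut r (\<lambda>s \<omega>. H s \<omega> - K s \<omega>) x = cut r H x - cut r K x"
  by (simp add: cut_def algebra_simps)

lemma pair_sf: "pair_sigma_finite lborel M" by unfold_locales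

text \<open>Tonelli with time outside, for bounds known at each time. The next lemma has the
  outcomes outside, for estimates made path by path.\<close>

lemma energy_time:
  assumes "progressive_on T H" and r: "r \<in> {0..T}"
  shows "energy r H = (\<integral>\<^sup>+s\<in>{0..r}. (\<integral>\<^sup>+\<omega>. ennreal ((norm (H s \<omega>))\<^sup>2) \<partial>M) \<partial>lborel)"
proof -
  note [measurable] = cut_measurable[OF assms]
  have "energy r H = (\<integral>\<^sup>+s. \<integral>\<^sup>+\<omega>. ennreal ((norm (cut r H (s, \<omega>)))\<^sup>2) \<partial>M \<partial>lborel)"
    unfolding energy_def by (rule nn_integral_fst[symmetric]) measurable
  also have "\<dots> = (\<integral>\<^sup>+s\<in>{0..r}. (\<integral>\<^sup>+\<omega>. ennreal ((norm (H s \<omega>))\<^sup>2) \<partial>M) \<partial>lborel)"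
    by (intro nn_integral_cong) (auto simp: cut_def indicator_def)
  finally show ?thesis .
qed

lemma energy_paths:
  assumes "progressive_on T H" and r: "r \<in> {0..T}"
  shows "energy r H = (\<integral>\<^sup>+\<omega>. (\<integral>\<^sup>+s\<in>{0..r}. ennreal ((norm (H s \<omega>))\<^sup>2) \<partial>lborel) \<partial>M)"
proof -
  note [measurable] = cut_measurable[OF assms]
  have "energy r H = (\<integral>\<^sup>+\<omega>. \<integral>\<^sup>+s. ennreal ((norm (cut r H (s, \<omega>)))\<^sup>2) \<partial>lborel \<partial>M)"
    unfolding energy_def by (rule pair_sigma_finite.nn_integral_snd[OF pair_sf, symmetric]) measurable
  also have "\<dots> = (\<integral>\<^sup>+\<omega>. (\<integral>\<^sup>+s\<in>{0..r}. ennreal ((norm (H s \<omega>))\<^sup>2) \<partial>lborel) \<partial>M)"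
    by (intro nn_integral_cong) (auto simp: cut_def indicator_def)
  finally show ?thesis .
qed

lemma energy_path_measurable:
  assumes "progressive_on T H" and r: "r \<in> {0..T}"
  shows "(\<lambda>\<omega>. \<integral>\<^sup>+s\<in>{0..r}. ennreal ((norm (H s \<omega>))\<^sup>2) \<partial>lborel) \<in> borel_measurable M"
proof -
  note [measurable] = cut_measurable[OF assms]
  have "(\<lambda>\<omega>. \<integral>\<^sup>+s. ennreal ((norm (cut r H (s, \<omega>)))\<^sup>2) \<partial>lborel) \<in> borel_measurable M"
    by measurable
  moreover have "ennreal ((norm (cut r H (s, \<omega>)))\<^sup>2) = ennreal ((norm (H s \<omega>))\<^sup>2) * indicator {0..r} s" for s \<omega>
    by (auto simp: cut_def indicator_def)
  ultimately show ?thesis by simp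
qed

lemma energy_mono_time: "0 \<le> t \<Longrightarrow> t \<le> T \<Longrightarrow> energy t H \<le> energy T H"
  unfolding energy_def by (intro nn_integral_mono ennreal_leI power_mono) (auto simp: cut_def indicator_def)

lemma energy_mono:
  "(\<And>s \<omega>. s \<in> {0..t} \<Longrightarrow> \<omega> \<in> space M \<Longrightarrow> norm (H s \<omega>) \<le> norm (K s \<omega>)) \<Longrightarrow> energy t H \<le> energy t K"
  unfolding energy_def
  by (intro nn_integral_mono ennreal_leI power_mono) (auto simp: cut_def indicator_def space_pair_measure)

lemma energy_triangle:
  fixes H K L :: "real \<Rightarrow> 'w \<Rightarrow> 'b::euclidean_space"
  assumes "progressive_on T H" "progressive_on T K" "progressive_on T L" and r: "r \<in> {0..T}"
  shows "energy r (\<lambda>s \<omega>. H s \<omega> - L s \<omega>) \<le>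
    2 * energy r (\<lambda>s \<omega>. H s \<omega> - K s \<omega>) + 2 * energy r (\<lambda>s \<omega>. K s \<omega> - L s \<omega>)"
  unfolding energy_def cut_diff using assms by (intro nn_integral_sq_diff_le cut_measurable)

text \<open>The time domain \<open>{0..}\<close> of \<open>g\<close> is that of the coefficients
  \<open>a\<close> and \<open>b\<close>, about which nothing is known at negative times.\<close>

lemma progressive_on_compose:
  assumes X: "progressive_on T X"
    and g: "(\<lambda>(s, x). g s x) \<in> borel_measurable (restrict_space borel {0..} \<Otimes>\<^sub>M borel)"
  shows "progressive_on T (\<lambda>s \<omega>. g s (X s \<omega>))"
  unfolding progressive_on_def
proof
  fix r assume r: "r \<in> {0..T}"
  let ?N = "restrict_space borel {0..r} \<Otimes>\<^sub>M F r"
  have "fst \<in> measurable ?N (restrict_space borel {0..})"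
    by (rule measurable_compose[OF measurable_fst]) (auto intro!: measurable_restrict_space3)
  then have "(\<lambda>x. (fst x, X (fst x) (snd x))) \<in> measurable ?N (restrict_space borel {0..} \<Otimes>\<^sub>M borel)"
    using X r by (intro measurable_Pair) (auto simp: progressive_on_def)
  from measurable_compose[OF this g]
  show "(\<lambda>x. g (fst x) (X (fst x) (snd x))) \<in> borel_measurable ?N" by simp
qed

lemma progressive_on_continuous2:
  fixes X :: "real \<Rightarrow> 'w \<Rightarrow> 'b::second_countable_topology"
    and Y :: "real \<Rightarrow> 'w \<Rightarrow> 'c::second_countable_topology"
  assumes "progressive_on T X" "progressive_on T Y" "continuous_on UNIV (\<lambda>x. h (fst x) (snd x))"
  shows "progressive_on T (\<lambda>s \<omega>. h (X s \<omega>) (Y s \<omega>) :: 'd::topological_space)"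
  unfolding progressive_on_def
proof
  fix r assume "r \<in> {0..T}"
  then show "(\<lambda>x. h (X (fst x) (snd x)) (Y (fst x) (snd x))) \<in> borel_measurable (restrict_space borel {0..r} \<Otimes>\<^sub>M F r)"
    using assms(1,2) unfolding progressive_on_def by (intro borel_measurable_continuous_Pair[OF _ _ assms(3)]) blast+
qed

lemma progressive_on_continuous1:
  fixes X :: "real \<Rightarrow> 'w \<Rightarrow> 'b::topological_space"
  assumes "progressive_on T X" "continuous_on UNIV h"
  shows "progressive_on T (\<lambda>s \<omega>. h (X s \<omega>) :: 'd::topological_space)"
  unfolding progressive_on_def
proof
  fix r assume "r \<in> {0..T}"
  then have "(\<lambda>x. X (fst x) (snd x)) \<in> borel_measurable (restrict_space borel {0..r} \<Otimes>\<^sub>M F r)"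
    using assms(1) unfolding progressive_on_def by blast
  then show "(\<lambda>x. h (X (fst x) (snd x))) \<in> borel_measurable (restrict_space borel {0..r} \<Otimes>\<^sub>M F r)"
    by (rule measurable_compose[OF _ borel_measurable_continuous_onI[OF assms(2)]])
qed

lemma progressive_on_diff:
  fixes X Y :: "real \<Rightarrow> 'w \<Rightarrow> 'b::euclidean_space"
  shows "progressive_on T X \<Longrightarrow> progressive_on T Y \<Longrightarrow> progressive_on T (\<lambda>s \<omega>. X s \<omega> - Y s \<omega>)"
  by (rule progressive_on_continuous2[where h="(-)"]) (auto intro!: continuous_intros)

lemma progressive_on_adapted_continuous:
  fixes X :: "real \<Rightarrow> 'w \<Rightarrow> 'b::metric_space"
  assumes ad: "\<And>t. t \<in> {0..T} \<Longrightarrow> X t \<in> borel_measurable (F t)"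
    and cont: "\<And>\<omega>. \<omega> \<in> space M \<Longrightarrow> continuous_on {0..T} (\<lambda>t. X t \<omega>)"
  shows "progressive_on T X"
  unfolding progressive_on_def
proof
  fix r assume r: "r \<in> {0..T}"
  let ?N = "restrict_space borel {0..r} \<Otimes>\<^sub>M F r"
  \<comment> \<open>Clamping to \<open>{0..r}\<close> makes every grid time, for whatever integer
    \<open>k\<close>, one whose variable is measurable with respect to \<open>F r\<close>.\<close>
  define q where "q n k = max 0 (min r (real_of_int k / real (Suc n)))" for n k
  have q: "q n k \<in> {0..r}" for n k using r by (auto simp: q_def)
  define g where "g n x = \<lfloor>real (Suc n) * fst x\<rfloor>" for n and x :: "real \<times> 'w"
  show "(\<lambda>x. X (fst x) (snd x)) \<in> borel_measurable ?N"
  proof (rule borel_measurable_LIMSEQ_metric)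
    fix n
    have 1: "(\<lambda>x. X (q n k) (snd x)) \<in> borel_measurable ?N" for k
    proof -
      have "X (q n k) \<in> borel_measurable (F r)"
        using q[of n k] r by (intro measurable_F_mono[OF ad]) auto
      then show ?thesis by (rule measurable_compose[OF measurable_snd])
    qed
    have 2: "g n \<in> measurable ?N (count_space UNIV)"
    proof -
      have "fst \<in> borel_measurable ?N"
        by (rule measurable_compose[OF measurable_fst]) (auto intro: measurable_restrict_space1)
      then have "(\<lambda>x. real (Suc n) * fst x) \<in> borel_measurable ?N" by measurable
      then show ?thesis unfolding g_def by (rule measurable_compose[OF _ measurable_real_floor])
    qed
    show "(\<lambda>x. X (q n (g n x)) (snd x)) \<in> borel_measurable ?N"
      by (rule measurable_compose_countable'[OF 1 2]) auto
  next
    fix x assume "x \<in> space ?N"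
    then obtain s \<omega> where x: "x = (s, \<omega>)" "s \<in> {0..r}" "\<omega> \<in> space M"
      using r by (cases x) (auto simp: space_pair_measure space_restrict_space)
    have "(\<lambda>n. q n (g n x)) \<longlonglongrightarrow> s"
    proof (rule tendsto_sandwich)
      have fl: "s - inverse (real (Suc n)) \<le> real_of_int (g n x) / real (Suc n)"
         "real_of_int (g n x) / real (Suc n) \<le> s" for n
      proof -
        have "real_of_int (g n x) \<le> real (Suc n) * s" "real (Suc n) * s - 1 \<le> real_of_int (g n x)"
          unfolding g_def x(1) fst_conv by linarith+
        then show "s - inverse (real (Suc n)) \<le> real_of_int (g n x) / real (Suc n)"
         "real_of_int (g n x) / real (Suc n) \<le> s"
        proof -
          have k: "real (Suc n) > 0" by simp
          show "real_of_int (g n x) / real (Suc n) \<le> s"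
            using \<open>real_of_int (g n x) \<le> real (Suc n) * s\<close> k by (simp only: pos_divide_le_eq mult.commute)
          have "(real (Suc n) * s - 1) / real (Suc n) \<le> real_of_int (g n x) / real (Suc n)"
            using \<open>real (Suc n) * s - 1 \<le> real_of_int (g n x)\<close> k by (intro divide_right_mono) auto
          moreover have "(real (Suc n) * s - 1) / real (Suc n) = s - inverse (real (Suc n))"
            using k by (simp add: diff_divide_distrib inverse_eq_divide del: of_nat_Suc)
          ultimately show "s - inverse (real (Suc n)) \<le> real_of_int (g n x) / real (Suc n)" by simp
        qed
      qed
      show "\<forall>\<^sub>F n in sequentially. s - inverse (real (Suc n)) \<le> q n (g n x)"
      proof (intro always_eventually allI)
        fix n show "s - inverse (real (Suc n)) \<le> q n (g n x)"
          using fl[of n] x(2) inverse_nonnegative_iff_nonnegative[of "real (Suc n)"]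
          unfolding q_def by (simp add: min_def max_def del: of_nat_Suc)
      qed
      show "\<forall>\<^sub>F n in sequentially. q n (g n x) \<le> s"
      proof (intro always_eventually allI)
        fix n show "q n (g n x) \<le> s"
          using fl[of n] x(2) unfolding q_def by (simp add: min_def max_def del: of_nat_Suc)
      qed
      show "(\<lambda>n. s - inverse (real (Suc n))) \<longlonglongrightarrow> s"
        using tendsto_diff[OF tendsto_const LIMSEQ_inverse_real_of_nat, of s] by simp
    qed simp
    then show "(\<lambda>n. X (q n (g n x)) (snd x)) \<longlonglongrightarrow> X (fst x) (snd x)"
    proof -
      have "q n (g n x) \<in> {0..T}" for n using q[of n "g n x"] r by auto
      moreover have "s \<in> {0..T}" using x(2) r by auto
      ultimately show ?thesis
        using x(1) \<open>(\<lambda>n. q n (g n x)) \<longlonglongrightarrow> s\<close>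
        by (simp only: fst_conv snd_conv)
          (intro continuous_on_tendsto_compose[OF cont[OF x(3)]] always_eventually allI)
    qed
  qed
qed

lemma progressive_on_deterministic:
  fixes V :: "real \<Rightarrow> 'b::metric_space"
  assumes "continuous_on {0..T} V"
  shows "progressive_on T (\<lambda>s \<omega>. V s)"
  using assms by (intro progressive_on_adapted_continuous) auto

lemma cut_section_measurable:
  fixes H :: "real \<Rightarrow> 'w \<Rightarrow> 'b::euclidean_space"
  assumes "progressive_on T H" "r \<in> {0..T}" "\<omega> \<in> space M"
  shows "(\<lambda>s. indicator {0..r} s *\<^sub>R H s \<omega>) \<in> borel_measurable borel"
proof -
  have "(\<lambda>s. cut r H (s, \<omega>)) \<in> borel_measurable borel"
    using assms by (intro measurable_compose[OF _ cut_measurable_F[OF assms(1,2)]] measurable_Pair2') auto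
  then show ?thesis by (simp add: cut_def)
qed

text \<open>The set \<open>A\<close> admits integrals over a subinterval that ends at
  \<open>r\<close>, such as the previous cell of a grid.\<close>

lemma integral_process_adapted:
  fixes H :: "real \<Rightarrow> 'w \<Rightarrow> 'b::euclidean_space"
  assumes "progressive_on T H" "r \<in> {0..T}" "A \<in> sets borel"
  shows "(\<lambda>\<omega>. LINT s:({0..r} \<inter> A)|lborel. H s \<omega>) \<in> borel_measurable (F r)"
proof -
  have "(\<lambda>x. (snd x, fst x)) \<in> measurable (F r \<Otimes>\<^sub>M lborel) (borel \<Otimes>\<^sub>M F r)"
    by (intro measurable_Pair) auto
  from measurable_compose[OF this cut_measurable_F[OF assms(1,2)]]
  have [measurable]: "(\<lambda>x. cut r H (snd x, fst x)) \<in> borel_measurable (F r \<Otimes>\<^sub>M lborel)" .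
  have [measurable]: "(\<lambda>x. indicator A (snd x) :: real) \<in> borel_measurable (F r \<Otimes>\<^sub>M lborel)"
    using assms(3) by (intro measurable_compose[OF measurable_snd] borel_measurable_indicator) auto
  have "(\<lambda>\<omega>. \<integral>s. indicator A s *\<^sub>R cut r H (s, \<omega>) \<partial>lborel) \<in> borel_measurable (F r)"
    by (intro lborel.borel_measurable_lebesgue_integral) (simp add: case_prod_beta)
  moreover have "indicator A s *\<^sub>R cut r H (s, \<omega>) = indicator ({0..r} \<inter> A) s *\<^sub>R H s \<omega>" for s \<omega>
    by (auto simp: cut_def indicator_def)
  ultimately show ?thesis by (simp add: set_lebesgue_integral_def)
qed

lemma drift_adapted_continuous:
  fixes H :: "real \<Rightarrow> 'w \<Rightarrow> 'b::euclidean_space"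
  assumes H: "progressive_on T H"
    and int: "\<And>\<omega>. \<omega> \<in> space M \<Longrightarrow> set_integrable lborel {0..T} (\<lambda>s. H s \<omega>)"
  shows "t \<in> {0..T} \<Longrightarrow> (\<lambda>\<omega>. LINT s:{0..t}|lborel. H s \<omega>) \<in> borel_measurable (F t)"
    and "\<omega> \<in> space M \<Longrightarrow> continuous_on {0..T} (\<lambda>t. LINT s:{0..t}|lborel. H s \<omega>)"
proof -
  show "(\<lambda>\<omega>. LINT s:{0..t}|lborel. H s \<omega>) \<in> borel_measurable (F t)" if "t \<in> {0..T}"
    using integral_process_adapted[OF H that, of UNIV] by simp
  assume w: "\<omega> \<in> space M"
  have "continuous_on {0..T} (\<lambda>t. integral {0..t} (\<lambda>s. H s \<omega>))"
    by (intro indefinite_integral_continuous_1 set_borel_integral_eq_integral(1) int w)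
  moreover have "(LINT s:{0..t}|lborel. H s \<omega>) = integral {0..t} (\<lambda>s. H s \<omega>)" if "t \<in> {0..T}" for t
    using that by (intro set_borel_integral_eq_integral(2) set_integrable_subset[OF int[OF w]]) auto
  ultimately show "continuous_on {0..T} (\<lambda>t. LINT s:{0..t}|lborel. H s \<omega>)"
    by (subst continuous_on_cong[OF refl]) auto
qed

lemma drift_sq_le:
  fixes H :: "real \<Rightarrow> 'w \<Rightarrow> 'b::euclidean_space"
  assumes H: "progressive_on T H" and w: "\<omega> \<in> space M" and t: "t \<in> {0..T}"
  shows "ennreal ((norm (LINT s:{0..t}|lborel. H s \<omega>))\<^sup>2) \<le>
    ennreal t * (\<integral>\<^sup>+s\<in>{0..t}. ennreal ((norm (H s \<omega>))\<^sup>2) \<partial>lborel)"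
proof -
  define h where "h s = indicator {0..t} s *\<^sub>R H s \<omega>" for s
  have [measurable]: "h \<in> borel_measurable lborel"
    using cut_section_measurable[OF H t w] by (simp add: h_def[abs_def])
  have h2: "ennreal (norm (h s)) ^ 2 = ennreal ((norm (H s \<omega>))\<^sup>2) * indicator {0..t} s" for s
    by (auto simp: h_def indicator_def ennreal_power)
  have "norm (LINT s:{0..t}|lborel. H s \<omega>) = norm (\<integral>s. h s \<partial>lborel)"
    by (simp add: set_lebesgue_integral_def h_def)
  also have "ennreal \<dots> \<le> (\<integral>\<^sup>+s. ennreal (norm (h s)) \<partial>lborel)"
  \<comment> \<open>A Bochner integral that does not exist is 0 by convention, so the estimate is
    trivial in that case.\<close>
  proof (cases "integrable lborel h")
    case False
    then show ?thesis by (simp add: not_integrable_integral_eq)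
  qed (rule integral_norm_bound_ennreal)
  also have "\<dots> = (\<integral>\<^sup>+s. indicator {0..t} s * ennreal (norm (h s)) \<partial>lborel)"
    by (intro nn_integral_cong) (auto simp: h_def indicator_def)
  finally have "(ennreal (norm (LINT s:{0..t}|lborel. H s \<omega>)))\<^sup>2 \<le>
      (\<integral>\<^sup>+s. indicator {0..t} s * ennreal (norm (h s)) \<partial>lborel)\<^sup>2"
    by (intro power_mono) auto
  also have "\<dots> \<le> (\<integral>\<^sup>+s. (indicator {0..t} s)\<^sup>2 \<partial>lborel) * (\<integral>\<^sup>+s. (ennreal (norm (h s)))\<^sup>2 \<partial>lborel)"
    by (intro Cauchy_Schwarz_nn_integral) measurable
  also have "(\<integral>\<^sup>+s. (indicator {0..t} s :: ennreal)\<^sup>2 \<partial>lborel) = (\<integral>\<^sup>+s. indicator {0..t} s \<partial>lborel)"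
    by (intro nn_integral_cong) (auto simp: indicator_def)
  also have "\<dots> = ennreal t" using t by simp
  finally show ?thesis by (simp add: h2 ennreal_power)
qed

lemma drift_mean_sq_le:
  fixes H :: "real \<Rightarrow> 'w \<Rightarrow> 'b::euclidean_space"
  assumes H: "progressive_on T H" and t: "t \<in> {0..T}"
  shows "(\<integral>\<^sup>+\<omega>. ennreal ((norm (LINT s:{0..t}|lborel. H s \<omega>))\<^sup>2) \<partial>M) \<le> ennreal t * energy t H"
proof -
  have "(\<integral>\<^sup>+\<omega>. ennreal ((norm (LINT s:{0..t}|lborel. H s \<omega>))\<^sup>2) \<partial>M) \<le>
      (\<integral>\<^sup>+\<omega>. ennreal t * (\<integral>\<^sup>+s\<in>{0..t}. ennreal ((norm (H s \<omega>))\<^sup>2) \<partial>lborel) \<partial>M)"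
    by (intro nn_integral_mono drift_sq_le[OF H _ t])
  also have "\<dots> = ennreal t * energy t H"
    unfolding energy_paths[OF H t] by (intro nn_integral_cmult energy_path_measurable[OF H t])
  finally show ?thesis .
qed

text \<open>The pathwise Cauchy-Schwarz bound increases with \<open>t\<close>, so its value at
  \<open>T\<close> controls the supremum.\<close>

lemma drift_sup_sq_le:
  fixes H :: "real \<Rightarrow> 'w \<Rightarrow> 'b::euclidean_space"
  assumes H: "progressive_on T H" and T: "0 \<le> T"
  shows "(\<integral>\<^sup>+\<omega>. (SUP t\<in>{0..T}. ennreal ((norm (LINT s:{0..t}|lborel. H s \<omega>))\<^sup>2)) \<partial>M) \<le> ennreal T * energy T H"
proof -
  have T': "T \<in> {0..T}" using T by simp
  have "(\<integral>\<^sup>+\<omega>. (SUP t\<in>{0..T}. ennreal ((norm (LINT s:{0..t}|lborel. H s \<omega>))\<^sup>2)) \<partial>M) \<le>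
      (\<integral>\<^sup>+\<omega>. ennreal T * (\<integral>\<^sup>+s\<in>{0..T}. ennreal ((norm (H s \<omega>))\<^sup>2) \<partial>lborel) \<partial>M)"
  proof (intro nn_integral_mono SUP_least)
    fix \<omega> t assume w: "\<omega> \<in> space M" and t: "t \<in> {0..T}"
    have "(\<integral>\<^sup>+s\<in>{0..t}. ennreal ((norm (H s \<omega>))\<^sup>2) \<partial>lborel) \<le> (\<integral>\<^sup>+s\<in>{0..T}. ennreal ((norm (H s \<omega>))\<^sup>2) \<partial>lborel)"
      using t by (intro nn_integral_mono mult_left_mono) (auto simp: indicator_def)
    then have "ennreal t * (\<integral>\<^sup>+s\<in>{0..t}. ennreal ((norm (H s \<omega>))\<^sup>2) \<partial>lborel) \<le>
        ennreal T * (\<integral>\<^sup>+s\<in>{0..T}. ennreal ((norm (H s \<omega>))\<^sup>2) \<partial>lborel)"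
      using t by (intro mult_mono ennreal_leI) auto
    with drift_sq_le[OF H w t]
    show "ennreal ((norm (LINT s:{0..t}|lborel. H s \<omega>))\<^sup>2) \<le>
      ennreal T * (\<integral>\<^sup>+s\<in>{0..T}. ennreal ((norm (H s \<omega>))\<^sup>2) \<partial>lborel)" by (rule order_trans)
  qed
  also have "\<dots> = ennreal T * energy T H"
    unfolding energy_paths[OF H T'] by (intro nn_integral_cmult energy_path_measurable[OF H T'])
  finally show ?thesis .
qed

end

section \<open>Square integrable continuous martingales\<close>

primrec running_max :: "(nat \<Rightarrow> real) \<Rightarrow> nat \<Rightarrow> real" where
  "running_max x 0 = x 0"
| "running_max x (Suc n) = max (running_max x n) (x (Suc n))"

lemma running_max_ge: "i \<le> n \<Longrightarrow> x i \<le> running_max x n"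
  by (induction n) (auto simp: le_Suc_eq intro: max.coboundedI1)

text \<open>A trajectorial form of Doob's inequality. The running maximum moves only when a new
  maximum is reached, and then the claim is a completed square. The sum is a discrete stochastic
  integral, whose mean is controlled for martingales.\<close>

lemma doob_pathwise:
  "(running_max x n)\<^sup>2 + 2 * (\<Sum>i<n. running_max x i * (x (Suc i) - x i)) \<le> 2 * running_max x n * x n"
proof (induction n)
  case 0
  then show ?case by (simp add: power2_eq_square)
next
  case (Suc n)
  define m where "m = running_max x n"
  show ?case
  proof (cases "x (Suc n) \<le> m")
    case True
    then have "running_max x (Suc n) = m" by (simp add: m_def)
    then show ?thesis using Suc.IH by (simp add: m_def algebra_simps)
  next
    case False
    then have e: "running_max x (Suc n) = x (Suc n)" by (simp add: m_def)
    have "0 \<le> (x (Suc n) - m)\<^sup>2" by simp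
    with Suc.IH show ?thesis unfolding e by (simp add: m_def[symmetric] power2_eq_square algebra_simps)
  qed
qed

context filtered_prob_space
begin

text \<open>The martingale property without conditional expectations: increments after
  \<open>s\<close> are orthogonal to all square integrable variables known at \<open>s\<close>.
  Continuity is asked of every path.\<close>

definition L2_martingale :: "real \<Rightarrow> (real \<Rightarrow> 'w \<Rightarrow> real) \<Rightarrow> bool" where
  "L2_martingale T X \<longleftrightarrow>
    (\<forall>t\<in>{0..T}. X t \<in> borel_measurable (F t) \<and> integrable M (\<lambda>\<omega>. (X t \<omega>)\<^sup>2)) \<and>
    (\<forall>\<omega>\<in>space M. continuous_on {0..T} (\<lambda>t. X t \<omega>)) \<and>
    (\<forall>s t \<phi>. 0 \<le> s \<longrightarrow> s \<le> t \<longrightarrow> t \<le> T \<longrightarrow> \<phi> \<in> borel_measurable (F s) \<longrightarrow>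
      integrable M (\<lambda>\<omega>. (\<phi> \<omega>)\<^sup>2) \<longrightarrow> (\<integral>\<omega>. \<phi> \<omega> * (X t \<omega> - X s \<omega>) \<partial>M) = 0)"

lemma L2_martingaleD:
  assumes "L2_martingale T X"
  shows "t \<in> {0..T} \<Longrightarrow> X t \<in> borel_measurable (F t)"
    and "t \<in> {0..T} \<Longrightarrow> X t \<in> borel_measurable M"
    and "t \<in> {0..T} \<Longrightarrow> integrable M (\<lambda>\<omega>. (X t \<omega>)\<^sup>2)"
    and "\<omega> \<in> space M \<Longrightarrow> continuous_on {0..T} (\<lambda>t. X t \<omega>)"
    and "0 \<le> s \<Longrightarrow> s \<le> t \<Longrightarrow> t \<le> T \<Longrightarrow> \<phi> \<in> borel_measurable (F s) \<Longrightarrow>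
      integrable M (\<lambda>\<omega>. (\<phi> \<omega>)\<^sup>2) \<Longrightarrow> (\<integral>\<omega>. \<phi> \<omega> * (X t \<omega> - X s \<omega>) \<partial>M) = 0"
proof -
  show 1: "X t \<in> borel_measurable (F t)" if "t \<in> {0..T}" using assms that unfolding L2_martingale_def by blast
  show "X t \<in> borel_measurable M" if "t \<in> {0..T}" using measurable_F_M[OF 1[OF that]] that by simp
qed (use assms in \<open>unfold L2_martingale_def, blast+\<close>)

lemma L2_martingaleI:
  assumes "\<And>t. t \<in> {0..T} \<Longrightarrow> X t \<in> borel_measurable (F t)"
    and "\<And>t. t \<in> {0..T} \<Longrightarrow> integrable M (\<lambda>\<omega>. (X t \<omega>)\<^sup>2)"
    and "\<And>\<omega>. \<omega> \<in> space M \<Longrightarrow> continuous_on {0..T} (\<lambda>t. X t \<omega>)"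
    and "\<And>s t \<phi>. 0 \<le> s \<Longrightarrow> s \<le> t \<Longrightarrow> t \<le> T \<Longrightarrow> \<phi> \<in> borel_measurable (F s) \<Longrightarrow>
      integrable M (\<lambda>\<omega>. (\<phi> \<omega>)\<^sup>2) \<Longrightarrow> (\<integral>\<omega>. \<phi> \<omega> * (X t \<omega> - X s \<omega>) \<partial>M) = 0"
  shows "L2_martingale T X"
  using assms unfolding L2_martingale_def by simp

lemma L2_martingale_increment_integrable:
  assumes X: "L2_martingale T X" and st: "0 \<le> s" "s \<le> t" "t \<le> T"
    and "\<phi> \<in> borel_measurable (F s)" "integrable M (\<lambda>\<omega>. (\<phi> \<omega>)\<^sup>2)"
  shows "integrable M (\<lambda>\<omega>. \<phi> \<omega> * (X t \<omega> - X s \<omega>))"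
proof -
  have "s \<in> {0..T}" "t \<in> {0..T}" using st by auto
  then show ?thesis
    by (intro integrable_mult_L2 integrable_L2_add(2) L2_martingaleD(2,3)[OF X]
        borel_measurable_diff measurable_F_M[OF assms(5,2)] assms(6))
qed

lemma L2_martingale_diff:
  assumes X: "L2_martingale T X" and Y: "L2_martingale T Y"
  shows "L2_martingale T (\<lambda>t \<omega>. X t \<omega> - Y t \<omega>)"
proof (rule L2_martingaleI)
  fix s t :: real and \<phi> :: "'w \<Rightarrow> real"
  assume A: "0 \<le> s" "s \<le> t" "t \<le> T" "\<phi> \<in> borel_measurable (F s)" "integrable M (\<lambda>\<omega>. (\<phi> \<omega>)\<^sup>2)"
  have "(\<integral>\<omega>. \<phi> \<omega> * (X t \<omega> - Y t \<omega> - (X s \<omega> - Y s \<omega>)) \<partial>M) =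
     (\<integral>\<omega>. \<phi> \<omega> * (X t \<omega> - X s \<omega>) - \<phi> \<omega> * (Y t \<omega> - Y s \<omega>) \<partial>M)"
    by (simp add: algebra_simps)
  also have "\<dots> = 0"
    using L2_martingaleD(5)[OF X A] L2_martingaleD(5)[OF Y A]
    by (subst Bochner_Integration.integral_diff)
      (auto intro: L2_martingale_increment_integrable[OF X A] L2_martingale_increment_integrable[OF Y A])
  finally show "(\<integral>\<omega>. \<phi> \<omega> * (X t \<omega> - Y t \<omega> - (X s \<omega> - Y s \<omega>)) \<partial>M) = 0" .
qed (auto intro!: borel_measurable_diff integrable_L2_add(2) continuous_on_diff
      L2_martingaleD[OF X] L2_martingaleD[OF Y])

lemma L2_martingale_zero: "L2_martingale T (\<lambda>t \<omega>. 0)"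
  by (rule L2_martingaleI) auto

lemma L2_martingale_sum:
  assumes "finite I" "\<And>i. i \<in> I \<Longrightarrow> L2_martingale T (X i)"
  shows "L2_martingale T (\<lambda>t \<omega>. \<Sum>i\<in>I. X i t \<omega>)"
  using assms
proof (induction I rule: finite_induct)
  case empty
  then show ?case using L2_martingale_zero by simp
next
  case (insert i I)
  \<comment> \<open>Addition is expressed by two differences, for which closure is already
    known.\<close>
  have "L2_martingale T (\<lambda>t \<omega>. X i t \<omega> - (0 - (\<Sum>i\<in>I. X i t \<omega>)))"
    using insert by (intro L2_martingale_diff L2_martingale_zero) auto
  then show ?case using insert.hyps by simp
qed

text \<open>The pathwise inequality is applied to \<open>\<bar>X\<bar>\<close>. By convexity its
  increments are at least \<open>sgn X\<close> times those of \<open>X\<close>, and against the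
  latter the running maximum integrates to 0.\<close>

lemma doob_discrete:
  assumes X: "L2_martingale T X"
    and \<tau>: "\<And>i. i \<le> n \<Longrightarrow> \<tau> i \<in> {0..T}" "\<And>i j. i \<le> j \<Longrightarrow> j \<le> n \<Longrightarrow> \<tau> i \<le> \<tau> j"
  shows "(\<integral>\<^sup>+\<omega>. ennreal ((running_max (\<lambda>i. \<bar>X (\<tau> i) \<omega>\<bar>) n)\<^sup>2) \<partial>M) \<le>
    4 * (\<integral>\<^sup>+\<omega>. ennreal ((X (\<tau> n) \<omega>)\<^sup>2) \<partial>M)"
proof -
  define m where "m k \<omega> = running_max (\<lambda>i. \<bar>X (\<tau> i) \<omega>\<bar>) k" for k \<omega>
  have m0: "0 \<le> m k \<omega>" for k \<omega>
    using running_max_ge[of 0 k "\<lambda>i. \<bar>X (\<tau> i) \<omega>\<bar>"] by (simp add: m_def)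
  have m: "m k \<in> borel_measurable (F (\<tau> k)) \<and> integrable M (\<lambda>\<omega>. (m k \<omega>)\<^sup>2)" if "k \<le> n" for k
    using that
  proof (induction k)
    case 0
    then show ?case using L2_martingaleD(1,3)[OF X \<tau>(1)[of 0]] by (auto simp: m_def)
  next
    case (Suc k)
    have k: "\<tau> k \<in> {0..T}" "\<tau> k \<le> \<tau> (Suc k)" "\<tau> (Suc k) \<in> {0..T}"
      using \<tau>(1)[of k] \<tau>(1)[of "Suc k"] \<tau>(2)[of k "Suc k"] Suc.prems by auto
    have IH: "m k \<in> borel_measurable (F (\<tau> k))" "integrable M (\<lambda>\<omega>. (m k \<omega>)\<^sup>2)" using Suc by auto
    have e: "m (Suc k) = (\<lambda>\<omega>. max (m k \<omega>) \<bar>X (\<tau> (Suc k)) \<omega>\<bar>)" by (simp add: m_def fun_eq_iff)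
    have 1: "m (Suc k) \<in> borel_measurable (F (\<tau> (Suc k)))"
      unfolding e using measurable_F_mono[OF IH(1) _ k(2)] L2_martingaleD(1)[OF X k(3)] k(1) by auto
    have "integrable M (\<lambda>\<omega>. (m (Suc k) \<omega>)\<^sup>2)"
    proof (rule Bochner_Integration.integrable_bound)
      show "integrable M (\<lambda>\<omega>. (m k \<omega>)\<^sup>2 + (X (\<tau> (Suc k)) \<omega>)\<^sup>2)"
        using IH(2) L2_martingaleD(3)[OF X k(3)] by auto
      show "(\<lambda>\<omega>. (m (Suc k) \<omega>)\<^sup>2) \<in> borel_measurable M"
        using measurable_F_M[OF 1] k(3) by auto
      show "AE \<omega> in M. norm ((m (Suc k) \<omega>)\<^sup>2) \<le> norm ((m k \<omega>)\<^sup>2 + (X (\<tau> (Suc k)) \<omega>)\<^sup>2)"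
        by (intro AE_I2) (simp add: e max_def)
    qed
    with 1 show ?case by simp
  qed
  \<comment> \<open>The sign is a subgradient of the absolute value; the product with the running
    maximum is known at time \<open>\<tau> i\<close> and serves as test variable for the next
    increment.\<close>
  define \<phi> where "\<phi> i \<omega> = m i \<omega> * sgn (X (\<tau> i) \<omega>)" for i \<omega>
  have \<phi>: "\<phi> i \<in> borel_measurable (F (\<tau> i))" "integrable M (\<lambda>\<omega>. (\<phi> i \<omega>)\<^sup>2)" if "i \<le> n" for i
  proof -
    have "(\<lambda>\<omega>. sgn (X (\<tau> i) \<omega>)) \<in> borel_measurable (F (\<tau> i))"
      using L2_martingaleD(1)[OF X \<tau>(1)[OF that]] by measurable
    then show 1: "\<phi> i \<in> borel_measurable (F (\<tau> i))" unfolding \<phi>_def using m[OF that] by auto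
    show "integrable M (\<lambda>\<omega>. (\<phi> i \<omega>)\<^sup>2)"
    proof (rule Bochner_Integration.integrable_bound)
      show "integrable M (\<lambda>\<omega>. (m i \<omega>)\<^sup>2)" using m[OF that] by auto
      show "(\<lambda>\<omega>. (\<phi> i \<omega>)\<^sup>2) \<in> borel_measurable M"
        using measurable_F_M[OF 1] \<tau>(1)[OF that] by auto
      show "AE \<omega> in M. norm ((\<phi> i \<omega>)\<^sup>2) \<le> norm ((m i \<omega>)\<^sup>2)"
        by (intro AE_I2) (simp add: \<phi>_def sgn_real_def)
    qed
  qed
  have st: "0 \<le> \<tau> i" "\<tau> i \<le> \<tau> (Suc i)" "\<tau> (Suc i) \<le> T" if "i < n" for i
    using \<tau>(1)[of i] \<tau>(1)[of "Suc i"] \<tau>(2)[of i "Suc i"] that by auto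
  have int: "integrable M (\<lambda>\<omega>. \<phi> i \<omega> * (X (\<tau> (Suc i)) \<omega> - X (\<tau> i) \<omega>))"
    and zero: "(\<integral>\<omega>. \<phi> i \<omega> * (X (\<tau> (Suc i)) \<omega> - X (\<tau> i) \<omega>) \<partial>M) = 0" if "i < n" for i
    using L2_martingale_increment_integrable[OF X st \<phi>] L2_martingaleD(5)[OF X st \<phi>] that by auto
  have path: "(m n \<omega>)\<^sup>2 \<le> 4 * (X (\<tau> n) \<omega>)\<^sup>2 - 4 * (\<Sum>i<n. \<phi> i \<omega> * (X (\<tau> (Suc i)) \<omega> - X (\<tau> i) \<omega>))" for \<omega>
  proof -
    have "(\<Sum>i<n. \<phi> i \<omega> * (X (\<tau> (Suc i)) \<omega> - X (\<tau> i) \<omega>)) \<le>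
        (\<Sum>i<n. m i \<omega> * (\<bar>X (\<tau> (Suc i)) \<omega>\<bar> - \<bar>X (\<tau> i) \<omega>\<bar>))"
    proof (rule sum_mono)
      fix i
      have "sgn (X (\<tau> i) \<omega>) * (X (\<tau> (Suc i)) \<omega> - X (\<tau> i) \<omega>) \<le> \<bar>X (\<tau> (Suc i)) \<omega>\<bar> - \<bar>X (\<tau> i) \<omega>\<bar>"
        by (auto simp: sgn_real_def)
      from mult_left_mono[OF this m0[of i \<omega>]]
      show "\<phi> i \<omega> * (X (\<tau> (Suc i)) \<omega> - X (\<tau> i) \<omega>) \<le> m i \<omega> * (\<bar>X (\<tau> (Suc i)) \<omega>\<bar> - \<bar>X (\<tau> i) \<omega>\<bar>)"
        by (simp add: \<phi>_def mult.assoc)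
    qed
    moreover have "(m n \<omega>)\<^sup>2 + 2 * (\<Sum>i<n. m i \<omega> * (\<bar>X (\<tau> (Suc i)) \<omega>\<bar> - \<bar>X (\<tau> i) \<omega>\<bar>)) \<le> 2 * m n \<omega> * \<bar>X (\<tau> n) \<omega>\<bar>"
      unfolding m_def by (rule doob_pathwise)
    \<comment> \<open>This square absorbs half of the squared maximum and produces the constant
      4.\<close>
    moreover have "0 \<le> (m n \<omega> - 2 * \<bar>X (\<tau> n) \<omega>\<bar>)\<^sup>2" by simp
    then have "4 * (m n \<omega> * \<bar>X (\<tau> n) \<omega>\<bar>) \<le> (m n \<omega>)\<^sup>2 + 4 * (X (\<tau> n) \<omega>)\<^sup>2"
      by (simp add: power2_diff power_mult_distrib)
    ultimately show ?thesis by linarith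
  qed
  have Xn: "integrable M (\<lambda>\<omega>. (X (\<tau> n) \<omega>)\<^sup>2)" using L2_martingaleD(3)[OF X \<tau>(1)[of n]] by simp
  have mn: "integrable M (\<lambda>\<omega>. (m n \<omega>)\<^sup>2)" using m[of n] by simp
  have "(\<integral>\<omega>. (m n \<omega>)\<^sup>2 \<partial>M) \<le>
      (\<integral>\<omega>. 4 * (X (\<tau> n) \<omega>)\<^sup>2 - 4 * (\<Sum>i<n. \<phi> i \<omega> * (X (\<tau> (Suc i)) \<omega> - X (\<tau> i) \<omega>)) \<partial>M)"
    by (intro integral_mono path mn Bochner_Integration.integrable_diff integrable_mult_right
        Bochner_Integration.integrable_sum int Xn) simp
  also have "\<dots> = 4 * (\<integral>\<omega>. (X (\<tau> n) \<omega>)\<^sup>2 \<partial>M)"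
    using Xn int zero by (subst Bochner_Integration.integral_diff)
      (auto simp: Bochner_Integration.integral_sum intro!: Bochner_Integration.integrable_sum)
  finally have "ennreal (\<integral>\<omega>. (m n \<omega>)\<^sup>2 \<partial>M) \<le> ennreal (4 * (\<integral>\<omega>. (X (\<tau> n) \<omega>)\<^sup>2 \<partial>M))"
    by (rule ennreal_leI)
  then have "ennreal (\<integral>\<omega>. (m n \<omega>)\<^sup>2 \<partial>M) \<le> 4 * ennreal (\<integral>\<omega>. (X (\<tau> n) \<omega>)\<^sup>2 \<partial>M)"
    by (simp add: ennreal_mult)
  then show ?thesis
    using nn_integral_eq_integral[OF mn] nn_integral_eq_integral[OF Xn] by (simp add: m_def)
qed

text \<open>Every value on a path is a limit along the dyadic grids, so the supremum is below the
  lower limit of the squared grid maxima. Fatou's lemma then transfers the discrete bound.\<close>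

lemma doob_maximal:
  assumes X: "L2_martingale T X" and T: "0 \<le> T"
  shows "(\<integral>\<^sup>+\<omega>. (SUP t\<in>{0..T}. ennreal ((X t \<omega>)\<^sup>2)) \<partial>M) \<le> 4 * (\<integral>\<^sup>+\<omega>. ennreal ((X T \<omega>)\<^sup>2) \<partial>M)"
proof -
  define R where "R n \<omega> = ennreal ((running_max (\<lambda>i. \<bar>X (dyadic T n i) \<omega>\<bar>) (2 ^ n))\<^sup>2)" for n \<omega>
  have [measurable]: "(\<lambda>\<omega>. running_max (\<lambda>i. \<bar>X (dyadic T n i) \<omega>\<bar>) k) \<in> borel_measurable M" if "k \<le> 2 ^ n" for n k
    using that
  proof (induction k)
    case 0
    show ?case using L2_martingaleD(2)[OF X dyadic_in[OF T, of 0 n]] by simp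
  next
    case (Suc k)
    then show ?case using L2_martingaleD(2)[OF X dyadic_in[OF T Suc.prems]] by simp
  qed
  have Rm: "R n \<in> borel_measurable M" for n unfolding R_def by measurable
  have "(\<integral>\<^sup>+\<omega>. (SUP t\<in>{0..T}. ennreal ((X t \<omega>)\<^sup>2)) \<partial>M) \<le> (\<integral>\<^sup>+\<omega>. liminf (\<lambda>n. R n \<omega>) \<partial>M)"
  proof (intro nn_integral_mono SUP_least)
    fix \<omega> t assume w: "\<omega> \<in> space M" and t: "t \<in> {0..T}"
    obtain i where i: "\<And>n. i n \<le> 2 ^ n" "(\<lambda>n. dyadic T n (i n)) \<longlonglongrightarrow> t"
      using dyadic_approx[OF t] by blast
    have "(\<lambda>n. X (dyadic T n (i n)) \<omega>) \<longlonglongrightarrow> X t \<omega>"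
      using i(1) dyadic_in[OF T]
      by (intro continuous_on_tendsto_compose[OF L2_martingaleD(4)[OF X w] i(2) t] always_eventually) auto
    then have "(\<lambda>n. ennreal ((X (dyadic T n (i n)) \<omega>)\<^sup>2)) \<longlonglongrightarrow> ennreal ((X t \<omega>)\<^sup>2)"
      by (intro tendsto_ennrealI tendsto_power)
    then have "ennreal ((X t \<omega>)\<^sup>2) = liminf (\<lambda>n. ennreal ((X (dyadic T n (i n)) \<omega>)\<^sup>2))"
      by (intro lim_imp_Liminf[symmetric]) auto
    also have "\<dots> \<le> liminf (\<lambda>n. R n \<omega>)"
    proof (intro Liminf_mono always_eventually allI)
      fix n
      have "\<bar>X (dyadic T n (i n)) \<omega>\<bar> \<le> running_max (\<lambda>i. \<bar>X (dyadic T n i) \<omega>\<bar>) (2 ^ n)"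
        using running_max_ge[OF i(1)[of n], of "\<lambda>i. \<bar>X (dyadic T n i) \<omega>\<bar>"] .
      then have "\<bar>X (dyadic T n (i n)) \<omega>\<bar>\<^sup>2 \<le> (running_max (\<lambda>i. \<bar>X (dyadic T n i) \<omega>\<bar>) (2 ^ n))\<^sup>2"
        by (intro power_mono) auto
      then show "ennreal ((X (dyadic T n (i n)) \<omega>)\<^sup>2) \<le> R n \<omega>"
        unfolding R_def by (intro ennreal_leI) simp
    qed
    finally show "ennreal ((X t \<omega>)\<^sup>2) \<le> liminf (\<lambda>n. R n \<omega>)" .
  qed
  also have "\<dots> \<le> liminf (\<lambda>n. \<integral>\<^sup>+\<omega>. R n \<omega> \<partial>M)"
    by (intro nn_integral_liminf Rm)
  also have "\<dots> \<le> 4 * (\<integral>\<^sup>+\<omega>. ennreal ((X T \<omega>)\<^sup>2) \<partial>M)"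
  proof (rule Liminf_le)
    show "\<forall>\<^sub>F n in sequentially. (\<integral>\<^sup>+\<omega>. R n \<omega> \<partial>M) \<le> 4 * (\<integral>\<^sup>+\<omega>. ennreal ((X T \<omega>)\<^sup>2) \<partial>M)"
    proof (intro always_eventually allI)
      fix n
      show "(\<integral>\<^sup>+\<omega>. R n \<omega> \<partial>M) \<le> 4 * (\<integral>\<^sup>+\<omega>. ennreal ((X T \<omega>)\<^sup>2) \<partial>M)"
        unfolding R_def using doob_discrete[OF X, of "2 ^ n" "dyadic T n"] dyadic_in[OF T] dyadic_mono[OF T]
        by simp
    qed
  qed simp
  finally show ?thesis .
qed

text \<open>By Cauchy-Schwarz the pairing with a fixed \<open>\<phi>\<close> is continuous in mean
  square, so orthogonality of increments passes to the limit.\<close>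

lemma L2_martingale_limit:
  assumes X: "\<And>n. L2_martingale T (X n)"
    and Y: "\<And>t. t \<in> {0..T} \<Longrightarrow> Y t \<in> borel_measurable (F t)"
    "\<And>\<omega>. \<omega> \<in> space M \<Longrightarrow> continuous_on {0..T} (\<lambda>t. Y t \<omega>)"
    and lim: "\<And>t. t \<in> {0..T} \<Longrightarrow> (\<lambda>n. \<integral>\<^sup>+\<omega>. ennreal ((X n t \<omega> - Y t \<omega>)\<^sup>2) \<partial>M) \<longlonglongrightarrow> 0"
  shows "L2_martingale T Y"
proof -
  have YM [measurable]: "Y t \<in> borel_measurable M" if "t \<in> {0..T}" for t
    using measurable_F_M[OF Y(1)[OF that]] that by auto
  note XM [measurable] = L2_martingaleD(2)[OF X]
  \<comment> \<open>Convergence to 0 in \<open>ennreal\<close> makes the differences square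
    integrable from some index on. One such index already yields square integrability of
    \<open>Y\<close>.\<close>
  have fin: "\<exists>n0. \<forall>n\<ge>n0. integrable M (\<lambda>\<omega>. (X n t \<omega> - Y t \<omega>)\<^sup>2)" if t: "t \<in> {0..T}" for t
  proof -
    have "\<forall>\<^sub>F n in sequentially. (\<integral>\<^sup>+\<omega>. ennreal ((X n t \<omega> - Y t \<omega>)\<^sup>2) \<partial>M) < 1"
      using order_tendstoD(2)[OF lim[OF t], of 1] by simp
    then obtain n0 where n0: "\<And>n. n \<ge> n0 \<Longrightarrow> (\<integral>\<^sup>+\<omega>. ennreal ((X n t \<omega> - Y t \<omega>)\<^sup>2) \<partial>M) < 1"
      by (auto simp: eventually_sequentially)
    have "integrable M (\<lambda>\<omega>. (X n t \<omega> - Y t \<omega>)\<^sup>2)" if "n \<ge> n0" for n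
      using n0[OF that] t by (intro integrableI_nonneg) (auto intro: order.strict_trans)
    then show ?thesis by blast
  qed
  have Y2: "integrable M (\<lambda>\<omega>. (Y t \<omega>)\<^sup>2)" if t: "t \<in> {0..T}" for t
  proof -
    obtain n where n: "integrable M (\<lambda>\<omega>. (X n t \<omega> - Y t \<omega>)\<^sup>2)" using fin[OF t] by blast
    have "integrable M (\<lambda>\<omega>. (X n t \<omega> - (X n t \<omega> - Y t \<omega>))\<^sup>2)"
      by (intro integrable_L2_add(2) L2_martingaleD(3)[OF X t] XM[OF t] borel_measurable_diff YM[OF t] n)
    then show ?thesis by simp
  qed
  show ?thesis
  proof (rule L2_martingaleI)
    fix s t :: real and \<phi> :: "'w \<Rightarrow> real"
    assume A: "0 \<le> s" "s \<le> t" "t \<le> T" and \<phi>: "\<phi> \<in> borel_measurable (F s)" "integrable M (\<lambda>\<omega>. (\<phi> \<omega>)\<^sup>2)"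
    have st: "s \<in> {0..T}" "t \<in> {0..T}" using A by auto
    have \<phi>M [measurable]: "\<phi> \<in> borel_measurable M" using measurable_F_M[OF \<phi>(1) A(1)] .
    define D where "D n \<omega> = (X n t \<omega> - Y t \<omega>) - (X n s \<omega> - Y s \<omega>)" for n \<omega>
    have Dm [measurable]: "D n \<in> borel_measurable M" for n unfolding D_def using st by measurable
    obtain n0 where n0: "\<And>n. n \<ge> n0 \<Longrightarrow> integrable M (\<lambda>\<omega>. (X n t \<omega> - Y t \<omega>)\<^sup>2)" using fin[OF st(2)] by blast
    obtain n1 where n1: "\<And>n. n \<ge> n1 \<Longrightarrow> integrable M (\<lambda>\<omega>. (X n s \<omega> - Y s \<omega>)\<^sup>2)" using fin[OF st(1)] by blast
    have D2: "integrable M (\<lambda>\<omega>. (D n \<omega>)\<^sup>2)" if "n \<ge> max n0 n1" for n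
      unfolding D_def by (intro integrable_L2_add(2) n0 n1 borel_measurable_diff XM YM st) (use that in auto)
    have "(\<lambda>n. \<integral>\<^sup>+\<omega>. ennreal ((norm (D n \<omega>))\<^sup>2) \<partial>M) \<longlonglongrightarrow> 0"
    proof (rule tendsto_sandwich[where f="\<lambda>_. 0"])
      show "\<forall>\<^sub>F n in sequentially. (\<integral>\<^sup>+\<omega>. ennreal ((norm (D n \<omega>))\<^sup>2) \<partial>M) \<le>
          2 * (\<integral>\<^sup>+\<omega>. ennreal ((X n t \<omega> - Y t \<omega>)\<^sup>2) \<partial>M) + 2 * (\<integral>\<^sup>+\<omega>. ennreal ((X n s \<omega> - Y s \<omega>)\<^sup>2) \<partial>M)"
      proof (intro always_eventually allI)
        fix n
        show "(\<integral>\<^sup>+\<omega>. ennreal ((norm (D n \<omega>))\<^sup>2) \<partial>M) \<le>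
          2 * (\<integral>\<^sup>+\<omega>. ennreal ((X n t \<omega> - Y t \<omega>)\<^sup>2) \<partial>M) + 2 * (\<integral>\<^sup>+\<omega>. ennreal ((X n s \<omega> - Y s \<omega>)\<^sup>2) \<partial>M)"
        proof -
          have eq: "X n t \<omega> - Y t \<omega> + - (X n s \<omega> - Y s \<omega>) = D n \<omega>" for \<omega> by (simp add: D_def)
          have "(\<integral>\<^sup>+\<omega>. ennreal ((norm (D n \<omega>))\<^sup>2) \<partial>M) \<le>
            2 * (\<integral>\<^sup>+\<omega>. ennreal ((norm (X n t \<omega> - Y t \<omega>))\<^sup>2) \<partial>M)
              + 2 * (\<integral>\<^sup>+\<omega>. ennreal ((norm (X n s \<omega> - Y s \<omega>))\<^sup>2) \<partial>M)"
            by (rule nn_integral_sq_add_le[of "\<lambda>\<omega>. X n t \<omega> - Y t \<omega>" M "\<lambda>\<omega>. - (X n s \<omega> - Y s \<omega>)",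
              unfolded eq norm_minus_cancel]) (intro borel_measurable_diff borel_measurable_uminus XM YM st)+
          then show ?thesis by (simp only: real_norm_def power2_abs)
        qed
      qed
      have "(\<lambda>n. 2 * (\<integral>\<^sup>+\<omega>. ennreal ((X n t \<omega> - Y t \<omega>)\<^sup>2) \<partial>M) + 2 * (\<integral>\<^sup>+\<omega>. ennreal ((X n s \<omega> - Y s \<omega>)\<^sup>2) \<partial>M)) \<longlonglongrightarrow> 0 + 0"
        by (intro tendsto_add ennreal_tendsto_mult_0 lim st) auto
      then show "(\<lambda>n. 2 * (\<integral>\<^sup>+\<omega>. ennreal ((X n t \<omega> - Y t \<omega>)\<^sup>2) \<partial>M) + 2 * (\<integral>\<^sup>+\<omega>. ennreal ((X n s \<omega> - Y s \<omega>)\<^sup>2) \<partial>M)) \<longlonglongrightarrow> 0"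
        by simp
    qed auto
    moreover have "\<forall>\<^sub>F n in sequentially. (\<integral>\<^sup>+\<omega>. ennreal ((norm (D n \<omega>))\<^sup>2) \<partial>M) = ennreal (\<integral>\<omega>. (D n \<omega>)\<^sup>2 \<partial>M)"
      using nn_integral_eq_integral[OF D2] unfolding eventually_sequentially
      by (intro exI[of _ "max n0 n1"]) auto
    ultimately have "(\<lambda>n. ennreal (\<integral>\<omega>. (D n \<omega>)\<^sup>2 \<partial>M)) \<longlonglongrightarrow> ennreal 0"
      by (subst (asm) tendsto_cong) auto
    then have "(\<lambda>n. \<integral>\<omega>. (D n \<omega>)\<^sup>2 \<partial>M) \<longlonglongrightarrow> 0"
      by (subst (asm) tendsto_ennreal_iff) auto
    then have "(\<lambda>n. sqrt (\<integral>\<omega>. (\<phi> \<omega>)\<^sup>2 \<partial>M) * sqrt (\<integral>\<omega>. (D n \<omega>)\<^sup>2 \<partial>M)) \<longlonglongrightarrow> sqrt (\<integral>\<omega>. (\<phi> \<omega>)\<^sup>2 \<partial>M) * sqrt 0"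
      by (intro tendsto_mult tendsto_const tendsto_real_sqrt)
    moreover have "\<bar>\<integral>\<omega>. \<phi> \<omega> * (Y t \<omega> - Y s \<omega>) \<partial>M\<bar> \<le> sqrt (\<integral>\<omega>. (\<phi> \<omega>)\<^sup>2 \<partial>M) * sqrt (\<integral>\<omega>. (D n \<omega>)\<^sup>2 \<partial>M)"
      if n: "n \<ge> max n0 n1" for n
    proof -
      have i1: "integrable M (\<lambda>\<omega>. \<phi> \<omega> * (X n t \<omega> - X n s \<omega>))"
        by (rule L2_martingale_increment_integrable[OF X A \<phi>])
      have i2: "integrable M (\<lambda>\<omega>. \<phi> \<omega> * D n \<omega>)"
        by (intro integrable_mult_L2 D2 n \<phi> \<phi>M Dm)
      have "(\<integral>\<omega>. \<phi> \<omega> * (Y t \<omega> - Y s \<omega>) \<partial>M) = (\<integral>\<omega>. \<phi> \<omega> * (X n t \<omega> - X n s \<omega>) - \<phi> \<omega> * D n \<omega> \<partial>M)"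
        by (intro Bochner_Integration.integral_cong) (auto simp: D_def algebra_simps)
      also have "\<dots> = - (\<integral>\<omega>. \<phi> \<omega> * D n \<omega> \<partial>M)"
        using i1 i2 L2_martingaleD(5)[OF X A \<phi>] by simp
      finally have "\<bar>\<integral>\<omega>. \<phi> \<omega> * (Y t \<omega> - Y s \<omega>) \<partial>M\<bar> = \<bar>\<integral>\<omega>. \<phi> \<omega> * D n \<omega> \<partial>M\<bar>" by simp
      also have "\<dots> \<le> (\<integral>\<omega>. \<bar>\<phi> \<omega>\<bar> * \<bar>D n \<omega>\<bar> \<partial>M)"
        using integral_norm_bound[of M "\<lambda>\<omega>. \<phi> \<omega> * D n \<omega>"] by (simp add: abs_mult)
      also have "\<dots> \<le> sqrt (\<integral>\<omega>. (\<phi> \<omega>)\<^sup>2 \<partial>M) * sqrt (\<integral>\<omega>. (D n \<omega>)\<^sup>2 \<partial>M)"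
        by (intro cauchy_schwarz_integral \<phi> D2 n \<phi>M Dm)
      finally show ?thesis .
    qed
    then have "\<exists>N. \<forall>n\<ge>N. \<bar>\<integral>\<omega>. \<phi> \<omega> * (Y t \<omega> - Y s \<omega>) \<partial>M\<bar> \<le>
        sqrt (\<integral>\<omega>. (\<phi> \<omega>)\<^sup>2 \<partial>M) * sqrt (\<integral>\<omega>. (D n \<omega>)\<^sup>2 \<partial>M)" by blast
    ultimately have "\<bar>\<integral>\<omega>. \<phi> \<omega> * (Y t \<omega> - Y s \<omega>) \<partial>M\<bar> \<le> sqrt (\<integral>\<omega>. (\<phi> \<omega>)\<^sup>2 \<partial>M) * sqrt 0"
      by (rule LIMSEQ_le_const)
    then show "(\<integral>\<omega>. \<phi> \<omega> * (Y t \<omega> - Y s \<omega>) \<partial>M) = 0" by simp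
  qed (use Y Y2 in auto)
qed

end

section \<open>Moments of Brownian increments\<close>

lemma borel_measurable_nth:
  fixes f :: "'a \<Rightarrow> 'b::topological_space ^ 'n"
  assumes "f \<in> borel_measurable M"
  shows "(\<lambda>x. f x $ i) \<in> borel_measurable M"
  by (rule measurable_compose[OF assms borel_measurable_continuous_onI]) (intro continuous_intros)

lemma borel_measurable_nth_iff:
  fixes f :: "'a \<Rightarrow> 'b::{euclidean_space} ^ 'n"
  shows "f \<in> borel_measurable M \<longleftrightarrow> (\<forall>i. (\<lambda>x. f x $ i) \<in> borel_measurable M)"
proof (intro iffI allI borel_measurable_nth)
  assume *: "\<forall>i. (\<lambda>x. f x $ i) \<in> borel_measurable M"
  show "f \<in> borel_measurable M"
  proof (rule borel_measurable_euclidean_space[THEN iffD2], intro ballI)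
    fix b :: "'b ^ 'n" assume "b \<in> Basis"
    then obtain i c where b: "b = axis i c" by (auto simp: Basis_vec_def)
    have "(\<lambda>x. f x $ i \<bullet> c) \<in> borel_measurable M" using * by (intro borel_measurable_inner) auto
    then show "(\<lambda>x. f x \<bullet> b) \<in> borel_measurable M" by (simp add: b inner_axis)
  qed
qed

text \<open>What the integral uses of Brownian motion: continuity of every path and the first two
  conditional moments of increments, written as integrals against variables known at the earlier
  time. In the covariance law that variable is bounded, so that its product with two square
  integrable increments is integrable.\<close>

locale continuous_brownian_motion = filtered_prob_space M F for M :: "'w measure" and F +
  fixes B :: "real \<Rightarrow> 'w \<Rightarrow> real ^ 'm"
  assumes B_adapted: "\<And>t. 0 \<le> t \<Longrightarrow> B t \<in> borel_measurable (F t)"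
    and B_cont: "\<And>\<omega>. \<omega> \<in> space M \<Longrightarrow> continuous_on {0..} (\<lambda>t. B t \<omega>)"
    and B_sq: "\<And>s t j. 0 \<le> s \<Longrightarrow> s \<le> t \<Longrightarrow> integrable M (\<lambda>\<omega>. ((B t \<omega> - B s \<omega>) $ j)\<^sup>2)"
    and B_mean: "\<And>s t j \<phi>. 0 \<le> s \<Longrightarrow> s \<le> t \<Longrightarrow> \<phi> \<in> borel_measurable (F s) \<Longrightarrow>
      integrable M (\<lambda>\<omega>. (\<phi> \<omega>)\<^sup>2) \<Longrightarrow> (\<integral>\<omega>. \<phi> \<omega> * (B t \<omega> - B s \<omega>) $ j \<partial>M) = 0"
    and B_cov: "\<And>s t j k \<phi> c. 0 \<le> s \<Longrightarrow> s \<le> t \<Longrightarrow> \<phi> \<in> borel_measurable (F s) \<Longrightarrow>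
      (\<And>\<omega>. \<omega> \<in> space M \<Longrightarrow> \<bar>\<phi> \<omega>\<bar> \<le> c) \<Longrightarrow>
      (\<integral>\<omega>. \<phi> \<omega> * ((B t \<omega> - B s \<omega>) $ j * (B t \<omega> - B s \<omega>) $ k) \<partial>M) =
        (if j = k then (t - s) * (\<integral>\<omega>. \<phi> \<omega> \<partial>M) else 0)"

context brownian_motion
begin

lemma increment_moments:
  assumes st: "0 \<le> s" "s < t"
  shows "random_variable borel (\<lambda>\<omega>. (W t \<omega> - W s \<omega>) $ j)"
    and "integrable M (\<lambda>\<omega>. (W t \<omega> - W s \<omega>) $ j)"
    and "integrable M (\<lambda>\<omega>. ((W t \<omega> - W s \<omega>) $ j)\<^sup>2)"
    and "(\<integral>\<omega>. (W t \<omega> - W s \<omega>) $ j \<partial>M) = 0"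
    and "(\<integral>\<omega>. ((W t \<omega> - W s \<omega>) $ j)\<^sup>2 \<partial>M) = t - s"
proof -
  have \<sigma>: "0 < sqrt (t - s)" using st by simp
  note D = W_normal[OF st, of j]
  show rv: "random_variable borel (\<lambda>\<omega>. (W t \<omega> - W s \<omega>) $ j)"
    using D by (simp add: distributed_def)
  have i: "integrable lborel (\<lambda>x. normal_density 0 (sqrt (t - s)) x * x ^ k)" for k
    using integrable_normal_moment[OF \<sigma>, of 0 k] by (simp only: diff_0_right)
  have d: "integrable lborel (\<lambda>x. normal_density 0 (sqrt (t - s)) x * x ^ k) \<longleftrightarrow>
      integrable M (\<lambda>\<omega>. ((W t \<omega> - W s \<omega>) $ j) ^ k)" for k
    by (rule distributed_integrable[OF D]) auto
  show 1: "integrable M (\<lambda>\<omega>. (W t \<omega> - W s \<omega>) $ j)"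
    using i[of 1] d[of 1] by (simp only: power_one_right)
  show 2: "integrable M (\<lambda>\<omega>. ((W t \<omega> - W s \<omega>) $ j)\<^sup>2)"
    using i[of 2] d[of 2] by (simp only:)
  show 3: "(\<integral>\<omega>. (W t \<omega> - W s \<omega>) $ j \<partial>M) = 0"
    by (rule normal_distributed_expectation[OF \<sigma> D])
  show "(\<integral>\<omega>. ((W t \<omega> - W s \<omega>) $ j)\<^sup>2 \<partial>M) = t - s"
    using normal_distributed_variance[OF \<sigma> D] st unfolding 3 by simp
qed

text \<open>Here \<open>g\<close> is a function of the whole increment vector because the covariance
  law applies the lemma to a product of two coordinates.\<close>

lemma increment_independent:
  fixes g :: "real ^ 'm \<Rightarrow> real"
  assumes st: "0 \<le> s" "s < t" and \<phi>: "\<phi> \<in> borel_measurable (F s)" and g: "g \<in> borel_measurable borel"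
    and int: "integrable M \<phi>" "integrable M (\<lambda>\<omega>. g (W t \<omega> - W s \<omega>))"
  shows "(\<integral>\<omega>. \<phi> \<omega> * g (W t \<omega> - W s \<omega>) \<partial>M) = (\<integral>\<omega>. \<phi> \<omega> \<partial>M) * (\<integral>\<omega>. g (W t \<omega> - W s \<omega>) \<partial>M)"
proof -
  let ?V = "vimage_algebra (space M) (\<lambda>\<omega>. W t \<omega> - W s \<omega>) borel"
  have gV: "(\<lambda>\<omega>. g (W t \<omega> - W s \<omega>)) \<in> borel_measurable ?V"
    by (rule measurable_compose[OF measurable_vimage_algebra1 g]) simp
  have "indep_set (sigma_sets (space M) {\<phi> -` A \<inter> space M |A. A \<in> sets borel})
      (sigma_sets (space M) {(\<lambda>\<omega>. g (W t \<omega> - W s \<omega>)) -` A \<inter> space M |A. A \<in> sets borel})"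
    unfolding indep_set_def
  proof (rule indep_sets_mono_sets[OF W_indep[OF st, unfolded indep_set_def]])
    have 1: "sigma_sets (space M) {\<phi> -` A \<inter> space M |A. A \<in> sets borel} \<subseteq> sets (F s)"
      using sets.sigma_sets_subset[of "{\<phi> -` A \<inter> space M |A. A \<in> sets borel}" "F s"] measurable_sets[OF \<phi>] st(1)
      by auto
    have 2: "sigma_sets (space M) {(\<lambda>\<omega>. g (W t \<omega> - W s \<omega>)) -` A \<inter> space M |A. A \<in> sets borel} \<subseteq> sets ?V"
      using sets.sigma_sets_subset[of "{(\<lambda>\<omega>. g (W t \<omega> - W s \<omega>)) -` A \<inter> space M |A. A \<in> sets borel}" ?V]
        measurable_sets[OF gV] by auto
    fix i :: bool
    show "(case i of True \<Rightarrow> sigma_sets (space M) {\<phi> -` A \<inter> space M |A. A \<in> sets borel}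
        | False \<Rightarrow> sigma_sets (space M) {(\<lambda>\<omega>. g (W t \<omega> - W s \<omega>)) -` A \<inter> space M |A. A \<in> sets borel})
       \<subseteq> (case i of True \<Rightarrow> sets (F s) | False \<Rightarrow> sets ?V)"
      using 1 2 by (cases i) auto
  qed
  then have "indep_var borel \<phi> borel (\<lambda>\<omega>. g (W t \<omega> - W s \<omega>))"
    unfolding indep_var_eq using int by (auto intro: borel_measurable_integrable)
  then show ?thesis using int by (rule indep_var_lebesgue_integral)
qed

lemma increment_covariance:
  assumes st: "0 \<le> s" "s < t"
  shows "integrable M (\<lambda>\<omega>. (W t \<omega> - W s \<omega>) $ j * (W t \<omega> - W s \<omega>) $ k)"
    and "(\<integral>\<omega>. (W t \<omega> - W s \<omega>) $ j * (W t \<omega> - W s \<omega>) $ k \<partial>M) = (if j = k then t - s else 0)"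
proof -
  note m = increment_moments[OF st]
  show "integrable M (\<lambda>\<omega>. (W t \<omega> - W s \<omega>) $ j * (W t \<omega> - W s \<omega>) $ k)"
    by (intro integrable_mult_L2 m)
  show "(\<integral>\<omega>. (W t \<omega> - W s \<omega>) $ j * (W t \<omega> - W s \<omega>) $ k \<partial>M) = (if j = k then t - s else 0)"
  proof (cases "j = k")
    case True
    then show ?thesis using m(5)[of j] by (simp add: power2_eq_square)
  next
    case False
    have "(\<integral>\<omega>. (\<Prod>i\<in>{j, k}. (W t \<omega> - W s \<omega>) $ i) \<partial>M) = (\<Prod>i\<in>{j, k}. \<integral>\<omega>. (W t \<omega> - W s \<omega>) $ i \<partial>M)"
      using indep_vars_subset[OF W_components_indep[OF st], of "{j, k}"]
      by (intro indep_vars_lebesgue_integral m(2)) auto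
    then show ?thesis using False m(4) by simp
  qed
qed

text \<open>Paths are set to 0 off an event of \<open>F 0\<close> on which \<open>W\<close> is
  continuous. The event does not depend on time, hence the equality with \<open>W\<close> at all
  times at once outside one null set.\<close>

lemma continuous_version:
  obtains B where "continuous_brownian_motion M F B" "AE \<omega> in M. \<forall>t. B t \<omega> = W t \<omega>"
proof -
  obtain G where G: "G \<in> sets (F 0)" "\<And>\<omega>. \<omega> \<in> G \<Longrightarrow> \<omega> \<in> space M \<and> continuous_on {0..} (\<lambda>t. W t \<omega>)"
    "AE \<omega> in M. \<omega> \<in> G"
    using AE_F0_set[OF W_cont] by blast
  define B where "B t \<omega> = indicator G \<omega> *\<^sub>R W t \<omega>" for t \<omega>
  have ae: "AE \<omega> in M. \<forall>t. B t \<omega> = W t \<omega>"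
    using G(3) by eventually_elim (simp add: B_def)
  have Bm: "B t \<in> borel_measurable (F t)" if "0 \<le> t" for t
  proof -
    have "G \<in> sets (F t)" using G(1) F_mono[OF order_refl that] by blast
    then show ?thesis unfolding B_def[abs_def]
      by (intro borel_measurable_scaleR borel_measurable_indicator W_adapted that)
  qed
  have BM: "B t \<in> borel_measurable M" "W t \<in> borel_measurable M" if "0 \<le> t" for t
    using measurable_F_M[OF Bm that] measurable_F_M[OF W_adapted that] that by auto
  have nm: "(\<lambda>\<omega>. (B t \<omega> - B s \<omega>) $ j) \<in> borel_measurable M" "(\<lambda>\<omega>. (W t \<omega> - W s \<omega>) $ j) \<in> borel_measurable M"
    if "0 \<le> s" "0 \<le> t" for s t j
    by (intro borel_measurable_nth borel_measurable_diff BM that)+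
  have "continuous_brownian_motion M F B"
  proof
    show "B t \<in> borel_measurable (F t)" if "0 \<le> t" for t using Bm[OF that] .
    show "continuous_on {0..} (\<lambda>t. B t \<omega>)" if "\<omega> \<in> space M" for \<omega>
      using G(2)[of \<omega>] by (cases "\<omega> \<in> G") (auto simp: B_def)
  next
    fix s t :: real and j assume st: "0 \<le> s" "s \<le> t"
    have t: "0 \<le> t" using st by simp
    show "integrable M (\<lambda>\<omega>. ((B t \<omega> - B s \<omega>) $ j)\<^sup>2)"
    proof (cases "s = t")
      case False
      then have "integrable M (\<lambda>\<omega>. ((W t \<omega> - W s \<omega>) $ j)\<^sup>2)" using st by (intro increment_moments) auto
      then show ?thesis
      proof (rule integrable_cong_AE_imp)
        show "(\<lambda>\<omega>. ((B t \<omega> - B s \<omega>) $ j)\<^sup>2) \<in> borel_measurable M"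
          by (intro borel_measurable_power nm st t)
        show "AE \<omega> in M. ((W t \<omega> - W s \<omega>) $ j)\<^sup>2 = ((B t \<omega> - B s \<omega>) $ j)\<^sup>2"
          using ae by eventually_elim simp
      qed
    qed simp
  next
    fix s t :: real and j and \<phi> :: "'w \<Rightarrow> real"
    assume st: "0 \<le> s" "s \<le> t" and \<phi>: "\<phi> \<in> borel_measurable (F s)" "integrable M (\<lambda>\<omega>. (\<phi> \<omega>)\<^sup>2)"
    have t: "0 \<le> t" using st by simp
    note \<phi>M = measurable_F_M[OF \<phi>(1) st(1)]
    show "(\<integral>\<omega>. \<phi> \<omega> * (B t \<omega> - B s \<omega>) $ j \<partial>M) = 0"
    proof (cases "s = t")
      case False
      then have st': "s < t" using st by simp
      have "(\<integral>\<omega>. \<phi> \<omega> * (B t \<omega> - B s \<omega>) $ j \<partial>M) = (\<integral>\<omega>. \<phi> \<omega> * (W t \<omega> - W s \<omega>) $ j \<partial>M)"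
        using ae by (intro integral_cong_AE borel_measurable_times \<phi>M nm st t) auto
      also have "\<dots> = (\<integral>\<omega>. \<phi> \<omega> \<partial>M) * (\<integral>\<omega>. (W t \<omega> - W s \<omega>) $ j \<partial>M)"
        using square_integrable_imp_integrable[OF \<phi>M \<phi>(2)] increment_moments(2)[OF st(1) st']
        by (intro increment_independent[OF st(1) st' \<phi>(1), of "\<lambda>x. x $ j"] borel_measurable_nth) auto
      also have "\<dots> = 0" using increment_moments(4)[OF st(1) st'] by simp
      finally show ?thesis .
    qed simp
  next
    fix s t :: real and j k and \<phi> :: "'w \<Rightarrow> real" and c
    assume st: "0 \<le> s" "s \<le> t" and \<phi>: "\<phi> \<in> borel_measurable (F s)"
      and c: "\<And>\<omega>. \<omega> \<in> space M \<Longrightarrow> \<bar>\<phi> \<omega>\<bar> \<le> c"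
    have t: "0 \<le> t" using st by simp
    note \<phi>M = measurable_F_M[OF \<phi> st(1)]
    have \<phi>i: "integrable M \<phi>" using c by (intro integrable_const_bound[OF _ \<phi>M] AE_I2) auto
    show "(\<integral>\<omega>. \<phi> \<omega> * ((B t \<omega> - B s \<omega>) $ j * (B t \<omega> - B s \<omega>) $ k) \<partial>M) =
        (if j = k then (t - s) * (\<integral>\<omega>. \<phi> \<omega> \<partial>M) else 0)"
    proof (cases "s = t")
      case False
      then have st': "s < t" using st by simp
      have "(\<integral>\<omega>. \<phi> \<omega> * ((B t \<omega> - B s \<omega>) $ j * (B t \<omega> - B s \<omega>) $ k) \<partial>M) =
          (\<integral>\<omega>. \<phi> \<omega> * ((W t \<omega> - W s \<omega>) $ j * (W t \<omega> - W s \<omega>) $ k) \<partial>M)"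
        using ae by (intro integral_cong_AE borel_measurable_times \<phi>M nm st t) auto
      also have "\<dots> = (\<integral>\<omega>. \<phi> \<omega> \<partial>M) * (\<integral>\<omega>. (W t \<omega> - W s \<omega>) $ j * (W t \<omega> - W s \<omega>) $ k \<partial>M)"
        using \<phi>i increment_covariance(1)[OF st(1) st']
        by (intro increment_independent[OF st(1) st' \<phi>, of "\<lambda>x. x $ j * x $ k"] borel_measurable_times borel_measurable_nth) auto
      also have "\<dots> = (if j = k then (t - s) * (\<integral>\<omega>. \<phi> \<omega> \<partial>M) else 0)"
        using increment_covariance(2)[OF st(1) st'] by simp
      finally show ?thesis .
    qed simp
  qed
  then show thesis using ae that by blast
qed

end

section \<open>Integrals of simple processes\<close>

context continuous_brownian_motion
begin

lemma B_M: "0 \<le> t \<Longrightarrow> B t \<in> borel_measurable M"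
  using measurable_F_M[OF B_adapted] by blast

text \<open>The change of the stopped increment between \<open>s\<close> and \<open>t\<close> is
  again an increment of \<open>B\<close>, over the part of the step interval in between. If this
  part is not empty, it begins no earlier than \<open>u\<close> and \<open>s\<close>, so both
  \<open>f\<close> and the test variable are known at its start.\<close>

lemma scalar_step_L2_martingale:
  fixes f :: "'w \<Rightarrow> real"
  assumes uv: "0 \<le> u" "u \<le> v" and f: "f \<in> borel_measurable (F u)" and c: "\<And>\<omega>. \<omega> \<in> space M \<Longrightarrow> \<bar>f \<omega>\<bar> \<le> c"
  shows "L2_martingale T (\<lambda>t \<omega>. f \<omega> * (B (min v t) \<omega> - B (min u t) \<omega>) $ j)"
proof (rule L2_martingaleI)
  note fM = measurable_F_M[OF f uv(1)]
  fix t assume t: "t \<in> {0..T}"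
  then have t0: "0 \<le> t" by simp
  show "(\<lambda>\<omega>. f \<omega> * (B (min v t) \<omega> - B (min u t) \<omega>) $ j) \<in> borel_measurable (F t)"
  proof (cases "u \<le> t")
    case True
    have "B (min v t) \<in> borel_measurable (F t)" "B (min u t) \<in> borel_measurable (F t)"
      using uv t0 by (auto intro!: measurable_F_mono[OF B_adapted])
    then show ?thesis
      by (intro borel_measurable_times measurable_F_mono[OF f uv(1) True] borel_measurable_nth borel_measurable_diff)
  next
    case False
    then show ?thesis using uv by simp
  qed
  show "integrable M (\<lambda>\<omega>. (f \<omega> * (B (min v t) \<omega> - B (min u t) \<omega>) $ j)\<^sup>2)"
    using uv t0 by (intro integrable_L2_bounded_mult[where c=c] fM borel_measurable_nth borel_measurable_diff B_M B_sq c) auto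
next
  fix \<omega> assume w: "\<omega> \<in> space M"
  have "continuous_on {0..T} (\<lambda>t. B (min x t) \<omega>)" if "0 \<le> x" for x
    using that by (intro continuous_on_compose2[OF B_cont[OF w]] continuous_intros) auto
  then show "continuous_on {0..T} (\<lambda>t. f \<omega> * (B (min v t) \<omega> - B (min u t) \<omega>) $ j)"
    using uv by (intro continuous_on_mult continuous_on_const continuous_on_component continuous_on_diff) auto
next
  fix s t :: real and \<phi> :: "'w \<Rightarrow> real"
  assume st: "0 \<le> s" "s \<le> t" "t \<le> T" and \<phi>: "\<phi> \<in> borel_measurable (F s)" "integrable M (\<lambda>\<omega>. (\<phi> \<omega>)\<^sup>2)"
  \<comment> \<open>These are \<open>u\<close> and \<open>v\<close> clipped to the interval from
    \<open>s\<close> to \<open>t\<close>. For \<open>u > t\<close> both clipped ends coincide and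
    the increment is 0.\<close>
  define u' v' where "u' = max s (min u t)" and "v' = max s (min v t)"
  have clip: "B (min x t) \<omega> - B (min x s) \<omega> = B (max s (min x t)) \<omega> - B s \<omega>" for x \<omega>
    using st by (cases "x \<le> s") (auto simp: min_def max_def)
  have e: "(B (min v t) \<omega> - B (min u t) \<omega>) - (B (min v s) \<omega> - B (min u s) \<omega>) = B v' \<omega> - B u' \<omega>" for \<omega>
  proof -
    have "(B (min v t) \<omega> - B (min u t) \<omega>) - (B (min v s) \<omega> - B (min u s) \<omega>) =
        (B (min v t) \<omega> - B (min v s) \<omega>) - (B (min u t) \<omega> - B (min u s) \<omega>)" by simp
    then show ?thesis unfolding clip by (simp add: u'_def v'_def)
  qed
  have "(\<integral>\<omega>. \<phi> \<omega> * (f \<omega> * (B (min v t) \<omega> - B (min u t) \<omega>) $ j - f \<omega> * (B (min v s) \<omega> - B (min u s) \<omega>) $ j) \<partial>M)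
      = (\<integral>\<omega>. (f \<omega> * \<phi> \<omega>) * (B v' \<omega> - B u' \<omega>) $ j \<partial>M)"
    unfolding e[symmetric] by (intro Bochner_Integration.integral_cong) (auto simp: algebra_simps)
  also have "\<dots> = 0"
  proof (cases "u \<le> t")
    case True
    then have u': "u \<le> u'" "s \<le> u'" "0 \<le> u'" "u' \<le> v'" using uv st by (auto simp: u'_def v'_def)
    have "(\<lambda>\<omega>. f \<omega> * \<phi> \<omega>) \<in> borel_measurable (F u')"
      by (intro borel_measurable_times measurable_F_mono[OF f uv(1) u'(1)] measurable_F_mono[OF \<phi>(1) st(1) u'(2)])
    moreover have "integrable M (\<lambda>\<omega>. (f \<omega> * \<phi> \<omega>)\<^sup>2)"
      by (intro integrable_L2_bounded_mult[where c=c] measurable_F_M[OF f uv(1)] measurable_F_M[OF \<phi>(1) st(1)] \<phi>(2) c)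
    ultimately show ?thesis by (rule B_mean[OF u'(3,4)])
  next
    case False
    then have "u' = v'" using uv by (auto simp: u'_def v'_def)
    then show ?thesis by simp
  qed
  finally show "(\<integral>\<omega>. \<phi> \<omega> * (f \<omega> * (B (min v t) \<omega> - B (min u t) \<omega>) $ j - f \<omega> * (B (min v s) \<omega> - B (min u s) \<omega>) $ j) \<partial>M) = 0" .
qed

text \<open>The integrand is a vector and the integral an inner product with the increment: one row
  of a matrix diffusion against all coordinates of the noise.\<close>

definition ito_step :: "real \<Rightarrow> real \<Rightarrow> ('w \<Rightarrow> real ^ 'm) \<Rightarrow> real \<Rightarrow> 'w \<Rightarrow> real" where
  "ito_step u v z t \<omega> = z \<omega> \<bullet> (B (min v t) \<omega> - B (min u t) \<omega>)"

lemma ito_step_L2_martingale: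
  assumes uv: "0 \<le> u" "u \<le> v" and z: "z \<in> borel_measurable (F u)" and c: "\<And>\<omega>. \<omega> \<in> space M \<Longrightarrow> norm (z \<omega>) \<le> c"
  shows "L2_martingale T (ito_step u v z)"
proof -
  have "L2_martingale T (\<lambda>t \<omega>. \<Sum>j\<in>UNIV. z \<omega> $ j * (B (min v t) \<omega> - B (min u t) \<omega>) $ j)"
    using c component_le_norm_cart[of "z _"] order_trans
    by (intro L2_martingale_sum scalar_step_L2_martingale[OF uv borel_measurable_nth[OF z], where c=c]) (auto, blast)
  then show ?thesis by (simp add: ito_step_def[abs_def] inner_vec_def)
qed

text \<open>When the inner product is expanded, the covariance law of the increments leaves only the
  diagonal terms, and these add up to the squared norm.\<close>

lemma ito_step_sq:
  assumes uv: "0 \<le> u" "u \<le> v" and z: "z \<in> borel_measurable (F u)" and c: "\<And>\<omega>. \<omega> \<in> space M \<Longrightarrow> norm (z \<omega>) \<le> c"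
    and t: "0 \<le> t"
  shows "(\<integral>\<omega>. (ito_step u v z t \<omega>)\<^sup>2 \<partial>M) = (min v t - min u t) * (\<integral>\<omega>. (norm (z \<omega>))\<^sup>2 \<partial>M)"
proof (cases "u \<le> t")
  case True
  define D where "D \<omega> = B (min v t) \<omega> - B u \<omega>" for \<omega>
  have v': "u \<le> min v t" "0 \<le> min v t" using True uv by auto
  have zj: "(\<lambda>\<omega>. z \<omega> $ j) \<in> borel_measurable (F u)" for j by (rule borel_measurable_nth[OF z])
  have cj: "\<bar>z \<omega> $ j\<bar> \<le> c" if "\<omega> \<in> space M" for \<omega> j
    using component_le_norm_cart[of "z \<omega>" j] c[OF that] by linarith
  have Dm: "(\<lambda>\<omega>. D \<omega> $ j) \<in> borel_measurable M" for j
    unfolding D_def by (intro borel_measurable_nth borel_measurable_diff B_M v' uv)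
  have D2: "integrable M (\<lambda>\<omega>. (D \<omega> $ j)\<^sup>2)" for j unfolding D_def by (rule B_sq[OF uv(1) v'(1)])
  have zD: "integrable M (\<lambda>\<omega>. (z \<omega> $ j * D \<omega> $ j)\<^sup>2)" for j
    by (intro integrable_L2_bounded_mult[where c=c] measurable_F_M[OF zj uv(1)] Dm D2 cj)
  have zDm: "(\<lambda>\<omega>. z \<omega> $ j * D \<omega> $ j) \<in> borel_measurable M" for j
    by (intro borel_measurable_times measurable_F_M[OF zj uv(1)] Dm)
  have "(\<integral>\<omega>. (ito_step u v z t \<omega>)\<^sup>2 \<partial>M) =
      (\<integral>\<omega>. (\<Sum>j\<in>UNIV. \<Sum>k\<in>UNIV. (z \<omega> $ j * D \<omega> $ j) * (z \<omega> $ k * D \<omega> $ k)) \<partial>M)"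
    using True by (simp add: ito_step_def inner_vec_def D_def power2_eq_square sum_product)
  also have "\<dots> = (\<Sum>j\<in>UNIV. \<Sum>k\<in>UNIV. \<integral>\<omega>. (z \<omega> $ j * D \<omega> $ j) * (z \<omega> $ k * D \<omega> $ k) \<partial>M)"
    by (subst Bochner_Integration.integral_sum; (intro sum.cong refl Bochner_Integration.integral_sum)?)
      (intro Bochner_Integration.integrable_sum integrable_mult_L2 zD zDm)+
  also have "\<dots> = (\<Sum>j\<in>UNIV. \<Sum>k\<in>UNIV. if j = k then (min v t - u) * (\<integral>\<omega>. z \<omega> $ j * z \<omega> $ j \<partial>M) else 0)"
  proof (intro sum.cong refl)
    fix j k
    have b: "\<bar>z \<omega> $ j * z \<omega> $ k\<bar> \<le> c * c" if "\<omega> \<in> space M" for \<omega>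
      unfolding abs_mult using cj[OF that, of j] cj[OF that, of k] by (intro mult_mono) auto
    have "(\<integral>\<omega>. (z \<omega> $ j * D \<omega> $ j) * (z \<omega> $ k * D \<omega> $ k) \<partial>M) = (\<integral>\<omega>. (z \<omega> $ j * z \<omega> $ k) * (D \<omega> $ j * D \<omega> $ k) \<partial>M)"
      by (intro Bochner_Integration.integral_cong) (auto simp: ac_simps)
    also have "\<dots> = (if j = k then (min v t - u) * (\<integral>\<omega>. z \<omega> $ j * z \<omega> $ k \<partial>M) else 0)"
      unfolding D_def by (intro B_cov[OF uv(1) v'(1) borel_measurable_times[OF zj zj] b])
    finally show "(\<integral>\<omega>. (z \<omega> $ j * D \<omega> $ j) * (z \<omega> $ k * D \<omega> $ k) \<partial>M)
        = (if j = k then (min v t - u) * (\<integral>\<omega>. z \<omega> $ j * z \<omega> $ j \<partial>M) else 0)" by simp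
  qed
  also have "\<dots> = (min v t - u) * (\<Sum>j\<in>UNIV. \<integral>\<omega>. z \<omega> $ j * z \<omega> $ j \<partial>M)"
    by (simp add: sum_distrib_left)
  also have "(\<Sum>j\<in>UNIV. \<integral>\<omega>. z \<omega> $ j * z \<omega> $ j \<partial>M) = (\<integral>\<omega>. (\<Sum>j\<in>UNIV. z \<omega> $ j * z \<omega> $ j) \<partial>M)"
  proof (intro Bochner_Integration.integral_sum[symmetric] integrable_const_bound[where B="c * c"] AE_I2)
    fix j \<omega> assume w: "\<omega> \<in> space M"
    show "norm (z \<omega> $ j * z \<omega> $ j) \<le> c * c"
      unfolding real_norm_def abs_mult using cj[OF w, of j] by (intro mult_mono) auto
  qed (intro borel_measurable_times measurable_F_M[OF zj uv(1)])
  also have "\<dots> = (\<integral>\<omega>. (norm (z \<omega>))\<^sup>2 \<partial>M)"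
    by (simp add: power2_norm_eq_inner inner_vec_def)
  finally show ?thesis using True by simp
next
  case False
  then show ?thesis using uv by (simp add: ito_step_def)
qed

text \<open>The first step is over when the second begins, so its value is known at
  \<open>u'\<close> and is a test variable for the second martingale.\<close>

lemma ito_step_orthogonal:
  assumes uv: "0 \<le> u" "u \<le> v" "v \<le> u'" "u' \<le> v'" and z: "z \<in> borel_measurable (F u)" "z' \<in> borel_measurable (F u')"
    and c: "\<And>\<omega>. \<omega> \<in> space M \<Longrightarrow> norm (z \<omega>) \<le> c" "\<And>\<omega>. \<omega> \<in> space M \<Longrightarrow> norm (z' \<omega>) \<le> c'"
    and t: "0 \<le> t"
  shows "(\<integral>\<omega>. ito_step u v z t \<omega> * ito_step u' v' z' t \<omega> \<partial>M) = 0"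
proof (cases "t \<le> u'")
  case True
  then show ?thesis using uv by (simp add: ito_step_def)
next
  case False
  have u': "0 \<le> u'" using uv by simp
  have X: "L2_martingale t (ito_step u v z)" by (rule ito_step_L2_martingale[OF uv(1,2) z(1) c(1)])
  have Y: "L2_martingale t (ito_step u' v' z')" by (rule ito_step_L2_martingale[OF u' uv(4) z(2) c(2)])
  have "ito_step u v z t \<omega> = ito_step u v z u' \<omega>" "ito_step u' v' z' u' \<omega> = 0" for \<omega>
    using uv False by (auto simp: ito_step_def)
  then have "(\<integral>\<omega>. ito_step u v z t \<omega> * ito_step u' v' z' t \<omega> \<partial>M) =
     (\<integral>\<omega>. ito_step u v z u' \<omega> * (ito_step u' v' z' t \<omega> - ito_step u' v' z' u' \<omega>) \<partial>M)" by simp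
  also have "\<dots> = 0"
    using False u' by (intro L2_martingaleD(5)[OF Y] L2_martingaleD(1,3)[OF X]) auto
  finally show ?thesis .
qed

section \<open>Step processes on dyadic grids and their isometry\<close>

definition step_coeffs :: "real \<Rightarrow> nat \<Rightarrow> (nat \<Rightarrow> 'w \<Rightarrow> real ^ 'm) \<Rightarrow> bool" where
  "step_coeffs T n \<zeta> \<longleftrightarrow> (\<forall>i<2 ^ n. \<zeta> i \<in> borel_measurable (F (dyadic T n i)) \<and>
    (\<exists>c. \<forall>\<omega>\<in>space M. norm (\<zeta> i \<omega>) \<le> c))"

text \<open>The cells are open on the left, so the value at time 0 is 0; a single time carries no
  energy.\<close>

definition step_val :: "real \<Rightarrow> nat \<Rightarrow> (nat \<Rightarrow> 'w \<Rightarrow> real ^ 'm) \<Rightarrow> real \<Rightarrow> 'w \<Rightarrow> real ^ 'm" where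
  "step_val T n \<zeta> s \<omega> = (\<Sum>i<2 ^ n. indicator {dyadic T n i<..dyadic T n (Suc i)} s *\<^sub>R \<zeta> i \<omega>)"

definition ito_sum :: "real \<Rightarrow> nat \<Rightarrow> (nat \<Rightarrow> 'w \<Rightarrow> real ^ 'm) \<Rightarrow> real \<Rightarrow> 'w \<Rightarrow> real" where
  "ito_sum T n \<zeta> t \<omega> = (\<Sum>i<2 ^ n. ito_step (dyadic T n i) (dyadic T n (Suc i)) (\<zeta> i) t \<omega>)"

lemma step_coeffsD:
  assumes "step_coeffs T n \<zeta>" "i < 2 ^ n"
  obtains c where "\<zeta> i \<in> borel_measurable (F (dyadic T n i))" "\<And>\<omega>. \<omega> \<in> space M \<Longrightarrow> norm (\<zeta> i \<omega>) \<le> c"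
  using assms unfolding step_coeffs_def by blast

lemma step_coeffs_diff:
  assumes "step_coeffs T n \<zeta>" "step_coeffs T n \<zeta>'"
  shows "step_coeffs T n (\<lambda>i \<omega>. \<zeta> i \<omega> - \<zeta>' i \<omega>)"
  unfolding step_coeffs_def
proof (intro allI impI)
  fix i :: nat assume i: "i < 2 ^ n"
  obtain c where c: "\<zeta> i \<in> borel_measurable (F (dyadic T n i))" "\<And>\<omega>. \<omega> \<in> space M \<Longrightarrow> norm (\<zeta> i \<omega>) \<le> c"
    using step_coeffsD[OF assms(1) i] by blast
  obtain c' where c': "\<zeta>' i \<in> borel_measurable (F (dyadic T n i))" "\<And>\<omega>. \<omega> \<in> space M \<Longrightarrow> norm (\<zeta>' i \<omega>) \<le> c'"
    using step_coeffsD[OF assms(2) i] by blast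
  have "norm (\<zeta> i \<omega> - \<zeta>' i \<omega>) \<le> c + c'" if "\<omega> \<in> space M" for \<omega>
    using c(2)[OF that] c'(2)[OF that] norm_triangle_ineq4[of "\<zeta> i \<omega>" "\<zeta>' i \<omega>"] by linarith
  then show "(\<lambda>\<omega>. \<zeta> i \<omega> - \<zeta>' i \<omega>) \<in> borel_measurable (F (dyadic T n i)) \<and>
      (\<exists>c. \<forall>\<omega>\<in>space M. norm (\<zeta> i \<omega> - \<zeta>' i \<omega>) \<le> c)"
    using c(1) c'(1) by (intro conjI borel_measurable_diff) blast+
qed

lemma step_val_diff:
  "step_val T n (\<lambda>i \<omega>. \<zeta> i \<omega> - \<zeta>' i \<omega>) s \<omega> = step_val T n \<zeta> s \<omega> - step_val T n \<zeta>' s \<omega>"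
  by (simp add: step_val_def scaleR_diff_right sum_subtractf)

lemma ito_sum_diff:
  "ito_sum T n (\<lambda>i \<omega>. \<zeta> i \<omega> - \<zeta>' i \<omega>) t \<omega> = ito_sum T n \<zeta> t \<omega> - ito_sum T n \<zeta>' t \<omega>"
  by (simp add: ito_sum_def ito_step_def inner_diff_left sum_subtractf)

lemma ito_sum_L2_martingale:
  assumes T: "0 \<le> T" and z: "step_coeffs T n \<zeta>"
  shows "L2_martingale T (ito_sum T n \<zeta>)"
proof -
  have "L2_martingale T (\<lambda>t \<omega>. \<Sum>i<2 ^ n. ito_step (dyadic T n i) (dyadic T n (Suc i)) (\<zeta> i) t \<omega>)"
  proof (rule L2_martingale_sum)
    fix i :: nat assume "i \<in> {..<2 ^ n}"
    then have i: "i < 2 ^ n" by simp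
    from step_coeffsD[OF z i] obtain c where "\<zeta> i \<in> borel_measurable (F (dyadic T n i))"
      "\<And>\<omega>. \<omega> \<in> space M \<Longrightarrow> norm (\<zeta> i \<omega>) \<le> c" by blast
    then show "L2_martingale T (ito_step (dyadic T n i) (dyadic T n (Suc i)) (\<zeta> i))"
      using T by (intro ito_step_L2_martingale) (auto intro: dyadic_mono)
  qed simp
  then show ?thesis by (simp add: ito_sum_def[abs_def])
qed

lemma dyadic_cell_unique:
  assumes T: "0 \<le> T" and "s \<in> {dyadic T n i<..dyadic T n (Suc i)}" "s \<in> {dyadic T n k<..dyadic T n (Suc k)}"
  shows "i = k"
proof (rule ccontr)
  assume "i \<noteq> k"
  then consider "Suc i \<le> k" | "Suc k \<le> i" by linarith
  then show False
    using assms(2,3) dyadic_mono[OF T, of "Suc i" k n] dyadic_mono[OF T, of "Suc k" i n] by cases auto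
qed

lemma indicator_dyadic_cell:
  assumes T: "0 \<le> T" and s: "s \<in> {dyadic T n i<..dyadic T n (Suc i)}"
  shows "indicator {dyadic T n k<..dyadic T n (Suc k)} s = (if k = i then 1 else (0::real))"
proof (cases "k = i")
  case True
  then show ?thesis using s by (simp add: indicator_def del: greaterThanAtMost_iff)
next
  case False
  then have "s \<notin> {dyadic T n k<..dyadic T n (Suc k)}" using dyadic_cell_unique[OF T s] by blast
  then show ?thesis using False by (simp add: indicator_def del: greaterThanAtMost_iff)
qed

lemma step_val_cell:
  assumes T: "0 \<le> T" and i: "i < 2 ^ n" and s: "s \<in> {dyadic T n i<..dyadic T n (Suc i)}"
  shows "step_val T n \<zeta> s \<omega> = \<zeta> i \<omega>"
proof -
  have "indicator {dyadic T n k<..dyadic T n (Suc k)} s *\<^sub>R \<zeta> k \<omega> = (if k = i then \<zeta> i \<omega> else 0)" for k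
    unfolding indicator_dyadic_cell[OF T s] by simp
  then show ?thesis using i by (simp add: step_val_def)
qed

lemma step_val_outside:
  assumes "\<And>i. i < 2 ^ n \<Longrightarrow> s \<notin> {dyadic T n i<..dyadic T n (Suc i)}"
  shows "step_val T n \<zeta> s \<omega> = 0"
  unfolding step_val_def
proof (intro sum.neutral ballI)
  fix i :: nat assume "i \<in> {..<2 ^ n}"
  then have "s \<notin> {dyadic T n i<..dyadic T n (Suc i)}" by (intro assms) simp
  then show "indicator {dyadic T n i<..dyadic T n (Suc i)} s *\<^sub>R \<zeta> i \<omega> = 0"
    by (simp add: indicator_def del: greaterThanAtMost_iff)
qed

text \<open>At most one cell contains \<open>s\<close>, so squaring the sum produces no mixed
  terms.\<close>

lemma step_val_norm_sq:
  assumes T: "0 \<le> T"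
  shows "(norm (step_val T n \<zeta> s \<omega>))\<^sup>2 =
    (\<Sum>i<2 ^ n. indicator {dyadic T n i<..dyadic T n (Suc i)} s * (norm (\<zeta> i \<omega>))\<^sup>2)"
proof (cases "\<exists>i<2 ^ n. s \<in> {dyadic T n i<..dyadic T n (Suc i)}")
  case True
  then obtain i where i: "i < 2 ^ n" "s \<in> {dyadic T n i<..dyadic T n (Suc i)}" by blast
  have "indicator {dyadic T n k<..dyadic T n (Suc k)} s * (norm (\<zeta> k \<omega>))\<^sup>2 = (if k = i then (norm (\<zeta> i \<omega>))\<^sup>2 else 0)" for k
    unfolding indicator_dyadic_cell[OF T i(2)] by simp
  then show ?thesis using i(1) step_val_cell[OF T i] by simp
next
  case False
  then have "step_val T n \<zeta> s \<omega> = 0" by (intro step_val_outside) blast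
  moreover have "(\<Sum>i<2 ^ n. indicator {dyadic T n i<..dyadic T n (Suc i)} s * (norm (\<zeta> i \<omega>))\<^sup>2) = 0"
  proof (intro sum.neutral ballI)
    fix i :: nat assume "i \<in> {..<2 ^ n}"
    then have "s \<notin> {dyadic T n i<..dyadic T n (Suc i)}" using False by blast
    then show "indicator {dyadic T n i<..dyadic T n (Suc i)} s * (norm (\<zeta> i \<omega>))\<^sup>2 = 0"
      by (simp add: indicator_def del: greaterThanAtMost_iff)
  qed
  ultimately show ?thesis by simp
qed

lemma step_val_progressive:
  assumes T: "0 \<le> T" and z: "step_coeffs T n \<zeta>"
  shows "progressive_on T (step_val T n \<zeta>)"
  unfolding progressive_on_def
proof
  fix r assume r: "r \<in> {0..T}"
  let ?N = "restrict_space borel {0..r} \<Otimes>\<^sub>M F r"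
  have "(\<lambda>x. indicator {dyadic T n i<..dyadic T n (Suc i)} (fst x) *\<^sub>R \<zeta> i (snd x)) \<in> borel_measurable ?N"
    if i: "i < 2 ^ n" for i
  proof (cases "dyadic T n i \<le> r")
    case True
    obtain c where "\<zeta> i \<in> borel_measurable (F (dyadic T n i))" using step_coeffsD[OF z i] by blast
    from measurable_F_mono[OF this dyadic_nonneg[OF T] True]
    have "(\<lambda>x. \<zeta> i (snd x)) \<in> borel_measurable ?N" by (rule measurable_compose[OF measurable_snd])
    moreover have "(\<lambda>x. indicator {dyadic T n i<..dyadic T n (Suc i)} (fst x) :: real) \<in> borel_measurable ?N"
      by (rule measurable_compose[OF measurable_fst]) (intro measurable_restrict_space1 borel_measurable_indicator, simp)
    ultimately show ?thesis by (intro borel_measurable_scaleR)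
  next
    \<comment> \<open>The coefficient of a cell that starts after \<open>r\<close> need not be
      measurable with respect to \<open>F r\<close>, but the indicator of that cell vanishes up to
      \<open>r\<close>.\<close>
    case False
    have "(\<lambda>x. indicator {dyadic T n i<..dyadic T n (Suc i)} (fst x) *\<^sub>R \<zeta> i (snd x)) \<in> borel_measurable ?N \<longleftrightarrow>
      (\<lambda>x. 0 :: real ^ 'm) \<in> borel_measurable ?N"
    proof (rule measurable_cong)
      fix x assume "x \<in> space ?N"
      then have "fst x \<le> r" by (auto simp: space_pair_measure space_restrict_space)
      then show "indicator {dyadic T n i<..dyadic T n (Suc i)} (fst x) *\<^sub>R \<zeta> i (snd x) = 0"
        using False by (simp add: indicator_def)
    qed
    then show ?thesis by simp
  qed
  then show "(\<lambda>x. step_val T n \<zeta> (fst x) (snd x)) \<in> borel_measurable ?N"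
    unfolding step_val_def by (intro borel_measurable_sum) simp
qed

text \<open>Both sides reduce to cell lengths times second moments of the coefficients: on the left
  by orthogonality of different steps, on the right by disjointness of the cells.\<close>

lemma ito_sum_isometry:
  assumes T: "0 \<le> T" and z: "step_coeffs T n \<zeta>" and t: "t \<in> {0..T}"
  shows "(\<integral>\<^sup>+\<omega>. ennreal ((ito_sum T n \<zeta> t \<omega>)\<^sup>2) \<partial>M) = energy t (step_val T n \<zeta>)"
proof -
  let ?d = "dyadic T n"
  define X where "X i = ito_step (?d i) (?d (Suc i)) (\<zeta> i) t" for i
  \<comment> \<open>The length of the part of cell \<open>i\<close> that lies before
    \<open>t\<close>.\<close>
  define l where "l i = min (?d (Suc i)) t - min (?d i) t" for i
  have d: "?d i \<le> ?d (Suc i)" "0 \<le> ?d i" for i using T by (auto intro: dyadic_mono)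
  have t0: "0 \<le> t" using t by simp
  have l: "0 \<le> l i" for i using d(1)[of i] by (auto simp: l_def)
  have mart: "L2_martingale T (ito_step (?d i) (?d (Suc i)) (\<zeta> i))"
    and sq: "(\<integral>\<omega>. (X i \<omega>)\<^sup>2 \<partial>M) = l i * (\<integral>\<omega>. (norm (\<zeta> i \<omega>))\<^sup>2 \<partial>M)"
    and zi: "integrable M (\<lambda>\<omega>. (norm (\<zeta> i \<omega>))\<^sup>2)" if i: "i < 2 ^ n" for i
  proof -
    obtain c where c: "\<zeta> i \<in> borel_measurable (F (?d i))" "\<And>\<omega>. \<omega> \<in> space M \<Longrightarrow> norm (\<zeta> i \<omega>) \<le> c"
      using step_coeffsD[OF z i] by blast
    show "L2_martingale T (ito_step (?d i) (?d (Suc i)) (\<zeta> i))" by (rule ito_step_L2_martingale[OF d(2,1) c])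
    show "(\<integral>\<omega>. (X i \<omega>)\<^sup>2 \<partial>M) = l i * (\<integral>\<omega>. (norm (\<zeta> i \<omega>))\<^sup>2 \<partial>M)"
      unfolding X_def l_def by (rule ito_step_sq[OF d(2,1) c t0])
    show "integrable M (\<lambda>\<omega>. (norm (\<zeta> i \<omega>))\<^sup>2)"
    proof (rule integrable_const_bound[where B="c\<^sup>2"])
      show "AE \<omega> in M. norm ((norm (\<zeta> i \<omega>))\<^sup>2) \<le> c\<^sup>2" using c(2) by (intro AE_I2) (simp add: power_mono)
      note [measurable] = measurable_F_M[OF c(1) d(2)]
      show "(\<lambda>\<omega>. (norm (\<zeta> i \<omega>))\<^sup>2) \<in> borel_measurable M" by measurable
    qed
  qed
  have orth: "(\<integral>\<omega>. X i \<omega> * X k \<omega> \<partial>M) = 0" if ik: "i < 2 ^ n" "k < 2 ^ n" "i < k" for i k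
  proof -
    obtain c where c: "\<zeta> i \<in> borel_measurable (F (?d i))" "\<And>\<omega>. \<omega> \<in> space M \<Longrightarrow> norm (\<zeta> i \<omega>) \<le> c"
      using step_coeffsD[OF z ik(1)] by blast
    obtain c' where c': "\<zeta> k \<in> borel_measurable (F (?d k))" "\<And>\<omega>. \<omega> \<in> space M \<Longrightarrow> norm (\<zeta> k \<omega>) \<le> c'"
      using step_coeffsD[OF z ik(2)] by blast
    have le: "?d (Suc i) \<le> ?d k" using ik T by (intro dyadic_mono) auto
    show ?thesis unfolding X_def
      by (rule ito_step_orthogonal[where c=c and c'=c']) (fact d c c' t0 le)+
  qed
  have Xint: "integrable M (\<lambda>\<omega>. X i \<omega> * X k \<omega>)" if "i < 2 ^ n" "k < 2 ^ n" for i k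
    unfolding X_def using that by (intro integrable_mult_L2 L2_martingaleD(2,3)[OF mart t])
  have Xeq: "(\<integral>\<omega>. X i \<omega> * X k \<omega> \<partial>M) = (if k = i then l i * (\<integral>\<omega>. (norm (\<zeta> i \<omega>))\<^sup>2 \<partial>M) else 0)"
    if "i < 2 ^ n" "k < 2 ^ n" for i k
  proof -
    consider "i = k" | "i < k" | "k < i" by linarith
    then show ?thesis
    proof cases
      case 1
      then show ?thesis using sq[OF that(1)] by (simp add: power2_eq_square)
    next
      case 2
      then show ?thesis using orth[OF that] by simp
    next
      case 3
      have "(\<integral>\<omega>. X i \<omega> * X k \<omega> \<partial>M) = (\<integral>\<omega>. X k \<omega> * X i \<omega> \<partial>M)" by (simp only: mult.commute)
      then show ?thesis using orth[OF that(2,1) 3] 3 by simp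
    qed
  qed
  have S2: "integrable M (\<lambda>\<omega>. (ito_sum T n \<zeta> t \<omega>)\<^sup>2)"
    by (rule L2_martingaleD(3)[OF ito_sum_L2_martingale[OF T z] t])
  have "(\<integral>\<omega>. (ito_sum T n \<zeta> t \<omega>)\<^sup>2 \<partial>M) = (\<integral>\<omega>. (\<Sum>i<2 ^ n. \<Sum>k<2 ^ n. X i \<omega> * X k \<omega>) \<partial>M)"
    by (simp add: ito_sum_def X_def power2_eq_square sum_product)
  also have "\<dots> = (\<Sum>i<2 ^ n. \<integral>\<omega>. (\<Sum>k<2 ^ n. X i \<omega> * X k \<omega>) \<partial>M)"
    by (intro Bochner_Integration.integral_sum Bochner_Integration.integrable_sum Xint) auto
  also have "\<dots> = (\<Sum>i<2 ^ n. \<Sum>k<2 ^ n. \<integral>\<omega>. X i \<omega> * X k \<omega> \<partial>M)"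
    by (intro sum.cong refl Bochner_Integration.integral_sum Xint) auto
  also have "\<dots> = (\<Sum>i<2 ^ n. \<Sum>k<2 ^ n. if k = i then l i * (\<integral>\<omega>. (norm (\<zeta> i \<omega>))\<^sup>2 \<partial>M) else 0)"
    by (intro sum.cong refl Xeq) auto
  also have "\<dots> = (\<Sum>i<2 ^ n. l i * (\<integral>\<omega>. (norm (\<zeta> i \<omega>))\<^sup>2 \<partial>M))" by simp
  finally have 1: "(\<integral>\<^sup>+\<omega>. ennreal ((ito_sum T n \<zeta> t \<omega>)\<^sup>2) \<partial>M) = ennreal (\<Sum>i<2 ^ n. l i * (\<integral>\<omega>. (norm (\<zeta> i \<omega>))\<^sup>2 \<partial>M))"
    using nn_integral_eq_integral[OF S2] by simp
  have cell: "(\<integral>\<^sup>+s. indicator {?d i<..?d (Suc i)} s * indicator {0..t} s \<partial>lborel) = ennreal (l i)" for i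
  proof -
    have "(\<integral>\<^sup>+s. indicator {?d i<..?d (Suc i)} s * indicator {0..t} s \<partial>lborel) =
        (\<integral>\<^sup>+s. indicator {min (?d i) t<..min (?d (Suc i)) t} s \<partial>lborel)"
      using d(2)[of i] d(1)[of i] by (intro nn_integral_cong) (auto simp: indicator_def min_def)
    also have "\<dots> = ennreal (l i)"
      using d(1)[of i] by (simp add: l_def)
    finally show ?thesis .
  qed
  have "(\<integral>\<^sup>+s\<in>{0..t}. ennreal ((norm (step_val T n \<zeta> s \<omega>))\<^sup>2) \<partial>lborel) =
      (\<Sum>i<2 ^ n. ennreal (l i) * ennreal ((norm (\<zeta> i \<omega>))\<^sup>2))" for \<omega>
  proof -
    have "(\<integral>\<^sup>+s\<in>{0..t}. ennreal ((norm (step_val T n \<zeta> s \<omega>))\<^sup>2) \<partial>lborel) =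
        (\<integral>\<^sup>+s. (\<Sum>i<2 ^ n. (indicator {?d i<..?d (Suc i)} s * indicator {0..t} s) * ennreal ((norm (\<zeta> i \<omega>))\<^sup>2)) \<partial>lborel)"
    proof (rule nn_integral_cong)
      fix s
      have "ennreal ((norm (step_val T n \<zeta> s \<omega>))\<^sup>2) =
          (\<Sum>i<2 ^ n. ennreal (indicator {?d i<..?d (Suc i)} s * (norm (\<zeta> i \<omega>))\<^sup>2))"
        unfolding step_val_norm_sq[OF T] by (intro sum_ennreal[symmetric]) auto
      also have "\<dots> = (\<Sum>i<2 ^ n. indicator {?d i<..?d (Suc i)} s * ennreal ((norm (\<zeta> i \<omega>))\<^sup>2))"
        by (intro sum.cong refl) (simp add: indicator_def)
      finally have e: "ennreal ((norm (step_val T n \<zeta> s \<omega>))\<^sup>2) =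
          (\<Sum>i<2 ^ n. indicator {?d i<..?d (Suc i)} s * ennreal ((norm (\<zeta> i \<omega>))\<^sup>2))" .
      show "ennreal ((norm (step_val T n \<zeta> s \<omega>))\<^sup>2) * indicator {0..t} s =
        (\<Sum>i<2 ^ n. (indicator {?d i<..?d (Suc i)} s * indicator {0..t} s) * ennreal ((norm (\<zeta> i \<omega>))\<^sup>2))"
        unfolding e sum_distrib_right by (intro sum.cong refl) (simp only: ac_simps)
    qed
    also have "\<dots> = (\<Sum>i<2 ^ n. ennreal (l i) * ennreal ((norm (\<zeta> i \<omega>))\<^sup>2))"
    proof -
      have "(\<integral>\<^sup>+s. (\<Sum>i<2 ^ n. (indicator {?d i<..?d (Suc i)} s * indicator {0..t} s) * ennreal ((norm (\<zeta> i \<omega>))\<^sup>2)) \<partial>lborel)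
        = (\<Sum>i<2 ^ n. \<integral>\<^sup>+s. (indicator {?d i<..?d (Suc i)} s * indicator {0..t} s) * ennreal ((norm (\<zeta> i \<omega>))\<^sup>2) \<partial>lborel)"
        by (intro nn_integral_sum) measurable
      also have "\<dots> = (\<Sum>i<2 ^ n. ennreal (l i) * ennreal ((norm (\<zeta> i \<omega>))\<^sup>2))"
        by (intro sum.cong refl, subst nn_integral_multc) (measurable, simp only: cell)
      finally show ?thesis .
    qed
    finally show ?thesis .
  qed
  then have "energy t (step_val T n \<zeta>) = (\<integral>\<^sup>+\<omega>. (\<Sum>i<2 ^ n. ennreal (l i) * ennreal ((norm (\<zeta> i \<omega>))\<^sup>2)) \<partial>M)"
    unfolding energy_paths[OF step_val_progressive[OF T z] t] by simp
  also have "\<dots> = (\<Sum>i<2 ^ n. ennreal (l i) * (\<integral>\<^sup>+\<omega>. ennreal ((norm (\<zeta> i \<omega>))\<^sup>2) \<partial>M))"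
  proof -
    have m: "(\<lambda>\<omega>. ennreal ((norm (\<zeta> i \<omega>))\<^sup>2)) \<in> borel_measurable M" if "i < 2 ^ n" for i
      using borel_measurable_integrable[OF zi[OF that]] by measurable
    have "(\<integral>\<^sup>+\<omega>. (\<Sum>i<2 ^ n. ennreal (l i) * ennreal ((norm (\<zeta> i \<omega>))\<^sup>2)) \<partial>M) =
        (\<Sum>i<2 ^ n. \<integral>\<^sup>+\<omega>. ennreal (l i) * ennreal ((norm (\<zeta> i \<omega>))\<^sup>2) \<partial>M)"
      by (intro nn_integral_sum borel_measurable_times_ennreal borel_measurable_const m) simp
    also have "\<dots> = (\<Sum>i<2 ^ n. ennreal (l i) * (\<integral>\<^sup>+\<omega>. ennreal ((norm (\<zeta> i \<omega>))\<^sup>2) \<partial>M))"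
      by (intro sum.cong refl nn_integral_cmult m) simp
    finally show ?thesis .
  qed
  also have "\<dots> = (\<Sum>i<2 ^ n. ennreal (l i * (\<integral>\<omega>. (norm (\<zeta> i \<omega>))\<^sup>2 \<partial>M)))"
    using nn_integral_eq_integral[OF zi] l by (intro sum.cong refl) (simp add: ennreal_mult)
  also have "\<dots> = ennreal (\<Sum>i<2 ^ n. l i * (\<integral>\<omega>. (norm (\<zeta> i \<omega>))\<^sup>2 \<partial>M))"
    using l by (intro sum_ennreal) auto
  finally show ?thesis using 1 by simp
qed

text \<open>A telescoping sum over each block of \<open>q\<close> fine cells. The map
  \<open>h\<close> is an abstract additive one because the lemma serves both Brownian increments and
  increments of indicators of half-lines.\<close>

lemma refine_sum:
  fixes h :: "nat \<Rightarrow> 'a::ab_group_add \<Rightarrow> 'b::comm_monoid_add"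
  assumes h: "\<And>k x y. h k (x + y) = h k x + h k y" "\<And>k. h k 0 = 0" and q: "0 < q"
  shows "(\<Sum>i<N * q. h (i div q) (g (Suc i) - g i)) = (\<Sum>k<N. h k (g (Suc k * q) - g (k * q)))"
proof -
  have tele: "(\<Sum>i=k * q..<k * q + p. h (i div q) (g (Suc i) - g i)) = h k (g (k * q + p) - g (k * q))"
    if "p \<le> q" for k p
    using that
  proof (induction p)
    case 0
    then show ?case by (simp add: h)
  next
    case (Suc p)
    have "(k * q + p) div q = k" using Suc.prems q by simp
    then have "(\<Sum>i=k * q..<k * q + Suc p. h (i div q) (g (Suc i) - g i)) =
        h k (g (k * q + p) - g (k * q)) + h k (g (Suc (k * q + p)) - g (k * q + p))"
      using Suc by simp
    also have "\<dots> = h k (g (k * q + Suc p) - g (k * q))" by (simp add: h(1)[symmetric])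
    finally show ?case .
  qed
  have "(\<Sum>i<N * q. h (i div q) (g (Suc i) - g i)) = (\<Sum>k<N. \<Sum>i=k * q..<k * q + q. h (i div q) (g (Suc i) - g i))"
    by (rule sum.nat_group[symmetric])
  also have "\<dots> = (\<Sum>k<N. h k (g (k * q + q) - g (k * q)))"
    by (intro sum.cong refl tele order_refl)
  finally show ?thesis by (simp add: add.commute)
qed

text \<open>Two dyadic step processes are compared after passing to the finer of the two grids.\<close>

definition refine :: "nat \<Rightarrow> nat \<Rightarrow> (nat \<Rightarrow> 'w \<Rightarrow> real ^ 'm) \<Rightarrow> nat \<Rightarrow> 'w \<Rightarrow> real ^ 'm" where
  "refine n n' \<zeta> i = \<zeta> (i div 2 ^ (n' - n))"

lemma dyadic_refine:
  assumes "n \<le> n'"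
  shows "dyadic T n' (k * 2 ^ (n' - n)) = dyadic T n k"
proof -
  have "(2::real) ^ n' = 2 ^ n * 2 ^ (n' - n)" using assms by (simp add: power_add[symmetric])
  then show ?thesis by (simp add: dyadic_def)
qed

lemma refine_step_coeffs:
  assumes T: "0 \<le> T" and n: "n \<le> n'" and z: "step_coeffs T n \<zeta>"
  shows "step_coeffs T n' (refine n n' \<zeta>)"
  unfolding step_coeffs_def
proof (intro allI impI)
  fix i :: nat assume i: "i < 2 ^ n'"
  let ?q = "2 ^ (n' - n) :: nat"
  have "2 ^ n * ?q = 2 ^ n'" using n by (simp add: power_add[symmetric])
  then have k: "i div ?q < 2 ^ n" using i by (simp add: less_mult_imp_div_less)
  have "dyadic T n (i div ?q) = dyadic T n' (i div ?q * ?q)" using dyadic_refine[OF n] by simp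
  also have "\<dots> \<le> dyadic T n' i" by (intro dyadic_mono[OF T]) simp
  finally have le: "dyadic T n (i div ?q) \<le> dyadic T n' i" .
  obtain c where c: "\<zeta> (i div ?q) \<in> borel_measurable (F (dyadic T n (i div ?q)))"
    "\<And>\<omega>. \<omega> \<in> space M \<Longrightarrow> norm (\<zeta> (i div ?q) \<omega>) \<le> c"
    using step_coeffsD[OF z k] by blast
  show "refine n n' \<zeta> i \<in> borel_measurable (F (dyadic T n' i)) \<and> (\<exists>c. \<forall>\<omega>\<in>space M. norm (refine n n' \<zeta> i \<omega>) \<le> c)"
    using measurable_F_mono[OF c(1) dyadic_nonneg[OF T] le] c(2) by (auto simp: refine_def)
qed

lemma refine_ito_sum:
  assumes n: "n \<le> n'"
  shows "ito_sum T n' (refine n n' \<zeta>) t \<omega> = ito_sum T n \<zeta> t \<omega>"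
proof -
  let ?q = "2 ^ (n' - n) :: nat"
  have q: "2 ^ n' = 2 ^ n * ?q" using n by (simp add: power_add[symmetric])
  have "ito_sum T n' (refine n n' \<zeta>) t \<omega> =
    (\<Sum>k<2 ^ n. \<zeta> k \<omega> \<bullet> (B (min (dyadic T n' (Suc k * ?q)) t) \<omega> - B (min (dyadic T n' (k * ?q)) t) \<omega>))"
    unfolding ito_sum_def ito_step_def refine_def q
    by (rule refine_sum) (auto simp: inner_add_right)
  also have "\<dots> = ito_sum T n \<zeta> t \<omega>"
    unfolding dyadic_refine[OF n] by (simp add: ito_sum_def ito_step_def)
  finally show ?thesis .
qed

lemma refine_step_val:
  assumes T: "0 \<le> T" and n: "n \<le> n'"
  shows "step_val T n' (refine n n' \<zeta>) s \<omega> = step_val T n \<zeta> s \<omega>"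
proof -
  let ?q = "2 ^ (n' - n) :: nat"
  have q: "2 ^ n' = 2 ^ n * ?q" using n by (simp add: power_add[symmetric])
  \<comment> \<open>In this form the indicator of a cell is an increment of a function of the grid
    index, as \<open>refine_sum\<close> requires.\<close>
  have ind: "indicator {dyadic T n i<..dyadic T n (Suc i)} s =
     (indicator {..dyadic T n (Suc i)} s - indicator {..dyadic T n i} s :: real)" for n i
    using dyadic_mono[OF T, of i "Suc i" n] by (auto simp: indicator_def)
  have "step_val T n' (refine n n' \<zeta>) s \<omega> =
    (\<Sum>k<2 ^ n. (indicator {..dyadic T n' (Suc k * ?q)} s - indicator {..dyadic T n' (k * ?q)} s :: real) *\<^sub>R \<zeta> k \<omega>)"
    unfolding step_val_def ind refine_def q
    by (rule refine_sum[where h="\<lambda>k x. x *\<^sub>R \<zeta> k \<omega>"]) (auto simp: scaleR_add_left)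
  also have "\<dots> = step_val T n \<zeta> s \<omega>"
    unfolding dyadic_refine[OF n] by (simp add: step_val_def ind)
  finally show ?thesis .
qed

text \<open>Differences of step processes are step processes again, so the isometry applies to them.
  The Cauchy estimates for the integral rest on this.\<close>

lemma step_diff:
  assumes T: "0 \<le> T" and z: "step_coeffs T n \<zeta>" and z': "step_coeffs T n' \<zeta>'"
  obtains N \<xi> where "step_coeffs T N \<xi>"
    "\<And>s \<omega>. step_val T N \<xi> s \<omega> = step_val T n \<zeta> s \<omega> - step_val T n' \<zeta>' s \<omega>"
    "\<And>t \<omega>. ito_sum T N \<xi> t \<omega> = ito_sum T n \<zeta> t \<omega> - ito_sum T n' \<zeta>' t \<omega>"
proof
  let ?N = "max n n'"
  let ?\<xi> = "\<lambda>i \<omega>. refine n ?N \<zeta> i \<omega> - refine n' ?N \<zeta>' i \<omega>"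
  show "step_coeffs T ?N ?\<xi>" using z z' T by (intro step_coeffs_diff refine_step_coeffs) auto
  show "step_val T ?N ?\<xi> s \<omega> = step_val T n \<zeta> s \<omega> - step_val T n' \<zeta>' s \<omega>" for s \<omega>
    using T by (simp only: step_val_diff refine_step_val max.cobounded1 max.cobounded2)
  show "ito_sum T ?N ?\<xi> t \<omega> = ito_sum T n \<zeta> t \<omega> - ito_sum T n' \<zeta>' t \<omega>" for t \<omega>
    by (simp only: ito_sum_diff refine_ito_sum max.cobounded1 max.cobounded2)
qed

end

section \<open>The Ito integral\<close>

lemma dyadic_cell_exists:
  assumes s: "0 < s" "s \<le> T"
  obtains i where "i < 2 ^ n" "s \<in> {dyadic T n i<..dyadic T n (Suc i)}"
proof -
  define x where "x = s * 2 ^ n / T"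
  have T: "0 < T" using s by simp
  have x: "0 < x" "x \<le> 2 ^ n" using s T by (auto simp: x_def pos_divide_le_eq mult_right_mono mult.commute)
  define k where "k = nat \<lceil>x\<rceil>"
  have k: "0 < k" "x \<le> real k" "real k < x + 1" using x unfolding k_def by linarith+
  have "\<lceil>x\<rceil> \<le> 2 ^ n" using x(2) by (simp add: ceiling_le_iff)
  then have k2: "k \<le> 2 ^ n" unfolding k_def by (simp add: nat_le_iff)
  have sx: "s = T * x / 2 ^ n" using T by (simp add: x_def)
  show thesis
  \<comment> \<open>Cells are closed on the right, so the index is one less than the ceiling of the
    rescaled time.\<close>
  proof (rule that[of "k - 1"])
    show "k - 1 < 2 ^ n" using k(1) k2 by linarith
    have "real (k - 1) < x" using k by (simp add: of_nat_diff)
    then have "T * real (k - 1) / 2 ^ n < T * x / 2 ^ n" using T by (intro divide_strict_right_mono mult_strict_left_mono) auto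
    moreover have "T * x / 2 ^ n \<le> T * real k / 2 ^ n" using T k(2) by (intro divide_right_mono mult_left_mono) auto
    ultimately show "s \<in> {dyadic T n (k - 1)<..dyadic T n (Suc (k - 1))}"
      using k(1) sx by (simp add: dyadic_def)
  qed
qed

lemma dyadic_Suc_diff: "dyadic T n (Suc i) - dyadic T n i = T / 2 ^ n"
  by (simp add: dyadic_def diff_divide_distrib[symmetric] algebra_simps)

text \<open>Markov's inequality.\<close>

lemma null_in_prob_nn_integral:
  assumes M: "finite_measure M" and U [measurable]: "\<And>k. U k \<in> borel_measurable M"
    and lim: "(\<lambda>k. \<integral>\<^sup>+\<omega>. U k \<omega> \<partial>M) \<longlonglongrightarrow> 0"
  shows "null_in_prob M U"
  unfolding null_in_prob_def
proof (intro conjI allI impI U)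
  fix e :: real assume e: "e > 0"
  interpret finite_measure M by (rule M)
  have 1: "ennreal (e * measure M {\<omega> \<in> space M. ennreal e < U k \<omega>}) \<le> (\<integral>\<^sup>+\<omega>. U k \<omega> \<partial>M)" for k
  proof -
    have "ennreal (e * measure M {\<omega> \<in> space M. ennreal e < U k \<omega>}) =
        ennreal e * emeasure M {\<omega> \<in> space M. ennreal e < U k \<omega>}"
      using e by (simp add: ennreal_mult emeasure_eq_measure)
    also have "\<dots> = (\<integral>\<^sup>+\<omega>. ennreal e * indicator {\<omega> \<in> space M. ennreal e < U k \<omega>} \<omega> \<partial>M)"
      by (intro nn_integral_cmult_indicator[symmetric]) measurable
    also have "\<dots> \<le> (\<integral>\<^sup>+\<omega>. U k \<omega> \<partial>M)"
      by (intro nn_integral_mono) (auto simp: indicator_def)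
    finally show ?thesis .
  qed
  have "(\<lambda>k. ennreal (e * measure M {\<omega> \<in> space M. ennreal e < U k \<omega>})) \<longlonglongrightarrow> ennreal 0"
    unfolding ennreal_0 using 1 by (intro tendsto_sandwich[OF _ _ tendsto_const lim] always_eventually allI) auto
  then have "(\<lambda>k. e * measure M {\<omega> \<in> space M. ennreal e < U k \<omega>}) \<longlonglongrightarrow> 0"
    using e by (subst (asm) tendsto_ennreal_iff) (auto intro!: always_eventually)
  then have "(\<lambda>k. inverse e * (e * measure M {\<omega> \<in> space M. ennreal e < U k \<omega>})) \<longlonglongrightarrow> inverse e * 0"
    by (intro tendsto_mult tendsto_const)
  then show "(\<lambda>k. measure M {\<omega> \<in> space M. ennreal e < U k \<omega>}) \<longlonglongrightarrow> 0"
    using e by (simp add: mult.assoc[symmetric])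
qed

lemma null_in_prob_mean_square:
  fixes Z :: "nat \<Rightarrow> 'a \<Rightarrow> real"
  assumes M: "finite_measure M" and Z [measurable]: "\<And>k. Z k \<in> borel_measurable M"
    and lim: "(\<lambda>k. \<integral>\<^sup>+\<omega>. ennreal ((Z k \<omega>)\<^sup>2) \<partial>M) \<longlonglongrightarrow> 0"
  shows "null_in_prob M (\<lambda>k \<omega>. ennreal \<bar>Z k \<omega>\<bar>)"
  unfolding null_in_prob_def
proof (intro conjI allI impI)
  have 1: "null_in_prob M (\<lambda>k \<omega>. ennreal ((Z k \<omega>)\<^sup>2))"
    by (rule null_in_prob_nn_integral[OF M _ lim]) measurable
  fix e :: real assume e: "e > 0"
  then have "e\<^sup>2 > 0" by simp
  with 1 have "(\<lambda>k. measure M {\<omega> \<in> space M. ennreal (e\<^sup>2) < ennreal ((Z k \<omega>)\<^sup>2)}) \<longlonglongrightarrow> 0"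
    unfolding null_in_prob_def by blast
  moreover have "ennreal (e\<^sup>2) < ennreal ((Z k \<omega>)\<^sup>2) \<longleftrightarrow> ennreal e < ennreal \<bar>Z k \<omega>\<bar>" for k \<omega>
  proof -
    have "e\<^sup>2 < (Z k \<omega>)\<^sup>2 \<longleftrightarrow> e < \<bar>Z k \<omega>\<bar>"
      using power_strict_mono[of e "\<bar>Z k \<omega>\<bar>" 2] power_mono[of "\<bar>Z k \<omega>\<bar>" e 2] e
      by (cases "e < \<bar>Z k \<omega>\<bar>") auto
    then show ?thesis using e by (simp add: ennreal_less_iff)
  qed
  ultimately show "(\<lambda>k. measure M {\<omega> \<in> space M. ennreal e < ennreal \<bar>Z k \<omega>\<bar>}) \<longlonglongrightarrow> 0" by simp
qed measurable

context continuous_brownian_motion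
begin

lemma energy_commute: "energy r (\<lambda>s \<omega>. H s \<omega> - K s \<omega>) = energy r (\<lambda>s \<omega>. K s \<omega> - H s \<omega>)"
  by (simp add: energy_def cut_diff norm_minus_commute)

text \<open>On each cell the step takes the mean of \<open>h\<close> over the previous cell. Both
  ends of that cell lie within two cell lengths before \<open>s\<close>, so differentiability of the
  indefinite integral at \<open>s\<close> controls the mean although the averaging interval precedes
  \<open>s\<close>.\<close>

lemma averages_converge:
  fixes h :: "real \<Rightarrow> real ^ 'm"
  assumes T: "0 < T" and h: "h integrable_on {0..T}" and s: "0 < s" "s \<le> T"
    and D: "((\<lambda>t. integral {0..t} h) has_vector_derivative h s) (at s within {0..T})"
    and z: "\<And>n i. 0 < i \<Longrightarrow> i < 2 ^ n \<Longrightarrow>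
      z n i = (2 ^ n / T) *\<^sub>R (integral {0..dyadic T n i} h - integral {0..dyadic T n (i - 1)} h)"
    and v: "\<And>n i. i < 2 ^ n \<Longrightarrow> s \<in> {dyadic T n i<..dyadic T n (Suc i)} \<Longrightarrow> v n = z n i"
  shows "v \<longlonglongrightarrow> h s"
proof (rule metric_LIMSEQ_I)
  fix e :: real assume e: "e > 0"
  define \<Phi> where "\<Phi> t = integral {0..t} h" for t
  have "(\<Phi> has_derivative (\<lambda>x. x *\<^sub>R h s)) (at s within {0..T})"
    using D by (simp add: has_vector_derivative_def \<Phi>_def[abs_def])
  moreover have "e / 4 > 0" using e by simp
  ultimately obtain d where d: "d > 0" "\<And>y. y \<in> {0..T} \<Longrightarrow> norm (y - s) < d \<Longrightarrow>
      norm (\<Phi> y - \<Phi> s - (y - s) *\<^sub>R h s) \<le> (e / 4) * norm (y - s)"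
    unfolding has_derivative_within_alt by blast
  have "(\<lambda>n. T * (1 / 2) ^ n) \<longlonglongrightarrow> T * 0" by (intro tendsto_intros LIMSEQ_power_zero) auto
  \<comment> \<open>Cell lengths below \<open>s\<close> put \<open>s\<close> outside the first cell,
    which has no predecessor; below \<open>d / 2\<close> they bring both ends of the previous cell
    within \<open>d\<close>. The errors then add up to at most \<open>3 * e / 4\<close>.\<close>
  then have "\<forall>\<^sub>F n in sequentially. T * (1 / 2) ^ n < min s (d / 2)"
    using s d by (intro order_tendstoD(2)) auto
  then obtain n0 where n0: "\<And>n. n \<ge> n0 \<Longrightarrow> T * (1 / 2) ^ n < min s (d / 2)"
    by (auto simp: eventually_sequentially)
  have "dist (v n) (h s) < e" if n: "n \<ge> n0" for n
  proof -
    define l where "l = T / 2 ^ n"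
    have l: "0 < l" "l < s" "2 * l < d" using n0[OF n] T by (auto simp: l_def power_one_over mult.commute)
    obtain i where i: "i < 2 ^ n" "s \<in> {dyadic T n i<..dyadic T n (Suc i)}"
      using dyadic_cell_exists[OF s] by blast
    have i0: "0 < i"
    proof (rule ccontr)
      assume "\<not> 0 < i"
      then have "s \<le> l" using i(2) by (simp add: dyadic_def l_def)
      then show False using l by simp
    qed
    define p q where "p = dyadic T n i" and "q = dyadic T n (i - 1)"
    have pq: "p - q = l" "dyadic T n (Suc i) - p = l"
      using dyadic_Suc_diff[of T n "i - 1"] dyadic_Suc_diff[of T n i] i0 by (auto simp: p_def q_def l_def)
    have p: "p < s" "s - l \<le> p" using i(2) pq by (auto simp: p_def)
    have in0T: "p \<in> {0..T}" "q \<in> {0..T}"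
      unfolding p_def q_def using T i by (intro dyadic_in; simp)+
    have np: "norm (\<Phi> p - \<Phi> s - (p - s) *\<^sub>R h s) \<le> (e / 4) * l"
    proof -
      have "norm (p - s) \<le> l" "norm (p - s) < d" using p l by auto
      then show ?thesis
        using order_trans[OF d(2)[OF in0T(1)] mult_left_mono[of "norm (p - s)" l "e / 4"]] e by simp
    qed
    have nq: "norm (\<Phi> q - \<Phi> s - (q - s) *\<^sub>R h s) \<le> (e / 4) * (2 * l)"
    proof -
      have "norm (q - s) \<le> 2 * l" "norm (q - s) < d" using p pq l by auto
      then show ?thesis
        using order_trans[OF d(2)[OF in0T(2)] mult_left_mono[of "norm (q - s)" "2 * l" "e / 4"]] e by simp
    qed
    have "v n - h s = (1 / l) *\<^sub>R (\<Phi> p - \<Phi> q - l *\<^sub>R h s)"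
      using v[OF i] z[OF i0 i(1)] l T by (simp add: \<Phi>_def p_def q_def l_def scaleR_diff_right)
    also have "\<Phi> p - \<Phi> q - l *\<^sub>R h s = (\<Phi> p - \<Phi> s - (p - s) *\<^sub>R h s) - (\<Phi> q - \<Phi> s - (q - s) *\<^sub>R h s)"
      unfolding pq(1)[symmetric] by (simp add: algebra_simps)
    finally have "norm (v n - h s) = (1 / l) * norm ((\<Phi> p - \<Phi> s - (p - s) *\<^sub>R h s) - (\<Phi> q - \<Phi> s - (q - s) *\<^sub>R h s))"
      using l by simp
    also have "\<dots> \<le> (1 / l) * ((e / 4) * l + (e / 4) * (2 * l))"
      using l norm_triangle_ineq4[of "\<Phi> p - \<Phi> s - (p - s) *\<^sub>R h s" "\<Phi> q - \<Phi> s - (q - s) *\<^sub>R h s"] np nq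
      by (intro mult_left_mono) auto
    also have "\<dots> = 3 * e / 4" using l by (simp add: field_simps)
    finally show ?thesis using e by (simp add: dist_norm)
  qed
  then show "\<exists>n0. \<forall>n\<ge>n0. dist (v n) (h s) < e" by blast
qed

text \<open>Means over the previous cell keep the coefficients adapted and bounded by
  \<open>N\<close>. On each path they converge at almost every time by differentiation; dominated
  convergence is then used in time and, after that, over the outcomes.\<close>

lemma step_density_bounded:
  fixes H :: "real \<Rightarrow> 'w \<Rightarrow> real ^ 'm"
  assumes T: "0 < T" and H: "progressive_on T H"
    and N: "\<And>s \<omega>. s \<in> {0..T} \<Longrightarrow> \<omega> \<in> space M \<Longrightarrow> norm (H s \<omega>) \<le> N"
  shows "\<exists>\<zeta>. (\<forall>n. step_coeffs T n (\<zeta> n)) \<and> (\<lambda>n. energy T (\<lambda>s \<omega>. step_val T n (\<zeta> n) s \<omega> - H s \<omega>)) \<longlonglongrightarrow> 0"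
proof -
  have T0: "0 \<le> T" and TT: "T \<in> {0..T}" using T by auto
  obtain \<omega>0 where "\<omega>0 \<in> space M" using not_empty by blast
  from order_trans[OF norm_ge_zero N[OF TT this]] have N0: "0 \<le> N" .
  \<comment> \<open>The first cell has no previous one and gets the value 0.\<close>
  define \<zeta> where "\<zeta> n i \<omega> = (if i = 0 then 0 else
    (2 ^ n / T) *\<^sub>R (LINT s:{dyadic T n (i - 1)..dyadic T n i}|lborel. H s \<omega>))" for n i \<omega>
  have hS: "set_integrable lborel {0..T} (\<lambda>s. H s \<omega>)" if "\<omega> \<in> space M" for \<omega>
    by (rule set_integrable_bounded[OF cut_section_measurable[OF H TT that] N[OF _ that]])
  have hI: "(\<lambda>s. H s \<omega>) integrable_on {0..T}" if "\<omega> \<in> space M" for \<omega>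
    by (rule set_borel_integral_eq_integral(1)[OF hS[OF that]])
  have z: "(LINT s:{dyadic T n (i - 1)..dyadic T n i}|lborel. H s \<omega>) =
      integral {0..dyadic T n i} (\<lambda>s. H s \<omega>) - integral {0..dyadic T n (i - 1)} (\<lambda>s. H s \<omega>)"
    "norm (LINT s:{dyadic T n (i - 1)..dyadic T n i}|lborel. H s \<omega>) \<le> N * (T / 2 ^ n)"
    if w: "\<omega> \<in> space M" and i: "0 < i" "i < 2 ^ n" for n i \<omega>
  proof -
    have d: "0 \<le> dyadic T n (i - 1)" "dyadic T n (i - 1) \<le> dyadic T n i" "dyadic T n i \<le> T"
      using dyadic_in[OF T0, of i n] i dyadic_mono[OF T0, of "i - 1" i n] T0 by auto
    have "set_integrable lborel {dyadic T n (i - 1)..dyadic T n i} (\<lambda>s. H s \<omega>)"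
      by (rule set_integrable_subset[OF hS[OF w]]) (use d in auto)
    then have e: "(LINT s:{dyadic T n (i - 1)..dyadic T n i}|lborel. H s \<omega>) =
        integral {dyadic T n (i - 1)..dyadic T n i} (\<lambda>s. H s \<omega>)"
      by (rule set_borel_integral_eq_integral(2))
    have l: "dyadic T n i - dyadic T n (i - 1) = T / 2 ^ n"
      using dyadic_Suc_diff[of T n "i - 1"] i by simp
    show "(LINT s:{dyadic T n (i - 1)..dyadic T n i}|lborel. H s \<omega>) =
      integral {0..dyadic T n i} (\<lambda>s. H s \<omega>) - integral {0..dyadic T n (i - 1)} (\<lambda>s. H s \<omega>)"
      unfolding e by (rule integral_lipschitz(1)[OF hI[OF w] N[OF _ w] d, symmetric])
    show "norm (LINT s:{dyadic T n (i - 1)..dyadic T n i}|lborel. H s \<omega>) \<le> N * (T / 2 ^ n)"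
      unfolding e l[symmetric] by (rule integral_lipschitz(2)[OF hI[OF w] N[OF _ w] d])
  qed
  have bound: "norm (\<zeta> n i \<omega>) \<le> N" if w: "\<omega> \<in> space M" and i: "i < 2 ^ n" for n i \<omega>
  proof (cases "i = 0")
    case False
    then have "norm (\<zeta> n i \<omega>) = (2 ^ n / T) * norm (LINT s:{dyadic T n (i - 1)..dyadic T n i}|lborel. H s \<omega>)"
      using T by (simp add: \<zeta>_def)
    also have "\<dots> \<le> (2 ^ n / T) * (N * (T / 2 ^ n))"
      using T False by (intro mult_left_mono z(2)[OF w _ i]) auto
    also have "\<dots> = N" using T by simp
    finally show ?thesis .
  qed (simp add: \<zeta>_def N0)
  have coeffs: "step_coeffs T n (\<zeta> n)" for n
    unfolding step_coeffs_def
  proof (intro allI impI conjI)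
    fix i :: nat assume i: "i < 2 ^ n"
    show "\<exists>c. \<forall>\<omega>\<in>space M. norm (\<zeta> n i \<omega>) \<le> c" using bound[OF _ i] by blast
    show "\<zeta> n i \<in> borel_measurable (F (dyadic T n i))"
    proof (cases "i = 0")
      case True
      then show ?thesis by (simp add: \<zeta>_def[abs_def])
    next
      case False
      have di: "dyadic T n i \<in> {0..T}" using i by (intro dyadic_in T0) simp
      have "{0..dyadic T n i} \<inter> {dyadic T n (i - 1)..} = {dyadic T n (i - 1)..dyadic T n i}"
        using dyadic_nonneg[OF T0, of n "i - 1"] by auto
      note eq = this
      have "(\<lambda>\<omega>. LINT s:{dyadic T n (i - 1)..dyadic T n i}|lborel. H s \<omega>) \<in> borel_measurable (F (dyadic T n i))"
        by (rule integral_process_adapted[OF H di, of "{dyadic T n (i - 1)..}", unfolded eq]) simp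
      then have "(\<lambda>\<omega>. (2 ^ n / T) *\<^sub>R (LINT s:{dyadic T n (i - 1)..dyadic T n i}|lborel. H s \<omega>)) \<in> borel_measurable (F (dyadic T n i))"
        by (intro borel_measurable_scaleR borel_measurable_const)
      then show ?thesis using False by (simp add: \<zeta>_def[abs_def])
    qed
  qed
  define D where "D n s \<omega> = step_val T n (\<zeta> n) s \<omega> - H s \<omega>" for n s \<omega>
  have Dp: "progressive_on T (D n)" for n
    unfolding D_def by (intro progressive_on_diff step_val_progressive T0 coeffs H)
  have Db: "norm (D n s \<omega>) \<le> 2 * N" if w: "\<omega> \<in> space M" and s: "s \<in> {0..T}" for n s \<omega>
  proof -
    have "norm (step_val T n (\<zeta> n) s \<omega>) \<le> N"
    proof (cases "\<exists>i<2 ^ n. s \<in> {dyadic T n i<..dyadic T n (Suc i)}")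
      case True
      then obtain i where i: "i < 2 ^ n" "s \<in> {dyadic T n i<..dyadic T n (Suc i)}" by blast
      show ?thesis unfolding step_val_cell[OF T0 i] by (rule bound[OF w i(1)])
    next
      case False
      then have "step_val T n (\<zeta> n) s \<omega> = 0" by (intro step_val_outside) blast
      then show ?thesis using N0 by simp
    qed
    then show ?thesis unfolding D_def
      using norm_triangle_ineq4[of "step_val T n (\<zeta> n) s \<omega>" "H s \<omega>"] N[OF s w] by linarith
  qed
  define C where "C = (2 * N)\<^sup>2"
  have Db2: "(norm (D n s \<omega>))\<^sup>2 \<le> C" if "\<omega> \<in> space M" "s \<in> {0..T}" for n s \<omega>
    unfolding C_def by (rule power_mono[OF Db[OF that] norm_ge_zero])
  define E where "E n \<omega> = (\<integral>\<^sup>+s\<in>{0..T}. ennreal ((norm (D n s \<omega>))\<^sup>2) \<partial>lborel)" for n \<omega>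
  have E_alt: "E n \<omega> = (\<integral>\<^sup>+s. ennreal ((norm (indicator {0..T} s *\<^sub>R D n s \<omega>))\<^sup>2) \<partial>lborel)" for n \<omega>
    unfolding E_def by (intro nn_integral_cong) (auto simp: indicator_def)
  have W: "(\<integral>\<^sup>+s. ennreal C * indicator {0..T} s \<partial>lborel) = ennreal C * ennreal T"
    using T0 by (subst nn_integral_cmult_indicator) auto
  have Eb: "E n \<omega> \<le> ennreal C * ennreal T" if "\<omega> \<in> space M" for n \<omega>
    unfolding E_def W[symmetric] using Db2[OF that]
    by (intro nn_integral_mono) (auto simp: indicator_def intro!: ennreal_leI)
  have E0: "(\<lambda>n. E n \<omega>) \<longlonglongrightarrow> 0" if w: "\<omega> \<in> space M" for \<omega>
  proof -
    have m: "(\<lambda>s. indicator {0..T} s *\<^sub>R D n s \<omega>) \<in> borel_measurable lborel" for n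
      using cut_section_measurable[OF Dp TT w] by simp
    have "(\<lambda>n. \<integral>\<^sup>+s. ennreal ((norm (indicator {0..T} s *\<^sub>R D n s \<omega>))\<^sup>2) \<partial>lborel) \<longlonglongrightarrow> (\<integral>\<^sup>+s. 0 \<partial>(lborel :: real measure))"
    proof (rule nn_integral_dominated_convergence[where w="\<lambda>s. ennreal C * indicator {0..T} s"])
      show "(\<lambda>s. ennreal ((norm (indicator {0..T} s *\<^sub>R D n s \<omega>))\<^sup>2)) \<in> borel_measurable lborel" for n
        using m[of n] by measurable
      show "AE s in lborel. ennreal ((norm (indicator {0..T} s *\<^sub>R D n s \<omega>))\<^sup>2) \<le> ennreal C * indicator {0..T} s" for n
        using Db2[OF w] by (intro AE_I2) (auto simp: indicator_def intro!: ennreal_leI)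
      show "(\<integral>\<^sup>+s. ennreal C * indicator {0..T} s \<partial>lborel) < \<infinity>"
        unfolding W by (simp add: ennreal_mult_less_top)
      show "AE s in lborel. (\<lambda>n. ennreal ((norm (indicator {0..T} s *\<^sub>R D n s \<omega>))\<^sup>2)) \<longlonglongrightarrow> 0"
        \<comment> \<open>Time 0 lies in no cell and is discarded as a single point.\<close>
        using lebesgue_differentiation_AE[OF hI[OF w]] AE_lborel_singleton[of 0]
      proof eventually_elim
        case (elim s)
        show ?case
        proof (cases "s \<in> {0..T}")
          case True
          then have s: "0 < s" "s \<le> T" using elim(2) by auto
          have "(\<lambda>n. step_val T n (\<zeta> n) s \<omega>) \<longlonglongrightarrow> H s \<omega>"
          proof (rule averages_converge[OF T hI[OF w] s, where z="\<lambda>n i. \<zeta> n i \<omega>"])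
            show "((\<lambda>t. integral {0..t} (\<lambda>s. H s \<omega>)) has_vector_derivative H s \<omega>) (at s within {0..T})"
              using elim(1) True by blast
            show "\<zeta> n i \<omega> = (2 ^ n / T) *\<^sub>R (integral {0..dyadic T n i} (\<lambda>s. H s \<omega>) -
                integral {0..dyadic T n (i - 1)} (\<lambda>s. H s \<omega>))" if "0 < i" "i < 2 ^ n" for n i
              using that z(1)[OF w that] by (simp add: \<zeta>_def)
          qed (rule step_val_cell[OF T0])
          then have "(\<lambda>n. ennreal ((norm (step_val T n (\<zeta> n) s \<omega> - H s \<omega>))\<^sup>2)) \<longlonglongrightarrow> ennreal ((norm (H s \<omega> - H s \<omega>))\<^sup>2)"
            by (intro tendsto_ennrealI tendsto_power tendsto_norm tendsto_diff tendsto_const)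
          then show ?thesis using True by (simp add: D_def)
        next
          case False
          then have "indicator {0..T} s *\<^sub>R D n s \<omega> = 0" for n by (simp add: indicator_def del: atLeastAtMost_iff)
          then show ?thesis by (simp only: norm_zero zero_power2 ennreal_0 tendsto_const)
        qed
      qed
    qed (use T0 in measurable)
    then show ?thesis by (simp add: E_alt)
  qed
  have "(\<lambda>n. \<integral>\<^sup>+\<omega>. E n \<omega> \<partial>M) \<longlonglongrightarrow> (\<integral>\<^sup>+\<omega>. 0 \<partial>M)"
  proof (rule nn_integral_dominated_convergence[where w="\<lambda>_. ennreal C * ennreal T"])
    show "E n \<in> borel_measurable M" for n
      unfolding E_def[abs_def] by (rule energy_path_measurable[OF Dp TT])
    show "AE \<omega> in M. E n \<omega> \<le> ennreal C * ennreal T" for n using Eb by (intro AE_I2)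
    show "AE \<omega> in M. (\<lambda>n. E n \<omega>) \<longlonglongrightarrow> 0" using E0 by (intro AE_I2)
    show "(\<integral>\<^sup>+\<omega>. ennreal C * ennreal T \<partial>M) < \<infinity>"
      by (simp add: ennreal_mult_less_top emeasure_space_1)
  qed measurable
  then have "(\<lambda>n. energy T (D n)) \<longlonglongrightarrow> 0"
    unfolding energy_paths[OF Dp TT] by (simp add: E_def)
  then show ?thesis using coeffs by (auto simp: D_def[abs_def])
qed

text \<open>Large values of \<open>H\<close> are replaced by 0; the truncated processes are bounded
  and converge to \<open>H\<close> in energy by domination.\<close>

lemma step_density:
  fixes H :: "real \<Rightarrow> 'w \<Rightarrow> real ^ 'm"
  assumes T: "0 < T" and H: "progressive_on T H" and fin: "energy T H < \<infinity>" and e: "e > 0"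
  shows "\<exists>n \<zeta>. step_coeffs T n \<zeta> \<and> energy T (\<lambda>s \<omega>. step_val T n \<zeta> s \<omega> - H s \<omega>) \<le> ennreal e"
proof -
  have T0: "0 \<le> T" and TT: "T \<in> {0..T}" using T by auto
  define K where "K k s \<omega> = (if norm (H s \<omega>) \<le> real k then H s \<omega> else 0)" for k :: nat and s \<omega>
  have Kp: "progressive_on T (K k)" for k
    unfolding K_def by (rule progressive_on_compose[OF H, of "\<lambda>s x. if norm x \<le> real k then x else 0"]) measurable
  have "(\<lambda>k. energy T (\<lambda>s \<omega>. K k s \<omega> - H s \<omega>)) \<longlonglongrightarrow> (\<integral>\<^sup>+x. 0 \<partial>((lborel :: real measure) \<Otimes>\<^sub>M M))"
    unfolding energy_def
  proof (rule nn_integral_dominated_convergence[where w="\<lambda>x. ennreal ((norm (cut T H x))\<^sup>2)"])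
    note [measurable] = cut_measurable[OF H TT] cut_measurable[OF progressive_on_diff[OF Kp H] TT]
    show "(\<lambda>x. ennreal ((norm (cut T (\<lambda>s \<omega>. K k s \<omega> - H s \<omega>) x))\<^sup>2)) \<in> borel_measurable (lborel \<Otimes>\<^sub>M M)" for k by measurable
    show "(\<lambda>x. ennreal ((norm (cut T H x))\<^sup>2)) \<in> borel_measurable (lborel \<Otimes>\<^sub>M M)" by measurable
    show "AE x in lborel \<Otimes>\<^sub>M M. ennreal ((norm (cut T (\<lambda>s \<omega>. K k s \<omega> - H s \<omega>) x))\<^sup>2) \<le> ennreal ((norm (cut T H x))\<^sup>2)" for k
      by (intro AE_I2 ennreal_leI power_mono) (auto simp: cut_def K_def indicator_def)
    show "(\<integral>\<^sup>+x. ennreal ((norm (cut T H x))\<^sup>2) \<partial>(lborel \<Otimes>\<^sub>M M)) < \<infinity>" using fin by (simp add: energy_def)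
    show "AE x in lborel \<Otimes>\<^sub>M M. (\<lambda>k. ennreal ((norm (cut T (\<lambda>s \<omega>. K k s \<omega> - H s \<omega>) x))\<^sup>2)) \<longlonglongrightarrow> 0"
    proof (intro AE_I2 tendsto_eventually)
      fix x :: "real \<times> 'w"
      obtain k0 :: nat where k0: "norm (H (fst x) (snd x)) \<le> real k0" using real_arch_simple by blast
      have "ennreal ((norm (cut T (\<lambda>s \<omega>. K k s \<omega> - H s \<omega>) x))\<^sup>2) = 0" if "k \<ge> k0" for k
      proof -
        have "norm (H (fst x) (snd x)) \<le> real k" using k0 that by linarith
        then show ?thesis by (simp add: cut_def K_def)
      qed
      then show "\<forall>\<^sub>F k in sequentially. ennreal ((norm (cut T (\<lambda>s \<omega>. K k s \<omega> - H s \<omega>) x))\<^sup>2) = 0"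
        unfolding eventually_sequentially by blast
    qed
  qed measurable
  then have "(\<lambda>k. energy T (\<lambda>s \<omega>. K k s \<omega> - H s \<omega>)) \<longlonglongrightarrow> 0" by simp
  \<comment> \<open>The triangle inequality for energies doubles both errors, hence
    \<open>e / 4\<close>.\<close>
  then have "\<forall>\<^sub>F k in sequentially. energy T (\<lambda>s \<omega>. K k s \<omega> - H s \<omega>) < ennreal (e / 4)"
    using e by (intro order_tendstoD(2)) auto
  then obtain k where k: "energy T (\<lambda>s \<omega>. K k s \<omega> - H s \<omega>) < ennreal (e / 4)"
    using eventually_happens'[OF sequentially_bot] by blast
  have "norm (K k s \<omega>) \<le> real k" for s \<omega> by (simp add: K_def)
  from step_density_bounded[OF T Kp this] obtain \<zeta> where \<zeta>: "\<And>n. step_coeffs T n (\<zeta> n)"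
    "(\<lambda>n. energy T (\<lambda>s \<omega>. step_val T n (\<zeta> n) s \<omega> - K k s \<omega>)) \<longlonglongrightarrow> 0" by blast
  have "\<forall>\<^sub>F n in sequentially. energy T (\<lambda>s \<omega>. step_val T n (\<zeta> n) s \<omega> - K k s \<omega>) < ennreal (e / 4)"
    using e by (intro order_tendstoD(2)[OF \<zeta>(2)]) auto
  then obtain n where n: "energy T (\<lambda>s \<omega>. step_val T n (\<zeta> n) s \<omega> - K k s \<omega>) < ennreal (e / 4)"
    using eventually_happens'[OF sequentially_bot] by blast
  have "energy T (\<lambda>s \<omega>. step_val T n (\<zeta> n) s \<omega> - H s \<omega>) \<le>
      2 * energy T (\<lambda>s \<omega>. step_val T n (\<zeta> n) s \<omega> - K k s \<omega>) + 2 * energy T (\<lambda>s \<omega>. K k s \<omega> - H s \<omega>)"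
    by (rule energy_triangle[OF step_val_progressive[OF T0 \<zeta>(1)] Kp H TT])
  also have "\<dots> \<le> 2 * ennreal (e / 4) + 2 * ennreal (e / 4)"
    using k n by (intro add_mono mult_left_mono) auto
  also have "2 * ennreal (e / 4) = ennreal (e / 2)" using ennreal_mult[of 2 "e / 4"] e by simp
  also have "ennreal (e / 2) + ennreal (e / 2) = ennreal e" using e by (subst ennreal_plus[symmetric]) auto
  finally show ?thesis using \<zeta>(1) by blast
qed

text \<open>\<open>X\<close> is the integral of \<open>H\<close> with respect to \<open>B\<close>,
  as a continuous process on \<open>{0..T}\<close>. One approximating sequence serves all times;
  that its choice does not matter is the content of \<open>ito_unique\<close>.\<close>

definition ito :: "real \<Rightarrow> (real \<Rightarrow> 'w \<Rightarrow> real ^ 'm) \<Rightarrow> (real \<Rightarrow> 'w \<Rightarrow> real) \<Rightarrow> bool" where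
  "ito T H X \<longleftrightarrow> progressive_on T H \<and> energy T H < \<infinity> \<and> L2_martingale T X \<and>
    (\<exists>n \<zeta>. (\<forall>k. step_coeffs T (n k) (\<zeta> k)) \<and>
      (\<lambda>k. energy T (\<lambda>s \<omega>. step_val T (n k) (\<zeta> k) s \<omega> - H s \<omega>)) \<longlonglongrightarrow> 0 \<and>
      (\<forall>t\<in>{0..T}. (\<lambda>k. \<integral>\<^sup>+\<omega>. ennreal ((norm (ito_sum T (n k) (\<zeta> k) t \<omega> - X t \<omega>))\<^sup>2) \<partial>M) \<longlonglongrightarrow> 0))"

lemma itoE:
  assumes "ito T H X"
  obtains n \<zeta> where "progressive_on T H" "energy T H < \<infinity>" "L2_martingale T X"
    "\<And>k. step_coeffs T (n k) (\<zeta> k)"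
    "(\<lambda>k. energy T (\<lambda>s \<omega>. step_val T (n k) (\<zeta> k) s \<omega> - H s \<omega>)) \<longlonglongrightarrow> 0"
    "\<And>t. t \<in> {0..T} \<Longrightarrow> (\<lambda>k. \<integral>\<^sup>+\<omega>. ennreal ((norm (ito_sum T (n k) (\<zeta> k) t \<omega> - X t \<omega>))\<^sup>2) \<partial>M) \<longlonglongrightarrow> 0"
  using assms unfolding ito_def by blast

lemma itoD:
  assumes "ito T H X"
  shows "progressive_on T H" "energy T H < \<infinity>" "L2_martingale T X"
  using assms unfolding ito_def by blast+

text \<open>Energy errors of \<open>(1/4) ^ k\<close> make the step integrals converge fast enough
  for uniform limits of paths; Doob's inequality turns the bound at time \<open>T\<close> into one
  for the supremum.\<close>

theorem ito_exists:
  assumes T: "0 < T" and H: "progressive_on T H" and fin: "energy T H < \<infinity>"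
  shows "\<exists>X. ito T H X"
proof -
  have T0: "0 \<le> T" and TT: "T \<in> {0..T}" using T by auto
  have "\<forall>k. \<exists>n \<zeta>. step_coeffs T n \<zeta> \<and> energy T (\<lambda>s \<omega>. step_val T n \<zeta> s \<omega> - H s \<omega>) \<le> ennreal ((1/4) ^ k)"
    by (intro allI step_density[OF T H fin]) simp
  from choice[OF this] obtain n where
    "\<forall>k. \<exists>\<zeta>. step_coeffs T (n k) \<zeta> \<and> energy T (\<lambda>s \<omega>. step_val T (n k) \<zeta> s \<omega> - H s \<omega>) \<le> ennreal ((1/4) ^ k)" ..
  from choice[OF this] obtain \<zeta> where z: "\<And>k. step_coeffs T (n k) (\<zeta> k)"
    "\<And>k. energy T (\<lambda>s \<omega>. step_val T (n k) (\<zeta> k) s \<omega> - H s \<omega>) \<le> ennreal ((1/4) ^ k)"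
    by blast
  define S where "S k = ito_sum T (n k) (\<zeta> k)" for k
  define V where "V k = step_val T (n k) (\<zeta> k)" for k
  have Sm: "L2_martingale T (S k)" for k unfolding S_def by (rule ito_sum_L2_martingale[OF T0 z(1)])
  have Vp: "progressive_on T (V k)" for k unfolding V_def by (rule step_val_progressive[OF T0 z(1)])
  \<comment> \<open>The constant comes from \<open>2 + 2 / 4 \<le> 3\<close>. It grows to 12 twice
    below, once by the geometric Cauchy bound and once by Doob's factor 4.\<close>
  have step: "(\<integral>\<^sup>+\<omega>. ennreal ((norm (S k t \<omega> - S (Suc k) t \<omega>))\<^sup>2) \<partial>M) \<le> ennreal (3 * (1/4) ^ k)"
    if t: "t \<in> {0..T}" for k t
  proof -
    obtain N \<xi> where N: "step_coeffs T N \<xi>" "\<And>s \<omega>. step_val T N \<xi> s \<omega> = V k s \<omega> - V (Suc k) s \<omega>"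
      "\<And>t \<omega>. ito_sum T N \<xi> t \<omega> = S k t \<omega> - S (Suc k) t \<omega>"
      using step_diff[OF T0 z(1)[of k] z(1)[of "Suc k"]] unfolding V_def S_def by blast
    have "(\<integral>\<^sup>+\<omega>. ennreal ((norm (S k t \<omega> - S (Suc k) t \<omega>))\<^sup>2) \<partial>M) = energy t (step_val T N \<xi>)"
      using ito_sum_isometry[OF T0 N(1) t] by (simp add: N(3))
    also have "\<dots> \<le> energy T (step_val T N \<xi>)" using t by (intro energy_mono_time) auto
    also have "step_val T N \<xi> = (\<lambda>s \<omega>. V k s \<omega> - V (Suc k) s \<omega>)" by (intro ext N(2))
    also have "energy T (\<lambda>s \<omega>. V k s \<omega> - V (Suc k) s \<omega>) \<le>
        2 * energy T (\<lambda>s \<omega>. V k s \<omega> - H s \<omega>) + 2 * energy T (\<lambda>s \<omega>. H s \<omega> - V (Suc k) s \<omega>)"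
      by (rule energy_triangle[OF Vp H Vp TT])
    also have "\<dots> \<le> 2 * ennreal ((1/4) ^ k) + 2 * ennreal ((1/4) ^ Suc k)"
      unfolding energy_commute[of T H] V_def by (intro add_mono mult_left_mono z(2)) auto
    also have "\<dots> = ennreal (2 * (1/4) ^ k) + ennreal (2 * (1/4) ^ Suc k)"
      using ennreal_mult[of 2 "(1/4) ^ k"] ennreal_mult[of 2 "(1/4) ^ Suc k"] by simp
    also have "\<dots> = ennreal (2 * (1/4) ^ k + 2 * (1/4) ^ Suc k)" by (rule ennreal_plus[symmetric]) auto
    also have "\<dots> \<le> ennreal (3 * (1/4) ^ k)" by (intro ennreal_leI) simp
    finally show ?thesis .
  qed
  have cauchy: "(\<integral>\<^sup>+\<omega>. ennreal ((norm (S m t \<omega> - S k t \<omega>))\<^sup>2) \<partial>M) \<le> ennreal (12 * (1/4) ^ k)"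
    if t: "t \<in> {0..T}" and km: "k \<le> m" for k m t
  proof -
    have "(\<integral>\<^sup>+\<omega>. ennreal ((norm (S k t \<omega> - S m t \<omega>))\<^sup>2) \<partial>M) \<le> ennreal (4 * 3 * (1/4) ^ k)"
    proof (rule geometric_cauchy_bound[where D="\<lambda>k m. \<integral>\<^sup>+\<omega>. ennreal ((norm (S k t \<omega> - S m t \<omega>))\<^sup>2) \<partial>M"])
      show "(\<integral>\<^sup>+\<omega>. ennreal ((norm (S k t \<omega> - S m t \<omega>))\<^sup>2) \<partial>M) \<le>
          2 * (\<integral>\<^sup>+\<omega>. ennreal ((norm (S k t \<omega> - S (Suc k) t \<omega>))\<^sup>2) \<partial>M) +
          2 * (\<integral>\<^sup>+\<omega>. ennreal ((norm (S (Suc k) t \<omega> - S m t \<omega>))\<^sup>2) \<partial>M)" for k m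
        by (intro nn_integral_sq_diff_le L2_martingaleD(2)[OF Sm t])
    qed (use step[OF t] km in auto)
    then show ?thesis by (simp only: norm_minus_commute[of "S m t _"]) simp
  qed
  have sup: "(\<integral>\<^sup>+\<omega>. (SUP t\<in>{0..T}. ennreal ((norm (S (Suc k) t \<omega> - S k t \<omega>))\<^sup>2)) \<partial>M) \<le> ennreal (12 * (1/4) ^ k)" for k
  proof -
    have "(\<integral>\<^sup>+\<omega>. (SUP t\<in>{0..T}. ennreal ((norm (S (Suc k) t \<omega> - S k t \<omega>))\<^sup>2)) \<partial>M) \<le>
        4 * (\<integral>\<^sup>+\<omega>. ennreal ((norm (S (Suc k) T \<omega> - S k T \<omega>))\<^sup>2) \<partial>M)"
      using doob_maximal[OF L2_martingale_diff[OF Sm[of "Suc k"] Sm[of k]] T0] by simp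
    also have "\<dots> \<le> 4 * ennreal (3 * (1/4) ^ k)"
      unfolding norm_minus_commute[of "S (Suc k) T _"] by (intro mult_left_mono step[OF TT]) simp
    also have "\<dots> = ennreal (12 * (1/4) ^ k)"
      using ennreal_mult[of 4 "3 * (1/4) ^ k"] by simp
    finally show ?thesis .
  qed
  obtain X where X: "\<And>t. t \<in> {0..T} \<Longrightarrow> X t \<in> borel_measurable (F t)"
    "\<And>\<omega>. \<omega> \<in> space M \<Longrightarrow> continuous_on {0..T} (\<lambda>t. X t \<omega>)"
    "AE \<omega> in M. uniform_limit {0..T} (\<lambda>n t. S n t \<omega>) (\<lambda>t. X t \<omega>) sequentially"
    using continuous_process_limit[OF T0 L2_martingaleD(1)[OF Sm] L2_martingaleD(4)[OF Sm] _ sup] by auto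
  have lim: "(\<lambda>k. \<integral>\<^sup>+\<omega>. ennreal ((norm (S k t \<omega> - X t \<omega>))\<^sup>2) \<partial>M) \<longlonglongrightarrow> 0" if t: "t \<in> {0..T}" for t
  proof -
    have ae: "AE \<omega> in M. (\<lambda>k. S k t \<omega>) \<longlonglongrightarrow> X t \<omega>"
      using X(3) by eventually_elim (rule tendsto_uniform_limitI[OF _ t])
    have "(\<integral>\<^sup>+\<omega>. ennreal ((norm (X t \<omega> - S k t \<omega>))\<^sup>2) \<partial>M) \<le> ennreal (12 * (1/4) ^ k)" for k
      by (rule nn_integral_sq_limit_bound[OF L2_martingaleD(2)[OF Sm t] ae cauchy[OF t]])
    then have le: "(\<integral>\<^sup>+\<omega>. ennreal ((norm (S k t \<omega> - X t \<omega>))\<^sup>2) \<partial>M) \<le> ennreal (12 * (1/4) ^ k)" for k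
      by (simp only: norm_minus_commute[of "S _ t _" "X t _"])
    have "(\<lambda>k. 12 * (1/4) ^ k :: real) \<longlonglongrightarrow> 12 * 0" by (intro tendsto_intros LIMSEQ_power_zero) auto
    then have "(\<lambda>k. ennreal (12 * (1/4) ^ k)) \<longlonglongrightarrow> ennreal 0" by (intro tendsto_ennrealI) simp
    then have z0: "(\<lambda>k. ennreal (12 * (1/4) ^ k)) \<longlonglongrightarrow> 0" by (simp only: ennreal_0)
    show ?thesis
      by (rule tendsto_sandwich[OF _ _ tendsto_const z0]) (use le in \<open>auto intro: always_eventually\<close>)
  qed
  have Xm: "L2_martingale T X"
    by (rule L2_martingale_limit[OF Sm X(1,2)]) (use lim in simp_all)
  have "(\<lambda>k. energy T (\<lambda>s \<omega>. V k s \<omega> - H s \<omega>)) \<longlonglongrightarrow> 0"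
  proof -
    have "(\<lambda>k. (1/4) ^ k :: real) \<longlonglongrightarrow> 0" by (intro LIMSEQ_power_zero) auto
    then have "(\<lambda>k. ennreal ((1/4) ^ k)) \<longlonglongrightarrow> ennreal 0" by (intro tendsto_ennrealI)
    then have z0: "(\<lambda>k. ennreal ((1/4) ^ k)) \<longlonglongrightarrow> 0" by (simp only: ennreal_0)
    show ?thesis
      by (rule tendsto_sandwich[OF _ _ tendsto_const z0]) (use z(2) in \<open>auto simp: V_def intro: always_eventually\<close>)
  qed
  then have "ito T H X"
    unfolding ito_def using H fin Xm z(1) lim unfolding V_def S_def by blast
  then show ?thesis by (rule exI[where x=X])
qed

section \<open>Linearity, isometry and uniqueness of the integral\<close>

lemma progressive_on_zero: "progressive_on T (\<lambda>s \<omega>. 0 :: 'b::euclidean_space)"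
  by (rule progressive_on_deterministic) simp

lemma energy_zero: "energy T (\<lambda>s \<omega>. 0 :: 'b::euclidean_space) = 0"
  by (simp add: energy_def cut_def)

lemma ito_diff:
  assumes T: "0 < T" and X: "ito T H X" and Y: "ito T K Y"
  shows "ito T (\<lambda>s \<omega>. H s \<omega> - K s \<omega>) (\<lambda>t \<omega>. X t \<omega> - Y t \<omega>)"
proof -
  have T0: "0 \<le> T" and TT: "T \<in> {0..T}" using T by auto
  obtain n \<zeta> where X': "progressive_on T H" "energy T H < \<infinity>" "L2_martingale T X"
    "\<And>k. step_coeffs T (n k) (\<zeta> k)"
    "(\<lambda>k. energy T (\<lambda>s \<omega>. step_val T (n k) (\<zeta> k) s \<omega> - H s \<omega>)) \<longlonglongrightarrow> 0"
    "\<And>t. t \<in> {0..T} \<Longrightarrow> (\<lambda>k. \<integral>\<^sup>+\<omega>. ennreal ((norm (ito_sum T (n k) (\<zeta> k) t \<omega> - X t \<omega>))\<^sup>2) \<partial>M) \<longlonglongrightarrow> 0"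
    using itoE[OF X] by blast
  obtain n' \<zeta>' where Y': "progressive_on T K" "energy T K < \<infinity>" "L2_martingale T Y"
    "\<And>k. step_coeffs T (n' k) (\<zeta>' k)"
    "(\<lambda>k. energy T (\<lambda>s \<omega>. step_val T (n' k) (\<zeta>' k) s \<omega> - K s \<omega>)) \<longlonglongrightarrow> 0"
    "\<And>t. t \<in> {0..T} \<Longrightarrow> (\<lambda>k. \<integral>\<^sup>+\<omega>. ennreal ((norm (ito_sum T (n' k) (\<zeta>' k) t \<omega> - Y t \<omega>))\<^sup>2) \<partial>M) \<longlonglongrightarrow> 0"
    using itoE[OF Y] by blast
  \<comment> \<open>The two approximating sequences live on different grids, so a common refinement
    is chosen for each index.\<close>
  have "\<forall>k. \<exists>N \<xi>. step_coeffs T N \<xi> \<and>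
    (\<forall>s \<omega>. step_val T N \<xi> s \<omega> = step_val T (n k) (\<zeta> k) s \<omega> - step_val T (n' k) (\<zeta>' k) s \<omega>) \<and>
    (\<forall>t \<omega>. ito_sum T N \<xi> t \<omega> = ito_sum T (n k) (\<zeta> k) t \<omega> - ito_sum T (n' k) (\<zeta>' k) t \<omega>)"
  proof
    fix k
    show "\<exists>N \<xi>. step_coeffs T N \<xi> \<and>
      (\<forall>s \<omega>. step_val T N \<xi> s \<omega> = step_val T (n k) (\<zeta> k) s \<omega> - step_val T (n' k) (\<zeta>' k) s \<omega>) \<and>
      (\<forall>t \<omega>. ito_sum T N \<xi> t \<omega> = ito_sum T (n k) (\<zeta> k) t \<omega> - ito_sum T (n' k) (\<zeta>' k) t \<omega>)"
      by (rule step_diff[OF T0 X'(4)[of k] Y'(4)[of k]]) blast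
  qed
  then obtain N \<xi> where N: "\<And>k. step_coeffs T (N k) (\<xi> k)"
    "\<And>k s \<omega>. step_val T (N k) (\<xi> k) s \<omega> = step_val T (n k) (\<zeta> k) s \<omega> - step_val T (n' k) (\<zeta>' k) s \<omega>"
    "\<And>k t \<omega>. ito_sum T (N k) (\<xi> k) t \<omega> = ito_sum T (n k) (\<zeta> k) t \<omega> - ito_sum T (n' k) (\<zeta>' k) t \<omega>"
    by metis
  have Vp: "progressive_on T (step_val T (n k) (\<zeta> k))" "progressive_on T (step_val T (n' k) (\<zeta>' k))" for k
    by (intro step_val_progressive T0 X'(4) Y'(4))+
  have "energy T (\<lambda>s \<omega>. H s \<omega> - K s \<omega>) \<le> 2 * energy T (\<lambda>s \<omega>. H s \<omega> - 0) + 2 * energy T (\<lambda>s \<omega>. 0 - K s \<omega>)"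
    by (rule energy_triangle[OF X'(1) progressive_on_zero Y'(1) TT])
  also have "\<dots> < \<infinity>" unfolding energy_commute[of T "\<lambda>s \<omega>. 0"] using X'(2) Y'(2) by (simp add: ennreal_mult_less_top)
  finally have fin: "energy T (\<lambda>s \<omega>. H s \<omega> - K s \<omega>) < \<infinity>" .
  have lim1: "(\<lambda>k. energy T (\<lambda>s \<omega>. step_val T (N k) (\<xi> k) s \<omega> - (H s \<omega> - K s \<omega>))) \<longlonglongrightarrow> 0"
  proof (rule tendsto_sandwich[OF _ _ tendsto_const])
    show "\<forall>\<^sub>F k in sequentially. energy T (\<lambda>s \<omega>. step_val T (N k) (\<xi> k) s \<omega> - (H s \<omega> - K s \<omega>)) \<le>
        2 * energy T (\<lambda>s \<omega>. step_val T (n k) (\<zeta> k) s \<omega> - H s \<omega>) + 2 * energy T (\<lambda>s \<omega>. step_val T (n' k) (\<zeta>' k) s \<omega> - K s \<omega>)"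
    proof (intro always_eventually allI)
      fix k
      have "energy T (\<lambda>s \<omega>. (step_val T (n k) (\<zeta> k) s \<omega> - step_val T (n' k) (\<zeta>' k) s \<omega>) - (H s \<omega> - K s \<omega>)) \<le>
        2 * energy T (\<lambda>s \<omega>. (step_val T (n k) (\<zeta> k) s \<omega> - step_val T (n' k) (\<zeta>' k) s \<omega>) - (H s \<omega> - step_val T (n' k) (\<zeta>' k) s \<omega>))
        + 2 * energy T (\<lambda>s \<omega>. (H s \<omega> - step_val T (n' k) (\<zeta>' k) s \<omega>) - (H s \<omega> - K s \<omega>))"
        by (intro energy_triangle[OF _ _ _ TT] progressive_on_diff Vp X'(1) Y'(1))
      also have "(\<lambda>s \<omega>. (step_val T (n k) (\<zeta> k) s \<omega> - step_val T (n' k) (\<zeta>' k) s \<omega>) - (H s \<omega> - step_val T (n' k) (\<zeta>' k) s \<omega>))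
        = (\<lambda>s \<omega>. step_val T (n k) (\<zeta> k) s \<omega> - H s \<omega>)" by simp
      also have "(\<lambda>s \<omega>. (H s \<omega> - step_val T (n' k) (\<zeta>' k) s \<omega>) - (H s \<omega> - K s \<omega>))
        = (\<lambda>s \<omega>. K s \<omega> - step_val T (n' k) (\<zeta>' k) s \<omega>)" by simp
      finally show "energy T (\<lambda>s \<omega>. step_val T (N k) (\<xi> k) s \<omega> - (H s \<omega> - K s \<omega>)) \<le>
        2 * energy T (\<lambda>s \<omega>. step_val T (n k) (\<zeta> k) s \<omega> - H s \<omega>) + 2 * energy T (\<lambda>s \<omega>. step_val T (n' k) (\<zeta>' k) s \<omega> - K s \<omega>)"
        unfolding N(2) energy_commute[of T K] .
    qed
    have "(\<lambda>k. 2 * energy T (\<lambda>s \<omega>. step_val T (n k) (\<zeta> k) s \<omega> - H s \<omega>) + 2 * energy T (\<lambda>s \<omega>. step_val T (n' k) (\<zeta>' k) s \<omega> - K s \<omega>))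
        \<longlonglongrightarrow> 0 + 0"
      by (intro tendsto_add ennreal_tendsto_mult_0 X'(5) Y'(5)) auto
    then show "(\<lambda>k. 2 * energy T (\<lambda>s \<omega>. step_val T (n k) (\<zeta> k) s \<omega> - H s \<omega>) + 2 * energy T (\<lambda>s \<omega>. step_val T (n' k) (\<zeta>' k) s \<omega> - K s \<omega>))
        \<longlonglongrightarrow> 0" by simp
  qed auto
  have lim2: "(\<lambda>k. \<integral>\<^sup>+\<omega>. ennreal ((norm (ito_sum T (N k) (\<xi> k) t \<omega> - (X t \<omega> - Y t \<omega>)))\<^sup>2) \<partial>M) \<longlonglongrightarrow> 0"
    if t: "t \<in> {0..T}" for t
  proof (rule tendsto_sandwich[OF _ _ tendsto_const])
    let ?S = "\<lambda>k. ito_sum T (n k) (\<zeta> k) t" and ?S' = "\<lambda>k. ito_sum T (n' k) (\<zeta>' k) t"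
    have m: "?S k \<in> borel_measurable M" "?S' k \<in> borel_measurable M" "X t \<in> borel_measurable M" "Y t \<in> borel_measurable M" for k
      using L2_martingaleD(2)[OF ito_sum_L2_martingale[OF T0 X'(4)] t] L2_martingaleD(2)[OF ito_sum_L2_martingale[OF T0 Y'(4)] t]
        L2_martingaleD(2)[OF X'(3) t] L2_martingaleD(2)[OF Y'(3) t] by auto
    show "\<forall>\<^sub>F k in sequentially. (\<integral>\<^sup>+\<omega>. ennreal ((norm (ito_sum T (N k) (\<xi> k) t \<omega> - (X t \<omega> - Y t \<omega>)))\<^sup>2) \<partial>M) \<le>
        2 * (\<integral>\<^sup>+\<omega>. ennreal ((norm (?S k \<omega> - X t \<omega>))\<^sup>2) \<partial>M) + 2 * (\<integral>\<^sup>+\<omega>. ennreal ((norm (?S' k \<omega> - Y t \<omega>))\<^sup>2) \<partial>M)"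
    proof (intro always_eventually allI)
      fix k
      have "(\<integral>\<^sup>+\<omega>. ennreal ((norm ((?S k \<omega> - X t \<omega>) + - (?S' k \<omega> - Y t \<omega>)))\<^sup>2) \<partial>M) \<le>
          2 * (\<integral>\<^sup>+\<omega>. ennreal ((norm (?S k \<omega> - X t \<omega>))\<^sup>2) \<partial>M) + 2 * (\<integral>\<^sup>+\<omega>. ennreal ((norm (- (?S' k \<omega> - Y t \<omega>)))\<^sup>2) \<partial>M)"
        by (intro nn_integral_sq_add_le borel_measurable_uminus borel_measurable_diff m)
      moreover have "(?S k \<omega> - X t \<omega>) + - (?S' k \<omega> - Y t \<omega>) = ito_sum T (N k) (\<xi> k) t \<omega> - (X t \<omega> - Y t \<omega>)" for \<omega>
        by (simp add: N(3))
      ultimately show "(\<integral>\<^sup>+\<omega>. ennreal ((norm (ito_sum T (N k) (\<xi> k) t \<omega> - (X t \<omega> - Y t \<omega>)))\<^sup>2) \<partial>M) \<le>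
        2 * (\<integral>\<^sup>+\<omega>. ennreal ((norm (?S k \<omega> - X t \<omega>))\<^sup>2) \<partial>M) + 2 * (\<integral>\<^sup>+\<omega>. ennreal ((norm (?S' k \<omega> - Y t \<omega>))\<^sup>2) \<partial>M)"
        by (simp only: norm_minus_cancel)
    qed
    have "(\<lambda>k. 2 * (\<integral>\<^sup>+\<omega>. ennreal ((norm (?S k \<omega> - X t \<omega>))\<^sup>2) \<partial>M) + 2 * (\<integral>\<^sup>+\<omega>. ennreal ((norm (?S' k \<omega> - Y t \<omega>))\<^sup>2) \<partial>M)) \<longlonglongrightarrow> 0 + 0"
      by (intro tendsto_add ennreal_tendsto_mult_0 X'(6)[OF t] Y'(6)[OF t]) auto
    then show "(\<lambda>k. 2 * (\<integral>\<^sup>+\<omega>. ennreal ((norm (?S k \<omega> - X t \<omega>))\<^sup>2) \<partial>M) + 2 * (\<integral>\<^sup>+\<omega>. ennreal ((norm (?S' k \<omega> - Y t \<omega>))\<^sup>2) \<partial>M)) \<longlonglongrightarrow> 0"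
      by simp
  qed auto
  show ?thesis unfolding ito_def
    using progressive_on_diff[OF X'(1) Y'(1)] fin L2_martingale_diff[OF X'(3) Y'(3)] N(1) lim1 lim2 by blast
qed

text \<open>The isometry of step integrals passes to the limit as an inequality, the direction in
  which all later estimates run.\<close>

lemma ito_isometry:
  assumes T: "0 < T" and X: "ito T H X" and t: "t \<in> {0..T}"
  shows "(\<integral>\<^sup>+\<omega>. ennreal ((norm (X t \<omega>))\<^sup>2) \<partial>M) \<le> energy t H"
proof -
  have T0: "0 \<le> T" using T by simp
  obtain n \<zeta> where X': "progressive_on T H" "energy T H < \<infinity>" "L2_martingale T X"
    "\<And>k. step_coeffs T (n k) (\<zeta> k)"
    "(\<lambda>k. energy T (\<lambda>s \<omega>. step_val T (n k) (\<zeta> k) s \<omega> - H s \<omega>)) \<longlonglongrightarrow> 0"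
    "\<And>t. t \<in> {0..T} \<Longrightarrow> (\<lambda>k. \<integral>\<^sup>+\<omega>. ennreal ((norm (ito_sum T (n k) (\<zeta> k) t \<omega> - X t \<omega>))\<^sup>2) \<partial>M) \<longlonglongrightarrow> 0"
    using itoE[OF X] by blast
  have "(\<lambda>k. energy t (\<lambda>s \<omega>. step_val T (n k) (\<zeta> k) s \<omega> - H s \<omega>)) \<longlonglongrightarrow> 0"
    by (rule tendsto_sandwich[OF _ _ tendsto_const X'(5)]) (use t in \<open>auto intro!: always_eventually energy_mono_time\<close>)
  then have lim: "(\<lambda>k. \<integral>\<^sup>+x. ennreal ((norm (cut t (step_val T (n k) (\<zeta> k)) x - cut t H x))\<^sup>2) \<partial>(lborel \<Otimes>\<^sub>M M)) \<longlonglongrightarrow> 0"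
    by (simp only: energy_def cut_diff)
  show ?thesis unfolding energy_def
  proof (rule nn_integral_sq_limit_le[OF _ _ _ _ _ lim X'(6)[OF t]])
    show "cut t H \<in> borel_measurable (lborel \<Otimes>\<^sub>M M)" by (rule cut_measurable[OF X'(1) t])
    show "cut t (step_val T (n k) (\<zeta> k)) \<in> borel_measurable (lborel \<Otimes>\<^sub>M M)" for k
      by (rule cut_measurable[OF step_val_progressive[OF T0 X'(4)] t])
    show "X t \<in> borel_measurable M" by (rule L2_martingaleD(2)[OF X'(3) t])
    show "ito_sum T (n k) (\<zeta> k) t \<in> borel_measurable M" for k
      by (rule L2_martingaleD(2)[OF ito_sum_L2_martingale[OF T0 X'(4)] t])
    show "(\<integral>\<^sup>+\<omega>. ennreal ((norm (ito_sum T (n k) (\<zeta> k) t \<omega>))\<^sup>2) \<partial>M) \<le>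
        (\<integral>\<^sup>+x. ennreal ((norm (cut t (step_val T (n k) (\<zeta> k)) x))\<^sup>2) \<partial>(lborel \<Otimes>\<^sub>M M))" for k
      using ito_sum_isometry[OF T0 X'(4)[of k] t] by (simp add: energy_def)
  qed
qed

lemma ito_maximal:
  assumes T: "0 < T" and X: "ito T H X"
  shows "(\<integral>\<^sup>+\<omega>. (SUP t\<in>{0..T}. ennreal ((norm (X t \<omega>))\<^sup>2)) \<partial>M) \<le> 4 * energy T H"
proof -
  have "(\<integral>\<^sup>+\<omega>. (SUP t\<in>{0..T}. ennreal ((norm (X t \<omega>))\<^sup>2)) \<partial>M) \<le> 4 * (\<integral>\<^sup>+\<omega>. ennreal ((norm (X T \<omega>))\<^sup>2) \<partial>M)"
    using doob_maximal[OF itoD(3)[OF X]] T by simp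
  also have "\<dots> \<le> 4 * energy T H" using ito_isometry[OF T X, of T] T by (intro mult_left_mono) auto
  finally show ?thesis .
qed

lemma ito_zero: "ito T (\<lambda>s \<omega>. 0) (\<lambda>t \<omega>. 0)"
  unfolding ito_def
proof (intro conjI exI[of _ "\<lambda>_. 0"] exI[of _ "\<lambda>_ _ _. 0"] allI ballI)
  show "step_coeffs T 0 (\<lambda>i \<omega>. 0)"
    unfolding step_coeffs_def by (intro allI impI conjI exI[of _ 0]) auto
qed (auto simp: progressive_on_zero energy_zero L2_martingale_zero step_val_def ito_sum_def ito_step_def)

lemma ito_sum_family:
  assumes T: "0 < T" and "finite J" "\<And>j. j \<in> J \<Longrightarrow> ito T (H j) (X j)"
  shows "ito T (\<lambda>s \<omega>. \<Sum>j\<in>J. H j s \<omega>) (\<lambda>t \<omega>. \<Sum>j\<in>J. X j t \<omega>)"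
  using assms(2,3)
proof (induction J rule: finite_induct)
  case empty
  then show ?case using ito_zero by simp
next
  case (insert j J)
  have "ito T (\<lambda>s \<omega>. H j s \<omega> - (0 - (\<Sum>j\<in>J. H j s \<omega>))) (\<lambda>t \<omega>. X j t \<omega> - (0 - (\<Sum>j\<in>J. X j t \<omega>)))"
    by (intro ito_diff[OF T] ito_zero insert) auto
  then show ?case using insert.hyps by simp
qed

text \<open>The difference of two integrals of \<open>H\<close> is an integral of a process with
  energy 0.\<close>

lemma ito_unique:
  assumes T: "0 < T" and X: "ito T H X" and Y: "ito T H Y" and t: "t \<in> {0..T}"
  shows "AE \<omega> in M. X t \<omega> = Y t \<omega>"
proof -
  have "(\<integral>\<^sup>+\<omega>. ennreal ((norm (X t \<omega> - Y t \<omega>))\<^sup>2) \<partial>M) \<le> energy t (\<lambda>s \<omega>. H s \<omega> - H s \<omega>)"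
    by (rule ito_isometry[OF T ito_diff[OF T X Y] t])
  then have "(\<integral>\<^sup>+\<omega>. ennreal ((norm (X t \<omega> - Y t \<omega>))\<^sup>2) \<partial>M) = 0" by (simp add: energy_zero)
  moreover have "(\<lambda>\<omega>. ennreal ((norm (X t \<omega> - Y t \<omega>))\<^sup>2)) \<in> borel_measurable M"
    using L2_martingaleD(2)[OF itoD(3)[OF X] t] L2_martingaleD(2)[OF itoD(3)[OF Y] t] by measurable
  ultimately have "AE \<omega> in M. ennreal ((norm (X t \<omega> - Y t \<omega>))\<^sup>2) = 0" by (simp add: nn_integral_0_iff_AE)
  then show ?thesis by eventually_elim simp
qed

section \<open>Scalar and matrix integrals\<close>

lemma norm_axis_real: "norm (axis j x :: real ^ 'm) = \<bar>x\<bar>"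
  by (simp add: norm_eq_sqrt_inner inner_axis_axis)

text \<open>Projecting \<open>v\<close> to coordinate \<open>j\<close> removes exactly the entries
  in which every vector on that axis is 0; the removed part is thus no larger than the distance from
  \<open>v\<close> to any point of the axis.\<close>

lemma norm_axis_component_le: "norm (axis j (v $ j) - v) \<le> norm (v - axis j c)" for v :: "real ^ 'm"
  by (rule norm_le_componentwise_cart) (simp add: axis_def)

text \<open>This connects the vector integral with the scalar one of
  \<open>has_ito_integral\<close>. The approximations of \<open>axis j (h s \<omega>)\<close> may
  have entries off the axis. These are removed at a cost bounded by the approximation error, after
  which only coordinate \<open>j\<close> of the noise is left.\<close>

lemma ito_component:
  assumes T: "0 < T" and X: "ito T (\<lambda>s \<omega>. axis j (h s \<omega>)) X" and t: "t \<in> {0..T}"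
    and w: "\<And>t. 0 \<le> t \<Longrightarrow> w t \<in> borel_measurable M" "AE \<omega> in M. \<forall>t. w t \<omega> = B t \<omega> $ j"
  shows "has_ito_integral M F w h t (X t)"
proof -
  have T0: "0 \<le> T" and t0: "0 \<le> t" using T t by auto
  have fm: "finite_measure M" by unfold_locales
  obtain n \<zeta> where X': "progressive_on T (\<lambda>s \<omega>. axis j (h s \<omega>))" "energy T (\<lambda>s \<omega>. axis j (h s \<omega>)) < \<infinity>"
    "L2_martingale T X" "\<And>k. step_coeffs T (n k) (\<zeta> k)"
    "(\<lambda>k. energy T (\<lambda>s \<omega>. step_val T (n k) (\<zeta> k) s \<omega> - axis j (h s \<omega>))) \<longlonglongrightarrow> 0"
    "\<And>t. t \<in> {0..T} \<Longrightarrow> (\<lambda>k. \<integral>\<^sup>+\<omega>. ennreal ((norm (ito_sum T (n k) (\<zeta> k) t \<omega> - X t \<omega>))\<^sup>2) \<partial>M) \<longlonglongrightarrow> 0"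
    using itoE[OF X] by blast
  have nth: "continuous_on UNIV (\<lambda>x::real ^ 'm. x $ j)" by (intro continuous_intros)
  have hp: "progressive_on T h"
    using progressive_on_continuous1[OF X'(1) nth] by simp
  have hpt: "progressive F t h"
    unfolding progressive_def case_prod_beta' using hp t by (auto simp: progressive_on_def)
  have "energy t h \<le> energy T (\<lambda>s \<omega>. axis j (h s \<omega>))"
    using order_trans[OF energy_mono[of t h "\<lambda>s \<omega>. axis j (h s \<omega>)"] energy_mono_time[OF t0]] t
    by (simp add: norm_axis_real)
  then have "(\<integral>\<^sup>+\<omega>. (\<integral>\<^sup>+s\<in>{0..t}. ennreal ((norm (h s \<omega>))\<^sup>2) \<partial>lborel) \<partial>M) < \<infinity>"
    using X'(2) unfolding energy_paths[OF hp t] by (rule order.strict_trans1)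
  then have "AE \<omega> in M. (\<integral>\<^sup>+s\<in>{0..t}. ennreal ((norm (h s \<omega>))\<^sup>2) \<partial>lborel) \<noteq> \<infinity>"
    by (intro nn_integral_PInf_AE energy_path_measurable[OF hp t]) simp
  then have fin: "AE \<omega> in M. (\<integral>\<^sup>+s\<in>{0..t}. ennreal ((h s \<omega>)\<^sup>2) \<partial>lborel) < \<infinity>"
    by eventually_elim (simp add: less_top)
  define \<tau> where "\<tau> k i = dyadic T (n k) i" for k i
  define z where "z k i \<omega> = \<zeta> k i \<omega> $ j" for k i \<omega>
  define V where "V k = step_val T (n k) (\<zeta> k)" for k
  have Vp: "progressive_on T (V k)" for k unfolding V_def by (rule step_val_progressive[OF T0 X'(4)])
  have simple: "simple_process M F (2 ^ n k) (\<tau> k) (z k)" for k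
    unfolding simple_process_def
  proof (intro conjI allI impI)
    show "0 \<le> \<tau> k 0" by (simp add: \<tau>_def)
    show "\<tau> k i \<le> \<tau> k (Suc i)" for i unfolding \<tau>_def by (intro dyadic_mono T0) simp
    fix i :: nat assume i: "i < 2 ^ n k"
    obtain c where c: "\<zeta> k i \<in> borel_measurable (F (dyadic T (n k) i))" "\<And>\<omega>. \<omega> \<in> space M \<Longrightarrow> norm (\<zeta> k i \<omega>) \<le> c"
      using step_coeffsD[OF X'(4) i] by blast
    show "z k i \<in> borel_measurable (F (\<tau> k i))"
      unfolding z_def[abs_def] \<tau>_def by (rule borel_measurable_nth[OF c(1)])
    have "\<bar>z k i \<omega>\<bar> \<le> c" if "\<omega> \<in> space M" for \<omega>
      unfolding z_def using component_le_norm_cart[of "\<zeta> k i \<omega>" j] c(2)[OF that] by linarith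
    then show "bounded (z k i ` space M)" unfolding bounded_iff by auto
  qed
  have val: "simple_value (2 ^ n k) (\<tau> k) (z k) s \<omega> = V k s \<omega> $ j" for k s \<omega>
    by (simp add: simple_value_def V_def step_val_def z_def \<tau>_def mult.commute)
  have p1: "progressive_on T (\<lambda>s \<omega>. V k s \<omega> $ j - h s \<omega>)" for k
    by (intro progressive_on_diff progressive_on_continuous1[OF Vp nth] hp)
  have null1: "null_in_prob M (\<lambda>k \<omega>. \<integral>\<^sup>+s\<in>{0..t}.
          ennreal ((simple_value (2 ^ n k) (\<tau> k) (z k) s \<omega> - h s \<omega>)\<^sup>2) \<partial>lborel)"
  proof (rule null_in_prob_nn_integral[OF fm])
    show "(\<lambda>\<omega>. \<integral>\<^sup>+s\<in>{0..t}. ennreal ((simple_value (2 ^ n k) (\<tau> k) (z k) s \<omega> - h s \<omega>)\<^sup>2) \<partial>lborel) \<in> borel_measurable M" for k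
      using energy_path_measurable[OF p1[of k] t] by (simp add: val)
    have le: "(\<integral>\<^sup>+\<omega>. (\<integral>\<^sup>+s\<in>{0..t}. ennreal ((simple_value (2 ^ n k) (\<tau> k) (z k) s \<omega> - h s \<omega>)\<^sup>2) \<partial>lborel) \<partial>M)
        \<le> energy T (\<lambda>s \<omega>. V k s \<omega> - axis j (h s \<omega>))" for k
    proof -
      have "(\<integral>\<^sup>+\<omega>. (\<integral>\<^sup>+s\<in>{0..t}. ennreal ((simple_value (2 ^ n k) (\<tau> k) (z k) s \<omega> - h s \<omega>)\<^sup>2) \<partial>lborel) \<partial>M) =
          energy t (\<lambda>s \<omega>. V k s \<omega> $ j - h s \<omega>)"
        unfolding energy_paths[OF p1[of k] t] by (simp add: val)
      also have "\<dots> \<le> energy t (\<lambda>s \<omega>. V k s \<omega> - axis j (h s \<omega>))"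
      proof (rule energy_mono)
        fix s \<omega>
        show "norm (V k s \<omega> $ j - h s \<omega>) \<le> norm (V k s \<omega> - axis j (h s \<omega>))"
          using component_le_norm_cart[of "V k s \<omega> - axis j (h s \<omega>)" j] by simp
      qed
      also have "\<dots> \<le> energy T (\<lambda>s \<omega>. V k s \<omega> - axis j (h s \<omega>))" using t by (intro energy_mono_time) auto
      finally show ?thesis .
    qed
    show "(\<lambda>k. \<integral>\<^sup>+\<omega>. (\<integral>\<^sup>+s\<in>{0..t}. ennreal ((simple_value (2 ^ n k) (\<tau> k) (z k) s \<omega> - h s \<omega>)\<^sup>2) \<partial>lborel) \<partial>M) \<longlonglongrightarrow> 0"
      by (rule tendsto_sandwich[OF _ _ tendsto_const X'(5)]) (use le in \<open>auto simp: V_def intro: always_eventually\<close>)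
  qed
  \<comment> \<open>The step process stripped to coordinate \<open>j\<close>. Its integral is the
    simple integral against \<open>w\<close>, up to the null event on which \<open>w\<close> and
    coordinate \<open>j\<close> of \<open>B\<close> differ.\<close>
  define \<zeta>' where "\<zeta>' k i \<omega> = axis j (\<zeta> k i \<omega> $ j)" for k i \<omega>
  have coeffs': "step_coeffs T (n k) (\<zeta>' k)" for k
    unfolding step_coeffs_def
  proof (intro allI impI)
    fix i :: nat assume i: "i < 2 ^ n k"
    obtain c where c: "\<zeta> k i \<in> borel_measurable (F (dyadic T (n k) i))" "\<And>\<omega>. \<omega> \<in> space M \<Longrightarrow> norm (\<zeta> k i \<omega>) \<le> c"
      using step_coeffsD[OF X'(4) i] by blast
    have "(\<lambda>\<omega>. axis j (\<zeta> k i \<omega> $ j) $ l) \<in> borel_measurable (F (dyadic T (n k) i))" for l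
      using borel_measurable_nth[OF c(1), of j] by (cases "l = j") (simp_all add: axis_def)
    then have "\<zeta>' k i \<in> borel_measurable (F (dyadic T (n k) i))"
      unfolding \<zeta>'_def[abs_def] by (subst borel_measurable_nth_iff) blast
    moreover have "norm (\<zeta>' k i \<omega>) \<le> c" if "\<omega> \<in> space M" for \<omega>
      unfolding \<zeta>'_def using component_le_norm_cart[of "\<zeta> k i \<omega>" j] c(2)[OF that] by (simp add: norm_axis_real)
    ultimately show "\<zeta>' k i \<in> borel_measurable (F (dyadic T (n k) i)) \<and> (\<exists>c. \<forall>\<omega>\<in>space M. norm (\<zeta>' k i \<omega>) \<le> c)"
      by blast
  qed
  define S S' where "S k = ito_sum T (n k) (\<zeta> k) t" and "S' k = ito_sum T (n k) (\<zeta>' k) t" for k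
  have Sm: "S k \<in> borel_measurable M" "S' k \<in> borel_measurable M" for k
    unfolding S_def S'_def
    using L2_martingaleD(2)[OF ito_sum_L2_martingale[OF T0 X'(4)] t] L2_martingaleD(2)[OF ito_sum_L2_martingale[OF T0 coeffs'] t]
    by auto
  have Xm: "X t \<in> borel_measurable M" by (rule L2_martingaleD(2)[OF X'(3) t])
  have SS': "(\<integral>\<^sup>+\<omega>. ennreal ((norm (S' k \<omega> - S k \<omega>))\<^sup>2) \<partial>M) \<le> energy T (\<lambda>s \<omega>. V k s \<omega> - axis j (h s \<omega>))" for k
  proof -
    have "(\<integral>\<^sup>+\<omega>. ennreal ((norm (S' k \<omega> - S k \<omega>))\<^sup>2) \<partial>M) =
        energy t (step_val T (n k) (\<lambda>i \<omega>. \<zeta>' k i \<omega> - \<zeta> k i \<omega>))"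
      using ito_sum_isometry[OF T0 step_coeffs_diff[OF coeffs'[of k] X'(4)[of k]] t] by (simp add: ito_sum_diff S_def S'_def)
    also have "step_val T (n k) (\<lambda>i \<omega>. \<zeta>' k i \<omega> - \<zeta> k i \<omega>) = (\<lambda>s \<omega>. axis j (V k s \<omega> $ j) - V k s \<omega>)"
    proof (intro ext)
      fix s \<omega>
      have "step_val T (n k) (\<zeta>' k) s \<omega> = axis j (V k s \<omega> $ j)"
        by (simp add: step_val_def \<zeta>'_def V_def vec_eq_iff axis_def)
      then show "step_val T (n k) (\<lambda>i \<omega>. \<zeta>' k i \<omega> - \<zeta> k i \<omega>) s \<omega> = axis j (V k s \<omega> $ j) - V k s \<omega>"
        by (simp add: step_val_diff V_def)
    qed
    also have "energy t \<dots> \<le> energy t (\<lambda>s \<omega>. V k s \<omega> - axis j (h s \<omega>))"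
      by (intro energy_mono norm_axis_component_le)
    also have "\<dots> \<le> energy T (\<lambda>s \<omega>. V k s \<omega> - axis j (h s \<omega>))" using t by (intro energy_mono_time) auto
    finally show ?thesis .
  qed
  have limS': "(\<lambda>k. \<integral>\<^sup>+\<omega>. ennreal ((norm (S' k \<omega> - X t \<omega>))\<^sup>2) \<partial>M) \<longlonglongrightarrow> 0"
  proof (rule tendsto_sandwich[OF _ _ tendsto_const])
    show "\<forall>\<^sub>F k in sequentially. (\<integral>\<^sup>+\<omega>. ennreal ((norm (S' k \<omega> - X t \<omega>))\<^sup>2) \<partial>M) \<le>
        2 * energy T (\<lambda>s \<omega>. V k s \<omega> - axis j (h s \<omega>)) + 2 * (\<integral>\<^sup>+\<omega>. ennreal ((norm (S k \<omega> - X t \<omega>))\<^sup>2) \<partial>M)"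
    proof (intro always_eventually allI)
      fix k
      have "(\<integral>\<^sup>+\<omega>. ennreal ((norm (S' k \<omega> - X t \<omega>))\<^sup>2) \<partial>M) \<le>
        2 * (\<integral>\<^sup>+\<omega>. ennreal ((norm (S' k \<omega> - S k \<omega>))\<^sup>2) \<partial>M) + 2 * (\<integral>\<^sup>+\<omega>. ennreal ((norm (S k \<omega> - X t \<omega>))\<^sup>2) \<partial>M)"
        by (intro nn_integral_sq_diff_le Sm Xm)
      also have "\<dots> \<le> 2 * energy T (\<lambda>s \<omega>. V k s \<omega> - axis j (h s \<omega>)) + 2 * (\<integral>\<^sup>+\<omega>. ennreal ((norm (S k \<omega> - X t \<omega>))\<^sup>2) \<partial>M)"
        by (intro add_right_mono mult_left_mono SS') simp
      finally show "(\<integral>\<^sup>+\<omega>. ennreal ((norm (S' k \<omega> - X t \<omega>))\<^sup>2) \<partial>M) \<le>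
        2 * energy T (\<lambda>s \<omega>. V k s \<omega> - axis j (h s \<omega>)) + 2 * (\<integral>\<^sup>+\<omega>. ennreal ((norm (S k \<omega> - X t \<omega>))\<^sup>2) \<partial>M)" .
    qed
    have "(\<lambda>k. 2 * energy T (\<lambda>s \<omega>. V k s \<omega> - axis j (h s \<omega>)) + 2 * (\<integral>\<^sup>+\<omega>. ennreal ((norm (S k \<omega> - X t \<omega>))\<^sup>2) \<partial>M)) \<longlonglongrightarrow> 0 + 0"
      unfolding V_def S_def by (intro tendsto_add ennreal_tendsto_mult_0 X'(5) X'(6)[OF t]) auto
    then show "(\<lambda>k. 2 * energy T (\<lambda>s \<omega>. V k s \<omega> - axis j (h s \<omega>)) + 2 * (\<integral>\<^sup>+\<omega>. ennreal ((norm (S k \<omega> - X t \<omega>))\<^sup>2) \<partial>M)) \<longlonglongrightarrow> 0"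
      by simp
  qed auto
  define I where "I k = simple_integral w (2 ^ n k) (\<tau> k) (z k) t" for k
  have IS: "AE \<omega> in M. I k \<omega> = S' k \<omega>" for k
    using w(2)
  proof eventually_elim
    case (elim \<omega>)
    have "axis j (\<zeta> k i \<omega> $ j) \<bullet> x = \<zeta> k i \<omega> $ j * x $ j" for i x
      by (simp add: inner_axis')
    then show ?case using elim
      by (simp add: I_def simple_integral_def S'_def ito_sum_def ito_step_def \<zeta>'_def z_def \<tau>_def)
  qed
  have Im: "I k \<in> borel_measurable M" for k
    unfolding I_def simple_integral_def[abs_def]
  proof (intro borel_measurable_sum borel_measurable_times borel_measurable_diff w(1))
    fix i :: nat assume "i \<in> {..<2 ^ n k}"
    then have i: "i < 2 ^ n k" by simp
    obtain c where c: "\<zeta> k i \<in> borel_measurable (F (dyadic T (n k) i))" using step_coeffsD[OF X'(4) i] by blast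
    show "z k i \<in> borel_measurable M"
      unfolding z_def[abs_def] by (rule borel_measurable_nth[OF measurable_F_M[OF c dyadic_nonneg[OF T0]]])
    show "0 \<le> min (\<tau> k (Suc i)) t" "0 \<le> min (\<tau> k i) t" using t0 T0 by (auto simp: \<tau>_def)
  qed
  have "(\<integral>\<^sup>+\<omega>. ennreal ((I k \<omega> - X t \<omega>)\<^sup>2) \<partial>M) = (\<integral>\<^sup>+\<omega>. ennreal ((norm (S' k \<omega> - X t \<omega>))\<^sup>2) \<partial>M)" for k
    by (rule nn_integral_cong_AE) (use IS[of k] in eventually_elim, simp)
  then have "(\<lambda>k. \<integral>\<^sup>+\<omega>. ennreal ((I k \<omega> - X t \<omega>)\<^sup>2) \<partial>M) \<longlonglongrightarrow> 0" using limS' by simp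
  then have null2: "null_in_prob M (\<lambda>k \<omega>. ennreal \<bar>I k \<omega> - X t \<omega>\<bar>)"
    by (intro null_in_prob_mean_square[OF fm] borel_measurable_diff Im Xm)
  show ?thesis unfolding has_ito_integral_def
  proof (intro conjI Xm exI[of _ h])
    show "\<exists>n \<tau> \<zeta>. (\<forall>k. simple_process M F (n k) (\<tau> k) (\<zeta> k)) \<and>
        null_in_prob M (\<lambda>k \<omega>. \<integral>\<^sup>+s\<in>{0..t}. ennreal ((simple_value (n k) (\<tau> k) (\<zeta> k) s \<omega> - h s \<omega>)\<^sup>2) \<partial>lborel) \<and>
        null_in_prob M (\<lambda>k \<omega>. ennreal \<bar>simple_integral w (n k) (\<tau> k) (\<zeta> k) t \<omega> - X t \<omega>\<bar>)"
      using simple null1 null2 unfolding I_def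
      by (intro exI[of _ "\<lambda>k. 2 ^ n k"] exI[of _ \<tau>] exI[of _ z] conjI allI)
  qed (use hpt fin in auto)
qed

text \<open>The definition wants a separate integral for each matrix entry, while the construction
  gives one integral per row. A row is the sum of its axis parts, so by uniqueness the entry
  integrals of a row add up to the row integral almost surely.\<close>

lemma matrix_ito:
  fixes H :: "'k::finite \<Rightarrow> real \<Rightarrow> 'w \<Rightarrow> real ^ 'm"
  assumes T: "0 < T" and X: "\<And>i. ito T (H i) (X i)" and t: "t \<in> {0..T}"
    and W: "\<And>t. 0 \<le> t \<Longrightarrow> W t \<in> borel_measurable M" "AE \<omega> in M. \<forall>t. B t \<omega> = W t \<omega>"
  shows "\<exists>I. has_matrix_ito_integral M F W (\<lambda>s \<omega>. \<chi> i. H i s \<omega>) t I \<and> (AE \<omega> in M. I \<omega> = (\<chi> i. X i t \<omega>))"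
proof -
  have "\<exists>Y. ito T (\<lambda>s \<omega>. axis j (H i s \<omega> $ j)) Y" for i j
  proof (rule ito_exists[OF T])
    have "continuous_on UNIV (\<lambda>x::real ^ 'm. axis j (x $ j) :: real ^ 'm)"
      unfolding axis_def
    proof (rule continuous_on_vec_lambda)
      fix i
      show "continuous_on UNIV (\<lambda>x::real ^ 'm. if i = j then x $ j else 0)"
        by (cases "i = j") (auto intro!: continuous_intros)
    qed
    then show "progressive_on T (\<lambda>s \<omega>. axis j (H i s \<omega> $ j))"
      by (rule progressive_on_continuous1[OF itoD(1)[OF X]])
    have "energy T (\<lambda>s \<omega>. axis j (H i s \<omega> $ j)) \<le> energy T (H i)"
      by (intro energy_mono) (simp add: norm_axis_real component_le_norm_cart)
    then show "energy T (\<lambda>s \<omega>. axis j (H i s \<omega> $ j)) < \<infinity>" using itoD(2)[OF X] by (rule order.strict_trans1)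
  qed
  then have "\<exists>Y. \<forall>j. ito T (\<lambda>s \<omega>. axis j (H i s \<omega> $ j)) (Y j)" for i by (intro choice allI)
  then have "\<exists>Y. \<forall>i j. ito T (\<lambda>s \<omega>. axis j (H i s \<omega> $ j)) (Y i j)"
    by (intro choice[where Q="\<lambda>i Y. \<forall>j. ito T (\<lambda>s \<omega>. axis j (H i s \<omega> $ j)) (Y j)", OF allI])
  then obtain Y where Y: "\<And>i j. ito T (\<lambda>s \<omega>. axis j (H i s \<omega> $ j)) (Y i j)" by blast
  have "ito T (\<lambda>s \<omega>. \<Sum>j\<in>UNIV. axis j (H i s \<omega> $ j)) (\<lambda>t \<omega>. \<Sum>j\<in>UNIV. Y i j t \<omega>)" for i
    by (rule ito_sum_family[OF T _ Y]) simp
  moreover have "(\<Sum>j\<in>UNIV. axis j (v $ j)) = v" for v :: "real ^ 'm"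
    by (simp add: vec_eq_iff axis_def)
  ultimately have "ito T (H i) (\<lambda>t \<omega>. \<Sum>j\<in>UNIV. Y i j t \<omega>)" for i by simp
  from ito_unique[OF T this X t] have "AE \<omega> in M. (\<Sum>j\<in>UNIV. Y i j t \<omega>) = X i t \<omega>" for i .
  then have "AE \<omega> in M. \<forall>i. (\<Sum>j\<in>UNIV. Y i j t \<omega>) = X i t \<omega>" by (intro AE_all_countable[THEN iffD2] allI)
  then have ae: "AE \<omega> in M. (\<chi> i. \<Sum>j\<in>UNIV. Y i j t \<omega>) = (\<chi> i. X i t \<omega>)" by eventually_elim simp
  have "has_ito_integral M F (\<lambda>s \<omega>. W s \<omega> $ j) (\<lambda>s \<omega>. (\<chi> i. H i s \<omega>) $ i $ j) t (Y i j t)" for i j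
  proof (rule ito_component[OF T _ t])
    show "ito T (\<lambda>s \<omega>. axis j ((\<chi> i. H i s \<omega>) $ i $ j)) (Y i j)" using Y by simp
    show "(\<lambda>\<omega>. W t \<omega> $ j) \<in> borel_measurable M" if "0 \<le> t" for t by (rule borel_measurable_nth[OF W(1)[OF that]])
    show "AE \<omega> in M. \<forall>t. W t \<omega> $ j = B t \<omega> $ j" using W(2) by eventually_elim simp
  qed
  then have "has_matrix_ito_integral M F W (\<lambda>s \<omega>. \<chi> i. H i s \<omega>) t (\<lambda>\<omega>. \<chi> i. \<Sum>j\<in>UNIV. Y i j t \<omega>)"
    unfolding has_matrix_ito_integral_def by (intro exI[of _ "\<lambda>i j. Y i j t"]) blast
  with ae show ?thesis by blast
qed

end

section \<open>Matrix estimates\<close>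

lemma norm_matrix_sq: "(norm A)\<^sup>2 = (\<Sum>i\<in>UNIV. (norm (A $ i))\<^sup>2)" for A :: "'a::real_inner ^ 'n"
  by (simp add: power2_norm_eq_inner inner_vec_def)

lemma norm_matrix_vector_le: "norm (A *v x) \<le> norm A * norm x" for A :: "real ^ 'n ^ 'm"
proof (rule power2_le_imp_le)
  have "(norm (A *v x))\<^sup>2 = (\<Sum>i\<in>UNIV. (A $ i \<bullet> x)\<^sup>2)"
    by (simp add: norm_matrix_sq matrix_vector_mul_component)
  also have "\<dots> \<le> (\<Sum>i\<in>UNIV. (norm (A $ i))\<^sup>2 * (norm x)\<^sup>2)"
  proof (rule sum_mono)
    fix i
    have "\<bar>A $ i \<bullet> x\<bar>\<^sup>2 \<le> (norm (A $ i) * norm x)\<^sup>2" by (intro power_mono Cauchy_Schwarz_ineq2) simp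
    then show "(A $ i \<bullet> x)\<^sup>2 \<le> (norm (A $ i))\<^sup>2 * (norm x)\<^sup>2" by (simp add: power_mult_distrib)
  qed
  also have "\<dots> = (norm A * norm x)\<^sup>2"
    by (simp add: norm_matrix_sq[of A] sum_distrib_right power_mult_distrib)
  finally show "(norm (A *v x))\<^sup>2 \<le> (norm A * norm x)\<^sup>2" .
qed simp

lemma norm_transpose: "norm (transpose A) = norm A" for A :: "real ^ 'n ^ 'm"
proof -
  have "(norm (transpose A))\<^sup>2 = (\<Sum>i\<in>UNIV. \<Sum>j\<in>UNIV. (A $ j $ i)\<^sup>2)"
    by (simp add: norm_matrix_sq transpose_def)
  also have "\<dots> = (norm A)\<^sup>2" by (subst sum.swap) (simp add: norm_matrix_sq)
  finally show ?thesis by simp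
qed

lemma matrix_mult_row: "(A ** B) $ i = transpose B *v (A $ i)" for A :: "real ^ 'n ^ 'm"
  by (simp add: matrix_matrix_mult_def matrix_vector_mult_def transpose_def vec_eq_iff mult.commute)

text \<open>Rows of \<open>A ** B\<close> are images of rows of \<open>A\<close> under
  \<open>transpose B\<close>. So an operator bound for one factor is enough, which is sharper than
  its Frobenius norm for the projection and for the inverse Gram matrix.\<close>

lemma norm_matrix_mult_right:
  fixes A :: "real ^ 'n ^ 'm" and B :: "real ^ 'p ^ 'n"
  assumes "\<And>x. norm (transpose B *v x) \<le> k * norm x" "k \<ge> 0"
  shows "norm (A ** B) \<le> k * norm A"
proof (rule power2_le_imp_le)
  have "(norm (A ** B))\<^sup>2 = (\<Sum>i\<in>UNIV. (norm (transpose B *v (A $ i)))\<^sup>2)"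
    by (simp only: norm_matrix_sq matrix_mult_row)
  also have "\<dots> \<le> (\<Sum>i\<in>UNIV. (k * norm (A $ i))\<^sup>2)" by (intro sum_mono power_mono assms) simp
  also have "\<dots> = (k * norm A)\<^sup>2"
    by (simp add: norm_matrix_sq[of A] sum_distrib_left power_mult_distrib)
  finally show "(norm (A ** B))\<^sup>2 \<le> (k * norm A)\<^sup>2" .
qed (use assms in simp)

lemma norm_matrix_mult_left:
  fixes A :: "real ^ 'n ^ 'm" and B :: "real ^ 'p ^ 'n"
  assumes "\<And>x. norm (A *v x) \<le> k * norm x" "k \<ge> 0"
  shows "norm (A ** B) \<le> k * norm B"
proof -
  have "norm (transpose B ** transpose A) \<le> k * norm (transpose B)"
    using assms by (intro norm_matrix_mult_right) (simp only: transpose_transpose)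
  then show ?thesis by (simp only: norm_transpose matrix_transpose_mul[symmetric])
qed

lemma norm_matrix_mult_le: "norm (A ** B) \<le> norm A * norm B"
  for A :: "real ^ 'n ^ 'm" and B :: "real ^ 'p ^ 'n"
  by (rule norm_matrix_mult_left[OF norm_matrix_vector_le]) simp

lemma matrix_mult_diff_left: "A ** B - A ** C = A ** (B - C)" for A :: "real ^ 'n ^ 'm"
  by (simp add: matrix_matrix_mult_def vec_eq_iff sum_subtractf right_diff_distrib)

lemma matrix_mult_diff_right: "A ** C - B ** C = (A - B) ** C" for A :: "real ^ 'n ^ 'm"
  by (simp add: matrix_matrix_mult_def vec_eq_iff sum_subtractf left_diff_distrib)

lemma transpose_diff: "transpose (A - B) = transpose A - transpose B" for A :: "real ^ 'n ^ 'm"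
  by (simp add: transpose_def vec_eq_iff)

lemma norm_outer_prod: "norm (outer_prod x y) = norm x * norm y"
proof -
  have "(norm (outer_prod x y))\<^sup>2 = (\<Sum>i\<in>UNIV. \<Sum>j\<in>UNIV. (x $ i)\<^sup>2 * (y $ j)\<^sup>2)"
    by (simp add: norm_matrix_sq outer_prod_def power_mult_distrib)
  also have "\<dots> = (\<Sum>i\<in>UNIV. (x $ i)\<^sup>2) * (\<Sum>j\<in>UNIV. (y $ j)\<^sup>2)" by (simp add: sum_product)
  also have "\<dots> = (norm x * norm y)\<^sup>2" by (simp add: norm_matrix_sq[of x] norm_matrix_sq[of y] power_mult_distrib)
  finally show ?thesis by simp
qed

lemma outer_prod_diff_left: "outer_prod (x - y) z = outer_prod x z - outer_prod y z"
  and outer_prod_diff_right: "outer_prod z (v - w) = outer_prod z v - outer_prod z w"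
  by (simp_all add: outer_prod_def vec_eq_iff algebra_simps)

lemma outer_prod_mult_vector: "outer_prod x y *v z = (y \<bullet> z) *\<^sub>R x"
  by (simp add: outer_prod_def matrix_vector_mult_def vec_eq_iff inner_vec_def sum_distrib_left mult_ac)

lemma continuous_matrix_ops:
  shows "continuous_on UNIV (\<lambda>x. outer_prod (fst x) (snd x) :: real ^ 'q ^ 'p)"
    and "continuous_on UNIV (\<lambda>x. fst x *v snd x :: real ^ 'p)"
    and "continuous_on UNIV (\<lambda>x. transpose (fst x) *v snd x :: real ^ 'p)"
    and "continuous_on UNIV (\<lambda>x. fst x ** snd x :: real ^ 'q ^ 'p)"
  unfolding outer_prod_def matrix_vector_mult_def matrix_matrix_mult_def transpose_def
  by (auto intro!: continuous_intros continuous_on_vec_lambda)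

lemma orthonormal_rows_iff: "orthonormal_rows U \<longleftrightarrow> U ** transpose U = mat 1"
  by (simp add: orthonormal_rows_def vec_eq_iff mat_def matrix_matrix_mult_def transpose_def row_def inner_vec_def)

lemma inner_transpose_mult: "x \<bullet> (transpose A *v y) = (A *v x) \<bullet> y" for A :: "real ^ 'n ^ 'm"
  using dot_lmul_matrix[of y A x] by (simp add: inner_commute)

text \<open>For orthonormal rows, \<open>transpose U ** U\<close> maps into the row span and leaves
  a residual orthogonal to it; by Pythagoras the image is the closest point.\<close>

lemma row_projection_orthonormal:
  fixes U :: "real ^ 'd ^ 'r"
  assumes U: "U ** transpose U = mat 1"
  shows "row_projection U = transpose U ** U"
proof -
  have "closest_point (span (rows U)) x = (transpose U ** U) *v x" for x
  proof (rule closest_point_unique[symmetric])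
    let ?y = "transpose U *v (U *v x)"
    show "convex (span (rows U))" by (intro subspace_imp_convex subspace_span)
    show "closed (span (rows U))" by (rule closed_span)
    have rng: "transpose U *v z \<in> span (rows U)" for z
    proof -
      have "transpose U *v z = (\<Sum>i\<in>UNIV. z $ i *s row i U)"
        unfolding matrix_mult_sum column_transpose by simp
      also have "\<dots> \<in> span (rows U)"
        unfolding scalar_mult_eq_scaleR
        by (intro span_sum span_mul span_base) (auto simp: rows_def)
      finally show ?thesis .
    qed
    show "(transpose U ** U) *v x \<in> span (rows U)"
      using rng by (simp add: matrix_vector_mul_assoc[symmetric])
    have "U *v ?y = (U ** transpose U) *v (U *v x)" by (simp only: matrix_vector_mul_assoc matrix_mul_assoc)
    then have Uy: "U *v (x - ?y) = 0" by (simp add: U matrix_vector_mult_diff_distrib)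
    have orth: "(x - ?y) \<bullet> z = 0" if "z \<in> span (rows U)" for z
      using that
    proof (rule span_induct)
      show "subspace {z. (x - ?y) \<bullet> z = 0}" by (rule subspace_hyperplane)
      fix z assume "z \<in> rows U"
      then obtain i where "z = row i U" by (auto simp: rows_def)
      then have "(x - ?y) \<bullet> z = (U *v (x - ?y)) $ i"
        by (simp add: matrix_vector_mul_component row_def inner_commute vec_nth_inverse)
      then show "(x - ?y) \<bullet> z = 0" using Uy by simp
    qed
    show "\<forall>z\<in>span (rows U). dist x ((transpose U ** U) *v x) \<le> dist x z"
    proof
      fix z assume z: "z \<in> span (rows U)"
      have "?y - z \<in> span (rows U)" using rng z by (intro span_diff)
      from orth[OF this] have o: "(x - ?y) \<bullet> (?y - z) = 0" .
      have "(norm (x - z))\<^sup>2 = (norm ((x - ?y) + (?y - z)))\<^sup>2" by simp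
      also have "\<dots> = (norm (x - ?y))\<^sup>2 + (norm (?y - z))\<^sup>2"
        using o by (intro norm_add_Pythagorean) (simp add: orthogonal_def)
      finally have "(norm (x - ?y))\<^sup>2 \<le> (norm (x - z))\<^sup>2" by simp
      then have "norm (x - ?y) \<le> norm (x - z)" by (rule power2_le_imp_le) simp
      then show "dist x ((transpose U ** U) *v x) \<le> dist x z"
        by (simp add: dist_norm matrix_vector_mul_assoc[symmetric])
    qed
  qed
  then have "closest_point (span (rows U)) = (*v) (transpose U ** U)" by (intro ext)
  then show ?thesis unfolding row_projection_def by (simp only: matrix_of_matrix_vector_mul)
qed

lemma
  fixes A :: "real ^ 'n ^ 'n"
  assumes "invertible A"
  shows matrix_inv_left: "matrix_inv A ** A = mat 1" and matrix_inv_right: "A ** matrix_inv A = mat 1"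
  using someI_ex[OF assms[unfolded invertible_def]] unfolding matrix_inv_def by blast+

text \<open>From \<open>norm y \<le> \<gamma> * norm (A *v y)\<close> and the closeness of
  \<open>B\<close> follows \<open>norm y \<le> \<gamma> * norm (B *v y) + norm y / 2\<close>.
  Absorbing the last term gives injectivity of \<open>B\<close> and the bound for its inverse at
  once.\<close>

lemma matrix_inverse_bound:
  fixes A B :: "real ^ 'n ^ 'n"
  assumes inv: "invertible A" and g: "norm (matrix_inv A) \<le> \<gamma>" "\<gamma> > 0" and close: "norm (B - A) \<le> 1 / (2 * \<gamma>)"
  shows "invertible B" and "norm (matrix_inv B *v x) \<le> 2 * \<gamma> * norm x"
proof -
  have low: "norm y \<le> 2 * \<gamma> * norm (B *v y)" for y
  proof -
    have "norm y = norm (matrix_inv A *v (A *v y))"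
      using matrix_inv_left[OF inv] by (simp add: matrix_vector_mul_assoc)
    also have "\<dots> \<le> \<gamma> * norm (A *v y)"
      using norm_matrix_vector_le[of "matrix_inv A" "A *v y"] mult_right_mono[OF g(1), of "norm (A *v y)"] by simp
    also have "norm (A *v y) \<le> norm (B *v y) + norm ((B - A) *v y)"
      using norm_triangle_ineq4[of "B *v y" "(B - A) *v y"] by (simp add: matrix_vector_mult_diff_rdistrib)
    also have "norm ((B - A) *v y) \<le> 1 / (2 * \<gamma>) * norm y"
      using norm_matrix_vector_le[of "B - A" y] mult_right_mono[OF close, of "norm y"] by simp
    finally have "norm y \<le> \<gamma> * (norm (B *v y) + 1 / (2 * \<gamma>) * norm y)"
      using g(2) by (simp add: mult_left_mono)
    then show ?thesis using g(2) by (simp add: field_simps)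
  qed
  have "inj ((*v) B)"
  proof (rule injI)
    fix x y assume "B *v x = B *v y"
    then have "B *v (x - y) = 0" by (simp add: matrix_vector_mult_diff_distrib)
    then show "x = y" using low[of "x - y"] by simp
  qed
  then obtain C where "C ** B = mat 1" using matrix_left_invertible_injective by blast
  then show B: "invertible B" using invertible_left_inverse by blast
  show "norm (matrix_inv B *v x) \<le> 2 * \<gamma> * norm x"
    using low[of "matrix_inv B *v x"] matrix_inv_right[OF B] by (simp add: matrix_vector_mul_assoc)
qed

text \<open>Cramer's rule expresses the entries of the inverse by determinants, which are polynomial.\<close>

lemma matrix_inv_measurable:
  fixes A :: "'a \<Rightarrow> real ^ 'n ^ 'n"
  assumes A: "A \<in> borel_measurable M" and inv: "\<And>x. x \<in> space M \<Longrightarrow> invertible (A x)"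
  shows "(\<lambda>x. matrix_inv (A x)) \<in> borel_measurable M"
proof -
  have entry: "(\<lambda>x. A x $ i $ j) \<in> borel_measurable M" for i j
    by (intro borel_measurable_nth A)
  have "(\<lambda>x. matrix_inv (A x) $ k $ l) \<in> borel_measurable M" for k l
  proof -
    have eq: "matrix_inv (A x) $ k $ l =
        det (\<chi> i j. if j = k then axis l 1 $ i else A x $ i $ j) / det (A x)" if "x \<in> space M" for x
    proof -
      \<comment> \<open>Column \<open>l\<close> of the inverse solves the linear system with
        right-hand side \<open>axis l 1\<close>; this is the system that Cramer's rule is used
        for.\<close>
      have "A x *v (matrix_inv (A x) *v axis l 1) = axis l 1"
        using matrix_inv_right[OF inv[OF that]] by (simp add: matrix_vector_mul_assoc)
      moreover have "det (A x) \<noteq> 0" using inv[OF that] invertible_det_nz by blast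
      ultimately have "(matrix_inv (A x) *v axis l 1) $ k =
        det (\<chi> i j. if j = k then axis l 1 $ i else A x $ i $ j) / det (A x)"
        using cramer[of "A x" "matrix_inv (A x) *v axis l 1" "axis l 1"] by simp
      then show ?thesis by (simp add: matrix_vector_mult_basis column_def)
    qed
    have "(\<lambda>x. det (\<chi> i j. if j = k then axis l 1 $ i else A x $ i $ j) / det (A x)) \<in> borel_measurable M"
      unfolding det_def using entry
      by (intro borel_measurable_divide borel_measurable_sum borel_measurable_times borel_measurable_prod borel_measurable_const)
        auto
    then show ?thesis by (subst measurable_cong[OF eq])
  qed
  then show ?thesis by (subst borel_measurable_nth_iff, subst borel_measurable_nth_iff) blast
qed

section \<open>A priori bounds\<close>

text \<open>The hypotheses of the theorem with the Brownian motion replaced by its continuous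
  version; \<open>R\<close> is the number of rows as a real number.\<close>

locale DO_setting = continuous_brownian_motion M F B
  for M :: "'w measure" and F and B :: "real \<Rightarrow> 'w \<Rightarrow> real ^ 'm" +
  fixes a :: "real \<Rightarrow> real ^ 'd \<Rightarrow> real ^ 'd"
    and b :: "real \<Rightarrow> real ^ 'd \<Rightarrow> real ^ 'm ^ 'd"
    and \<phi> :: "real ^ 'd ^ 'r" and \<xi> :: "'w \<Rightarrow> real ^ 'r"
    and L C \<rho> \<gamma> \<eta> \<delta> R :: real
  assumes R_eq: "R = real CARD('r)"
    and a_meas: "(\<lambda>(s, x). a s x) \<in> borel_measurable (restrict_space borel {0..} \<Otimes>\<^sub>M borel)"
    and b_meas: "(\<lambda>(s, x). b s x) \<in> borel_measurable (restrict_space borel {0..} \<Otimes>\<^sub>M borel)"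
    and L_pos: "L > 0"
    and a_Lip: "\<And>s x y. s \<ge> 0 \<Longrightarrow> norm (a s x - a s y) \<le> L * norm (x - y)"
    and b_Lip: "\<And>s x y. s \<ge> 0 \<Longrightarrow> norm (b s x - b s y) \<le> L * norm (x - y)"
    and C_pos: "C > 0"
    and lgb: "\<And>s x. s \<ge> 0 \<Longrightarrow> (norm (a s x))\<^sup>2 + (norm (b s x))\<^sup>2 \<le> C * (1 + (norm x)\<^sup>2)"
    and phi: "orthonormal_rows \<phi>"
    and xi_meas: "\<xi> \<in> borel_measurable (F 0)"
    and xi_L2: "in_L2 M \<xi>"
    and rho: "L2_norm M \<xi> = \<rho>" "\<rho> > 0"
    and gram_inv: "invertible (gram M \<xi>)"
    and gamma: "norm (matrix_inv (gram M \<xi>)) = \<gamma>" "\<gamma> > 0"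
    and eta: "\<eta> = DO_eta CARD('r) \<rho> \<gamma>"
    and delta: "\<delta> = DO_delta CARD('r) \<rho> \<gamma> C"
begin

text \<open>Bound for the second moments of the iterates; the value is the one that
  \<open>D_sto\<close> prescribes for the supremum.\<close>

definition m :: real where "m = 3 * \<rho>\<^sup>2 + 1"

text \<open>Bound for the joint second moment of \<open>a\<close> and \<open>b\<close> on the balls:
  \<open>3 * R\<close> bounds the squared norm of \<open>V\<close> and \<open>m\<close> the second
  moment of \<open>Z\<close>. It is the factor that recurs in the denominators of
  \<open>DO_delta\<close>.\<close>

definition \<Lambda> :: real where "\<Lambda> = C * (1 + 3 * R * m)"

lemma R_ge_1: "R \<ge> 1"
  using zero_less_card_finite[where 'a='r] unfolding R_eq by linarith

lemma m_ge_1: "m \<ge> 1" by (simp add: m_def)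

lemma Lambda_pos: "\<Lambda> > 0"
  unfolding \<Lambda>_def using C_pos R_ge_1 m_ge_1 by (intro mult_pos_pos) (auto intro: add_pos_nonneg)

text \<open>The definition solves a quadratic equation: adding \<open>p\<^sup>2\<close> completes
  the square on the left.\<close>

lemma eta_fun_props:
  assumes "p > 0" "q > 0"
  shows "eta_fun p q > 0" and "\<And>y. 0 \<le> y \<Longrightarrow> y \<le> eta_fun p q \<Longrightarrow> y\<^sup>2 + 2 * p * y \<le> 1 / (2 * q)"
proof -
  have "sqrt (p\<^sup>2) < sqrt (p\<^sup>2 + 1 / (2 * q))" using assms by (intro real_sqrt_less_mono) simp
  then show "eta_fun p q > 0" using assms by (simp add: eta_fun_def)
  fix y assume y: "0 \<le> y" "y \<le> eta_fun p q"
  then have "(y + p)\<^sup>2 \<le> (sqrt (p\<^sup>2 + 1 / (2 * q)))\<^sup>2"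
    using assms by (intro power_mono) (auto simp: eta_fun_def)
  also have "\<dots> = p\<^sup>2 + 1 / (2 * q)" using assms by (intro real_sqrt_pow2) auto
  finally show "y\<^sup>2 + 2 * p * y \<le> 1 / (2 * q)" by (simp add: power2_sum algebra_simps)
qed

text \<open>The first entry of the minimum gives \<open>2 * \<eta> \<le> 2 * sqrt R * \<eta> \<le> 1
  / (2 * sqrt R) \<le> 1 / 2\<close>; the second gives the tolerance for the Gram matrix.\<close>

lemma eta_props: "0 < \<eta>" "\<eta> \<le> 1 / 4" "\<eta>\<^sup>2 + 2 * \<rho> * \<eta> \<le> 1 / (2 * \<gamma>)"
proof -
  have sR: "sqrt R \<ge> 1" using R_ge_1 by simp
  note e1 = eta_fun_props[of "sqrt R" "sqrt R"] and e2 = eta_fun_props[OF rho(2) gamma(2)]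
  show pos: "0 < \<eta>" using e1(1) e2(1) sR by (simp add: eta DO_eta_def R_eq)
  have le: "\<eta> \<le> eta_fun (sqrt R) (sqrt R)" "\<eta> \<le> eta_fun \<rho> \<gamma>" by (simp_all add: eta DO_eta_def R_eq)
  show "\<eta>\<^sup>2 + 2 * \<rho> * \<eta> \<le> 1 / (2 * \<gamma>)" using e2(2)[of \<eta>] pos le by simp
  have "\<eta>\<^sup>2 + 2 * sqrt R * \<eta> \<le> 1 / (2 * sqrt R)" using e1(2)[of \<eta>] pos le sR by simp
  moreover have "1 / (2 * sqrt R) \<le> 1 / 2" using sR by (simp add: field_simps)
  moreover have "2 * \<eta> \<le> 2 * sqrt R * \<eta>" using sR pos by (simp add: mult_right_mono)
  moreover have "0 \<le> \<eta>\<^sup>2" by simp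
  ultimately show "\<eta> \<le> 1 / 4" by linarith
qed

text \<open>The quotients of the minimum with their denominators cleared. The first quotient serves
  the supremum bound and the ball around \<open>\<xi>\<close>, the second the ball around
  \<open>\<phi>\<close>.\<close>

lemma delta_props: "0 < \<delta>" "\<delta> \<le> 1" "\<delta> * (36 * R * \<Lambda>) \<le> 1" "\<delta> * (36 * R * \<Lambda>) \<le> \<eta>\<^sup>2"
  "\<delta> * (8 * \<gamma>\<^sup>2 * m * \<Lambda>) \<le> \<eta>\<^sup>2"
proof -
  define p where "p = 36 * R * \<Lambda>"
  define q where "q = 8 * \<gamma>\<^sup>2 * m * \<Lambda>"
  have p: "p > 0" unfolding p_def using R_ge_1 Lambda_pos by (intro mult_pos_pos) auto
  have q: "q > 0" unfolding q_def using m_ge_1 Lambda_pos gamma(2) by (intro mult_pos_pos) auto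
  have e: "\<delta> = Min {1, min 1 (\<eta>\<^sup>2) / p, min (\<eta>\<^sup>2) R / q}"
    unfolding delta DO_delta_def p_def q_def eta \<Lambda>_def m_def R_eq[symmetric] by (simp add: mult.assoc)
  have "1 > (0::real)" "min 1 (\<eta>\<^sup>2) / p > 0" "min (\<eta>\<^sup>2) R / q > 0"
    using p q eta_props(1) R_ge_1 by auto
  then show "0 < \<delta>" unfolding e by simp
  have le: "\<delta> \<le> 1" "\<delta> \<le> min 1 (\<eta>\<^sup>2) / p" "\<delta> \<le> min (\<eta>\<^sup>2) R / q" unfolding e by auto
  show "\<delta> \<le> 1" by (rule le)
  have "\<delta> * p \<le> min 1 (\<eta>\<^sup>2)" "\<delta> * q \<le> min (\<eta>\<^sup>2) R" using le p q by (auto simp: pos_le_divide_eq)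
  then show "\<delta> * (36 * R * \<Lambda>) \<le> 1" "\<delta> * (36 * R * \<Lambda>) \<le> \<eta>\<^sup>2" "\<delta> * (8 * \<gamma>\<^sup>2 * m * \<Lambda>) \<le> \<eta>\<^sup>2"
    unfolding p_def q_def by auto
qed

lemma phi_mat: "\<phi> ** transpose \<phi> = mat 1"
  using phi by (simp add: orthonormal_rows_iff)

lemma phi_isometry: "norm (transpose \<phi> *v y) = norm y"
proof -
  have "(transpose \<phi> *v y) \<bullet> (transpose \<phi> *v y) = y \<bullet> y"
    unfolding inner_transpose_mult matrix_vector_mul_assoc phi_mat by simp
  then show ?thesis by (simp add: norm_eq_sqrt_inner)
qed

lemma norm_phi: "norm \<phi> = sqrt R"
proof -
  have "\<phi> $ i \<bullet> \<phi> $ i = 1" for i using phi by (simp add: orthonormal_rows_def row_def vec_lambda_eta)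
  then have "(norm \<phi>)\<^sup>2 = R" by (simp add: power2_norm_eq_inner inner_vec_def[of \<phi>] R_eq)
  then show ?thesis by (metis norm_ge_zero real_sqrt_unique)
qed

text \<open>A perturbation by at most \<open>1 / 4\<close> of a matrix that has norm
  \<open>sqrt R\<close> and an isometric transpose: both squares grow at most by the factor
  \<open>25 / 16\<close>. The factor 2 of the second claim is what \<open>Pi_contraction\<close> can
  absorb.\<close>

lemma V_bounds:
  assumes V: "norm (V - \<phi>) \<le> \<eta>"
  shows "(norm V)\<^sup>2 \<le> 3 * R" and "(norm (transpose V *v y))\<^sup>2 \<le> 2 * (norm y)\<^sup>2"
proof -
  have sR: "1 \<le> sqrt R" using R_ge_1 by simp
  have "norm V \<le> norm \<phi> + norm (V - \<phi>)" by (metis norm_triangle_sub)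
  also have "\<dots> \<le> sqrt R + 1 / 4" using V eta_props by (simp add: norm_phi)
  also have "\<dots> \<le> (5 / 4) * sqrt R" using sR by simp
  finally have "(norm V)\<^sup>2 \<le> ((5 / 4) * sqrt R)\<^sup>2" by (intro power_mono) auto
  also have "\<dots> = (25 / 16) * R" using R_ge_1 by (simp add: power_mult_distrib power_divide)
  also have "\<dots> \<le> 3 * R" using R_ge_1 by simp
  finally show "(norm V)\<^sup>2 \<le> 3 * R" .
  have "transpose V *v y = transpose \<phi> *v y + transpose (V - \<phi>) *v y"
    by (simp add: transpose_diff matrix_vector_mult_diff_rdistrib)
  then have "norm (transpose V *v y) \<le> norm y + norm (transpose (V - \<phi>) *v y)"
    using norm_triangle_ineq phi_isometry by metis
  also have "norm (transpose (V - \<phi>) *v y) \<le> \<eta> * norm y"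
    using norm_matrix_vector_le[of "transpose (V - \<phi>)" y] mult_right_mono[OF V, of "norm y"]
    by (simp add: norm_transpose)
  also have "\<eta> * norm y \<le> 1 / 4 * norm y" using eta_props by (intro mult_right_mono) auto
  finally have "norm (transpose V *v y) \<le> (5 / 4) * norm y" by simp
  then have "(norm (transpose V *v y))\<^sup>2 \<le> ((5 / 4) * norm y)\<^sup>2" by (intro power_mono) auto
  also have "\<dots> \<le> 2 * (norm y)\<^sup>2" by (simp add: power_mult_distrib power_divide)
  finally show "(norm (transpose V *v y))\<^sup>2 \<le> 2 * (norm y)\<^sup>2" .
qed

definition Pi :: "real ^ 'd ^ 'r \<Rightarrow> real ^ 'd ^ 'd" where
  "Pi V = mat 1 - transpose V ** V"

lemma transpose_Pi: "transpose (Pi V) = Pi V"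
  by (simp add: Pi_def transpose_diff matrix_transpose_mul transpose_transpose transpose_mat)

text \<open>With \<open>y = V *v x\<close> the squared norm of the image is that of
  \<open>x\<close>, minus \<open>2 * (norm y)\<^sup>2\<close>, plus the squared norm of
  \<open>transpose V *v y\<close>, and the last term is at most the one subtracted. The transpose
  and the factor 1 fit \<open>norm_matrix_mult_right\<close>.\<close>

lemma Pi_contraction:
  assumes V: "norm (V - \<phi>) \<le> \<eta>"
  shows "norm (transpose (Pi V) *v x) \<le> 1 * norm x"
proof -
  define y where "y = V *v x"
  have "Pi V *v x = x - transpose V *v y"
    by (simp add: Pi_def y_def matrix_vector_mult_diff_rdistrib matrix_vector_mul_assoc)
  then have "(norm (Pi V *v x))\<^sup>2 = (norm x)\<^sup>2 - 2 * (x \<bullet> (transpose V *v y)) + (norm (transpose V *v y))\<^sup>2"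
    by (simp add: power2_norm_eq_inner inner_diff_left inner_diff_right inner_commute)
  also have "x \<bullet> (transpose V *v y) = (norm y)\<^sup>2"
    unfolding inner_transpose_mult by (simp add: y_def power2_norm_eq_inner)
  finally have "(norm (Pi V *v x))\<^sup>2 \<le> (norm x)\<^sup>2" using V_bounds(2)[OF V, of y] by simp
  from power2_le_imp_le[OF this norm_ge_zero] show ?thesis by (simp only: transpose_Pi mult_1)
qed

end

section \<open>Mean square norms and outer products\<close>

definition sq_integrable :: "'a measure \<Rightarrow> ('a \<Rightarrow> 'b::euclidean_space) \<Rightarrow> bool" where
  "sq_integrable M f \<longleftrightarrow> f \<in> borel_measurable M \<and> integrable M (\<lambda>x. (norm (f x))\<^sup>2)"

definition mean_sq :: "'a measure \<Rightarrow> ('a \<Rightarrow> 'b::euclidean_space) \<Rightarrow> real" where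
  "mean_sq M f = (\<integral>x. (norm (f x))\<^sup>2 \<partial>M)"

lemma sq_integrableD: "sq_integrable M f \<Longrightarrow> f \<in> borel_measurable M" "sq_integrable M f \<Longrightarrow> integrable M (\<lambda>x. (norm (f x))\<^sup>2)"
  by (simp_all add: sq_integrable_def)

lemma mean_sq_nonneg [simp]: "0 \<le> mean_sq M f"
  by (simp add: mean_sq_def)

lemma nn_integral_mean_sq: "sq_integrable M f \<Longrightarrow> (\<integral>\<^sup>+x. ennreal ((norm (f x))\<^sup>2) \<partial>M) = ennreal (mean_sq M f)"
  unfolding mean_sq_def sq_integrable_def by (intro nn_integral_eq_integral) auto

lemma sq_integrable_bound:
  assumes f: "f \<in> borel_measurable M" and h: "integrable M h" and le: "\<And>x. x \<in> space M \<Longrightarrow> (norm (f x))\<^sup>2 \<le> h x"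
  shows "sq_integrable M f" "mean_sq M f \<le> (\<integral>x. h x \<partial>M)"
proof -
  have i: "integrable M (\<lambda>x. (norm (f x))\<^sup>2)"
  proof (rule Bochner_Integration.integrable_bound[OF h])
    show "(\<lambda>x. (norm (f x))\<^sup>2) \<in> borel_measurable M" using f by measurable
    show "AE x in M. norm ((norm (f x))\<^sup>2) \<le> norm (h x)"
      using le by (intro AE_I2) (simp add: order_trans[OF _ abs_ge_self])
  qed
  then show "sq_integrable M f" using f by (simp add: sq_integrable_def)
  show "mean_sq M f \<le> (\<integral>x. h x \<partial>M)" unfolding mean_sq_def by (intro integral_mono i h le)
qed

lemma sq_integrable_add:
  assumes f: "sq_integrable M f" and g: "sq_integrable M g"
  shows "sq_integrable M (\<lambda>x. f x + g x)" "mean_sq M (\<lambda>x. f x + g x) \<le> 2 * mean_sq M f + 2 * mean_sq M g"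
proof -
  have h: "integrable M (\<lambda>x. 2 * (norm (f x))\<^sup>2 + 2 * (norm (g x))\<^sup>2)"
    by (intro Bochner_Integration.integrable_add integrable_mult_right sq_integrableD f g)
  have m: "(\<lambda>x. f x + g x) \<in> borel_measurable M" by (intro borel_measurable_add sq_integrableD f g)
  show "sq_integrable M (\<lambda>x. f x + g x)" by (rule sq_integrable_bound(1)[OF m h norm_add_sq_le])
  have "mean_sq M (\<lambda>x. f x + g x) \<le> (\<integral>x. 2 * (norm (f x))\<^sup>2 + 2 * (norm (g x))\<^sup>2 \<partial>M)"
    by (rule sq_integrable_bound(2)[OF m h norm_add_sq_le])
  also have "\<dots> = 2 * mean_sq M f + 2 * mean_sq M g"
    using sq_integrableD(2)[OF f] sq_integrableD(2)[OF g] by (simp add: mean_sq_def)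
  finally show "mean_sq M (\<lambda>x. f x + g x) \<le> 2 * mean_sq M f + 2 * mean_sq M g" .
qed

lemma sq_integrable_diff:
  assumes f: "sq_integrable M f" and g: "sq_integrable M g"
  shows "sq_integrable M (\<lambda>x. f x - g x)" "mean_sq M (\<lambda>x. f x - g x) \<le> 2 * mean_sq M f + 2 * mean_sq M g"
proof -
  have "sq_integrable M (\<lambda>x. - g x)" "mean_sq M (\<lambda>x. - g x) = mean_sq M g"
    using g by (simp_all add: sq_integrable_def mean_sq_def)
  then show "sq_integrable M (\<lambda>x. f x - g x)" "mean_sq M (\<lambda>x. f x - g x) \<le> 2 * mean_sq M f + 2 * mean_sq M g"
    using sq_integrable_add[OF f, of "\<lambda>x. - g x"] by simp_all
qed

lemma outer_prod_measurable:
  assumes "f \<in> borel_measurable M" "g \<in> borel_measurable M"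
  shows "(\<lambda>x. outer_prod (f x) (g x)) \<in> borel_measurable M"
  by (rule borel_measurable_continuous_Pair[OF assms]) (rule continuous_matrix_ops)

lemma outer_prod_integral:
  fixes f :: "'a \<Rightarrow> real ^ 'p" and g :: "'a \<Rightarrow> real ^ 'q"
  assumes f: "sq_integrable M f" and g: "sq_integrable M g"
  shows "integrable M (\<lambda>x. outer_prod (f x) (g x))"
    and "norm (\<integral>x. outer_prod (f x) (g x) \<partial>M) \<le> sqrt (mean_sq M f) * sqrt (mean_sq M g)"
proof -
  note [measurable] = sq_integrableD(1)[OF f] sq_integrableD(1)[OF g]
  have n: "(\<lambda>x. norm (f x)) \<in> borel_measurable M" "(\<lambda>x. norm (g x)) \<in> borel_measurable M" by measurable
  have i: "integrable M (\<lambda>x. norm (f x) * norm (g x))"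
    by (rule integrable_mult_L2[OF n sq_integrableD(2)[OF f] sq_integrableD(2)[OF g]])
  show int: "integrable M (\<lambda>x. outer_prod (f x) (g x))"
  proof (rule Bochner_Integration.integrable_bound[OF i])
    show "(\<lambda>x. outer_prod (f x) (g x)) \<in> borel_measurable M"
      by (intro outer_prod_measurable sq_integrableD f g)
  qed (simp add: norm_outer_prod)
  have "norm (\<integral>x. outer_prod (f x) (g x) \<partial>M) \<le> (\<integral>x. norm (f x) * norm (g x) \<partial>M)"
    using integral_norm_bound[of M "\<lambda>x. outer_prod (f x) (g x)"] by (simp add: norm_outer_prod)
  also have "\<dots> = (\<integral>x. \<bar>norm (f x)\<bar> * \<bar>norm (g x)\<bar> \<partial>M)" by simp
  also have "\<dots> \<le> sqrt (mean_sq M f) * sqrt (mean_sq M g)"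
    unfolding mean_sq_def by (rule cauchy_schwarz_integral[OF n sq_integrableD(2)[OF f] sq_integrableD(2)[OF g]])
  finally show "norm (\<integral>x. outer_prod (f x) (g x) \<partial>M) \<le> sqrt (mean_sq M f) * sqrt (mean_sq M g)" .
qed

text \<open>With \<open>D = f - g\<close>, the difference of the outer products is D D^T + D g^T + g
  D^T. The resulting quadratic in \<open>d\<close> is the one that \<open>eta_fun\<close>
  solves.\<close>

lemma gram_diff_bound:
  fixes f g :: "'a \<Rightarrow> real ^ 'p"
  assumes f: "sq_integrable M f" and g: "sq_integrable M g"
  defines "d \<equiv> sqrt (mean_sq M (\<lambda>x. f x - g x))"
  shows "norm (gram M f - gram M g) \<le> d\<^sup>2 + 2 * sqrt (mean_sq M g) * d"
proof -
  let ?D = "\<lambda>x. f x - g x"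
  have D: "sq_integrable M ?D" by (rule sq_integrable_diff[OF f g])
  note o = outer_prod_integral
  have "gram M f - gram M g = (\<integral>x. outer_prod (f x) (f x) - outer_prod (g x) (g x) \<partial>M)"
    unfolding gram_def by (rule Bochner_Integration.integral_diff[OF o(1)[OF f f] o(1)[OF g g], symmetric])
  also have "\<dots> = (\<integral>x. outer_prod (?D x) (?D x) + (outer_prod (?D x) (g x) + outer_prod (g x) (?D x)) \<partial>M)"
    by (simp add: outer_prod_diff_left outer_prod_diff_right)
  also have "\<dots> = (\<integral>x. outer_prod (?D x) (?D x) \<partial>M) + ((\<integral>x. outer_prod (?D x) (g x) \<partial>M) + (\<integral>x. outer_prod (g x) (?D x) \<partial>M))"
    by (simp only: Bochner_Integration.integral_add Bochner_Integration.integrable_add o(1)[OF D D] o(1)[OF D g] o(1)[OF g D])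
  also have "norm \<dots> \<le> d * d + (d * sqrt (mean_sq M g) + sqrt (mean_sq M g) * d)"
    unfolding d_def by (intro norm_triangle_mono o D g)
  finally show ?thesis by (simp add: power2_eq_square algebra_simps)
qed

section \<open>Growth and Lipschitz bounds on the closed balls\<close>

context DO_setting
begin

lemma rho_sq: "mean_sq M \<xi> = \<rho>\<^sup>2" and xi_sq: "sq_integrable M \<xi>"
proof -
  show "sq_integrable M \<xi>" using xi_L2 by (simp add: in_L2_def sq_integrable_def)
  have "sqrt (mean_sq M \<xi>) = \<rho>" using rho(1) by (simp add: L2_norm_def mean_sq_def)
  then have "(sqrt (mean_sq M \<xi>))\<^sup>2 = \<rho>\<^sup>2" by simp
  then show "mean_sq M \<xi> = \<rho>\<^sup>2" by simp
qed

text \<open>The balls are closed so that the property survives limits of Picard iterates.\<close>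

definition good :: "real ^ 'd ^ 'r \<Rightarrow> ('w \<Rightarrow> real ^ 'r) \<Rightarrow> bool" where
  "good V Z \<longleftrightarrow> norm (V - \<phi>) \<le> \<eta> \<and> sq_integrable M Z \<and> mean_sq M (\<lambda>\<omega>. Z \<omega> - \<xi> \<omega>) \<le> \<eta>\<^sup>2"

definition cross :: "real \<Rightarrow> real ^ 'd ^ 'r \<Rightarrow> ('w \<Rightarrow> real ^ 'r) \<Rightarrow> real ^ 'd ^ 'r" where
  "cross s V Z = (\<integral>\<omega>. outer_prod (Z \<omega>) (a s (transpose V *v Z \<omega>)) \<partial>M)"

text \<open>Right-hand side of the equation for \<open>U\<close>; the projection onto the row space is replaced by
  \<open>transpose V ** V\<close>, which agrees with it on matrices with orthonormal rows.\<close>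

definition G :: "real \<Rightarrow> real ^ 'd ^ 'r \<Rightarrow> ('w \<Rightarrow> real ^ 'r) \<Rightarrow> real ^ 'd ^ 'r" where
  "G s V Z = matrix_inv (gram M Z) ** (cross s V Z ** Pi V)"

lemma ab_continuous: "0 \<le> s \<Longrightarrow> continuous_on UNIV (a s)" "0 \<le> s \<Longrightarrow> continuous_on UNIV (b s)"
  using a_Lip b_Lip L_pos
  by (auto intro!: lipschitz_on_continuous_on[of L] lipschitz_onI simp: dist_norm)

lemma good_mean_sq: "good V Z \<Longrightarrow> mean_sq M Z \<le> m"
proof -
  assume g: "good V Z"
  then have "mean_sq M (\<lambda>\<omega>. (Z \<omega> - \<xi> \<omega>) + \<xi> \<omega>) \<le> 2 * mean_sq M (\<lambda>\<omega>. Z \<omega> - \<xi> \<omega>) + 2 * mean_sq M \<xi>"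
    unfolding good_def by (intro sq_integrable_add sq_integrable_diff xi_sq) auto
  also have "\<dots> \<le> 2 * \<eta>\<^sup>2 + 2 * \<rho>\<^sup>2" using g by (simp add: good_def rho_sq)
  also have "\<eta>\<^sup>2 \<le> (1 / 4)\<^sup>2" using eta_props by (intro power_mono) auto
  finally have "mean_sq M Z \<le> 1 / 8 + 2 * \<rho>\<^sup>2" by (simp add: power_divide)
  moreover have "0 \<le> \<rho>\<^sup>2" by simp
  ultimately show "mean_sq M Z \<le> m" unfolding m_def by linarith
qed

lemma ab_growth:
  assumes s: "0 \<le> s" and V: "norm (V - \<phi>) \<le> \<eta>"
  shows "(norm (a s (transpose V *v z)))\<^sup>2 + (norm (b s (transpose V *v z)))\<^sup>2 \<le> C * (1 + 3 * R * (norm z)\<^sup>2)"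
proof -
  have "(norm (transpose V *v z))\<^sup>2 \<le> (norm V * norm z)\<^sup>2"
    using norm_matrix_vector_le[of "transpose V" z] by (intro power_mono) (simp_all add: norm_transpose)
  also have "\<dots> \<le> 3 * R * (norm z)\<^sup>2"
    unfolding power_mult_distrib using V_bounds(1)[OF V] by (intro mult_right_mono) auto
  finally have "C * (1 + (norm (transpose V *v z))\<^sup>2) \<le> C * (1 + 3 * R * (norm z)\<^sup>2)"
    using C_pos by simp
  with lgb[OF s, of "transpose V *v z"] show ?thesis by linarith
qed

lemma transpose_mult_measurable:
  fixes Z :: "'w \<Rightarrow> real ^ 'r"
  assumes "Z \<in> borel_measurable N"
  shows "(\<lambda>\<omega>. transpose V *v Z \<omega>) \<in> borel_measurable N"
  by (rule borel_measurable_continuous_Pair[of "\<lambda>_. V", OF _ assms continuous_matrix_ops(3)]) simp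

text \<open>The growth condition bounds the sum of both squares, and the sum is kept together.
  Otherwise the constant 36 in \<open>DO_delta\<close> would not be enough.\<close>

lemma good_coefficients:
  assumes g: "good V Z" and s: "0 \<le> s"
  shows "sq_integrable M (\<lambda>\<omega>. a s (transpose V *v Z \<omega>))" "sq_integrable M (\<lambda>\<omega>. b s (transpose V *v Z \<omega>))"
    and "mean_sq M (\<lambda>\<omega>. a s (transpose V *v Z \<omega>)) + mean_sq M (\<lambda>\<omega>. b s (transpose V *v Z \<omega>)) \<le> \<Lambda>"
proof -
  have V: "norm (V - \<phi>) \<le> \<eta>" and Z: "sq_integrable M Z" using g by (auto simp: good_def)
  note gr = ab_growth[OF s V]
  have h: "integrable M (\<lambda>\<omega>. C * (1 + 3 * R * (norm (Z \<omega>))\<^sup>2))"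
    using sq_integrableD(2)[OF Z] by simp
  have am: "(\<lambda>\<omega>. a s (transpose V *v Z \<omega>)) \<in> borel_measurable M"
    by (rule measurable_compose[OF transpose_mult_measurable[OF sq_integrableD(1)[OF Z]]
        borel_measurable_continuous_onI[OF ab_continuous(1)[OF s]]])
  have bm: "(\<lambda>\<omega>. b s (transpose V *v Z \<omega>)) \<in> borel_measurable M"
    by (rule measurable_compose[OF transpose_mult_measurable[OF sq_integrableD(1)[OF Z]]
        borel_measurable_continuous_onI[OF ab_continuous(2)[OF s]]])
  have le: "x \<le> h" "y \<le> h" if "x + y \<le> h" "0 \<le> x" "0 \<le> y" for x y h :: real using that by auto
  show A: "sq_integrable M (\<lambda>\<omega>. a s (transpose V *v Z \<omega>))"
    by (rule sq_integrable_bound(1)[OF am h]) (rule le(1)[OF gr]; simp)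
  show B: "sq_integrable M (\<lambda>\<omega>. b s (transpose V *v Z \<omega>))"
    by (rule sq_integrable_bound(1)[OF bm h]) (rule le(2)[OF gr]; simp)
  have "mean_sq M (\<lambda>\<omega>. a s (transpose V *v Z \<omega>)) + mean_sq M (\<lambda>\<omega>. b s (transpose V *v Z \<omega>)) =
      (\<integral>\<omega>. (norm (a s (transpose V *v Z \<omega>)))\<^sup>2 + (norm (b s (transpose V *v Z \<omega>)))\<^sup>2 \<partial>M)"
    unfolding mean_sq_def by (rule Bochner_Integration.integral_add[OF sq_integrableD(2)[OF A] sq_integrableD(2)[OF B], symmetric])
  also have "\<dots> \<le> (\<integral>\<omega>. C * (1 + 3 * R * (norm (Z \<omega>))\<^sup>2) \<partial>M)"
    by (intro integral_mono Bochner_Integration.integrable_add sq_integrableD A B h gr)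
  also have "\<dots> = C * (1 + 3 * R * mean_sq M Z)"
    using sq_integrableD(2)[OF Z] by (simp add: mean_sq_def prob_space)
  also have "\<dots> \<le> \<Lambda>"
    unfolding \<Lambda>_def using good_mean_sq[OF g] C_pos R_ge_1 by (intro mult_left_mono add_left_mono) auto
  finally show "mean_sq M (\<lambda>\<omega>. a s (transpose V *v Z \<omega>)) + mean_sq M (\<lambda>\<omega>. b s (transpose V *v Z \<omega>)) \<le> \<Lambda>" .
qed

lemma cross_bound:
  assumes g: "good V Z" and s: "0 \<le> s"
  shows "norm (cross s V Z) \<le> sqrt m * sqrt \<Lambda>"
proof -
  have Z: "sq_integrable M Z" using g by (simp add: good_def)
  have "mean_sq M (\<lambda>\<omega>. a s (transpose V *v Z \<omega>)) \<le> \<Lambda>"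
    using good_coefficients(3)[OF g s] mean_sq_nonneg[of M "\<lambda>\<omega>. b s (transpose V *v Z \<omega>)"] by linarith
  then have "sqrt (mean_sq M Z) * sqrt (mean_sq M (\<lambda>\<omega>. a s (transpose V *v Z \<omega>))) \<le> sqrt m * sqrt \<Lambda>"
    using good_mean_sq[OF g] m_ge_1 by (intro mult_mono) auto
  with outer_prod_integral(2)[OF Z good_coefficients(1)[OF g s]] show ?thesis unfolding cross_def by linarith
qed

text \<open>The quadratic bound for the change of the Gram matrix increases with the distance; its
  value at \<open>\<eta>\<close> is within the tolerance \<open>1 / (2 * \<gamma>)\<close> of
  \<open>matrix_inverse_bound\<close>.\<close>

lemma good_gram:
  assumes g: "good V Z"
  shows "invertible (gram M Z)" "norm (matrix_inv (gram M Z) *v x) \<le> 2 * \<gamma> * norm x"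
proof -
  have Z: "sq_integrable M Z" using g by (simp add: good_def)
  define d where "d = sqrt (mean_sq M (\<lambda>\<omega>. Z \<omega> - \<xi> \<omega>))"
  have d: "0 \<le> d" "d \<le> \<eta>" using g eta_props(1) by (auto simp: d_def good_def intro!: real_le_lsqrt)
  have "norm (gram M Z - gram M \<xi>) \<le> d\<^sup>2 + 2 * \<rho> * d"
    using gram_diff_bound[OF Z xi_sq] rho(2) by (simp add: d_def rho_sq)
  also have "\<dots> \<le> \<eta>\<^sup>2 + 2 * \<rho> * \<eta>" using d rho(2) by (intro add_mono power_mono mult_left_mono) auto
  also have "\<dots> \<le> 1 / (2 * \<gamma>)" by (rule eta_props)
  finally have c: "norm (gram M Z - gram M \<xi>) \<le> 1 / (2 * \<gamma>)" .
  show "invertible (gram M Z)" "norm (matrix_inv (gram M Z) *v x) \<le> 2 * \<gamma> * norm x"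
    using matrix_inverse_bound[OF gram_inv _ gamma(2) c] gamma(1) by auto
qed

text \<open>The operator bounds \<open>2 * \<gamma>\<close> for the inverse and 1 for
  \<open>Pi V\<close> introduce no dimensional factor; the square of the result reappears in the
  last denominator of \<open>DO_delta\<close>.\<close>

lemma G_bound:
  assumes g: "good V Z" and s: "0 \<le> s"
  shows "norm (G s V Z) \<le> 2 * \<gamma> * (sqrt m * sqrt \<Lambda>)"
proof -
  have V: "norm (V - \<phi>) \<le> \<eta>" using g by (simp add: good_def)
  have "norm (G s V Z) \<le> 2 * \<gamma> * norm (cross s V Z ** Pi V)"
    unfolding G_def using gamma(2) by (intro norm_matrix_mult_left good_gram(2)[OF g]) simp
  also have "norm (cross s V Z ** Pi V) \<le> 1 * norm (cross s V Z)"
    by (intro norm_matrix_mult_right Pi_contraction V) simp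
  also have "norm (cross s V Z) \<le> sqrt m * sqrt \<Lambda>" by (rule cross_bound[OF g s])
  finally show ?thesis using gamma(2) by simp
qed

definition \<kappa> :: real where "\<kappa> = L\<^sup>2 * (2 * m + 6 * R)"

lemma kappa_nonneg: "0 \<le> \<kappa>"
  unfolding \<kappa>_def using m_ge_1 R_ge_1 by simp

text \<open>One number \<open>q\<close> bounds both distances, in norm for \<open>V\<close> and in
  root mean square for \<open>Z\<close>. The arguments differ by \<open>transpose (V - V')\<close>
  applied to \<open>Z\<close> plus \<open>transpose V'\<close> applied to \<open>Z - Z'\<close>,
  which explains the two terms of \<open>\<kappa>\<close>.\<close>

lemma coefficient_diff:
  assumes g: "good V Z" and g': "good V' Z'" and s: "0 \<le> s"
    and q: "norm (V - V') \<le> q" "mean_sq M (\<lambda>\<omega>. Z \<omega> - Z' \<omega>) \<le> q\<^sup>2"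
  shows "mean_sq M (\<lambda>\<omega>. a s (transpose V *v Z \<omega>) - a s (transpose V' *v Z' \<omega>)) \<le> \<kappa> * q\<^sup>2"
    and "mean_sq M (\<lambda>\<omega>. b s (transpose V *v Z \<omega>) - b s (transpose V' *v Z' \<omega>)) \<le> \<kappa> * q\<^sup>2"
proof -
  have V': "norm (V' - \<phi>) \<le> \<eta>" and Z: "sq_integrable M Z" "sq_integrable M Z'"
    using g g' by (auto simp: good_def)
  define h where "h \<omega> = L\<^sup>2 * (2 * q\<^sup>2 * (norm (Z \<omega>))\<^sup>2 + 6 * R * (norm (Z \<omega> - Z' \<omega>))\<^sup>2)" for \<omega>
  have D: "sq_integrable M (\<lambda>\<omega>. Z \<omega> - Z' \<omega>)" by (rule sq_integrable_diff[OF Z])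
  have hi: "integrable M h"
    unfolding h_def using sq_integrableD(2)[OF Z(1)] sq_integrableD(2)[OF D] by simp
  have "(\<integral>\<omega>. h \<omega> \<partial>M) = L\<^sup>2 * (2 * q\<^sup>2 * mean_sq M Z + 6 * R * mean_sq M (\<lambda>\<omega>. Z \<omega> - Z' \<omega>))"
    unfolding h_def mean_sq_def using sq_integrableD(2)[OF Z(1)] sq_integrableD(2)[OF D] by simp
  also have "\<dots> \<le> L\<^sup>2 * (2 * q\<^sup>2 * m + 6 * R * q\<^sup>2)"
    using good_mean_sq[OF g] q(2) R_ge_1 by (intro mult_left_mono add_mono) auto
  also have "\<dots> = \<kappa> * q\<^sup>2" by (simp add: \<kappa>_def algebra_simps)
  finally have h: "(\<integral>\<omega>. h \<omega> \<partial>M) \<le> \<kappa> * q\<^sup>2" .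
  have arg: "(norm (transpose V *v Z \<omega> - transpose V' *v Z' \<omega>))\<^sup>2 \<le> 2 * q\<^sup>2 * (norm (Z \<omega>))\<^sup>2 + 6 * R * (norm (Z \<omega> - Z' \<omega>))\<^sup>2" for \<omega>
  proof -
    have "transpose V *v Z \<omega> - transpose V' *v Z' \<omega> = transpose (V - V') *v Z \<omega> + transpose V' *v (Z \<omega> - Z' \<omega>)"
      by (simp add: transpose_diff matrix_vector_mult_diff_rdistrib matrix_vector_mult_diff_distrib)
    then have "(norm (transpose V *v Z \<omega> - transpose V' *v Z' \<omega>))\<^sup>2 \<le>
        2 * (norm (transpose (V - V') *v Z \<omega>))\<^sup>2 + 2 * (norm (transpose V' *v (Z \<omega> - Z' \<omega>)))\<^sup>2"
      by (simp only: norm_add_sq_le)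
    also have "(norm (transpose (V - V') *v Z \<omega>))\<^sup>2 \<le> (q * norm (Z \<omega>))\<^sup>2"
      using norm_matrix_vector_le[of "transpose (V - V')" "Z \<omega>"] mult_right_mono[OF q(1), of "norm (Z \<omega>)"]
      by (intro power_mono) (simp_all add: norm_transpose)
    also have "(norm (transpose V' *v (Z \<omega> - Z' \<omega>)))\<^sup>2 \<le> (norm V' * norm (Z \<omega> - Z' \<omega>))\<^sup>2"
      using norm_matrix_vector_le[of "transpose V'" "Z \<omega> - Z' \<omega>"] by (intro power_mono) (simp_all add: norm_transpose)
    also have "(norm V' * norm (Z \<omega> - Z' \<omega>))\<^sup>2 \<le> 3 * R * (norm (Z \<omega> - Z' \<omega>))\<^sup>2"
      unfolding power_mult_distrib using V_bounds(1)[OF V'] by (intro mult_right_mono) auto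
    finally show ?thesis by (simp add: power_mult_distrib)
  qed
  have Lip: "(norm (f x - f y))\<^sup>2 \<le> L\<^sup>2 * (norm (x - y))\<^sup>2" if "norm (f x - f y) \<le> L * norm (x - y)"
    for f :: "real ^ 'd \<Rightarrow> 'e::real_normed_vector" and x y
    using power_mono[OF that, of 2] by (simp add: power_mult_distrib)
  have L2: "L\<^sup>2 * (norm (transpose V *v Z \<omega> - transpose V' *v Z' \<omega>))\<^sup>2 \<le> h \<omega>" for \<omega>
    unfolding h_def by (intro mult_left_mono arg) simp
  show "mean_sq M (\<lambda>\<omega>. a s (transpose V *v Z \<omega>) - a s (transpose V' *v Z' \<omega>)) \<le> \<kappa> * q\<^sup>2"
    by (rule order_trans[OF sq_integrable_bound(2)[OF _ hi] h])
      (intro borel_measurable_diff sq_integrableD(1) good_coefficients[OF g s] good_coefficients[OF g' s],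
        rule order_trans[OF Lip[OF a_Lip[OF s]] L2])
  show "mean_sq M (\<lambda>\<omega>. b s (transpose V *v Z \<omega>) - b s (transpose V' *v Z' \<omega>)) \<le> \<kappa> * q\<^sup>2"
    by (rule order_trans[OF sq_integrable_bound(2)[OF _ hi] h])
      (intro borel_measurable_diff sq_integrableD(1) good_coefficients[OF g s] good_coefficients[OF g' s],
        rule order_trans[OF Lip[OF b_Lip[OF s]] L2])
qed

lemma good_diff_small:
  assumes "good V Z" "good V' Z'"
  shows "sq_integrable M (\<lambda>\<omega>. Z \<omega> - Z' \<omega>)" "mean_sq M (\<lambda>\<omega>. Z \<omega> - Z' \<omega>) \<le> 1"
proof -
  have Z: "sq_integrable M Z" "sq_integrable M Z'" using assms by (auto simp: good_def)
  show "sq_integrable M (\<lambda>\<omega>. Z \<omega> - Z' \<omega>)" by (rule sq_integrable_diff[OF Z])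
  have "mean_sq M (\<lambda>\<omega>. (Z \<omega> - \<xi> \<omega>) - (Z' \<omega> - \<xi> \<omega>)) \<le> 2 * mean_sq M (\<lambda>\<omega>. Z \<omega> - \<xi> \<omega>) + 2 * mean_sq M (\<lambda>\<omega>. Z' \<omega> - \<xi> \<omega>)"
    by (intro sq_integrable_diff Z xi_sq)
  also have "\<dots> \<le> 2 * \<eta>\<^sup>2 + 2 * \<eta>\<^sup>2" using assms by (auto simp: good_def)
  also have "\<eta>\<^sup>2 \<le> (1 / 4)\<^sup>2" using eta_props by (intro power_mono) auto
  finally show "mean_sq M (\<lambda>\<omega>. Z \<omega> - Z' \<omega>) \<le> 1" by (simp add: power_divide)
qed

definition K\<^sub>G :: real where
  "K\<^sub>G = 2 * \<gamma> * ((1 + 2 * sqrt m) * (2 * \<gamma> * (sqrt m * sqrt \<Lambda>))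
    + (sqrt \<Lambda> + sqrt m * sqrt \<kappa>) + sqrt m * sqrt \<Lambda> * (2 * sqrt (3 * R)))"

text \<open>Inverse, cross term and projection are changed one at a time; the three changes are the
  three summands inside \<open>K\<^sub>G\<close>.\<close>

lemma G_diff:
  assumes g: "good V Z" and g': "good V' Z'" and s: "0 \<le> s"
    and q: "norm (V - V') \<le> q" "mean_sq M (\<lambda>\<omega>. Z \<omega> - Z' \<omega>) \<le> q\<^sup>2"
  shows "norm (G s V Z - G s V' Z') \<le> K\<^sub>G * q"
proof -
  have V: "norm (V - \<phi>) \<le> \<eta>" "norm (V' - \<phi>) \<le> \<eta>" and Z: "sq_integrable M Z" "sq_integrable M Z'"
    using g g' by (auto simp: good_def)
  have q0: "0 \<le> q" using q(1) norm_ge_zero order_trans by blast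
  define d where "d = sqrt (mean_sq M (\<lambda>\<omega>. Z \<omega> - Z' \<omega>))"
  \<comment> \<open>The bound \<open>d \<le> 1\<close> turns the quadratic term of the Gram
    difference into a linear one.\<close>
  have d: "0 \<le> d" "d \<le> q" "d \<le> 1"
    using q(2) q0 good_diff_small(2)[OF g g'] by (auto simp: d_def intro!: real_le_lsqrt)
  have "norm (gram M Z - gram M Z') \<le> d\<^sup>2 + 2 * sqrt (mean_sq M Z') * d"
    unfolding d_def by (rule gram_diff_bound[OF Z])
  also have "\<dots> \<le> 1 * q + 2 * sqrt m * q"
    using d good_mean_sq[OF g'] m_ge_1 unfolding power2_eq_square by (intro add_mono mult_mono) auto
  finally have gd: "norm (gram M Z' - gram M Z) \<le> (1 + 2 * sqrt m) * q"
    by (simp add: norm_minus_commute algebra_simps)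
  let ?\<alpha> = "\<lambda>\<omega>. a s (transpose V *v Z \<omega>)" and ?\<alpha>' = "\<lambda>\<omega>. a s (transpose V' *v Z' \<omega>)"
  have A: "sq_integrable M ?\<alpha>" "sq_integrable M ?\<alpha>'" by (intro good_coefficients[OF g s] good_coefficients[OF g' s])+
  note o = outer_prod_integral
  have DZ: "sq_integrable M (\<lambda>\<omega>. Z \<omega> - Z' \<omega>)" and DA: "sq_integrable M (\<lambda>\<omega>. ?\<alpha> \<omega> - ?\<alpha>' \<omega>)"
    by (intro sq_integrable_diff Z A)+
  have "cross s V Z - cross s V' Z' = (\<integral>\<omega>. outer_prod (Z \<omega>) (?\<alpha> \<omega>) - outer_prod (Z' \<omega>) (?\<alpha>' \<omega>) \<partial>M)"
    unfolding cross_def by (rule Bochner_Integration.integral_diff[OF o(1)[OF Z(1) A(1)] o(1)[OF Z(2) A(2)], symmetric])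
  also have "\<dots> = (\<integral>\<omega>. outer_prod (Z \<omega> - Z' \<omega>) (?\<alpha> \<omega>) + outer_prod (Z' \<omega>) (?\<alpha> \<omega> - ?\<alpha>' \<omega>) \<partial>M)"
    by (simp add: outer_prod_diff_left outer_prod_diff_right)
  also have "\<dots> = (\<integral>\<omega>. outer_prod (Z \<omega> - Z' \<omega>) (?\<alpha> \<omega>) \<partial>M) + (\<integral>\<omega>. outer_prod (Z' \<omega>) (?\<alpha> \<omega> - ?\<alpha>' \<omega>) \<partial>M)"
    by (rule Bochner_Integration.integral_add[OF o(1)[OF DZ A(1)] o(1)[OF Z(2) DA]])
  also have "norm \<dots> \<le> q * sqrt \<Lambda> + sqrt m * (sqrt \<kappa> * q)"
  proof (intro norm_triangle_mono order_trans[OF o(2)[OF DZ A(1)]] order_trans[OF o(2)[OF Z(2) DA]] mult_mono)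
    show "sqrt (mean_sq M ?\<alpha>) \<le> sqrt \<Lambda>"
      using good_coefficients(3)[OF g s] mean_sq_nonneg[of M "\<lambda>\<omega>. b s (transpose V *v Z \<omega>)"] by (intro real_sqrt_le_mono) linarith
    show "sqrt (mean_sq M (\<lambda>\<omega>. ?\<alpha> \<omega> - ?\<alpha>' \<omega>)) \<le> sqrt \<kappa> * q"
      using real_sqrt_le_mono[OF coefficient_diff(1)[OF g g' s q]] q0 by (simp add: real_sqrt_mult)
    show "sqrt (mean_sq M (\<lambda>\<omega>. Z \<omega> - Z' \<omega>)) \<le> q" using d(2) by (simp add: d_def)
    show "sqrt (mean_sq M Z') \<le> sqrt m" using good_mean_sq[OF g'] by simp
  qed (use q0 m_ge_1 in auto)
  finally have cd: "norm (cross s V Z - cross s V' Z') \<le> (sqrt \<Lambda> + sqrt m * sqrt \<kappa>) * q"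
    by (simp add: algebra_simps)
  have nV: "norm V \<le> sqrt (3 * R)" "norm V' \<le> sqrt (3 * R)"
    using V_bounds(1)[OF V(1)] V_bounds(1)[OF V(2)] by (auto intro: real_le_rsqrt)
  have "Pi V - Pi V' = transpose (V' - V) ** V' + transpose V ** (V' - V)"
    by (simp add: Pi_def transpose_diff matrix_mult_diff_left[symmetric] matrix_mult_diff_right[symmetric])
  also have "norm \<dots> \<le> q * sqrt (3 * R) + sqrt (3 * R) * q"
  proof (intro norm_triangle_mono order_trans[OF norm_matrix_mult_le] mult_mono)
    show "norm (transpose (V' - V)) \<le> q" "norm (V' - V) \<le> q" using q(1) by (simp_all add: norm_transpose norm_minus_commute)
    show "norm (transpose V) \<le> sqrt (3 * R)" "norm V' \<le> sqrt (3 * R)" using nV by (simp_all add: norm_transpose)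
  qed (use q0 R_ge_1 in auto)
  finally have pd: "norm (Pi V - Pi V') \<le> 2 * sqrt (3 * R) * q" by (simp add: mult_ac)
  let ?I = "matrix_inv (gram M Z)" and ?I' = "matrix_inv (gram M Z')"
  let ?X = "cross s V Z ** Pi V"
  define Y where "Y = (gram M Z' - gram M Z) ** (?I' ** ?X) + (cross s V Z - cross s V' Z') ** Pi V"
  have I: "norm (?I ** A) \<le> 2 * \<gamma> * norm A" "norm (?I' ** A) \<le> 2 * \<gamma> * norm A" for A :: "real ^ 'd ^ 'r"
    using gamma(2) by (intro norm_matrix_mult_left good_gram(2)[OF g] good_gram(2)[OF g']; simp)+
  have mm: "norm (A ** B) \<le> x * y" if "norm A \<le> x" "norm B \<le> y" "0 \<le> x"
    for A :: "real ^ 'p ^ 'q" and B :: "real ^ 's ^ 'p" and x y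
    by (rule order_trans[OF norm_matrix_mult_le mult_mono[OF that]]) simp
  have I2: "norm (?I ** A) \<le> 2 * \<gamma> * c" "norm (?I' ** A) \<le> 2 * \<gamma> * c" if "norm A \<le> c" for A :: "real ^ 'd ^ 'r" and c
    using gamma(2) that by (rule_tac order_trans[OF I(1) mult_left_mono] order_trans[OF I(2) mult_left_mono]; simp)+
  have inv: "?I ** gram M Z = mat 1" "gram M Z' ** ?I' = mat 1"
    by (intro matrix_inv_left matrix_inv_right good_gram(1)[OF g] good_gram(1)[OF g'])+
  have Pc: "norm (A ** Pi V) \<le> norm A" for A :: "real ^ 'd ^ 'r"
    using norm_matrix_mult_right[OF Pi_contraction[OF V(1)], of A] by simp
  \<comment> \<open>Resolvent identity: the difference of two inverses is one inverse times the
    difference of the matrices times the other inverse.\<close>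
  have "?I ** ((gram M Z' - gram M Z) ** (?I' ** ?X)) = ?I ** (gram M Z' ** (?I' ** ?X)) - ?I ** (gram M Z ** (?I' ** ?X))"
    by (simp only: matrix_mult_diff_right[symmetric] matrix_mult_diff_left[symmetric])
  also have "\<dots> = ?I ** ?X - ?I' ** ?X"
    by (simp only: matrix_mul_assoc inv matrix_mul_lid)
  finally have e1: "?I ** ((gram M Z' - gram M Z) ** (?I' ** ?X)) = ?I ** ?X - ?I' ** ?X" .
  have "G s V Z - G s V' Z' = ?I ** ((gram M Z' - gram M Z) ** (?I' ** ?X)) +
      (?I' ** ((cross s V Z - cross s V' Z') ** Pi V) + ?I' ** (cross s V' Z' ** (Pi V - Pi V')))"
    unfolding e1 G_def by (simp only: matrix_mult_diff_right[symmetric] matrix_mult_diff_left[symmetric]) simp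
  also have "norm \<dots> \<le> 2 * \<gamma> * ((1 + 2 * sqrt m) * q * (2 * \<gamma> * (sqrt m * sqrt \<Lambda>)))
     + (2 * \<gamma> * ((sqrt \<Lambda> + sqrt m * sqrt \<kappa>) * q) + 2 * \<gamma> * (sqrt m * sqrt \<Lambda> * (2 * sqrt (3 * R) * q)))"
  proof (intro norm_triangle_mono)
    have "norm (?I' ** ?X) \<le> 2 * \<gamma> * (sqrt m * sqrt \<Lambda>)"
      by (rule I2(2)[OF order_trans[OF Pc cross_bound[OF g s]]])
    then have "norm ((gram M Z' - gram M Z) ** (?I' ** ?X)) \<le> (1 + 2 * sqrt m) * q * (2 * \<gamma> * (sqrt m * sqrt \<Lambda>))"
      using q0 m_ge_1 by (intro mm[OF gd]) auto
    then show "norm (?I ** ((gram M Z' - gram M Z) ** (?I' ** ?X))) \<le> 2 * \<gamma> * ((1 + 2 * sqrt m) * q * (2 * \<gamma> * (sqrt m * sqrt \<Lambda>)))"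
      by (rule I2(1))
    show "norm (?I' ** ((cross s V Z - cross s V' Z') ** Pi V)) \<le> 2 * \<gamma> * ((sqrt \<Lambda> + sqrt m * sqrt \<kappa>) * q)"
      by (rule I2(2)[OF order_trans[OF Pc cd]])
    have "norm (cross s V' Z' ** (Pi V - Pi V')) \<le> sqrt m * sqrt \<Lambda> * (2 * sqrt (3 * R) * q)"
      using m_ge_1 Lambda_pos by (intro mm[OF cross_bound[OF g' s] pd]) auto
    then show "norm (?I' ** (cross s V' Z' ** (Pi V - Pi V'))) \<le> 2 * \<gamma> * (sqrt m * sqrt \<Lambda> * (2 * sqrt (3 * R) * q))"
      by (rule I2(2))
  qed
  also have "\<dots> = K\<^sub>G * q" by (simp add: K\<^sub>G_def algebra_simps)
  finally show ?thesis .
qed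

text \<open>Multiplication by \<open>V\<close> costs the factor \<open>3 * R\<close>, again for the
  sum of both second moments.\<close>

lemma reduced_bound:
  assumes g: "good V Z" and s: "0 \<le> s"
  shows "mean_sq M (\<lambda>\<omega>. V *v a s (transpose V *v Z \<omega>)) + mean_sq M (\<lambda>\<omega>. V ** b s (transpose V *v Z \<omega>)) \<le> 3 * R * \<Lambda>"
    and "sq_integrable M (\<lambda>\<omega>. V *v a s (transpose V *v Z \<omega>))" "sq_integrable M (\<lambda>\<omega>. V ** b s (transpose V *v Z \<omega>))"
proof -
  have V: "norm (V - \<phi>) \<le> \<eta>" using g by (simp add: good_def)
  note ab = good_coefficients[OF g s]
  have Vn: "(norm x)\<^sup>2 \<le> 3 * R * (norm y)\<^sup>2" if "norm x \<le> norm V * norm y"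
    for x :: "'x::real_normed_vector" and y :: "'y::real_normed_vector"
  proof -
    have "(norm x)\<^sup>2 \<le> (norm V * norm y)\<^sup>2" using that by (intro power_mono) auto
    also have "\<dots> \<le> 3 * R * (norm y)\<^sup>2"
      unfolding power_mult_distrib using V_bounds(1)[OF V] by (intro mult_right_mono) auto
    finally show ?thesis .
  qed
  have m1: "(\<lambda>\<omega>. V *v a s (transpose V *v Z \<omega>)) \<in> borel_measurable M"
    by (rule borel_measurable_continuous_Pair[of "\<lambda>_. V", OF _ sq_integrableD(1)[OF ab(1)] continuous_matrix_ops(2)]) simp
  have m2: "(\<lambda>\<omega>. V ** b s (transpose V *v Z \<omega>)) \<in> borel_measurable M"
    by (rule borel_measurable_continuous_Pair[of "\<lambda>_. V", OF _ sq_integrableD(1)[OF ab(2)] continuous_matrix_ops(4)]) simp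
  have i1: "integrable M (\<lambda>\<omega>. 3 * R * (norm (a s (transpose V *v Z \<omega>)))\<^sup>2)"
    and i2: "integrable M (\<lambda>\<omega>. 3 * R * (norm (b s (transpose V *v Z \<omega>)))\<^sup>2)"
    by (intro integrable_mult_right sq_integrableD ab)+
  note b1 = sq_integrable_bound[OF m1 i1 Vn[OF norm_matrix_vector_le]]
    and b2 = sq_integrable_bound[OF m2 i2 Vn[OF norm_matrix_mult_le]]
  show "sq_integrable M (\<lambda>\<omega>. V *v a s (transpose V *v Z \<omega>))" "sq_integrable M (\<lambda>\<omega>. V ** b s (transpose V *v Z \<omega>))"
    by (rule b1(1) b2(1))+
  have "mean_sq M (\<lambda>\<omega>. V *v a s (transpose V *v Z \<omega>)) + mean_sq M (\<lambda>\<omega>. V ** b s (transpose V *v Z \<omega>)) \<le>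
      3 * R * (mean_sq M (\<lambda>\<omega>. a s (transpose V *v Z \<omega>)) + mean_sq M (\<lambda>\<omega>. b s (transpose V *v Z \<omega>)))"
    using b1(2) b2(2) by (simp add: mean_sq_def algebra_simps)
  also have "\<dots> \<le> 3 * R * \<Lambda>" using ab(3) R_ge_1 by (intro mult_left_mono) auto
  finally show "mean_sq M (\<lambda>\<omega>. V *v a s (transpose V *v Z \<omega>)) + mean_sq M (\<lambda>\<omega>. V ** b s (transpose V *v Z \<omega>)) \<le> 3 * R * \<Lambda>" .
qed

definition K\<^sub>Y :: real where "K\<^sub>Y = 2 * \<Lambda> + 6 * R * \<kappa>"

text \<open>One factor is changed at a time: in \<open>K\<^sub>Y\<close> the term
  \<open>2 * \<Lambda>\<close> pays for the outer matrix and \<open>6 * R * \<kappa>\<close> for the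
  coefficient.\<close>

lemma reduced_diff:
  assumes g: "good V Z" and g': "good V' Z'" and s: "0 \<le> s"
    and q: "norm (V - V') \<le> q" "mean_sq M (\<lambda>\<omega>. Z \<omega> - Z' \<omega>) \<le> q\<^sup>2"
  shows "mean_sq M (\<lambda>\<omega>. V *v a s (transpose V *v Z \<omega>) - V' *v a s (transpose V' *v Z' \<omega>)) \<le> K\<^sub>Y * q\<^sup>2"
    and "mean_sq M (\<lambda>\<omega>. V ** b s (transpose V *v Z \<omega>) - V' ** b s (transpose V' *v Z' \<omega>)) \<le> K\<^sub>Y * q\<^sup>2"
proof -
  have V': "norm (V' - \<phi>) \<le> \<eta>" using g' by (simp add: good_def)
  have sq: "(norm (x + y))\<^sup>2 \<le> 2 * q\<^sup>2 * (norm u)\<^sup>2 + 6 * R * (norm v)\<^sup>2"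
    if "norm x \<le> norm (V - V') * norm u" "norm y \<le> norm V' * norm v"
    for x y :: "'x::real_normed_vector" and u v :: "'y::real_normed_vector"
  proof -
    have "(norm x)\<^sup>2 \<le> (q * norm u)\<^sup>2"
      using that(1) mult_right_mono[OF q(1), of "norm u"] by (intro power_mono) auto
    moreover have "(norm y)\<^sup>2 \<le> (norm V' * norm v)\<^sup>2" using that(2) by (intro power_mono) auto
    moreover have "(norm V' * norm v)\<^sup>2 \<le> 3 * R * (norm v)\<^sup>2"
      unfolding power_mult_distrib using V_bounds(1)[OF V'] by (intro mult_right_mono) auto
    ultimately show ?thesis using norm_add_sq_le[of x y] by (simp add: power_mult_distrib)
  qed
  have K: "2 * q\<^sup>2 * A + 6 * R * D \<le> K\<^sub>Y * q\<^sup>2" if "A \<le> \<Lambda>" "D \<le> \<kappa> * q\<^sup>2" for A D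
  proof -
    have "2 * q\<^sup>2 * A + 6 * R * D \<le> 2 * q\<^sup>2 * \<Lambda> + 6 * R * (\<kappa> * q\<^sup>2)"
      using that R_ge_1 by (intro add_mono mult_left_mono) auto
    then show ?thesis by (simp add: K\<^sub>Y_def algebra_simps)
  qed
  note ab = good_coefficients[OF g s] and ab' = good_coefficients[OF g' s]
  let ?\<alpha> = "\<lambda>\<omega>. a s (transpose V *v Z \<omega>)" and ?\<alpha>' = "\<lambda>\<omega>. a s (transpose V' *v Z' \<omega>)"
  let ?\<beta> = "\<lambda>\<omega>. b s (transpose V *v Z \<omega>)" and ?\<beta>' = "\<lambda>\<omega>. b s (transpose V' *v Z' \<omega>)"
  have le: "mean_sq M ?\<alpha> \<le> \<Lambda>" "mean_sq M ?\<beta> \<le> \<Lambda>"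
    using ab(3) mean_sq_nonneg[of M ?\<alpha>] mean_sq_nonneg[of M ?\<beta>] by linarith+
  have DA: "sq_integrable M (\<lambda>\<omega>. ?\<alpha> \<omega> - ?\<alpha>' \<omega>)" and DB: "sq_integrable M (\<lambda>\<omega>. ?\<beta> \<omega> - ?\<beta>' \<omega>)"
    by (intro sq_integrable_diff ab ab')+
  show "mean_sq M (\<lambda>\<omega>. V *v ?\<alpha> \<omega> - V' *v ?\<alpha>' \<omega>) \<le> K\<^sub>Y * q\<^sup>2"
  proof (rule order_trans[OF sq_integrable_bound(2)])
    show "(\<lambda>\<omega>. V *v ?\<alpha> \<omega> - V' *v ?\<alpha>' \<omega>) \<in> borel_measurable M"
      by (intro borel_measurable_diff sq_integrableD(1) reduced_bound[OF g s] reduced_bound[OF g' s])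
    show "integrable M (\<lambda>\<omega>. 2 * q\<^sup>2 * (norm (?\<alpha> \<omega>))\<^sup>2 + 6 * R * (norm (?\<alpha> \<omega> - ?\<alpha>' \<omega>))\<^sup>2)"
      by (intro Bochner_Integration.integrable_add integrable_mult_right sq_integrableD ab DA)
    fix \<omega>
    have "V *v ?\<alpha> \<omega> - V' *v ?\<alpha>' \<omega> = (V - V') *v ?\<alpha> \<omega> + V' *v (?\<alpha> \<omega> - ?\<alpha>' \<omega>)"
      by (simp add: matrix_vector_mult_diff_rdistrib matrix_vector_mult_diff_distrib)
    then show "(norm (V *v ?\<alpha> \<omega> - V' *v ?\<alpha>' \<omega>))\<^sup>2 \<le> 2 * q\<^sup>2 * (norm (?\<alpha> \<omega>))\<^sup>2 + 6 * R * (norm (?\<alpha> \<omega> - ?\<alpha>' \<omega>))\<^sup>2"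
      using sq[OF norm_matrix_vector_le norm_matrix_vector_le] by (simp only:)
  next
    have "(\<integral>\<omega>. 2 * q\<^sup>2 * (norm (?\<alpha> \<omega>))\<^sup>2 + 6 * R * (norm (?\<alpha> \<omega> - ?\<alpha>' \<omega>))\<^sup>2 \<partial>M) =
        2 * q\<^sup>2 * mean_sq M ?\<alpha> + 6 * R * mean_sq M (\<lambda>\<omega>. ?\<alpha> \<omega> - ?\<alpha>' \<omega>)"
      using sq_integrableD(2)[OF ab(1)] sq_integrableD(2)[OF DA] by (simp add: mean_sq_def)
    then show "(\<integral>\<omega>. 2 * q\<^sup>2 * (norm (?\<alpha> \<omega>))\<^sup>2 + 6 * R * (norm (?\<alpha> \<omega> - ?\<alpha>' \<omega>))\<^sup>2 \<partial>M) \<le> K\<^sub>Y * q\<^sup>2"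
      using K[OF le(1) coefficient_diff(1)[OF g g' s q]] by simp
  qed
  show "mean_sq M (\<lambda>\<omega>. V ** ?\<beta> \<omega> - V' ** ?\<beta>' \<omega>) \<le> K\<^sub>Y * q\<^sup>2"
  proof (rule order_trans[OF sq_integrable_bound(2)])
    show "(\<lambda>\<omega>. V ** ?\<beta> \<omega> - V' ** ?\<beta>' \<omega>) \<in> borel_measurable M"
      by (intro borel_measurable_diff sq_integrableD(1) reduced_bound[OF g s] reduced_bound[OF g' s])
    show "integrable M (\<lambda>\<omega>. 2 * q\<^sup>2 * (norm (?\<beta> \<omega>))\<^sup>2 + 6 * R * (norm (?\<beta> \<omega> - ?\<beta>' \<omega>))\<^sup>2)"
      by (intro Bochner_Integration.integrable_add integrable_mult_right sq_integrableD ab DB)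
    fix \<omega>
    have "V ** ?\<beta> \<omega> - V' ** ?\<beta>' \<omega> = (V - V') ** ?\<beta> \<omega> + V' ** (?\<beta> \<omega> - ?\<beta>' \<omega>)"
      by (simp add: matrix_mult_diff_right[symmetric] matrix_mult_diff_left[symmetric])
    then show "(norm (V ** ?\<beta> \<omega> - V' ** ?\<beta>' \<omega>))\<^sup>2 \<le> 2 * q\<^sup>2 * (norm (?\<beta> \<omega>))\<^sup>2 + 6 * R * (norm (?\<beta> \<omega> - ?\<beta>' \<omega>))\<^sup>2"
      using sq[OF norm_matrix_mult_le norm_matrix_mult_le] by (simp only:)
  next
    have "(\<integral>\<omega>. 2 * q\<^sup>2 * (norm (?\<beta> \<omega>))\<^sup>2 + 6 * R * (norm (?\<beta> \<omega> - ?\<beta>' \<omega>))\<^sup>2 \<partial>M) =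
        2 * q\<^sup>2 * mean_sq M ?\<beta> + 6 * R * mean_sq M (\<lambda>\<omega>. ?\<beta> \<omega> - ?\<beta>' \<omega>)"
      using sq_integrableD(2)[OF ab(2)] sq_integrableD(2)[OF DB] by (simp add: mean_sq_def)
    then show "(\<integral>\<omega>. 2 * q\<^sup>2 * (norm (?\<beta> \<omega>))\<^sup>2 + 6 * R * (norm (?\<beta> \<omega> - ?\<beta>' \<omega>))\<^sup>2 \<partial>M) \<le> K\<^sub>Y * q\<^sup>2"
      using K[OF le(2) coefficient_diff(2)[OF g g' s q]] by simp
  qed
qed

end

section \<open>Measurability and noise bounds for vector-valued processes\<close>

lemma sq_integrable_nn_integralI:
  assumes f: "f \<in> borel_measurable M" and le: "(\<integral>\<^sup>+x. ennreal ((norm (f x))\<^sup>2) \<partial>M) \<le> ennreal c" and c: "0 \<le> c"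
  shows "sq_integrable M f" "mean_sq M f \<le> c"
proof -
  have m: "(\<lambda>x. (norm (f x))\<^sup>2) \<in> borel_measurable M" using f by measurable
  have "(\<integral>\<^sup>+x. ennreal ((norm (f x))\<^sup>2) \<partial>M) < \<infinity>" using le by (rule order.strict_trans1) simp
  then have "integrable M (\<lambda>x. (norm (f x))\<^sup>2)" by (intro integrableI_nonneg m) auto
  then show s: "sq_integrable M f" using f by (simp add: sq_integrable_def)
  show "mean_sq M f \<le> c" using le c unfolding nn_integral_mean_sq[OF s] by simp
qed

context filtered_prob_space
begin

lemma energy_rows:
  fixes H :: "real \<Rightarrow> 'w \<Rightarrow> real ^ 'm ^ 'k"
  assumes H: "\<And>i. progressive_on T (\<lambda>s \<omega>. H s \<omega> $ i)" and t: "t \<in> {0..T}"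
  shows "(\<Sum>i\<in>UNIV. energy t (\<lambda>s \<omega>. H s \<omega> $ i)) = energy t H"
proof -
  note [measurable] = cut_measurable[OF H t]
  have e: "ennreal ((norm (cut t H x))\<^sup>2) = (\<Sum>i\<in>UNIV. ennreal ((norm (cut t (\<lambda>s \<omega>. H s \<omega> $ i) x))\<^sup>2))" for x
    unfolding norm_matrix_sq[of "cut t H x"] by (subst sum_ennreal) (simp_all add: cut_def)
  show ?thesis unfolding energy_def e by (intro nn_integral_sum[symmetric]) measurable
qed

text \<open>A deterministic function viewed as a process, so that the estimates for random drifts
  apply to the equation for \<open>U\<close> as well.\<close>

lemma progressive_on_integrand:
  fixes g :: "real \<Rightarrow> 'b::euclidean_space"
  assumes g: "(\<lambda>s. indicator {0..T} s *\<^sub>R g s) \<in> borel_measurable borel"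
  shows "progressive_on T (\<lambda>s \<omega>. g s)"
  unfolding progressive_on_def
proof
  fix r assume r: "r \<in> {0..T}"
  let ?N = "restrict_space borel {0..r} \<Otimes>\<^sub>M F r"
  have "fst \<in> borel_measurable ?N"
    by (rule measurable_compose[OF measurable_fst]) (auto intro: measurable_restrict_space1)
  from measurable_compose[OF this g]
  have "(\<lambda>x. indicator {0..T} (fst x) *\<^sub>R g (fst x)) \<in> borel_measurable ?N" .
  moreover have "indicator {0..T} (fst x) *\<^sub>R g (fst x) = g (fst x)" if "x \<in> space ?N" for x
    using that r by (auto simp: space_pair_measure space_restrict_space)
  ultimately show "(\<lambda>x. g (fst x)) \<in> borel_measurable ?N" by (subst measurable_cong[symmetric])
qed

text \<open>Measurability in time of the expectations \<open>gram\<close> and \<open>cross\<close>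
  comes from Fubini's theorem in this form.\<close>

lemma expectation_measurable:
  fixes H :: "real \<Rightarrow> 'w \<Rightarrow> 'b::euclidean_space"
  assumes H: "progressive_on T H" and T: "0 \<le> T"
  shows "(\<lambda>s. indicator {0..T} s *\<^sub>R (\<integral>\<omega>. H s \<omega> \<partial>M)) \<in> borel_measurable borel"
    and "(\<lambda>s. indicator {0..T} s * mean_sq M (H s)) \<in> borel_measurable borel"
proof -
  have TT: "T \<in> {0..T}" using T by simp
  note [measurable] = cut_measurable[OF H TT]
  have "(\<lambda>s. \<integral>\<omega>. cut T H (s, \<omega>) \<partial>M) \<in> borel_measurable lborel" by measurable
  moreover have "(\<integral>\<omega>. cut T H (s, \<omega>) \<partial>M) = indicator {0..T} s *\<^sub>R (\<integral>\<omega>. H s \<omega> \<partial>M)" for s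
    by (simp add: cut_def)
  ultimately show "(\<lambda>s. indicator {0..T} s *\<^sub>R (\<integral>\<omega>. H s \<omega> \<partial>M)) \<in> borel_measurable borel" by simp
  have "(\<lambda>s. \<integral>\<omega>. (norm (cut T H (s, \<omega>)))\<^sup>2 \<partial>M) \<in> borel_measurable lborel" by measurable
  moreover have "(\<integral>\<omega>. (norm (cut T H (s, \<omega>)))\<^sup>2 \<partial>M) = indicator {0..T} s * mean_sq M (H s)" for s
    by (cases "s \<in> {0..T}") (auto simp: cut_def mean_sq_def)
  ultimately show "(\<lambda>s. indicator {0..T} s * mean_sq M (H s)) \<in> borel_measurable borel" by simp
qed

end

context continuous_brownian_motion
begin

text \<open>Rows are integrated separately and their energies add up to that of the matrix; the
  supremum of the sum of squares is at most the sum of the suprema.\<close>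

lemma noise_bounds:
  fixes H :: "real \<Rightarrow> 'w \<Rightarrow> real ^ 'm ^ 'k"
  assumes T: "0 < T" and X: "\<And>i. ito T (\<lambda>s \<omega>. H s \<omega> $ i) (X i)"
  shows "t \<in> {0..T} \<Longrightarrow> (\<lambda>\<omega>. \<chi> i. X i t \<omega>) \<in> borel_measurable (F t)"
    and "\<omega> \<in> space M \<Longrightarrow> continuous_on {0..T} (\<lambda>t. \<chi> i. X i t \<omega>)"
    and "t \<in> {0..T} \<Longrightarrow> (\<integral>\<^sup>+\<omega>. ennreal ((norm (\<chi> i. X i t \<omega>))\<^sup>2) \<partial>M) \<le> energy t H"
    and "(\<integral>\<^sup>+\<omega>. (SUP t\<in>{0..T}. ennreal ((norm (\<chi> i. X i t \<omega>))\<^sup>2)) \<partial>M) \<le> 4 * energy T H"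
proof -
  note mart = itoD(3)[OF X] and H = itoD(1)[OF X]
  show "(\<lambda>\<omega>. \<chi> i. X i t \<omega>) \<in> borel_measurable (F t)" if "t \<in> {0..T}"
    using L2_martingaleD(1)[OF mart that] by (subst borel_measurable_nth_iff) simp
  show "continuous_on {0..T} (\<lambda>t. \<chi> i. X i t \<omega>)" if "\<omega> \<in> space M"
    by (intro continuous_on_vec_lambda L2_martingaleD(4)[OF mart that])
  have n: "ennreal ((norm (\<chi> i. X i t \<omega>))\<^sup>2) = (\<Sum>i\<in>UNIV. ennreal ((norm (X i t \<omega>))\<^sup>2))" for t \<omega>
    by (subst sum_ennreal) (simp_all add: norm_matrix_sq)
  show "(\<integral>\<^sup>+\<omega>. ennreal ((norm (\<chi> i. X i t \<omega>))\<^sup>2) \<partial>M) \<le> energy t H" if t: "t \<in> {0..T}"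
  proof -
    have "(\<integral>\<^sup>+\<omega>. ennreal ((norm (\<chi> i. X i t \<omega>))\<^sup>2) \<partial>M) = (\<Sum>i\<in>UNIV. \<integral>\<^sup>+\<omega>. ennreal ((norm (X i t \<omega>))\<^sup>2) \<partial>M)"
      unfolding n
    proof (rule nn_integral_sum)
      show "(\<lambda>\<omega>. ennreal ((norm (X i t \<omega>))\<^sup>2)) \<in> borel_measurable M" for i
        using L2_martingaleD(2)[OF mart[of i] t] by measurable
    qed
    also have "\<dots> \<le> (\<Sum>i\<in>UNIV. energy t (\<lambda>s \<omega>. H s \<omega> $ i))"
      by (intro sum_mono ito_isometry[OF T X t])
    finally show ?thesis unfolding energy_rows[OF H t] .
  qed
  have "(\<integral>\<^sup>+\<omega>. (SUP t\<in>{0..T}. ennreal ((norm (\<chi> i. X i t \<omega>))\<^sup>2)) \<partial>M) \<le>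
      (\<integral>\<^sup>+\<omega>. (\<Sum>i\<in>UNIV. SUP t\<in>{0..T}. ennreal ((norm (X i t \<omega>))\<^sup>2)) \<partial>M)"
    unfolding n by (intro nn_integral_mono SUP_least sum_mono SUP_upper)
  also have "\<dots> = (\<Sum>i\<in>UNIV. \<integral>\<^sup>+\<omega>. (SUP t\<in>{0..T}. ennreal ((norm (X i t \<omega>))\<^sup>2)) \<partial>M)"
    using T by (intro nn_integral_sum SUP_sq_measurable L2_martingaleD(2,4)[OF mart]) auto
  also have "\<dots> \<le> (\<Sum>i\<in>UNIV. 4 * energy T (\<lambda>s \<omega>. H s \<omega> $ i))"
    by (intro sum_mono ito_maximal[OF T X])
  also have "\<dots> = 4 * energy T H"
    using T by (simp add: sum_distrib_left[symmetric] energy_rows[OF H])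
  finally show "(\<integral>\<^sup>+\<omega>. (SUP t\<in>{0..T}. ennreal ((norm (\<chi> i. X i t \<omega>))\<^sup>2)) \<partial>M) \<le> 4 * energy T H" .
qed

end

section \<open>The Picard map\<close>

context DO_setting
begin

text \<open>Continuity holds for every outcome and not just almost surely, so the path integrals
  below exist without exceptional sets.\<close>

definition admissible :: "(real \<Rightarrow> real ^ 'd ^ 'r) \<Rightarrow> (real \<Rightarrow> 'w \<Rightarrow> real ^ 'r) \<Rightarrow> bool" where
  "admissible V Z \<longleftrightarrow> continuous_on {0..\<delta>} V \<and> (\<forall>t\<in>{0..\<delta>}. Z t \<in> borel_measurable (F t)) \<and>
    (\<forall>\<omega>\<in>space M. continuous_on {0..\<delta>} (\<lambda>t. Z t \<omega>)) \<and> (\<forall>t\<in>{0..\<delta>}. good (V t) (Z t))"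

definition drift :: "(real \<Rightarrow> real ^ 'd ^ 'r) \<Rightarrow> (real \<Rightarrow> 'w \<Rightarrow> real ^ 'r) \<Rightarrow> real \<Rightarrow> 'w \<Rightarrow> real ^ 'r" where
  "drift V Z s \<omega> = V s *v a s (transpose (V s) *v Z s \<omega>)"

definition diffusion :: "(real \<Rightarrow> real ^ 'd ^ 'r) \<Rightarrow> (real \<Rightarrow> 'w \<Rightarrow> real ^ 'r) \<Rightarrow> real \<Rightarrow> 'w \<Rightarrow> real ^ 'm ^ 'r" where
  "diffusion V Z s \<omega> = V s ** b s (transpose (V s) *v Z s \<omega>)"

text \<open>A relation and not a function, because \<open>ito\<close> fixes the integral only up to
  null sets. The formula for \<open>Z'\<close> nevertheless holds at every outcome.\<close>

definition picard_step :: "(real \<Rightarrow> real ^ 'd ^ 'r) \<Rightarrow> (real \<Rightarrow> 'w \<Rightarrow> real ^ 'r) \<Rightarrow>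
    (real \<Rightarrow> real ^ 'd ^ 'r) \<Rightarrow> (real \<Rightarrow> 'w \<Rightarrow> real ^ 'r) \<Rightarrow> bool" where
  "picard_step V Z V' Z' \<longleftrightarrow>
    (\<forall>t\<in>{0..\<delta>}. V' t = \<phi> + integral {0..t} (\<lambda>s. G s (V s) (Z s))) \<and>
    (\<exists>X. (\<forall>i. ito \<delta> (\<lambda>s \<omega>. diffusion V Z s \<omega> $ i) (X i)) \<and>
      (\<forall>t\<in>{0..\<delta>}. \<forall>\<omega>\<in>space M. Z' t \<omega> =
        \<xi> \<omega> + ((LINT s:{0..t}|lborel. drift V Z s \<omega>) + (\<chi> i. X i t \<omega>))))"

lemma admissibleD:
  assumes "admissible V Z"
  shows "continuous_on {0..\<delta>} V" "t \<in> {0..\<delta>} \<Longrightarrow> Z t \<in> borel_measurable (F t)"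
    "\<omega> \<in> space M \<Longrightarrow> continuous_on {0..\<delta>} (\<lambda>t. Z t \<omega>)" "t \<in> {0..\<delta>} \<Longrightarrow> good (V t) (Z t)"
    "t \<in> {0..\<delta>} \<Longrightarrow> sq_integrable M (Z t)"
  using assms unfolding admissible_def good_def by blast+

lemma delta_in: "\<delta> \<in> {0..\<delta>}" "0 \<le> \<delta>"
  using delta_props(1) by auto

lemma admissible_progressive:
  assumes A: "admissible V Z"
  shows "progressive_on \<delta> Z" "progressive_on \<delta> (\<lambda>s \<omega>. a s (transpose (V s) *v Z s \<omega>))"
    "progressive_on \<delta> (drift V Z)" "progressive_on \<delta> (diffusion V Z)"
    "progressive_on \<delta> (\<lambda>s \<omega>. diffusion V Z s \<omega> $ i)"
proof -
  show Z: "progressive_on \<delta> Z"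
    by (intro progressive_on_adapted_continuous admissibleD[OF A])
  have V: "progressive_on \<delta> (\<lambda>s \<omega>. V s)" by (intro progressive_on_deterministic admissibleD[OF A])
  have X: "progressive_on \<delta> (\<lambda>s \<omega>. transpose (V s) *v Z s \<omega>)"
    by (rule progressive_on_continuous2[OF V Z continuous_matrix_ops(3)])
  show a: "progressive_on \<delta> (\<lambda>s \<omega>. a s (transpose (V s) *v Z s \<omega>))"
    by (rule progressive_on_compose[OF X a_meas])
  have b: "progressive_on \<delta> (\<lambda>s \<omega>. b s (transpose (V s) *v Z s \<omega>))"
    by (rule progressive_on_compose[OF X b_meas])
  show "progressive_on \<delta> (drift V Z)"
    unfolding drift_def by (rule progressive_on_continuous2[OF V a continuous_matrix_ops(2)])
  show d: "progressive_on \<delta> (diffusion V Z)"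
    unfolding diffusion_def by (rule progressive_on_continuous2[OF V b continuous_matrix_ops(4)])
  show "progressive_on \<delta> (\<lambda>s \<omega>. diffusion V Z s \<omega> $ i)"
    by (rule progressive_on_continuous1[OF d]) (intro continuous_intros)
qed

lemma admissible_initial: "admissible (\<lambda>_. \<phi>) (\<lambda>_. \<xi>)"
  unfolding admissible_def good_def
  using eta_props(1) xi_sq measurable_F_mono[OF xi_meas order_refl]
  by (auto simp: mean_sq_def)

text \<open>A single path of \<open>Z\<close> is bounded by compactness, and linear growth then
  bounds the drift along it.\<close>

lemma drift_integrable:
  assumes A: "admissible V Z" and w: "\<omega> \<in> space M"
  shows "set_integrable lborel {0..\<delta>} (\<lambda>s. drift V Z s \<omega>)"
proof -
  obtain c where c: "\<And>s. s \<in> {0..\<delta>} \<Longrightarrow> norm (Z s \<omega>) \<le> c"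
    using continuous_on_Icc_bounded[OF admissibleD(3)[OF A w]] by blast
  show ?thesis
  proof (rule set_integrable_bounded)
    show "(\<lambda>s. indicator {0..\<delta>} s *\<^sub>R drift V Z s \<omega>) \<in> borel_measurable borel"
      by (rule cut_section_measurable[OF admissible_progressive(3)[OF A] delta_in(1) w])
    fix s assume s: "s \<in> {0..\<delta>}"
    then have V: "norm (V s - \<phi>) \<le> \<eta>" and s0: "0 \<le> s" using admissibleD(4)[OF A s] by (auto simp: good_def)
    have "(norm (drift V Z s \<omega>))\<^sup>2 \<le> (norm (V s) * norm (a s (transpose (V s) *v Z s \<omega>)))\<^sup>2"
      unfolding drift_def by (intro power_mono norm_matrix_vector_le) simp
    also have "\<dots> \<le> 3 * R * (C * (1 + 3 * R * c\<^sup>2))"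
      unfolding power_mult_distrib
    proof (rule mult_mono[OF V_bounds(1)[OF V]])
      have "(norm (a s (transpose (V s) *v Z s \<omega>)))\<^sup>2 \<le> C * (1 + 3 * R * (norm (Z s \<omega>))\<^sup>2)"
        using ab_growth[OF s0 V, of "Z s \<omega>"] zero_le_power2[of "norm (b s (transpose (V s) *v Z s \<omega>))"] by linarith
      also have "\<dots> \<le> C * (1 + 3 * R * c\<^sup>2)"
        using c[OF s] C_pos R_ge_1 by (intro mult_left_mono add_left_mono power_mono) auto
      finally show "(norm (a s (transpose (V s) *v Z s \<omega>)))\<^sup>2 \<le> C * (1 + 3 * R * c\<^sup>2)" .
    qed (use R_ge_1 in auto)
    finally show "norm (drift V Z s \<omega>) \<le> sqrt (3 * R * (C * (1 + 3 * R * c\<^sup>2)))" by (rule real_le_rsqrt)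
  qed
qed

lemma G_measurable:
  assumes A: "admissible V Z"
  shows "(\<lambda>s. indicator {0..\<delta>} s *\<^sub>R G s (V s) (Z s)) \<in> borel_measurable borel"
proof -
  note Z = admissible_progressive(1)[OF A] and a = admissible_progressive(2)[OF A]
  have cr: "(\<lambda>s. indicator {0..\<delta>} s *\<^sub>R cross s (V s) (Z s)) \<in> borel_measurable borel"
    unfolding cross_def
    by (rule expectation_measurable(1)[OF progressive_on_continuous2[OF Z a continuous_matrix_ops(1)] delta_in(2)])
  have gr: "(\<lambda>s. indicator {0..\<delta>} s *\<^sub>R gram M (Z s)) \<in> borel_measurable borel"
    unfolding gram_def
    by (rule expectation_measurable(1)[OF progressive_on_continuous2[OF Z Z continuous_matrix_ops(1)] delta_in(2)])
  have V: "(\<lambda>s. indicator {0..\<delta>} s *\<^sub>R V s) \<in> borel_measurable borel"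
    by (rule borel_measurable_continuous_on_indicator[OF _ admissibleD(1)[OF A]]) simp
  \<comment> \<open>Outside the interval the identity matrix is put in, so that every matrix to be
    inverted is invertible.\<close>
  define A' where "A' s = indicator {0..\<delta>} s *\<^sub>R gram M (Z s) + indicator (- {0..\<delta>}) s *\<^sub>R mat 1" for s
  have "A' \<in> borel_measurable borel"
    unfolding A'_def by (intro borel_measurable_add gr borel_measurable_scaleR borel_measurable_indicator borel_measurable_const) simp
  moreover have "invertible (A' s)" for s
  proof (cases "s \<in> {0..\<delta>}")
    case True
    then show ?thesis using good_gram(1)[OF admissibleD(4)[OF A True]] by (simp add: A'_def)
  next
    case False
    then show ?thesis by (simp add: A'_def indicator_def invertible_def del: atLeastAtMost_iff)
  qed
  ultimately have inv: "(\<lambda>s. matrix_inv (A' s)) \<in> borel_measurable borel" by (intro matrix_inv_measurable)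
  have "continuous_on UNIV (\<lambda>V. Pi V)"
    unfolding Pi_def mat_def matrix_matrix_mult_def transpose_def
    by (auto intro!: continuous_intros continuous_on_vec_lambda)
  from measurable_compose[OF V borel_measurable_continuous_onI[OF this]]
  have pi: "(\<lambda>s. Pi (indicator {0..\<delta>} s *\<^sub>R V s)) \<in> borel_measurable borel" .
  have "(\<lambda>s. (indicator {0..\<delta>} s *\<^sub>R cross s (V s) (Z s)) ** Pi (indicator {0..\<delta>} s *\<^sub>R V s)) \<in> borel_measurable borel"
    by (rule borel_measurable_continuous_Pair[OF cr pi continuous_matrix_ops(4)])
  from borel_measurable_continuous_Pair[OF inv this continuous_matrix_ops(4)]
  have "(\<lambda>s. indicator {0..\<delta>} s *\<^sub>R (matrix_inv (A' s) **
      ((indicator {0..\<delta>} s *\<^sub>R cross s (V s) (Z s)) ** Pi (indicator {0..\<delta>} s *\<^sub>R V s)))) \<in> borel_measurable borel"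
    by (intro borel_measurable_scaleR borel_measurable_indicator) auto
  moreover have "indicator {0..\<delta>} s *\<^sub>R (matrix_inv (A' s) **
      ((indicator {0..\<delta>} s *\<^sub>R cross s (V s) (Z s)) ** Pi (indicator {0..\<delta>} s *\<^sub>R V s))) =
      indicator {0..\<delta>} s *\<^sub>R G s (V s) (Z s)" for s
    by (cases "s \<in> {0..\<delta>}") (simp_all add: A'_def G_def)
  ultimately show ?thesis by simp
qed

definition G\<^sub>0 :: real where "G\<^sub>0 = 2 * \<gamma> * (sqrt m * sqrt \<Lambda>)"

lemma G0_nonneg: "0 \<le> G\<^sub>0"
  unfolding G\<^sub>0_def using gamma(2) m_ge_1 Lambda_pos by simp

lemma G_admissible:
  assumes A: "admissible V Z"
  shows "s \<in> {0..\<delta>} \<Longrightarrow> norm (G s (V s) (Z s)) \<le> G\<^sub>0"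
    and "set_integrable lborel {0..\<delta>} (\<lambda>s. G s (V s) (Z s))" "(\<lambda>s. G s (V s) (Z s)) integrable_on {0..\<delta>}"
proof -
  show b: "norm (G s (V s) (Z s)) \<le> G\<^sub>0" if "s \<in> {0..\<delta>}" for s
    unfolding G\<^sub>0_def using that by (intro G_bound[OF admissibleD(4)[OF A that]]) simp
  show i: "set_integrable lborel {0..\<delta>} (\<lambda>s. G s (V s) (Z s))"
    by (rule set_integrable_bounded[OF G_measurable[OF A] b])
  show "(\<lambda>s. G s (V s) (Z s)) integrable_on {0..\<delta>}" by (rule set_borel_integral_eq_integral(1)[OF i])
qed

lemma energy_drift_diffusion:
  assumes A: "admissible V Z" and t: "t \<in> {0..\<delta>}"
  shows "energy t (drift V Z) + energy t (diffusion V Z) \<le> ennreal (3 * R * \<Lambda> * t)"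
proof -
  note p = admissible_progressive(3,4)[OF A]
  note [measurable] = cut_measurable[OF p(1) t] cut_measurable[OF p(2) t]
  have "energy t (drift V Z) + energy t (diffusion V Z) =
      (\<integral>\<^sup>+x. ennreal ((norm (cut t (drift V Z) x))\<^sup>2) + ennreal ((norm (cut t (diffusion V Z) x))\<^sup>2) \<partial>(lborel \<Otimes>\<^sub>M M))"
    unfolding energy_def by (rule nn_integral_add[symmetric]) measurable
  also have "\<dots> = (\<integral>\<^sup>+s. (\<integral>\<^sup>+\<omega>. ennreal ((norm (cut t (drift V Z) (s, \<omega>)))\<^sup>2) +
      ennreal ((norm (cut t (diffusion V Z) (s, \<omega>)))\<^sup>2) \<partial>M) \<partial>lborel)"
    by (rule nn_integral_fst[symmetric]) measurable
  also have "\<dots> \<le> (\<integral>\<^sup>+s. ennreal (3 * R * \<Lambda>) * indicator {0..t} s \<partial>lborel)"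
  proof (rule nn_integral_mono)
    fix s
    show "(\<integral>\<^sup>+\<omega>. ennreal ((norm (cut t (drift V Z) (s, \<omega>)))\<^sup>2) +
      ennreal ((norm (cut t (diffusion V Z) (s, \<omega>)))\<^sup>2) \<partial>M) \<le> ennreal (3 * R * \<Lambda>) * indicator {0..t} s"
    proof (cases "s \<in> {0..t}")
      case True
      then have s: "s \<in> {0..\<delta>}" "0 \<le> s" using t by auto
      note r = reduced_bound[OF admissibleD(4)[OF A s(1)] s(2)]
      note [measurable] = sq_integrableD(1)[OF r(2)] sq_integrableD(1)[OF r(3)]
      have "(\<integral>\<^sup>+\<omega>. ennreal ((norm (cut t (drift V Z) (s, \<omega>)))\<^sup>2) + ennreal ((norm (cut t (diffusion V Z) (s, \<omega>)))\<^sup>2) \<partial>M) =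
          (\<integral>\<^sup>+\<omega>. ennreal ((norm (V s *v a s (transpose (V s) *v Z s \<omega>)))\<^sup>2) + ennreal ((norm (V s ** b s (transpose (V s) *v Z s \<omega>)))\<^sup>2) \<partial>M)"
        using True by (simp add: cut_def drift_def diffusion_def)
      also have "\<dots> = ennreal (mean_sq M (\<lambda>\<omega>. V s *v a s (transpose (V s) *v Z s \<omega>))) + ennreal (mean_sq M (\<lambda>\<omega>. V s ** b s (transpose (V s) *v Z s \<omega>)))"
        unfolding nn_integral_mean_sq[OF r(2), symmetric] nn_integral_mean_sq[OF r(3), symmetric]
        by (rule nn_integral_add) measurable
      also have "\<dots> \<le> ennreal (3 * R * \<Lambda>)"
        using r(1) by (simp add: ennreal_plus[symmetric] ennreal_leI del: ennreal_plus)
      finally show ?thesis using True by simp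
    next
      case False
      then show ?thesis by (simp add: cut_def indicator_def del: atLeastAtMost_iff)
    qed
  qed
  also have "\<dots> = ennreal (3 * R * \<Lambda>) * ennreal t"
    using t by (subst nn_integral_cmult_indicator) auto
  also have "\<dots> = ennreal (3 * R * \<Lambda> * t)"
    using R_ge_1 Lambda_pos t by (intro ennreal_mult[symmetric]) auto
  finally show ?thesis .
qed

lemma picard_step_exists:
  assumes A: "admissible V Z"
  shows "\<exists>V' Z'. picard_step V Z V' Z'"
proof -
  have "\<exists>X. ito \<delta> (\<lambda>s \<omega>. diffusion V Z s \<omega> $ i) X" for i
  proof (rule ito_exists[OF delta_props(1) admissible_progressive(5)[OF A]])
    have "energy \<delta> (\<lambda>s \<omega>. diffusion V Z s \<omega> $ i) \<le> energy \<delta> (diffusion V Z)"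
      by (rule energy_mono) (rule Finite_Cartesian_Product.norm_nth_le)
    also have "\<dots> \<le> energy \<delta> (drift V Z) + energy \<delta> (diffusion V Z)" by simp
    also have "\<dots> \<le> ennreal (3 * R * \<Lambda> * \<delta>)" by (rule energy_drift_diffusion[OF A delta_in(1)])
    also have "\<dots> < \<infinity>" by simp
    finally show "energy \<delta> (\<lambda>s \<omega>. diffusion V Z s \<omega> $ i) < \<infinity>" .
  qed
  then have "\<forall>i. \<exists>X. ito \<delta> (\<lambda>s \<omega>. diffusion V Z s \<omega> $ i) X" by blast
  from choice[OF this] obtain X where X: "\<forall>i. ito \<delta> (\<lambda>s \<omega>. diffusion V Z s \<omega> $ i) (X i)" ..
  show ?thesis
    unfolding picard_step_def
    by (intro exI[of _ "\<lambda>t. \<phi> + integral {0..t} (\<lambda>s. G s (V s) (Z s))"]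
        exI[of _ "\<lambda>t \<omega>. \<xi> \<omega> + ((LINT s:{0..t}|lborel. drift V Z s \<omega>) + (\<chi> i. X i t \<omega>))"] conjI exI[of _ X] X)
      auto
qed

text \<open>Closed balls are sent into open ones. The mean square bound is proportional to
  \<open>t\<close>; at \<open>t = 0\<close> it yields the initial condition.\<close>

lemma picard_step_strict:
  assumes A: "admissible V Z" and S: "picard_step V Z V' Z'" and t: "t \<in> {0..\<delta>}"
  shows "norm (V' t - \<phi>) < \<eta>" "Z' t \<in> borel_measurable (F t)"
    "sq_integrable M (\<lambda>\<omega>. Z' t \<omega> - \<xi> \<omega>)" "mean_sq M (\<lambda>\<omega>. Z' t \<omega> - \<xi> \<omega>) \<le> 6 * R * \<Lambda> * t"
proof -
  obtain X where X: "\<And>t. t \<in> {0..\<delta>} \<Longrightarrow> V' t = \<phi> + integral {0..t} (\<lambda>s. G s (V s) (Z s))"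
    "\<And>i. ito \<delta> (\<lambda>s \<omega>. diffusion V Z s \<omega> $ i) (X i)"
    "\<And>t \<omega>. t \<in> {0..\<delta>} \<Longrightarrow> \<omega> \<in> space M \<Longrightarrow>
      Z' t \<omega> = \<xi> \<omega> + ((LINT s:{0..t}|lborel. drift V Z s \<omega>) + (\<chi> i. X i t \<omega>))"
    using S unfolding picard_step_def by blast
  have t': "0 \<le> t" "t \<le> \<delta>" "t \<le> 1" using t delta_props(2) by auto
  have "norm (V' t - \<phi>) = norm (integral {0..t} (\<lambda>s. G s (V s) (Z s)))" using X(1)[OF t] by simp
  also have "\<dots> \<le> G\<^sub>0 * (t - 0)"
    by (rule integral_lipschitz(2)[OF G_admissible(3)[OF A] G_admissible(1)[OF A]]) (use t' in auto)
  also have "\<dots> \<le> G\<^sub>0 * \<delta>" using t' G0_nonneg by (simp add: mult_left_mono)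
  finally have le: "norm (V' t - \<phi>) \<le> G\<^sub>0 * \<delta>" .
  \<comment> \<open>One factor \<open>\<delta>\<close> is removed by
    \<open>\<delta> \<le> 1\<close>; the other is matched by the last quotient of the minimum, with
    a factor 2 to spare.\<close>
  have "(G\<^sub>0 * \<delta>)\<^sup>2 = (4 * \<gamma>\<^sup>2 * m * \<Lambda> * \<delta>) * \<delta>"
    unfolding G\<^sub>0_def using m_ge_1 Lambda_pos by (simp add: power_mult_distrib power2_eq_square[of \<delta>] mult_ac)
  also have "\<dots> \<le> (4 * \<gamma>\<^sup>2 * m * \<Lambda> * \<delta>) * 1"
    using delta_props m_ge_1 Lambda_pos by (intro mult_left_mono) auto
  also have "\<dots> \<le> \<eta>\<^sup>2 / 2" using delta_props(5) by (simp add: mult_ac)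
  also have "\<dots> < \<eta>\<^sup>2" using eta_props(1) by simp
  finally have "G\<^sub>0 * \<delta> < \<eta>" using eta_props(1) by (intro power2_less_imp_less[of "G\<^sub>0 * \<delta>" \<eta>]) auto
  with le show "norm (V' t - \<phi>) < \<eta>" by linarith
  let ?D = "\<lambda>\<omega>. LINT s:{0..t}|lborel. drift V Z s \<omega>" and ?N = "\<lambda>\<omega>. \<chi> i. X i t \<omega>"
  have Dm: "?D \<in> borel_measurable (F t)"
    by (rule drift_adapted_continuous(1)[OF admissible_progressive(3)[OF A] drift_integrable[OF A] t])
  have Nm: "?N \<in> borel_measurable (F t)" by (rule noise_bounds(1)[OF delta_props(1) X(2) t])
  have "(\<lambda>\<omega>. \<xi> \<omega> + (?D \<omega> + ?N \<omega>)) \<in> borel_measurable (F t)"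
    by (intro borel_measurable_add Dm Nm measurable_F_mono[OF xi_meas order_refl t'(1)])
  then show m: "Z' t \<in> borel_measurable (F t)"
    by (rule measurable_cong[THEN iffD1, rotated]) (use X(3)[OF t] t' in simp)
  have DM: "?D \<in> borel_measurable M" "?N \<in> borel_measurable M"
    by (intro measurable_F_M[OF Dm t'(1)] measurable_F_M[OF Nm t'(1)])+
  have "(\<integral>\<^sup>+\<omega>. ennreal ((norm (Z' t \<omega> - \<xi> \<omega>))\<^sup>2) \<partial>M) = (\<integral>\<^sup>+\<omega>. ennreal ((norm (?D \<omega> + ?N \<omega>))\<^sup>2) \<partial>M)"
    by (intro nn_integral_cong) (simp add: X(3)[OF t])
  also have "\<dots> \<le> 2 * (\<integral>\<^sup>+\<omega>. ennreal ((norm (?D \<omega>))\<^sup>2) \<partial>M) + 2 * (\<integral>\<^sup>+\<omega>. ennreal ((norm (?N \<omega>))\<^sup>2) \<partial>M)"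
    by (rule nn_integral_sq_add_le[OF DM])
  \<comment> \<open>Since \<open>t \<le> 1\<close>, the factor \<open>t\<close> from Cauchy-Schwarz
    disappears and drift and noise enter with equal weights, as the joint energy bound
    needs.\<close>
  also have "\<dots> \<le> 2 * (1 * energy t (drift V Z)) + 2 * energy t (diffusion V Z)"
  proof (intro add_mono mult_left_mono)
    have "ennreal t * energy t (drift V Z) \<le> 1 * energy t (drift V Z)"
      using t' by (intro mult_right_mono) (auto simp: ennreal_le_1)
    with drift_mean_sq_le[OF admissible_progressive(3)[OF A] t]
    show "(\<integral>\<^sup>+\<omega>. ennreal ((norm (?D \<omega>))\<^sup>2) \<partial>M) \<le> 1 * energy t (drift V Z)" by (rule order_trans)
    show "(\<integral>\<^sup>+\<omega>. ennreal ((norm (?N \<omega>))\<^sup>2) \<partial>M) \<le> energy t (diffusion V Z)"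
      by (rule noise_bounds(3)[OF delta_props(1) X(2) t])
  qed auto
  also have "\<dots> = 2 * (energy t (drift V Z) + energy t (diffusion V Z))" by (simp add: distrib_left)
  also have "\<dots> \<le> 2 * ennreal (3 * R * \<Lambda> * t)" by (intro mult_left_mono energy_drift_diffusion[OF A t]) simp
  also have "\<dots> = ennreal (6 * R * \<Lambda> * t)"
    using ennreal_mult[of 2 "3 * R * \<Lambda> * t"] R_ge_1 Lambda_pos t' by (simp add: mult.assoc)
  finally have le: "(\<integral>\<^sup>+\<omega>. ennreal ((norm (Z' t \<omega> - \<xi> \<omega>))\<^sup>2) \<partial>M) \<le> ennreal (6 * R * \<Lambda> * t)" .
  have dm: "(\<lambda>\<omega>. Z' t \<omega> - \<xi> \<omega>) \<in> borel_measurable M"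
    by (intro borel_measurable_diff measurable_F_M[OF m t'(1)] measurable_F_M[OF xi_meas]) simp
  have "0 \<le> 6 * R * \<Lambda> * t" using R_ge_1 Lambda_pos t' by simp
  then show "sq_integrable M (\<lambda>\<omega>. Z' t \<omega> - \<xi> \<omega>)" "mean_sq M (\<lambda>\<omega>. Z' t \<omega> - \<xi> \<omega>) \<le> 6 * R * \<Lambda> * t"
    by (rule sq_integrable_nn_integralI[OF dm le])+
qed

lemma picard_step_mean_sq_less:
  assumes A: "admissible V Z" and S: "picard_step V Z V' Z'" and t: "t \<in> {0..\<delta>}"
  shows "mean_sq M (\<lambda>\<omega>. Z' t \<omega> - \<xi> \<omega>) < \<eta>\<^sup>2"
proof -
  have "6 * R * \<Lambda> * t \<le> 6 * R * \<Lambda> * \<delta>" using R_ge_1 Lambda_pos t by (intro mult_left_mono) auto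
  also have "\<dots> \<le> \<eta>\<^sup>2 / 6" using delta_props(4) by (simp add: mult_ac)
  also have "\<dots> < \<eta>\<^sup>2" using eta_props(1) by simp
  finally show ?thesis using picard_step_strict(4)[OF assms] by linarith
qed

lemma picard_step_admissible:
  assumes A: "admissible V Z" and S: "picard_step V Z V' Z'"
  shows "admissible V' Z'"
  unfolding admissible_def
proof (intro conjI ballI)
  obtain X where X: "\<And>t. t \<in> {0..\<delta>} \<Longrightarrow> V' t = \<phi> + integral {0..t} (\<lambda>s. G s (V s) (Z s))"
    "\<And>i. ito \<delta> (\<lambda>s \<omega>. diffusion V Z s \<omega> $ i) (X i)"
    "\<And>t \<omega>. t \<in> {0..\<delta>} \<Longrightarrow> \<omega> \<in> space M \<Longrightarrow>
      Z' t \<omega> = \<xi> \<omega> + ((LINT s:{0..t}|lborel. drift V Z s \<omega>) + (\<chi> i. X i t \<omega>))"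
    using S unfolding picard_step_def by blast
  have "continuous_on {0..\<delta>} (\<lambda>t. \<phi> + integral {0..t} (\<lambda>s. G s (V s) (Z s)))"
    by (intro continuous_intros indefinite_integral_continuous_1 G_admissible(3)[OF A])
  then show "continuous_on {0..\<delta>} V'" by (rule continuous_on_cong[THEN iffD1, rotated 2]) (auto simp: X(1))
  show "Z' t \<in> borel_measurable (F t)" if "t \<in> {0..\<delta>}" for t by (rule picard_step_strict(2)[OF A S that])
  show "continuous_on {0..\<delta>} (\<lambda>t. Z' t \<omega>)" if w: "\<omega> \<in> space M" for \<omega>
  proof -
    have "continuous_on {0..\<delta>} (\<lambda>t. \<xi> \<omega> + ((LINT s:{0..t}|lborel. drift V Z s \<omega>) + (\<chi> i. X i t \<omega>)))"
      by (intro continuous_on_add continuous_on_const noise_bounds(2)[OF delta_props(1) X(2) w]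
          drift_adapted_continuous(2)[OF admissible_progressive(3)[OF A] drift_integrable[OF A] w])
    then show ?thesis by (rule continuous_on_cong[THEN iffD1, rotated 2]) (auto simp: X(3) w)
  qed
  fix t assume t: "t \<in> {0..\<delta>}"
  note st = picard_step_strict[OF A S t]
  have "sq_integrable M (\<lambda>\<omega>. (Z' t \<omega> - \<xi> \<omega>) + \<xi> \<omega>)" by (rule sq_integrable_add(1)[OF st(3) xi_sq])
  then show "good (V' t) (Z' t)"
    unfolding good_def using st(1) picard_step_mean_sq_less[OF A S t] by simp
qed

text \<open>Three summands cost the factor 3, Doob's inequality 4, and the energies together are at
  most \<open>3 * R * \<Lambda> * \<delta>\<close>: this is the 36 in
  \<open>DO_delta\<close>.\<close>

lemma picard_step_sup:
  assumes A: "admissible V Z" and S: "picard_step V Z V' Z'"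
  shows "(\<integral>\<^sup>+\<omega>. (SUP t\<in>{0..\<delta>}. ennreal ((norm (Z' t \<omega>))\<^sup>2)) \<partial>M) \<le> ennreal (3 * \<rho>\<^sup>2 + 1)"
proof -
  obtain X where "\<And>t. t \<in> {0..\<delta>} \<Longrightarrow> V' t = \<phi> + integral {0..t} (\<lambda>s. G s (V s) (Z s))"
    and X: "\<And>i. ito \<delta> (\<lambda>s \<omega>. diffusion V Z s \<omega> $ i) (X i)"
    "\<And>t \<omega>. t \<in> {0..\<delta>} \<Longrightarrow> \<omega> \<in> space M \<Longrightarrow>
      Z' t \<omega> = \<xi> \<omega> + ((LINT s:{0..t}|lborel. drift V Z s \<omega>) + (\<chi> i. X i t \<omega>))"
    using S unfolding picard_step_def by blast
  let ?D = "\<lambda>t \<omega>. LINT s:{0..t}|lborel. drift V Z s \<omega>" and ?N = "\<lambda>t \<omega>. \<chi> i. X i t \<omega>"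
  define SD where "SD \<omega> = (SUP t\<in>{0..\<delta>}. ennreal ((norm (?D t \<omega>))\<^sup>2))" for \<omega>
  define SN where "SN \<omega> = (SUP t\<in>{0..\<delta>}. ennreal ((norm (?N t \<omega>))\<^sup>2))" for \<omega>
  note p = admissible_progressive(3)[OF A] drift_integrable[OF A]
  have [measurable]: "SD \<in> borel_measurable M"
    unfolding SD_def[abs_def]
    by (intro SUP_sq_measurable delta_in measurable_F_M[OF drift_adapted_continuous(1)[OF p]] drift_adapted_continuous(2)[OF p]) auto
  have [measurable]: "SN \<in> borel_measurable M"
    unfolding SN_def[abs_def]
    by (intro SUP_sq_measurable delta_in measurable_F_M[OF noise_bounds(1)[OF delta_props(1) X(1)]] noise_bounds(2)[OF delta_props(1) X(1)]) auto
  have [measurable]: "\<xi> \<in> borel_measurable M" by (rule sq_integrableD(1)[OF xi_sq])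
  have three: "(norm (x + (y + z)))\<^sup>2 \<le> 3 * (norm x)\<^sup>2 + (3 * (norm y)\<^sup>2 + 3 * (norm z)\<^sup>2)" for x y z :: "real ^ 'r"
  proof -
    have "norm (x + (y + z)) \<le> norm x + norm y + norm z"
      using norm_triangle_ineq[of x "y + z"] norm_triangle_ineq[of y z] by linarith
    then have "(norm (x + (y + z)))\<^sup>2 \<le> (norm x + norm y + norm z)\<^sup>2" by (intro power_mono) auto
    also have "\<dots> \<le> 3 * (norm x)\<^sup>2 + (3 * (norm y)\<^sup>2 + 3 * (norm z)\<^sup>2)"
      using zero_le_power2[of "norm x - norm y"] zero_le_power2[of "norm x - norm z"] zero_le_power2[of "norm y - norm z"]
      by (simp add: power2_eq_square algebra_simps)
    finally show ?thesis .
  qed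
  have "(\<integral>\<^sup>+\<omega>. (SUP t\<in>{0..\<delta>}. ennreal ((norm (Z' t \<omega>))\<^sup>2)) \<partial>M) \<le>
      (\<integral>\<^sup>+\<omega>. 3 * ennreal ((norm (\<xi> \<omega>))\<^sup>2) + (3 * SD \<omega> + 3 * SN \<omega>) \<partial>M)"
  proof (intro nn_integral_mono SUP_least)
    fix \<omega> t assume w: "\<omega> \<in> space M" and t: "t \<in> {0..\<delta>}"
    have "ennreal ((norm (Z' t \<omega>))\<^sup>2) \<le> ennreal (3 * (norm (\<xi> \<omega>))\<^sup>2 + (3 * (norm (?D t \<omega>))\<^sup>2 + 3 * (norm (?N t \<omega>))\<^sup>2))"
      unfolding X(2)[OF t w] by (intro ennreal_leI three)
    also have "\<dots> = 3 * ennreal ((norm (\<xi> \<omega>))\<^sup>2) + (3 * ennreal ((norm (?D t \<omega>))\<^sup>2) + 3 * ennreal ((norm (?N t \<omega>))\<^sup>2))"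
      by (simp add: ennreal_plus ennreal_mult')
    also have "\<dots> \<le> 3 * ennreal ((norm (\<xi> \<omega>))\<^sup>2) + (3 * SD \<omega> + 3 * SN \<omega>)"
      unfolding SD_def SN_def using t by (intro add_left_mono add_mono mult_left_mono SUP_upper) auto
    finally show "ennreal ((norm (Z' t \<omega>))\<^sup>2) \<le> 3 * ennreal ((norm (\<xi> \<omega>))\<^sup>2) + (3 * SD \<omega> + 3 * SN \<omega>)" .
  qed
  also have "\<dots> = 3 * (\<integral>\<^sup>+\<omega>. ennreal ((norm (\<xi> \<omega>))\<^sup>2) \<partial>M) + (3 * (\<integral>\<^sup>+\<omega>. SD \<omega> \<partial>M) + 3 * (\<integral>\<^sup>+\<omega>. SN \<omega> \<partial>M))"
    by (simp add: nn_integral_add nn_integral_cmult)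
  also have "\<dots> \<le> 3 * ennreal (\<rho>\<^sup>2) + (3 * (4 * energy \<delta> (drift V Z)) + 3 * (4 * energy \<delta> (diffusion V Z)))"
  proof (intro add_mono mult_left_mono)
    show "(\<integral>\<^sup>+\<omega>. ennreal ((norm (\<xi> \<omega>))\<^sup>2) \<partial>M) \<le> ennreal (\<rho>\<^sup>2)"
      by (simp add: nn_integral_mean_sq[OF xi_sq] rho_sq)
    have "(\<integral>\<^sup>+\<omega>. SD \<omega> \<partial>M) \<le> ennreal \<delta> * energy \<delta> (drift V Z)"
      unfolding SD_def by (rule drift_sup_sq_le[OF p(1) delta_in(2)])
    \<comment> \<open>The factor 4 is wasteful for the drift but lets its energy be added to that of
      the diffusion.\<close>
    also have "\<dots> \<le> 4 * energy \<delta> (drift V Z)"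
    proof (intro mult_right_mono)
      have "ennreal \<delta> \<le> ennreal 4" using delta_props(2) by (intro ennreal_leI) simp
      then show "ennreal \<delta> \<le> 4" by simp
    qed simp
    finally show "(\<integral>\<^sup>+\<omega>. SD \<omega> \<partial>M) \<le> 4 * energy \<delta> (drift V Z)" .
    show "(\<integral>\<^sup>+\<omega>. SN \<omega> \<partial>M) \<le> 4 * energy \<delta> (diffusion V Z)"
      unfolding SN_def by (rule noise_bounds(4)[OF delta_props(1) X(1)])
  qed auto
  also have "\<dots> = 3 * ennreal (\<rho>\<^sup>2) + 12 * (energy \<delta> (drift V Z) + energy \<delta> (diffusion V Z))"
    by (simp add: distrib_left mult.assoc[symmetric])
  also have "\<dots> \<le> 3 * ennreal (\<rho>\<^sup>2) + 12 * ennreal (3 * R * \<Lambda> * \<delta>)"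
    by (intro add_left_mono mult_left_mono energy_drift_diffusion[OF A delta_in(1)]) simp
  also have "\<dots> = ennreal (3 * \<rho>\<^sup>2) + ennreal (36 * R * \<Lambda> * \<delta>)"
    using ennreal_mult[of 3 "\<rho>\<^sup>2"] ennreal_mult[of 12 "3 * R * \<Lambda> * \<delta>"] R_ge_1 Lambda_pos delta_in(2) by (simp add: mult.assoc)
  also have "\<dots> = ennreal (3 * \<rho>\<^sup>2 + 36 * R * \<Lambda> * \<delta>)"
    using R_ge_1 Lambda_pos delta_in(2) by (intro ennreal_plus[symmetric]) auto
  also have "\<dots> \<le> ennreal (3 * \<rho>\<^sup>2 + 1)"
    using delta_props(3) by (intro ennreal_leI) (simp add: mult_ac)
  finally show ?thesis .
qed

end

section \<open>Contraction\<close>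

context DO_setting
begin

text \<open>A squared distance at a single time. Its square root bounds both distances and takes the
  place of \<open>q\<close> in the Lipschitz estimates.\<close>

definition gap :: "(real \<Rightarrow> real ^ 'd ^ 'r) \<Rightarrow> (real \<Rightarrow> 'w \<Rightarrow> real ^ 'r) \<Rightarrow>
    (real \<Rightarrow> real ^ 'd ^ 'r) \<Rightarrow> (real \<Rightarrow> 'w \<Rightarrow> real ^ 'r) \<Rightarrow> real \<Rightarrow> real" where
  "gap V Z V\<^sub>2 Z\<^sub>2 s = max ((norm (V s - V\<^sub>2 s))\<^sup>2) (mean_sq M (\<lambda>\<omega>. Z s \<omega> - Z\<^sub>2 s \<omega>))"

lemma gap_nonneg [simp]: "0 \<le> gap V Z V\<^sub>2 Z\<^sub>2 s"
  by (simp add: gap_def le_max_iff_disj)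

lemma gap_bounds:
  "norm (V s - V\<^sub>2 s) \<le> sqrt (gap V Z V\<^sub>2 Z\<^sub>2 s)"
  "mean_sq M (\<lambda>\<omega>. Z s \<omega> - Z\<^sub>2 s \<omega>) \<le> (sqrt (gap V Z V\<^sub>2 Z\<^sub>2 s))\<^sup>2"
proof -
  show "norm (V s - V\<^sub>2 s) \<le> sqrt (gap V Z V\<^sub>2 Z\<^sub>2 s)"
    by (rule real_le_rsqrt) (simp add: gap_def)
  show "mean_sq M (\<lambda>\<omega>. Z s \<omega> - Z\<^sub>2 s \<omega>) \<le> (sqrt (gap V Z V\<^sub>2 Z\<^sub>2 s))\<^sup>2"
    by (subst real_sqrt_pow2) (simp_all add: gap_def le_max_iff_disj)
qed

lemma gap_commute: "gap V Z V\<^sub>2 Z\<^sub>2 s = gap V\<^sub>2 Z\<^sub>2 V Z s"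
  by (simp add: gap_def mean_sq_def norm_minus_commute[of "V s"] norm_minus_commute[of "Z s _"])

lemma gap_triangle:
  assumes "sq_integrable M (Z s)" "sq_integrable M (Z\<^sub>2 s)" "sq_integrable M (Z\<^sub>3 s)"
  shows "gap V Z V\<^sub>3 Z\<^sub>3 s \<le> 2 * gap V Z V\<^sub>2 Z\<^sub>2 s + 2 * gap V\<^sub>2 Z\<^sub>2 V\<^sub>3 Z\<^sub>3 s"
proof -
  have "mean_sq M (\<lambda>\<omega>. Z s \<omega> - Z\<^sub>3 s \<omega>) \<le>
      2 * mean_sq M (\<lambda>\<omega>. Z s \<omega> - Z\<^sub>2 s \<omega>) + 2 * mean_sq M (\<lambda>\<omega>. Z\<^sub>2 s \<omega> - Z\<^sub>3 s \<omega>)"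
    using sq_integrable_add(2)[OF sq_integrable_diff(1)[OF assms(1,2)] sq_integrable_diff(1)[OF assms(2,3)]] by simp
  moreover have "(norm (V s - V\<^sub>3 s))\<^sup>2 \<le> 2 * (norm (V s - V\<^sub>2 s))\<^sup>2 + 2 * (norm (V\<^sub>2 s - V\<^sub>3 s))\<^sup>2"
    using norm_add_sq_le[of "V s - V\<^sub>2 s" "V\<^sub>2 s - V\<^sub>3 s"] by simp
  ultimately show ?thesis unfolding gap_def by linarith
qed

lemma gap_le_1:
  assumes "good (V s) (Z s)" "good (V\<^sub>2 s) (Z\<^sub>2 s)"
  shows "gap V Z V\<^sub>2 Z\<^sub>2 s \<le> 1"
proof -
  have "norm ((V s - \<phi>) - (V\<^sub>2 s - \<phi>)) \<le> norm (V s - \<phi>) + norm (V\<^sub>2 s - \<phi>)" by (rule norm_triangle_ineq4)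
  also have "\<dots> \<le> 1" using assms eta_props(2) by (simp add: good_def)
  finally have "norm (V s - V\<^sub>2 s) \<le> 1" by simp
  then have "(norm (V s - V\<^sub>2 s))\<^sup>2 \<le> 1" by (simp add: power_le_one)
  then show ?thesis using good_diff_small(2)[OF assms] by (simp add: gap_def)
qed

definition accum :: "(real \<Rightarrow> real ^ 'd ^ 'r) \<Rightarrow> (real \<Rightarrow> 'w \<Rightarrow> real ^ 'r) \<Rightarrow>
    (real \<Rightarrow> real ^ 'd ^ 'r) \<Rightarrow> (real \<Rightarrow> 'w \<Rightarrow> real ^ 'r) \<Rightarrow> real \<Rightarrow> ennreal" where
  "accum V Z V\<^sub>2 Z\<^sub>2 t = (\<integral>\<^sup>+s\<in>{0..t}. ennreal (gap V Z V\<^sub>2 Z\<^sub>2 s) \<partial>lborel)"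

lemma gap_measurable:
  assumes A: "admissible V Z" and A\<^sub>2: "admissible V\<^sub>2 Z\<^sub>2" and t: "t \<in> {0..\<delta>}"
  shows "(\<lambda>s. ennreal (gap V Z V\<^sub>2 Z\<^sub>2 s) * indicator {0..t} s) \<in> borel_measurable lborel"
proof -
  have [measurable]: "(\<lambda>s. indicator {0..\<delta>} s * mean_sq M (\<lambda>\<omega>. Z s \<omega> - Z\<^sub>2 s \<omega>)) \<in> borel_measurable borel"
    by (rule expectation_measurable(2)[OF progressive_on_diff[OF admissible_progressive(1)[OF A] admissible_progressive(1)[OF A\<^sub>2]] delta_in(2)])
  have [measurable]: "(\<lambda>s. indicator {0..\<delta>} s *\<^sub>R (V s - V\<^sub>2 s)) \<in> borel_measurable borel"
    by (intro borel_measurable_continuous_on_indicator continuous_on_diff admissibleD(1)[OF A] admissibleD(1)[OF A\<^sub>2]) simp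
  have "(\<lambda>s. ennreal (max ((norm (indicator {0..\<delta>} s *\<^sub>R (V s - V\<^sub>2 s)))\<^sup>2)
      (indicator {0..\<delta>} s * mean_sq M (\<lambda>\<omega>. Z s \<omega> - Z\<^sub>2 s \<omega>))) * indicator {0..t} s) \<in> borel_measurable borel"
    by measurable
  moreover have "ennreal (max ((norm (indicator {0..\<delta>} s *\<^sub>R (V s - V\<^sub>2 s)))\<^sup>2)
      (indicator {0..\<delta>} s * mean_sq M (\<lambda>\<omega>. Z s \<omega> - Z\<^sub>2 s \<omega>))) * indicator {0..t} s =
      ennreal (gap V Z V\<^sub>2 Z\<^sub>2 s) * indicator {0..t} s" for s
    using t by (cases "s \<in> {0..t}") (simp_all add: gap_def)
  ultimately show ?thesis by simp
qed

lemma accum_cmult: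
  assumes A: "admissible V Z" and A\<^sub>2: "admissible V\<^sub>2 Z\<^sub>2" and t: "t \<in> {0..\<delta>}" and k: "0 \<le> k"
    and f: "\<And>s. s \<in> {0..t} \<Longrightarrow> f s \<le> ennreal (k * gap V Z V\<^sub>2 Z\<^sub>2 s)"
  shows "(\<integral>\<^sup>+s\<in>{0..t}. f s \<partial>lborel) \<le> ennreal k * accum V Z V\<^sub>2 Z\<^sub>2 t"
proof -
  have "(\<integral>\<^sup>+s\<in>{0..t}. f s \<partial>lborel) \<le> (\<integral>\<^sup>+s. ennreal k * (ennreal (gap V Z V\<^sub>2 Z\<^sub>2 s) * indicator {0..t} s) \<partial>lborel)"
    using f k by (intro nn_integral_mono) (auto simp: indicator_def ennreal_mult)
  also have "\<dots> = ennreal k * accum V Z V\<^sub>2 Z\<^sub>2 t"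
    unfolding accum_def by (rule nn_integral_cmult[OF gap_measurable[OF A A\<^sub>2 t]])
  finally show ?thesis .
qed

lemma accum_le:
  assumes t: "t \<in> {0..\<delta>}" and e: "0 \<le> e" "\<And>s. s \<in> {0..t} \<Longrightarrow> gap V Z V\<^sub>2 Z\<^sub>2 s \<le> e"
  shows "accum V Z V\<^sub>2 Z\<^sub>2 t \<le> ennreal e"
proof -
  have "accum V Z V\<^sub>2 Z\<^sub>2 t \<le> (\<integral>\<^sup>+s. ennreal e * indicator {0..t} s \<partial>lborel)"
    unfolding accum_def using e by (intro nn_integral_mono) (auto simp: indicator_def intro!: ennreal_leI)
  also have "\<dots> = ennreal (e * t)"
    using t e by (subst nn_integral_cmult_indicator) (auto simp: ennreal_mult)
  also have "\<dots> \<le> ennreal e"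
    using t e delta_props(2) by (intro ennreal_leI mult_left_le) auto
  finally show ?thesis .
qed

lemma constants_nonneg: "0 \<le> K\<^sub>Y" "0 \<le> K\<^sub>G"
  unfolding K\<^sub>Y_def K\<^sub>G_def using Lambda_pos R_ge_1 kappa_nonneg gamma(2) m_ge_1 by auto

lemma energy_gap:
  assumes A: "admissible V Z" and A\<^sub>2: "admissible V\<^sub>2 Z\<^sub>2" and t: "t \<in> {0..\<delta>}"
  shows "energy t (\<lambda>s \<omega>. drift V Z s \<omega> - drift V\<^sub>2 Z\<^sub>2 s \<omega>) \<le> ennreal K\<^sub>Y * accum V Z V\<^sub>2 Z\<^sub>2 t"
    and "energy t (\<lambda>s \<omega>. diffusion V Z s \<omega> - diffusion V\<^sub>2 Z\<^sub>2 s \<omega>) \<le> ennreal K\<^sub>Y * accum V Z V\<^sub>2 Z\<^sub>2 t"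
proof -
  have *: "(\<integral>\<^sup>+\<omega>. ennreal ((norm (drift V Z s \<omega> - drift V\<^sub>2 Z\<^sub>2 s \<omega>))\<^sup>2) \<partial>M) \<le> ennreal (K\<^sub>Y * gap V Z V\<^sub>2 Z\<^sub>2 s)"
    "(\<integral>\<^sup>+\<omega>. ennreal ((norm (diffusion V Z s \<omega> - diffusion V\<^sub>2 Z\<^sub>2 s \<omega>))\<^sup>2) \<partial>M) \<le> ennreal (K\<^sub>Y * gap V Z V\<^sub>2 Z\<^sub>2 s)"
    if "s \<in> {0..t}" for s
  proof -
    have s: "s \<in> {0..\<delta>}" "0 \<le> s" using that t by auto
    note g = admissibleD(4)[OF A s(1)] and g\<^sub>2 = admissibleD(4)[OF A\<^sub>2 s(1)]
    note r = reduced_bound[OF g s(2)] and r\<^sub>2 = reduced_bound[OF g\<^sub>2 s(2)]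
    note le = reduced_diff[OF g g\<^sub>2 s(2) gap_bounds(1)[of V s V\<^sub>2 Z Z\<^sub>2] gap_bounds(2)[of Z s Z\<^sub>2 V V\<^sub>2]]
    show "(\<integral>\<^sup>+\<omega>. ennreal ((norm (drift V Z s \<omega> - drift V\<^sub>2 Z\<^sub>2 s \<omega>))\<^sup>2) \<partial>M) \<le> ennreal (K\<^sub>Y * gap V Z V\<^sub>2 Z\<^sub>2 s)"
      unfolding drift_def nn_integral_mean_sq[OF sq_integrable_diff(1)[OF r(2) r\<^sub>2(2)]]
      using le(1) by (intro ennreal_leI) simp
    show "(\<integral>\<^sup>+\<omega>. ennreal ((norm (diffusion V Z s \<omega> - diffusion V\<^sub>2 Z\<^sub>2 s \<omega>))\<^sup>2) \<partial>M) \<le> ennreal (K\<^sub>Y * gap V Z V\<^sub>2 Z\<^sub>2 s)"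
      unfolding diffusion_def nn_integral_mean_sq[OF sq_integrable_diff(1)[OF r(3) r\<^sub>2(3)]]
      using le(2) by (intro ennreal_leI) simp
  qed
  note p = progressive_on_diff[OF admissible_progressive(3)[OF A] admissible_progressive(3)[OF A\<^sub>2]]
    progressive_on_diff[OF admissible_progressive(4)[OF A] admissible_progressive(4)[OF A\<^sub>2]]
  show "energy t (\<lambda>s \<omega>. drift V Z s \<omega> - drift V\<^sub>2 Z\<^sub>2 s \<omega>) \<le> ennreal K\<^sub>Y * accum V Z V\<^sub>2 Z\<^sub>2 t"
    unfolding energy_time[OF p(1) t] by (intro accum_cmult A A\<^sub>2 t constants_nonneg *)
  show "energy t (\<lambda>s \<omega>. diffusion V Z s \<omega> - diffusion V\<^sub>2 Z\<^sub>2 s \<omega>) \<le> ennreal K\<^sub>Y * accum V Z V\<^sub>2 Z\<^sub>2 t"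
    unfolding energy_time[OF p(2) t] by (intro accum_cmult A A\<^sub>2 t constants_nonneg *)
qed

text \<open>The initial value cancels, so the difference of two images is again drift plus noise,
  and the same estimates apply to it.\<close>

lemma picard_step_diff:
  assumes A: "admissible V Z" and A\<^sub>2: "admissible V\<^sub>2 Z\<^sub>2"
    and S: "picard_step V Z V' Z'" and S\<^sub>2: "picard_step V\<^sub>2 Z\<^sub>2 V\<^sub>2' Z\<^sub>2'"
  shows "\<exists>X. (\<forall>i. ito \<delta> (\<lambda>s \<omega>. (diffusion V Z s \<omega> - diffusion V\<^sub>2 Z\<^sub>2 s \<omega>) $ i) (X i)) \<and>
    (\<forall>t\<in>{0..\<delta>}. \<forall>\<omega>\<in>space M. Z' t \<omega> - Z\<^sub>2' t \<omega> =
      (LINT s:{0..t}|lborel. drift V Z s \<omega> - drift V\<^sub>2 Z\<^sub>2 s \<omega>) + (\<chi> i. X i t \<omega>))"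
proof -
  obtain X where X: "\<And>i. ito \<delta> (\<lambda>s \<omega>. diffusion V Z s \<omega> $ i) (X i)"
    and Z: "\<And>t \<omega>. t \<in> {0..\<delta>} \<Longrightarrow> \<omega> \<in> space M \<Longrightarrow>
      Z' t \<omega> = \<xi> \<omega> + ((LINT s:{0..t}|lborel. drift V Z s \<omega>) + (\<chi> i. X i t \<omega>))"
    using S unfolding picard_step_def by blast
  obtain X\<^sub>2 where X\<^sub>2: "\<And>i. ito \<delta> (\<lambda>s \<omega>. diffusion V\<^sub>2 Z\<^sub>2 s \<omega> $ i) (X\<^sub>2 i)"
    and Z\<^sub>2: "\<And>t \<omega>. t \<in> {0..\<delta>} \<Longrightarrow> \<omega> \<in> space M \<Longrightarrow>
      Z\<^sub>2' t \<omega> = \<xi> \<omega> + ((LINT s:{0..t}|lborel. drift V\<^sub>2 Z\<^sub>2 s \<omega>) + (\<chi> i. X\<^sub>2 i t \<omega>))"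
    using S\<^sub>2 unfolding picard_step_def by blast
  show ?thesis
  proof (intro exI[of _ "\<lambda>i t \<omega>. X i t \<omega> - X\<^sub>2 i t \<omega>"] conjI allI ballI)
    show "ito \<delta> (\<lambda>s \<omega>. (diffusion V Z s \<omega> - diffusion V\<^sub>2 Z\<^sub>2 s \<omega>) $ i) (\<lambda>t \<omega>. X i t \<omega> - X\<^sub>2 i t \<omega>)" for i
      unfolding vector_minus_component by (rule ito_diff[OF delta_props(1) X X\<^sub>2])
    fix t \<omega> assume t: "t \<in> {0..\<delta>}" and w: "\<omega> \<in> space M"
    have sub: "{0..t} \<subseteq> {0..\<delta>}" using t by auto
    note i = set_integrable_subset[OF drift_integrable[OF A w] _ sub] set_integrable_subset[OF drift_integrable[OF A\<^sub>2 w] _ sub]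
    have "(LINT s:{0..t}|lborel. drift V Z s \<omega> - drift V\<^sub>2 Z\<^sub>2 s \<omega>) =
        (LINT s:{0..t}|lborel. drift V Z s \<omega>) - (LINT s:{0..t}|lborel. drift V\<^sub>2 Z\<^sub>2 s \<omega>)"
      by (rule set_integral_diff(2)[OF i]) simp_all
    then show "Z' t \<omega> - Z\<^sub>2' t \<omega> =
        (LINT s:{0..t}|lborel. drift V Z s \<omega> - drift V\<^sub>2 Z\<^sub>2 s \<omega>) + (\<chi> i. X i t \<omega> - X\<^sub>2 i t \<omega>)"
      unfolding Z[OF t w] Z\<^sub>2[OF t w] by (simp add: vec_eq_iff)
  qed
qed

lemma drift_diff_integrable:
  assumes A: "admissible V Z" and A\<^sub>2: "admissible V\<^sub>2 Z\<^sub>2" and w: "\<omega> \<in> space M"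
  shows "set_integrable lborel {0..\<delta>} (\<lambda>s. drift V Z s \<omega> - drift V\<^sub>2 Z\<^sub>2 s \<omega>)"
  by (rule set_integral_diff(1)[OF drift_integrable[OF A w] drift_integrable[OF A\<^sub>2 w]])

lemma picard_mean_sq_diff:
  assumes A: "admissible V Z" and A\<^sub>2: "admissible V\<^sub>2 Z\<^sub>2"
    and S: "picard_step V Z V' Z'" and S\<^sub>2: "picard_step V\<^sub>2 Z\<^sub>2 V\<^sub>2' Z\<^sub>2'" and t: "t \<in> {0..\<delta>}"
  shows "(\<integral>\<^sup>+\<omega>. ennreal ((norm (Z' t \<omega> - Z\<^sub>2' t \<omega>))\<^sup>2) \<partial>M) \<le> ennreal (4 * K\<^sub>Y) * accum V Z V\<^sub>2 Z\<^sub>2 t"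
proof -
  obtain X where X: "\<And>i. ito \<delta> (\<lambda>s \<omega>. (diffusion V Z s \<omega> - diffusion V\<^sub>2 Z\<^sub>2 s \<omega>) $ i) (X i)"
    and Z: "\<And>t \<omega>. t \<in> {0..\<delta>} \<Longrightarrow> \<omega> \<in> space M \<Longrightarrow> Z' t \<omega> - Z\<^sub>2' t \<omega> =
      (LINT s:{0..t}|lborel. drift V Z s \<omega> - drift V\<^sub>2 Z\<^sub>2 s \<omega>) + (\<chi> i. X i t \<omega>)"
    using picard_step_diff[OF A A\<^sub>2 S S\<^sub>2] by blast
  let ?D = "\<lambda>\<omega>. LINT s:{0..t}|lborel. drift V Z s \<omega> - drift V\<^sub>2 Z\<^sub>2 s \<omega>" and ?N = "\<lambda>\<omega>. \<chi> i. X i t \<omega>"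
  have t': "0 \<le> t" "t \<le> 1" using t delta_props(2) by auto
  note p = progressive_on_diff[OF admissible_progressive(3)[OF A] admissible_progressive(3)[OF A\<^sub>2]]
  note i = drift_diff_integrable[OF A A\<^sub>2]
  have Dm: "?D \<in> borel_measurable M" by (rule measurable_F_M[OF drift_adapted_continuous(1)[OF p i t] t'(1)])
  have Nm: "?N \<in> borel_measurable M" by (rule measurable_F_M[OF noise_bounds(1)[OF delta_props(1) X t] t'(1)])
  have "(\<integral>\<^sup>+\<omega>. ennreal ((norm (Z' t \<omega> - Z\<^sub>2' t \<omega>))\<^sup>2) \<partial>M) = (\<integral>\<^sup>+\<omega>. ennreal ((norm (?D \<omega> + ?N \<omega>))\<^sup>2) \<partial>M)"
    by (intro nn_integral_cong) (simp add: Z[OF t])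
  also have "\<dots> \<le> 2 * (\<integral>\<^sup>+\<omega>. ennreal ((norm (?D \<omega>))\<^sup>2) \<partial>M) + 2 * (\<integral>\<^sup>+\<omega>. ennreal ((norm (?N \<omega>))\<^sup>2) \<partial>M)"
    by (rule nn_integral_sq_add_le[OF Dm Nm])
  also have "\<dots> \<le> 2 * (ennreal K\<^sub>Y * accum V Z V\<^sub>2 Z\<^sub>2 t) + 2 * (ennreal K\<^sub>Y * accum V Z V\<^sub>2 Z\<^sub>2 t)"
  proof (intro add_mono mult_left_mono)
    have "(\<integral>\<^sup>+\<omega>. ennreal ((norm (?D \<omega>))\<^sup>2) \<partial>M) \<le> ennreal t * energy t (\<lambda>s \<omega>. drift V Z s \<omega> - drift V\<^sub>2 Z\<^sub>2 s \<omega>)"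
      by (rule drift_mean_sq_le[OF p t])
    also have "\<dots> \<le> 1 * (ennreal K\<^sub>Y * accum V Z V\<^sub>2 Z\<^sub>2 t)"
      using t' by (intro mult_mono energy_gap(1) A A\<^sub>2 t) (auto simp: ennreal_le_1)
    finally show "(\<integral>\<^sup>+\<omega>. ennreal ((norm (?D \<omega>))\<^sup>2) \<partial>M) \<le> ennreal K\<^sub>Y * accum V Z V\<^sub>2 Z\<^sub>2 t" by simp
    show "(\<integral>\<^sup>+\<omega>. ennreal ((norm (?N \<omega>))\<^sup>2) \<partial>M) \<le> ennreal K\<^sub>Y * accum V Z V\<^sub>2 Z\<^sub>2 t"
      by (rule order_trans[OF noise_bounds(3)[OF delta_props(1) X t] energy_gap(2)[OF A A\<^sub>2 t]])
  qed auto
  also have "\<dots> = ennreal (4 * K\<^sub>Y) * accum V Z V\<^sub>2 Z\<^sub>2 t"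
    using constants_nonneg(1) by (simp add: ennreal_mult' mult.assoc[symmetric] distrib_right[symmetric])
  finally show ?thesis .
qed

text \<open>The constant is \<open>2 + 2 * 4\<close>, with Doob's factor on the noise only. The
  estimate serves the uniform convergence of paths; the contraction itself uses the bound at a fixed
  time.\<close>

lemma picard_sup_diff:
  assumes A: "admissible V Z" and A\<^sub>2: "admissible V\<^sub>2 Z\<^sub>2"
    and S: "picard_step V Z V' Z'" and S\<^sub>2: "picard_step V\<^sub>2 Z\<^sub>2 V\<^sub>2' Z\<^sub>2'"
  shows "(\<integral>\<^sup>+\<omega>. (SUP t\<in>{0..\<delta>}. ennreal ((norm (Z' t \<omega> - Z\<^sub>2' t \<omega>))\<^sup>2)) \<partial>M) \<le> ennreal (10 * K\<^sub>Y) * accum V Z V\<^sub>2 Z\<^sub>2 \<delta>"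
proof -
  obtain X where X: "\<And>i. ito \<delta> (\<lambda>s \<omega>. (diffusion V Z s \<omega> - diffusion V\<^sub>2 Z\<^sub>2 s \<omega>) $ i) (X i)"
    and Z: "\<And>t \<omega>. t \<in> {0..\<delta>} \<Longrightarrow> \<omega> \<in> space M \<Longrightarrow> Z' t \<omega> - Z\<^sub>2' t \<omega> =
      (LINT s:{0..t}|lborel. drift V Z s \<omega> - drift V\<^sub>2 Z\<^sub>2 s \<omega>) + (\<chi> i. X i t \<omega>)"
    using picard_step_diff[OF A A\<^sub>2 S S\<^sub>2] by blast
  let ?D = "\<lambda>t \<omega>. LINT s:{0..t}|lborel. drift V Z s \<omega> - drift V\<^sub>2 Z\<^sub>2 s \<omega>" and ?N = "\<lambda>t \<omega>. \<chi> i. X i t \<omega>"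
  define SD where "SD \<omega> = (SUP t\<in>{0..\<delta>}. ennreal ((norm (?D t \<omega>))\<^sup>2))" for \<omega>
  define SN where "SN \<omega> = (SUP t\<in>{0..\<delta>}. ennreal ((norm (?N t \<omega>))\<^sup>2))" for \<omega>
  note p = progressive_on_diff[OF admissible_progressive(3)[OF A] admissible_progressive(3)[OF A\<^sub>2]]
  note i = drift_diff_integrable[OF A A\<^sub>2]
  have [measurable]: "SD \<in> borel_measurable M"
    unfolding SD_def[abs_def]
    by (intro SUP_sq_measurable delta_in measurable_F_M[OF drift_adapted_continuous(1)[OF p i]] drift_adapted_continuous(2)[OF p i]) auto
  have [measurable]: "SN \<in> borel_measurable M"
    unfolding SN_def[abs_def]
    by (intro SUP_sq_measurable delta_in measurable_F_M[OF noise_bounds(1)[OF delta_props(1) X]] noise_bounds(2)[OF delta_props(1) X]) auto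
  have "(\<integral>\<^sup>+\<omega>. (SUP t\<in>{0..\<delta>}. ennreal ((norm (Z' t \<omega> - Z\<^sub>2' t \<omega>))\<^sup>2)) \<partial>M) \<le> (\<integral>\<^sup>+\<omega>. 2 * SD \<omega> + 2 * SN \<omega> \<partial>M)"
  proof (intro nn_integral_mono SUP_least)
    fix \<omega> t assume w: "\<omega> \<in> space M" and t: "t \<in> {0..\<delta>}"
    have "ennreal ((norm (Z' t \<omega> - Z\<^sub>2' t \<omega>))\<^sup>2) \<le> ennreal (2 * (norm (?D t \<omega>))\<^sup>2 + 2 * (norm (?N t \<omega>))\<^sup>2)"
      unfolding Z[OF t w] by (intro ennreal_leI norm_add_sq_le)
    also have "\<dots> = 2 * ennreal ((norm (?D t \<omega>))\<^sup>2) + 2 * ennreal ((norm (?N t \<omega>))\<^sup>2)"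
      by (simp add: ennreal_plus ennreal_mult')
    also have "\<dots> \<le> 2 * SD \<omega> + 2 * SN \<omega>"
      unfolding SD_def SN_def using t by (intro add_mono mult_left_mono SUP_upper) auto
    finally show "ennreal ((norm (Z' t \<omega> - Z\<^sub>2' t \<omega>))\<^sup>2) \<le> 2 * SD \<omega> + 2 * SN \<omega>" .
  qed
  also have "\<dots> = 2 * (\<integral>\<^sup>+\<omega>. SD \<omega> \<partial>M) + 2 * (\<integral>\<^sup>+\<omega>. SN \<omega> \<partial>M)"
    by (simp add: nn_integral_add nn_integral_cmult)
  also have "\<dots> \<le> 2 * (ennreal K\<^sub>Y * accum V Z V\<^sub>2 Z\<^sub>2 \<delta>) + 2 * (4 * (ennreal K\<^sub>Y * accum V Z V\<^sub>2 Z\<^sub>2 \<delta>))"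
  proof (intro add_mono mult_left_mono)
    have "(\<integral>\<^sup>+\<omega>. SD \<omega> \<partial>M) \<le> ennreal \<delta> * energy \<delta> (\<lambda>s \<omega>. drift V Z s \<omega> - drift V\<^sub>2 Z\<^sub>2 s \<omega>)"
      unfolding SD_def by (rule drift_sup_sq_le[OF p delta_in(2)])
    also have "\<dots> \<le> 1 * (ennreal K\<^sub>Y * accum V Z V\<^sub>2 Z\<^sub>2 \<delta>)"
      using delta_props by (intro mult_mono energy_gap(1) A A\<^sub>2 delta_in) (auto simp: ennreal_le_1)
    finally show "(\<integral>\<^sup>+\<omega>. SD \<omega> \<partial>M) \<le> ennreal K\<^sub>Y * accum V Z V\<^sub>2 Z\<^sub>2 \<delta>" by simp
    have "(\<integral>\<^sup>+\<omega>. SN \<omega> \<partial>M) \<le> 4 * energy \<delta> (\<lambda>s \<omega>. diffusion V Z s \<omega> - diffusion V\<^sub>2 Z\<^sub>2 s \<omega>)"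
      unfolding SN_def by (rule noise_bounds(4)[OF delta_props(1) X])
    also have "\<dots> \<le> 4 * (ennreal K\<^sub>Y * accum V Z V\<^sub>2 Z\<^sub>2 \<delta>)"
      by (intro mult_left_mono energy_gap(2)[OF A A\<^sub>2 delta_in(1)]) simp
    finally show "(\<integral>\<^sup>+\<omega>. SN \<omega> \<partial>M) \<le> 4 * (ennreal K\<^sub>Y * accum V Z V\<^sub>2 Z\<^sub>2 \<delta>)" .
  qed auto
  also have "\<dots> = ennreal (10 * K\<^sub>Y) * accum V Z V\<^sub>2 Z\<^sub>2 \<delta>"
    using constants_nonneg(1) by (simp add: ennreal_mult' mult.assoc[symmetric] distrib_right[symmetric])
  finally show ?thesis .
qed

lemma picard_deterministic_diff:
  assumes A: "admissible V Z" and A\<^sub>2: "admissible V\<^sub>2 Z\<^sub>2"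
    and S: "picard_step V Z V' Z'" and S\<^sub>2: "picard_step V\<^sub>2 Z\<^sub>2 V\<^sub>2' Z\<^sub>2'" and t: "t \<in> {0..\<delta>}"
  shows "ennreal ((norm (V' t - V\<^sub>2' t))\<^sup>2) \<le> ennreal (K\<^sub>G\<^sup>2) * accum V Z V\<^sub>2 Z\<^sub>2 t"
proof -
  define g where "g s = G s (V s) (Z s) - G s (V\<^sub>2 s) (Z\<^sub>2 s)" for s
  have t': "0 \<le> t" "t \<le> 1" and sub: "{0..t} \<subseteq> {0..\<delta>}" using t delta_props(2) by auto
  have gi: "set_integrable lborel {0..\<delta>} g"
    unfolding g_def by (rule set_integral_diff(1)[OF G_admissible(2)[OF A] G_admissible(2)[OF A\<^sub>2]])
  have gt: "set_integrable lborel {0..t} g" by (rule set_integrable_subset[OF gi _ sub]) simp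
  have gm: "(\<lambda>s. indicator {0..\<delta>} s *\<^sub>R g s) \<in> borel_measurable borel"
    unfolding g_def scaleR_diff_right by (intro borel_measurable_diff G_measurable A A\<^sub>2)
  have "V' t - V\<^sub>2' t = integral {0..t} (\<lambda>s. G s (V s) (Z s)) - integral {0..t} (\<lambda>s. G s (V\<^sub>2 s) (Z\<^sub>2 s))"
    using S S\<^sub>2 t unfolding picard_step_def by simp
  also have "\<dots> = integral {0..t} g"
    unfolding g_def
    by (intro Henstock_Kurzweil_Integration.integral_diff[symmetric] integrable_on_subinterval[OF G_admissible(3)[OF A] sub]
        integrable_on_subinterval[OF G_admissible(3)[OF A\<^sub>2] sub])
  also have "\<dots> = (LINT s:{0..t}|lborel. g s)" by (rule set_borel_integral_eq_integral(2)[OF gt, symmetric])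
  finally have e: "V' t - V\<^sub>2' t = (LINT s:{0..t}|lborel. g s)" .
  \<comment> \<open>Any outcome will do, because \<open>g\<close> is deterministic and merely viewed
    as a process.\<close>
  obtain \<omega> where w: "\<omega> \<in> space M" using not_empty by blast
  have "ennreal ((norm (V' t - V\<^sub>2' t))\<^sup>2) \<le> ennreal t * (\<integral>\<^sup>+s\<in>{0..t}. ennreal ((norm (g s))\<^sup>2) \<partial>lborel)"
    unfolding e by (rule drift_sq_le[OF progressive_on_integrand[OF gm] w t])
  also have "\<dots> \<le> 1 * (ennreal (K\<^sub>G\<^sup>2) * accum V Z V\<^sub>2 Z\<^sub>2 t)"
  proof (rule mult_mono)
    show "(\<integral>\<^sup>+s\<in>{0..t}. ennreal ((norm (g s))\<^sup>2) \<partial>lborel) \<le> ennreal (K\<^sub>G\<^sup>2) * accum V Z V\<^sub>2 Z\<^sub>2 t"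
    proof (rule accum_cmult[OF A A\<^sub>2 t])
      fix s assume "s \<in> {0..t}"
      then have s: "s \<in> {0..\<delta>}" "0 \<le> s" using t by auto
      have "norm (g s) \<le> K\<^sub>G * sqrt (gap V Z V\<^sub>2 Z\<^sub>2 s)"
        unfolding g_def
        by (rule G_diff[OF admissibleD(4)[OF A s(1)] admissibleD(4)[OF A\<^sub>2 s(1)] s(2)
              gap_bounds(1)[of V s V\<^sub>2 Z Z\<^sub>2] gap_bounds(2)[of Z s Z\<^sub>2 V V\<^sub>2]])
      from power_mono[OF this norm_ge_zero, of 2]
      show "ennreal ((norm (g s))\<^sup>2) \<le> ennreal (K\<^sub>G\<^sup>2 * gap V Z V\<^sub>2 Z\<^sub>2 s)"
        by (intro ennreal_leI) (simp add: power_mult_distrib)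
    qed simp
  qed (use t' in \<open>auto simp: ennreal_le_1\<close>)
  finally show ?thesis by simp
qed

text \<open>It dominates both Lipschitz constants, and the 1 makes it positive.\<close>

definition K :: real where "K = K\<^sub>G\<^sup>2 + 4 * K\<^sub>Y + 1"

lemma K_pos: "0 < K"
  unfolding K_def using constants_nonneg by (simp add: add_nonneg_pos)

text \<open>The estimate holds at each time with an integral on the right, the form of
  \<open>volterra_iteration_bound\<close>; large Lipschitz constants are then no obstacle on the
  given interval.\<close>

lemma picard_contraction:
  assumes A: "admissible V Z" and A\<^sub>2: "admissible V\<^sub>2 Z\<^sub>2"
    and S: "picard_step V Z V' Z'" and S\<^sub>2: "picard_step V\<^sub>2 Z\<^sub>2 V\<^sub>2' Z\<^sub>2'" and t: "t \<in> {0..\<delta>}"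
  shows "ennreal (gap V' Z' V\<^sub>2' Z\<^sub>2' t) \<le> ennreal K * accum V Z V\<^sub>2 Z\<^sub>2 t"
proof -
  note g = admissibleD(4)[OF picard_step_admissible[OF A S] t] admissibleD(4)[OF picard_step_admissible[OF A\<^sub>2 S\<^sub>2] t]
  have "ennreal ((norm (V' t - V\<^sub>2' t))\<^sup>2) \<le> ennreal K * accum V Z V\<^sub>2 Z\<^sub>2 t"
    using constants_nonneg
    by (intro order_trans[OF picard_deterministic_diff[OF assms]] mult_right_mono ennreal_leI) (simp_all add: K_def)
  moreover have "ennreal (mean_sq M (\<lambda>\<omega>. Z' t \<omega> - Z\<^sub>2' t \<omega>)) \<le> ennreal K * accum V Z V\<^sub>2 Z\<^sub>2 t"
    unfolding nn_integral_mean_sq[OF good_diff_small(1)[OF g], symmetric]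
    using constants_nonneg
    by (intro order_trans[OF picard_mean_sq_diff[OF assms]] mult_right_mono ennreal_leI) (simp_all add: K_def)
  ultimately show ?thesis unfolding gap_def max_def by simp
qed

end

section \<open>Convergence of the iterates\<close>

context DO_setting
begin

text \<open>Dependent choice, since \<open>picard_step\<close> is a relation.\<close>

lemma picard_sequence:
  obtains V Z where "\<And>n. admissible (V n) (Z n)" "\<And>n. picard_step (V n) (Z n) (V (Suc n)) (Z (Suc n))"
proof -
  have "\<exists>f. \<forall>n. admissible (fst (f n)) (snd (f n)) \<and>
      picard_step (fst (f n)) (snd (f n)) (fst (f (Suc n))) (snd (f (Suc n)))"
  proof (rule dependent_nat_choice)
    show "\<exists>x. admissible (fst x) (snd x)" using admissible_initial by (intro exI[of _ "(\<lambda>_. \<phi>, \<lambda>_. \<xi>)"]) simp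
    fix x and n :: nat assume x: "admissible (fst x) (snd x)"
    obtain V' Z' where S: "picard_step (fst x) (snd x) V' Z'" using picard_step_exists[OF x] by blast
    with picard_step_admissible[OF x S]
    show "\<exists>y. admissible (fst y) (snd y) \<and> picard_step (fst x) (snd x) (fst y) (snd y)"
      by (intro exI[of _ "(V', Z')"]) simp
  qed
  then obtain f where f: "\<And>n. admissible (fst (f n)) (snd (f n))"
      "\<And>n. picard_step (fst (f n)) (snd (f n)) (fst (f (Suc n))) (snd (f (Suc n)))"
    by blast
  show thesis by (rule that[of "\<lambda>n. fst (f n)" "\<lambda>n. snd (f n)"]) (use f in auto)
qed

text \<open>Squared distances of consecutive iterates are at most \<open>c * (1 / 4) ^ n\<close>,
  uniformly in time. For \<open>V\<close> this is enough; for \<open>Z\<close> the supremum estimate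
  lifts it to paths. Membership in the closed balls passes to the limits by continuity and by
  Fatou's lemma.\<close>

lemma picard_limit:
  assumes A: "\<And>n. admissible (V n) (Z n)" and S: "\<And>n. picard_step (V n) (Z n) (V (Suc n)) (Z (Suc n))"
  obtains U Y where "admissible U Y" "\<And>\<epsilon>. 0 < \<epsilon> \<Longrightarrow> \<exists>n. \<forall>m\<ge>n. \<forall>t\<in>{0..\<delta>}. gap (V m) (Z m) U Y t \<le> \<epsilon>"
proof -
  define c where "c = exp (4 * K)"
  have c: "0 < c" by (simp add: c_def)
  define e where "e n = gap (V (Suc n)) (Z (Suc n)) (V n) (Z n)" for n
  have e: "e n t \<le> c * (1 / 4) ^ n" if t: "t \<in> {0..\<delta>}" for n t
  proof -
    have "ennreal (e n t) \<le> ennreal (1 * (1 / 4) ^ n * exp (4 * K * t))"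
    proof (rule volterra_iteration_bound[OF K_pos _ _ _ t])
      show "ennreal (e (Suc n) t) \<le> ennreal K * (\<integral>\<^sup>+s\<in>{0..t}. ennreal (e n s) \<partial>lborel)" if "t \<in> {0..\<delta>}" for n t
        using picard_contraction[OF A A S S that] by (simp add: e_def accum_def)
      show "ennreal (e 0 t) \<le> ennreal 1" if "t \<in> {0..\<delta>}" for t
        unfolding e_def by (intro ennreal_leI gap_le_1 admissibleD(4)[OF A that])
    qed simp
    then have "e n t \<le> (1 / 4) ^ n * exp (4 * K * t)" by simp
    also have "\<dots> \<le> (1 / 4) ^ n * c"
      unfolding c_def using t delta_props(2) K_pos by (intro mult_left_mono) auto
    finally show ?thesis by (simp add: mult.commute)
  qed
  have Zm: "Z n t \<in> borel_measurable M" if "t \<in> {0..\<delta>}" for n t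
    by (rule measurable_F_M[OF admissibleD(2)[OF A that]]) (use that in simp)

  \<comment> \<open>The supremum estimate compares images under the Picard map, so the sequence of
    processes starts at index 1.\<close>
  have sup: "(\<integral>\<^sup>+\<omega>. (SUP t\<in>{0..\<delta>}. ennreal ((norm (Z (Suc (Suc n)) t \<omega> - Z (Suc n) t \<omega>))\<^sup>2)) \<partial>M)
      \<le> ennreal (10 * K\<^sub>Y * c * (1 / 4) ^ n)" for n
  proof -
    have "accum (V (Suc n)) (Z (Suc n)) (V n) (Z n) \<delta> \<le> ennreal (c * (1 / 4) ^ n)"
      using e[of _ n] c by (intro accum_le delta_in) (auto simp: e_def)
    then have "ennreal (10 * K\<^sub>Y) * accum (V (Suc n)) (Z (Suc n)) (V n) (Z n) \<delta> \<le> ennreal (10 * K\<^sub>Y) * ennreal (c * (1 / 4) ^ n)"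
      by (rule mult_left_mono) simp
    also have "\<dots> = ennreal (10 * K\<^sub>Y * c * (1 / 4) ^ n)"
      using constants_nonneg(1) c by (subst ennreal_mult[symmetric]) (auto simp: mult.assoc)
    finally show ?thesis by (rule order_trans[OF picard_sup_diff[OF A A S S]])
  qed
  have c10: "0 \<le> 10 * K\<^sub>Y * c" using constants_nonneg(1) c by simp
  obtain Y where Y: "\<And>t. t \<in> {0..\<delta>} \<Longrightarrow> Y t \<in> borel_measurable (F t)"
    "\<And>\<omega>. \<omega> \<in> space M \<Longrightarrow> continuous_on {0..\<delta>} (\<lambda>t. Y t \<omega>)"
    and Ylim: "AE \<omega> in M. uniform_limit {0..\<delta>} (\<lambda>n t. Z (Suc n) t \<omega>) (\<lambda>t. Y t \<omega>) sequentially"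
    using continuous_process_limit[OF delta_in(2) admissibleD(2)[OF A] admissibleD(3)[OF A] c10 sup] by blast
  have Yt: "AE \<omega> in M. (\<lambda>n. Z n t \<omega>) \<longlonglongrightarrow> Y t \<omega>" if t: "t \<in> {0..\<delta>}" for t
    using Ylim
  proof eventually_elim
    case (elim \<omega>)
    from tendsto_uniform_limitI[OF this t] show ?case by (rule LIMSEQ_imp_Suc)
  qed
  have Ym: "Y t \<in> borel_measurable M" if "t \<in> {0..\<delta>}" for t
    by (rule measurable_F_M[OF Y(1)[OF that]]) (use that in simp)

  have Vstep: "norm (V (Suc n) t - V n t) \<le> sqrt c * (1 / 2) ^ n" if t: "t \<in> {0..\<delta>}" for n t
  proof -
    have "norm (V (Suc n) t - V n t) \<le> sqrt (e n t)" unfolding e_def by (rule gap_bounds)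
    also have "\<dots> \<le> sqrt (c * ((1 / 2) ^ n)\<^sup>2)"
      using e[OF t, of n] by (intro real_sqrt_le_mono) (simp add: power_mult[symmetric] power2_eq_square power_mult_distrib[symmetric])
    also have "\<dots> = sqrt c * (1 / 2) ^ n" by (simp add: real_sqrt_mult)
    finally show ?thesis .
  qed
  have "summable (\<lambda>n. sqrt c * (1 / 2 :: real) ^ n)" by (intro summable_mult summable_geometric) simp
  with Vstep obtain U where U: "uniform_limit {0..\<delta>} V U sequentially"
    using uniform_limit_summable_steps[of "{0..\<delta>}" V "\<lambda>n. sqrt c * (1 / 2) ^ n"] by blast
  have Uc: "continuous_on {0..\<delta>} U"
    by (rule uniform_limit_theorem[OF _ U]) (auto intro!: always_eventually admissibleD(1)[OF A])

  have YZ: "mean_sq M (\<lambda>\<omega>. Y t \<omega> - Z n t \<omega>) \<le> 4 * c * (1 / 4) ^ n" if t: "t \<in> {0..\<delta>}" for n t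
  proof -
    let ?D = "\<lambda>n m. \<integral>\<^sup>+\<omega>. ennreal ((norm (Z m t \<omega> - Z n t \<omega>))\<^sup>2) \<partial>M"
    have D: "?D n m \<le> ennreal (4 * c * (1 / 4) ^ n)" if "n \<le> m" for n m
    proof (rule geometric_cauchy_bound[of c ?D, OF _ _ _ _ that])
      show "?D n n = 0" for n by simp
      show "?D n m \<le> 2 * ?D n (Suc n) + 2 * ?D (Suc n) m" for n m
        using nn_integral_sq_diff_le[OF Zm[OF t, of m] Zm[OF t, of "Suc n"] Zm[OF t, of n]] by (simp add: add.commute)
      show "?D n (Suc n) \<le> ennreal (c * (1 / 4) ^ n)" for n
      proof -
        have "mean_sq M (\<lambda>\<omega>. Z (Suc n) t \<omega> - Z n t \<omega>) \<le> e n t" by (simp add: e_def gap_def)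
        with e[OF t, of n] show ?thesis
          unfolding nn_integral_mean_sq[OF good_diff_small(1)[OF admissibleD(4)[OF A t] admissibleD(4)[OF A t]]]
          by (intro ennreal_leI) linarith
      qed
    qed (use c in simp)
    have "(\<integral>\<^sup>+\<omega>. ennreal ((norm (Y t \<omega> - Z n t \<omega>))\<^sup>2) \<partial>M) \<le> ennreal (4 * c * (1 / 4) ^ n)"
      by (rule nn_integral_sq_limit_bound[OF Zm[OF t] Yt[OF t] D])
    then show ?thesis
      using c by (intro sq_integrable_nn_integralI(2) borel_measurable_diff Ym Zm t) auto
  qed

  have AU: "admissible U Y"
    unfolding admissible_def good_def
  proof (intro conjI ballI Uc Y)
    fix t assume t: "t \<in> {0..\<delta>}"
    have "(\<lambda>n. norm (V n t - \<phi>)) \<longlonglongrightarrow> norm (U t - \<phi>)"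
      by (intro tendsto_norm tendsto_diff tendsto_uniform_limitI[OF U t] tendsto_const)
    then show "norm (U t - \<phi>) \<le> \<eta>"
      by (rule LIMSEQ_le_const2) (use admissibleD(4)[OF A t] in \<open>auto simp: good_def\<close>)
    \<comment> \<open>With \<open>\<xi>\<close> put in front of the sequence, the Fatou estimate for
      index 0 bounds the distance of the limit from \<open>\<xi>\<close>.\<close>
    define W where "W n = (case n of 0 \<Rightarrow> \<xi> | Suc k \<Rightarrow> Z k t)" for n
    have W: "W 0 = \<xi>" "W (Suc k) = Z k t" for k by (simp_all add: W_def)
    have "(\<integral>\<^sup>+\<omega>. ennreal ((norm (Y t \<omega> - W 0 \<omega>))\<^sup>2) \<partial>M) \<le> ennreal (\<eta>\<^sup>2)"
    proof (rule nn_integral_sq_limit_bound)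
      show "W n \<in> borel_measurable M" for n
        by (cases n) (simp_all add: W Zm[OF t] sq_integrableD(1)[OF xi_sq])
      show "AE \<omega> in M. (\<lambda>n. W n \<omega>) \<longlonglongrightarrow> Y t \<omega>"
        using Yt[OF t]
      proof eventually_elim
        case (elim \<omega>)
        have "(\<lambda>n. W (Suc n) \<omega>) \<longlonglongrightarrow> Y t \<omega>" using elim by (simp add: W)
        then show ?case by (rule LIMSEQ_imp_Suc)
      qed
      show "(\<integral>\<^sup>+\<omega>. ennreal ((norm (W k \<omega> - W 0 \<omega>))\<^sup>2) \<partial>M) \<le> ennreal (\<eta>\<^sup>2)" for k
      proof (cases k)
        case (Suc j)
        have g: "good (V j t) (Z j t)" by (rule admissibleD(4)[OF A t])
        then have s: "sq_integrable M (\<lambda>\<omega>. Z j t \<omega> - \<xi> \<omega>)" by (intro sq_integrable_diff(1) xi_sq) (simp add: good_def)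
        show ?thesis
          using g nn_integral_mean_sq[OF s] by (simp add: Suc W good_def ennreal_leI)
      qed simp
    qed
    from sq_integrable_nn_integralI[OF borel_measurable_diff[OF Ym[OF t] sq_integrableD(1)[OF xi_sq]] this[unfolded W(1)]]
    have s: "sq_integrable M (\<lambda>\<omega>. Y t \<omega> - \<xi> \<omega>)" and le: "mean_sq M (\<lambda>\<omega>. Y t \<omega> - \<xi> \<omega>) \<le> \<eta>\<^sup>2" by auto
    show "mean_sq M (\<lambda>\<omega>. Y t \<omega> - \<xi> \<omega>) \<le> \<eta>\<^sup>2" by (rule le)
    show "sq_integrable M (Y t)" using sq_integrable_add(1)[OF s xi_sq] by simp
  qed
  show thesis
  proof (rule that[OF AU])
    fix \<epsilon> :: real assume eps: "0 < \<epsilon>"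
    have "(\<lambda>n. 4 * c * (1 / 4 :: real) ^ n) \<longlonglongrightarrow> 4 * c * 0"
      by (intro tendsto_mult tendsto_const LIMSEQ_realpow_zero) auto
    then have "eventually (\<lambda>n. 4 * c * (1 / 4 :: real) ^ n < \<epsilon>) sequentially"
      using eps by (intro order_tendstoD(2)[of _ "4 * c * 0"]) auto
    moreover have "eventually (\<lambda>n. \<forall>t\<in>{0..\<delta>}. dist (V n t) (U t) < sqrt \<epsilon>) sequentially"
      using U eps by (intro uniform_limitD) auto
    ultimately have "eventually (\<lambda>n. \<forall>t\<in>{0..\<delta>}. gap (V n) (Z n) U Y t \<le> \<epsilon>) sequentially"
    proof eventually_elim
      case (elim n)
      show ?case
      proof
        fix t assume t: "t \<in> {0..\<delta>}"
        have "norm (V n t - U t) \<le> sqrt \<epsilon>" using elim(2) t by (simp add: dist_norm less_imp_le)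
        then have "(norm (V n t - U t))\<^sup>2 \<le> (sqrt \<epsilon>)\<^sup>2" by (rule power_mono) simp
        moreover have "mean_sq M (\<lambda>\<omega>. Y t \<omega> - Z n t \<omega>) \<le> \<epsilon>" using elim(1) YZ[OF t, of n] by linarith
        ultimately show "gap (V n) (Z n) U Y t \<le> \<epsilon>"
          unfolding gap_commute[of "V n"] using eps by (simp add: gap_def norm_minus_commute[of "U t"])
      qed
    qed
    then show "\<exists>n. \<forall>m\<ge>n. \<forall>t\<in>{0..\<delta>}. gap (V m) (Z m) U Y t \<le> \<epsilon>" by (simp add: eventually_sequentially)
  qed
qed

text \<open>The limit is compared with its own Picard image through a late iterate. The image of
  iterate \<open>n\<close> is iterate \<open>n + 1\<close>, which is close to the limit, and by the
  contraction estimate it is also close to the image of the limit.\<close>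

lemma picard_fixed_point:
  obtains U Y U' Y' where "admissible U Y" "picard_step U Y U' Y'"
    "\<And>t. t \<in> {0..\<delta>} \<Longrightarrow> U t = U' t" "\<And>t. t \<in> {0..\<delta>} \<Longrightarrow> AE \<omega> in M. Y t \<omega> = Y' t \<omega>"
proof -
  obtain V Z where A: "\<And>n. admissible (V n) (Z n)" and S: "\<And>n. picard_step (V n) (Z n) (V (Suc n)) (Z (Suc n))"
    by (rule picard_sequence) blast
  obtain U Y where AU: "admissible U Y"
    and lim: "\<And>\<epsilon>. 0 < \<epsilon> \<Longrightarrow> \<exists>n. \<forall>m\<ge>n. \<forall>t\<in>{0..\<delta>}. gap (V m) (Z m) U Y t \<le> \<epsilon>"
    by (rule picard_limit[where V = V and Z = Z, OF A S]) blast
  obtain U' Y' where SU: "picard_step U Y U' Y'" using picard_step_exists[OF AU] by blast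
  note AU' = picard_step_admissible[OF AU SU]
  have z: "gap U Y U' Y' t = 0" if t: "t \<in> {0..\<delta>}" for t
  proof -
    have "gap U Y U' Y' t \<le> (2 + 2 * K) * \<epsilon>" if eps: "0 < \<epsilon>" for \<epsilon>
    proof -
      obtain n where n: "\<And>m t. n \<le> m \<Longrightarrow> t \<in> {0..\<delta>} \<Longrightarrow> gap (V m) (Z m) U Y t \<le> \<epsilon>" using lim[OF eps] by blast
      have "ennreal (gap (V (Suc n)) (Z (Suc n)) U' Y' t) \<le> ennreal K * accum (V n) (Z n) U Y t"
        by (rule picard_contraction[OF A AU S SU t])
      also have "\<dots> \<le> ennreal K * ennreal \<epsilon>"
        using n eps t by (intro mult_left_mono accum_le) auto
      also have "\<dots> = ennreal (K * \<epsilon>)" using K_pos eps by (intro ennreal_mult[symmetric]) auto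
      finally have "gap (V (Suc n)) (Z (Suc n)) U' Y' t \<le> K * \<epsilon>" using K_pos eps by simp
      moreover have "gap U Y (V (Suc n)) (Z (Suc n)) t \<le> \<epsilon>" using n[of "Suc n", OF _ t] by (simp add: gap_commute)
      moreover have "gap U Y U' Y' t \<le> 2 * gap U Y (V (Suc n)) (Z (Suc n)) t + 2 * gap (V (Suc n)) (Z (Suc n)) U' Y' t"
        by (intro gap_triangle admissibleD(5)[OF AU t] admissibleD(5)[OF A t] admissibleD(5)[OF AU' t])
      ultimately show ?thesis by (simp add: distrib_right)
    qed
    from this[of "e / (2 + 2 * K)" for e] have "gap U Y U' Y' t \<le> 0 + e" if "0 < e" for e
      using K_pos that by simp
    then have "gap U Y U' Y' t \<le> 0" by (rule field_le_epsilon)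
    then show ?thesis using gap_nonneg[of U Y U' Y' t] by linarith
  qed
  show thesis
  proof (rule that[OF AU SU])
    fix t assume t: "t \<in> {0..\<delta>}"
    show "U t = U' t" using gap_bounds(1)[of U t U' Y Y'] by (simp add: z[OF t])
    have s: "sq_integrable M (\<lambda>\<omega>. Y t \<omega> - Y' t \<omega>)"
      by (intro sq_integrable_diff(1) admissibleD(5)[OF AU t] admissibleD(5)[OF AU' t])
    have "mean_sq M (\<lambda>\<omega>. Y t \<omega> - Y' t \<omega>) = 0"
      using gap_bounds(2)[of Y t Y' U U'] mean_sq_nonneg[of M "\<lambda>\<omega>. Y t \<omega> - Y' t \<omega>"] by (simp add: z[OF t])
    then have "AE \<omega> in M. (norm (Y t \<omega> - Y' t \<omega>))\<^sup>2 = 0"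
      unfolding mean_sq_def using integral_nonneg_eq_0_iff_AE[OF sq_integrableD(2)[OF s]] by simp
    then show "AE \<omega> in M. Y t \<omega> = Y' t \<omega>" by simp
  qed
qed

end

section \<open>The fixed point solves the DO equations\<close>

lemma matrix_mult_zero: "A ** (0 :: real ^ 'n ^ 'm) = 0" "(0 :: real ^ 'n ^ 'm) ** B = 0" "transpose (0 :: real ^ 'n ^ 'm) = 0"
  by (simp_all add: matrix_matrix_mult_def transpose_def vec_eq_iff)

text \<open>The Gram matrix applied to \<open>c\<close> is the mean of \<open>X\<close> times its
  inner product with \<open>c\<close>, so the coefficients of a vanishing combination lie in its
  kernel.\<close>

lemma components_independent_gram:
  fixes X :: "'w \<Rightarrow> real ^ 'r"
  assumes X: "sq_integrable M X" and inv: "invertible (gram M X)"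
  shows "components_independent M X"
  unfolding components_independent_def
proof (intro allI impI)
  fix c :: "real ^ 'r" assume c: "AE \<omega> in M. (\<Sum>i\<in>UNIV. c $ i * X \<omega> $ i) = 0"
  have "linear (\<lambda>A :: real ^ 'r ^ 'r. A *v c)"
    by (rule linearI) (simp_all add: matrix_vector_mult_add_rdistrib scaleR_matrix_vector_assoc)
  then have bl: "bounded_linear (\<lambda>A :: real ^ 'r ^ 'r. A *v c)" by (rule linear_conv_bounded_linear[THEN iffD1])
  have "gram M X *v c = (\<integral>\<omega>. outer_prod (X \<omega>) (X \<omega>) *v c \<partial>M)"
    unfolding gram_def by (rule integral_bounded_linear[OF bl outer_prod_integral(1)[OF X X], symmetric])
  also have "\<dots> = 0"
  proof (rule integral_eq_zero_AE)
    show "AE \<omega> in M. outer_prod (X \<omega>) (X \<omega>) *v c = 0"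
      using c by eventually_elim (simp add: outer_prod_mult_vector inner_vec_def mult.commute)
  qed
  finally have "matrix_inv (gram M X) *v (gram M X *v c) = 0" by simp
  then show "c = 0" by (simp add: matrix_vector_mul_assoc matrix_inv_left[OF inv])
qed

context DO_setting
begin

text \<open>The defect of orthonormality can be pulled out of the right-hand side; this is what
  makes the inequality for it homogeneous.\<close>

lemma Pi_mult_transpose: "Pi V ** transpose V = transpose V ** (mat 1 - V ** transpose V)"
  by (simp add: Pi_def matrix_mult_diff_left[symmetric] matrix_mult_diff_right[symmetric] matrix_mul_assoc)

text \<open>The defect of orthonormality satisfies a linear homogeneous Volterra inequality.\<close>

lemma fixed_point_orthonormal:
  assumes A: "admissible U Y" and U: "\<And>t. t \<in> {0..\<delta>} \<Longrightarrow> U t = \<phi> + integral {0..t} (\<lambda>s. G s (U s) (Y s))"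
    and t: "t \<in> {0..\<delta>}"
  shows "U t ** transpose (U t) = mat 1"
proof -
  define g where "g s = G s (U s) (Y s)" for s
  define N where "N s = mat 1 - U s ** transpose (U s)" for s
  define c where "c = 2 * \<gamma> * (sqrt m * sqrt \<Lambda> * sqrt (3 * R))"
  have c0: "0 \<le> c" unfolding c_def using gamma(2) m_ge_1 Lambda_pos R_ge_1 by simp
  have gU: "norm (g s ** transpose (U s)) \<le> c * norm (N s)" if s: "s \<in> {0..\<delta>}" for s
  proof -
    have gd: "good (U s) (Y s)" and s0: "0 \<le> s" using admissibleD(4)[OF A s] s by auto
    have nU: "norm (transpose (U s)) \<le> sqrt (3 * R)"
      using gd V_bounds(1)[of "U s"] by (auto simp: good_def norm_transpose intro: real_le_rsqrt)
    \<comment> \<open>The integrand of \<open>U ** transpose U\<close> is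
      \<open>g ** transpose U\<close> plus its transpose. Here the defect \<open>N\<close> appears
      as a factor of the first, hence of both.\<close>
    have "g s ** transpose (U s) = matrix_inv (gram M (Y s)) ** (cross s (U s) (Y s) ** (transpose (U s) ** N s))"
      unfolding g_def G_def N_def Pi_mult_transpose[symmetric] by (simp only: matrix_mul_assoc)
    also have "norm \<dots> \<le> 2 * \<gamma> * norm (cross s (U s) (Y s) ** (transpose (U s) ** N s))"
      using gamma(2) by (intro norm_matrix_mult_left good_gram(2)[OF gd]) simp
    also have "norm (cross s (U s) (Y s) ** (transpose (U s) ** N s)) \<le> sqrt m * sqrt \<Lambda> * (sqrt (3 * R) * norm (N s))"
    proof (rule order_trans[OF norm_matrix_mult_le mult_mono])
      show "norm (transpose (U s) ** N s) \<le> sqrt (3 * R) * norm (N s)"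
        by (rule order_trans[OF norm_matrix_mult_le mult_right_mono[OF nU]]) simp
    qed (use cross_bound[OF gd s0] m_ge_1 Lambda_pos in auto)
    finally show ?thesis using gamma(2) by (simp add: c_def mult.assoc)
  qed
  have "continuous_on UNIV (\<lambda>V :: real ^ 'd ^ 'r. norm (mat 1 - V ** transpose V))"
    unfolding matrix_matrix_mult_def transpose_def
    by (auto intro!: continuous_intros continuous_on_vec_lambda)
  from continuous_on_compose2[OF this admissibleD(1)[OF A]]
  have Nc: "continuous_on {0..\<delta>} (\<lambda>s. norm (N s))" by (simp add: N_def)
  have gm: "(\<lambda>s. indicator {0..\<delta>} s *\<^sub>R (g s $ i $ k)) \<in> borel_measurable borel" for i k
    using borel_measurable_nth[OF borel_measurable_nth[OF G_measurable[OF A]]] by (simp add: g_def)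
  have gb: "\<bar>g s $ i $ k\<bar> \<le> G\<^sub>0" if "s \<in> {0..\<delta>}" for s i k
  proof -
    have "norm (g s $ i $ k) \<le> norm (g s)"
      by (rule order_trans[OF Finite_Cartesian_Product.norm_nth_le Finite_Cartesian_Product.norm_nth_le])
    with G_admissible(1)[OF A that] show ?thesis by (simp add: g_def)
  qed
  have U0: "U 0 = \<phi>" using U[of 0] delta_in(2) by simp
  have Ui: "U t $ i $ k = U 0 $ i $ k + integral {0..t} (\<lambda>s. g s $ i $ k)" if t: "t \<in> {0..\<delta>}" for t i k
  proof -
    have bl: "bounded_linear (\<lambda>x :: real ^ 'd ^ 'r. x $ i $ k)"
      by (rule bounded_linear_compose[OF bounded_linear_vec_nth bounded_linear_vec_nth])
    have "g integrable_on {0..t}"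
      using integrable_on_subinterval[OF G_admissible(3)[OF A], of 0 t] t by (simp add: g_def[abs_def])
    from integral_linear[OF this bl] have "integral {0..t} (\<lambda>s. g s $ i $ k) = integral {0..t} g $ i $ k"
      by (simp add: o_def)
    then show ?thesis using U[OF t] by (simp add: U0 g_def[abs_def])
  qed
  have comp: "\<bar>N t $ i $ j\<bar> \<le> integral {0..t} (\<lambda>s. 2 * c * norm (N s))" if t: "t \<in> {0..\<delta>}" for t i j
  proof -
    let ?h = "\<lambda>k s. g s $ i $ k * U s $ j $ k + U s $ i $ k * g s $ j $ k"
    \<comment> \<open>Entries of \<open>U ** transpose U\<close> are sums over \<open>k\<close> of
      products of entries of \<open>U\<close>, each an integral of a bounded function.\<close>
    note pr = integral_product_rule[where T = \<delta> and B = G\<^sub>0 and f = "\<lambda>s. g s $ i $ k" and g = "\<lambda>s. g s $ j $ k"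
        and u = "\<lambda>s. U s $ i $ k" and v = "\<lambda>s. U s $ j $ k" for k]
    have hd: "?h k integrable_on {0..\<delta>}" for k
      by (rule pr(1)) (rule gm gb Ui t | assumption)+
    have hi: "?h k integrable_on {0..t}" for k
      using integrable_on_subinterval[OF hd, of 0 t] t by simp
    have he: "U t $ i $ k * U t $ j $ k = U 0 $ i $ k * U 0 $ j $ k + integral {0..t} (?h k)" for k
      by (rule pr(2)) (rule gm gb Ui t | assumption)+
    have "(U t ** transpose (U t)) $ i $ j = (\<Sum>k\<in>UNIV. U t $ i $ k * U t $ j $ k)"
      by (simp add: matrix_matrix_mult_def transpose_def)
    also have "\<dots> = (\<Sum>k\<in>UNIV. U 0 $ i $ k * U 0 $ j $ k) + (\<Sum>k\<in>UNIV. integral {0..t} (?h k))"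
      unfolding sum.distrib[symmetric] by (rule sum.cong[OF refl he])
    also have "(\<Sum>k\<in>UNIV. integral {0..t} (?h k)) = integral {0..t} (\<lambda>s. \<Sum>k\<in>UNIV. ?h k s)"
      by (rule Henstock_Kurzweil_Integration.integral_sum[OF _ hi, symmetric]) simp
    also have "(\<Sum>k\<in>UNIV. U 0 $ i $ k * U 0 $ j $ k) = (mat 1 :: real ^ 'r ^ 'r) $ i $ j"
      using arg_cong[OF phi_mat, of "\<lambda>A. A $ i $ j"] by (simp add: U0 matrix_matrix_mult_def transpose_def)
    finally have e: "N t $ i $ j = - integral {0..t} (\<lambda>s. \<Sum>k\<in>UNIV. ?h k s)" by (simp add: N_def)
    have "norm (integral {0..t} (\<lambda>s. \<Sum>k\<in>UNIV. ?h k s)) \<le> integral {0..t} (\<lambda>s. 2 * c * norm (N s))"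
    proof (rule integral_norm_bound_integral)
      show "(\<lambda>s. \<Sum>k\<in>UNIV. ?h k s) integrable_on {0..t}" by (rule integrable_sum[OF _ hi]) simp
      show "(\<lambda>s. 2 * c * norm (N s)) integrable_on {0..t}"
        using t by (intro integrable_continuous_interval continuous_on_mult continuous_on_const continuous_on_subset[OF Nc]) auto
      fix s assume "s \<in> {0..t}"
      then have s: "s \<in> {0..\<delta>}" using t by auto
      have el: "\<bar>(g s ** transpose (U s)) $ i' $ j'\<bar> \<le> c * norm (N s)" for i' j'
        using order_trans[OF order_trans[OF Finite_Cartesian_Product.norm_nth_le Finite_Cartesian_Product.norm_nth_le] gU[OF s]]
        by (metis real_norm_def)
      have "(\<Sum>k\<in>UNIV. ?h k s) = (g s ** transpose (U s)) $ i $ j + (g s ** transpose (U s)) $ j $ i"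
        by (simp add: matrix_matrix_mult_def transpose_def sum.distrib mult.commute)
      then show "norm (\<Sum>k\<in>UNIV. ?h k s) \<le> 2 * c * norm (N s)"
        using el[of i j] el[of j i] by (simp only: real_norm_def)
    qed
    then show ?thesis by (simp add: e)
  qed
  obtain b where b: "\<And>s. s \<in> {0..\<delta>} \<Longrightarrow> norm (norm (N s)) \<le> b"
    using continuous_on_Icc_bounded[OF Nc] by blast
  have b0: "0 \<le> b" using b[OF delta_in(1)] by (rule order_trans[OF norm_ge_zero])
  \<comment> \<open>The factor \<open>R * R\<close> counts the entries of the defect, over which its
    norm is estimated by a sum; the 1 makes \<open>k\<close> positive.\<close>
  define k where "k = R * R * (2 * c) + 1"
  have k: "0 < k" unfolding k_def using c0 R_ge_1 by (simp add: add_nonneg_pos)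
  have volterra: "ennreal (norm (N t)) \<le> ennreal k * (\<integral>\<^sup>+s\<in>{0..t}. ennreal (norm (N s)) \<partial>lborel)"
    if t: "t \<in> {0..\<delta>}" for t
  proof -
    have Nt: "continuous_on {0..t} (\<lambda>s. norm (N s))" using t by (intro continuous_on_subset[OF Nc]) auto
    have si: "set_integrable lborel {0..t} (\<lambda>s. norm (N s))" by (rule borel_integrable_atLeastAtMost'[OF Nt])
    define J where "J = integral {0..t} (\<lambda>s. norm (N s))"
    have J: "J = (LINT s:{0..t}|lborel. norm (N s))" unfolding J_def by (rule set_borel_integral_eq_integral(2)[OF si, symmetric])
    have "ennreal J = (\<integral>\<^sup>+s. ennreal (indicator {0..t} s *\<^sub>R norm (N s)) \<partial>lborel)"
      unfolding J set_lebesgue_integral_def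
      using si by (intro nn_integral_eq_integral[symmetric]) (auto simp: set_integrable_def)
    also have "\<dots> = (\<integral>\<^sup>+s\<in>{0..t}. ennreal (norm (N s)) \<partial>lborel)"
      by (intro nn_integral_cong) (simp add: indicator_def)
    finally have Jn: "ennreal J = (\<integral>\<^sup>+s\<in>{0..t}. ennreal (norm (N s)) \<partial>lborel)" .
    have J0: "0 \<le> J" unfolding J_def by (rule Henstock_Kurzweil_Integration.integral_nonneg[OF integrable_continuous_interval[OF Nt]]) simp
    have row: "norm (N t $ i) \<le> R * (2 * c * J)" for i
    proof -
      have "norm (N t $ i) \<le> (\<Sum>j\<in>UNIV. \<bar>N t $ i $ j\<bar>)" by (rule norm_le_l1_cart)
      also have "\<dots> \<le> (\<Sum>j\<in>(UNIV :: 'r set). 2 * c * J)" using comp[OF t] by (intro sum_mono) (simp add: J_def)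
      finally show ?thesis by (simp add: R_eq)
    qed
    have "norm (N t) \<le> (\<Sum>i\<in>UNIV. norm (N t $ i))"
      unfolding norm_vec_def by (rule L2_set_le_sum) simp
    also have "\<dots> \<le> (\<Sum>i\<in>(UNIV :: 'r set). R * (2 * c * J))" by (intro sum_mono row)
    also have "\<dots> = R * R * (2 * c) * J" by (simp add: R_eq)
    also have "\<dots> \<le> k * J" unfolding k_def using J0 by (intro mult_right_mono) auto
    finally have "ennreal (norm (N t)) \<le> ennreal (k * J)" by (rule ennreal_leI)
    also have "\<dots> = ennreal k * ennreal J" using k J0 by (intro ennreal_mult) auto
    finally show ?thesis unfolding Jn .
  qed
  \<comment> \<open>The iteration bound is applied to the constant sequence; letting
    \<open>n\<close> grow then forces the defect to be 0.\<close>
  have "norm (N t) \<le> b * (1 / 4) ^ n * exp (4 * k * t)" for n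
  proof -
    have "ennreal (norm (N t)) \<le> ennreal (b * (1 / 4) ^ n * exp (4 * k * t))"
      by (rule volterra_iteration_bound[where e = "\<lambda>_ s. ennreal (norm (N s))", OF k b0 volterra _ t])
        (use b in \<open>auto intro!: ennreal_leI\<close>)
    then show ?thesis using b0 by simp
  qed
  note le = this
  have "(\<lambda>n. b * (1 / 4 :: real) ^ n * exp (4 * k * t)) \<longlonglongrightarrow> b * 0 * exp (4 * k * t)"
    by (intro tendsto_mult tendsto_const LIMSEQ_realpow_zero) auto
  from LIMSEQ_le_const[OF this] le have "norm (N t) \<le> b * 0 * exp (4 * k * t)" by blast
  then show ?thesis by (simp add: N_def)
qed

text \<open>The equations are verified for the limit pair, the strict bounds for its Picard image,
  which equals \<open>U\<close> and, at each time, almost surely \<open>Y\<close>.\<close>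

theorem local_solution:
  assumes W: "\<And>t. 0 \<le> t \<Longrightarrow> W t \<in> borel_measurable M" "AE \<omega> in M. \<forall>t. B t \<omega> = W t \<omega>"
  shows "\<exists>U Y. strong_DO_solution M F W a b \<delta> U Y \<and>
    U 0 = \<phi> \<and> (AE \<omega> in M. Y 0 \<omega> = \<xi> \<omega>) \<and>
    (U, Y) \<in> D_det \<delta> \<eta> \<phi> \<times> D_sto M F \<delta> \<eta> \<rho> \<xi>"
proof -
  obtain U Y U' Y' where A: "admissible U Y" and S: "picard_step U Y U' Y'"
    and UU: "\<And>t. t \<in> {0..\<delta>} \<Longrightarrow> U t = U' t" and YY: "\<And>t. t \<in> {0..\<delta>} \<Longrightarrow> AE \<omega> in M. Y t \<omega> = Y' t \<omega>"
    by (rule picard_fixed_point) blast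
  note A' = picard_step_admissible[OF A S]
  define g where "g s = G s (U s) (Y s)" for s
  obtain X where U': "\<And>t. t \<in> {0..\<delta>} \<Longrightarrow> U' t = \<phi> + integral {0..t} g"
    and X: "\<And>i. ito \<delta> (\<lambda>s \<omega>. diffusion U Y s \<omega> $ i) (X i)"
    and Y': "\<And>t \<omega>. t \<in> {0..\<delta>} \<Longrightarrow> \<omega> \<in> space M \<Longrightarrow>
      Y' t \<omega> = \<xi> \<omega> + ((LINT s:{0..t}|lborel. drift U Y s \<omega>) + (\<chi> i. X i t \<omega>))"
    using S unfolding picard_step_def g_def[abs_def] by blast
  have U: "U t = \<phi> + integral {0..t} g" if "t \<in> {0..\<delta>}" for t using UU[OF that] U'[OF that] by simp
  have z: "0 \<in> {0..\<delta>}" using delta_in(2) by simp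
  have U0: "U 0 = \<phi>" using U[OF z] by simp
  have orth: "U t ** transpose (U t) = mat 1" if "t \<in> {0..\<delta>}" for t
    by (rule fixed_point_orthonormal[OF A _ that]) (simp add: U g_def[abs_def])
  have good: "good (U t) (Y t)" "sq_integrable M (Y t)" if "t \<in> {0..\<delta>}" for t
    by (rule admissibleD[OF A] that)+
  have indep: "components_independent M (Y t)" if "t \<in> {0..\<delta>}" for t
    by (rule components_independent_gram[OF good(2)[OF that] good_gram(1)[OF good(1)[OF that]]])

  \<comment> \<open>At time 0 the mean square bound of the Picard step is 0.\<close>
  have "(\<integral>\<^sup>+\<omega>. ennreal ((norm (Y' 0 \<omega> - \<xi> \<omega>))\<^sup>2) \<partial>M) = 0"
    using picard_step_strict(4)[OF A S z] mean_sq_nonneg[of M "\<lambda>\<omega>. Y' 0 \<omega> - \<xi> \<omega>"]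
    by (simp add: nn_integral_mean_sq[OF picard_step_strict(3)[OF A S z]])
  then have "AE \<omega> in M. ennreal ((norm (Y' 0 \<omega> - \<xi> \<omega>))\<^sup>2) = 0"
    using sq_integrableD(1)[OF picard_step_strict(3)[OF A S z]] by (simp add: nn_integral_0_iff_AE)
  then have Y0: "AE \<omega> in M. Y 0 \<omega> = \<xi> \<omega>"
    using YY[OF z] by eventually_elim (simp add: ennreal_eq_0_iff)

  have deriv: "AE t in lborel. t \<in> {0..\<delta>} \<longrightarrow> (U has_vector_derivative g t) (at t within {0..\<delta>})"
    using lebesgue_differentiation_AE[OF G_admissible(3)[OF A, folded g_def[abs_def]]]
  proof eventually_elim
    case (elim t)
    show ?case
    proof
      assume t: "t \<in> {0..\<delta>}"
      have "((\<lambda>t. \<phi> + integral {0..t} g) has_vector_derivative 0 + g t) (at t within {0..\<delta>})"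
        by (intro has_vector_derivative_add has_vector_derivative_const elim[rule_format, OF t])
      then show "(U has_vector_derivative g t) (at t within {0..\<delta>})"
        by (intro has_vector_derivative_transform[OF t U, where f' = "g t"]) simp_all
    qed
  qed
  \<comment> \<open>With orthonormal rows the defect factor of \<open>Pi_mult_transpose\<close>
    vanishes, and this is the orthogonality of \<open>U\<close> and its derivative.\<close>
  have gU: "U t ** transpose (g t) = 0" if t: "t \<in> {0..\<delta>}" for t
  proof -
    have "g t ** transpose (U t) = matrix_inv (gram M (Y t)) ** (cross t (U t) (Y t) ** (Pi (U t) ** transpose (U t)))"
      unfolding g_def G_def by (simp only: matrix_mul_assoc)
    also have "\<dots> = 0" by (simp add: Pi_mult_transpose orth[OF t] matrix_mult_zero)
    finally have "transpose (g t ** transpose (U t)) = 0" by (simp add: matrix_mult_zero)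
    then show ?thesis by (simp add: matrix_transpose_mul transpose_transpose)
  qed
  have first: "DO_first_equation M a \<delta> U Y"
    unfolding DO_first_equation_def
    using deriv
  proof eventually_elim
    case (elim t)
    show ?case
    proof (intro impI exI[of _ "g t"] conjI)
      assume t: "t \<in> {0..\<delta>}"
      then have t0: "0 \<le> t" by simp
      show "(U has_vector_derivative g t) (at t within {0..\<delta>})" using elim t by blast
      show "integrable M (\<lambda>\<omega>. outer_prod (Y t \<omega>) (a t (transpose (U t) *v Y t \<omega>)))"
        by (rule outer_prod_integral(1)[OF good(2)[OF t] good_coefficients(1)[OF good(1)[OF t] t0]])
      have "gram M (Y t) ** g t = cross t (U t) (Y t) ** Pi (U t)"
        unfolding g_def G_def
        by (simp only: matrix_mul_assoc matrix_inv_right[OF good_gram(1)[OF good(1)[OF t]]] matrix_mul_lid)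
      \<comment> \<open>Here the substitution is undone: with orthonormal rows
        \<open>Pi (U t)\<close> is the complement of the row projection.\<close>
      then show "gram M (Y t) ** g t =
          (\<integral>\<omega>. outer_prod (Y t \<omega>) (a t (transpose (U t) *v Y t \<omega>)) \<partial>M) ** (mat 1 - row_projection (U t))"
        unfolding row_projection_orthonormal[OF orth[OF t]] by (simp add: cross_def Pi_def)
    qed
  qed
  have second: "DO_second_equation M F W a b \<delta> U Y"
    unfolding DO_second_equation_def
  proof (intro conjI ballI)
    show "AE \<omega> in M. set_integrable lborel {0..\<delta>} (\<lambda>s. U s *v a s (transpose (U s) *v Y s \<omega>))"
      using drift_integrable[OF A] by (intro AE_I2) (simp add: drift_def)
    fix t assume t: "t \<in> {0..\<delta>}"
    obtain I where I: "has_matrix_ito_integral M F W (\<lambda>s \<omega>. \<chi> i. diffusion U Y s \<omega> $ i) t I"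
      "AE \<omega> in M. I \<omega> = (\<chi> i. X i t \<omega>)"
      using matrix_ito[where H = "\<lambda>i s \<omega>. diffusion U Y s \<omega> $ i" and X = X, OF delta_props(1) X t W] by blast
    show "\<exists>I. has_matrix_ito_integral M F W (\<lambda>s \<omega>. U s ** b s (transpose (U s) *v Y s \<omega>)) t I \<and>
      (AE \<omega> in M. Y t \<omega> = Y 0 \<omega> + (LINT s:{0..t}|lborel. U s *v a s (transpose (U s) *v Y s \<omega>)) + I \<omega>)"
    proof (intro exI[of _ I] conjI)
      show "has_matrix_ito_integral M F W (\<lambda>s \<omega>. U s ** b s (transpose (U s) *v Y s \<omega>)) t I"
        using I(1) by (simp add: vec_lambda_eta diffusion_def)
      show "AE \<omega> in M. Y t \<omega> = Y 0 \<omega> + (LINT s:{0..t}|lborel. U s *v a s (transpose (U s) *v Y s \<omega>)) + I \<omega>"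
        using I(2) Y0 YY[OF t] AE_space
      proof eventually_elim
        case (elim \<omega>)
        then show ?case by (simp add: Y'[OF t] drift_def add.assoc)
      qed
    qed
  qed
  have lip: "norm (U t - U s) \<le> G\<^sub>0 * (t - s)" if "0 \<le> s" "s \<le> t" "t \<le> \<delta>" for s t
    using integral_lipschitz(3)[OF G_admissible(3)[OF A] G_admissible(1)[OF A] that] that by (simp add: U g_def[abs_def])
  have solution: "strong_DO_solution M F W a b \<delta> U Y"
    unfolding strong_DO_solution_def
  proof (intro conjI ballI)
    show "in_L2 M (Y t)" if "t \<in> {0..\<delta>}" for t using good(2)[OF that] by (simp add: in_L2_def sq_integrable_def)
    show "orthonormal_rows (U 0)" by (simp add: U0 phi)
    show "abs_continuous_on 0 \<delta> U" by (rule lipschitz_imp_abs_continuous_on[OF lip])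
    show "AE t in lborel. t \<in> {0..\<delta>} \<longrightarrow>
        (\<exists>D. (U has_vector_derivative D) (at t within {0..\<delta>}) \<and> U t ** transpose D = 0)"
      using deriv by eventually_elim (use gU in blast)
    show "AE \<omega> in M. continuous_on {0..\<delta>} (\<lambda>t. Y t \<omega>)" by (intro AE_I2 admissibleD(3)[OF A])
    show "adapted_on F {0..\<delta>} Y" using admissibleD(2)[OF A] by (simp add: adapted_on_def)
  qed (rule indep first second z | assumption)+

  have det: "U \<in> D_det \<delta> \<eta> \<phi>"
    unfolding D_det_def mem_Collect_eq
  proof (intro conjI ballI admissibleD(1)[OF A])
    show "(SUP t\<in>{0..\<delta>}. (norm (U t))\<^sup>2) \<le> 3 * real CARD('r)"
      using z good(1) V_bounds(1) by (intro cSUP_least) (auto simp: good_def R_eq)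
    show "U t \<in> ball \<phi> \<eta>" if "t \<in> {0..\<delta>}" for t
      using picard_step_strict(1)[OF A S that] by (simp add: UU[OF that] dist_norm norm_minus_commute)
  qed
  have "Y \<in> D_sto M F \<delta> \<eta> \<rho> \<xi>"
    unfolding D_sto_def mem_Collect_eq
  proof (intro conjI ballI)
    show "adapted_on F {0..\<delta>} Y" using admissibleD(2)[OF A] by (simp add: adapted_on_def)
    show "AE \<omega> in M. continuous_on {0..\<delta>} (\<lambda>t. Y t \<omega>)" by (intro AE_I2 admissibleD(3)[OF A])
    \<comment> \<open>Almost sure equality at each time holds simultaneously on a countable dense
      set of times, and continuity extends it to the supremum.\<close>
    have "AE \<omega> in M. \<forall>t\<in>dyadic_points \<delta>. Y t \<omega> = Y' t \<omega>"
      using YY dyadic_points_subset[OF delta_in(2)] by (subst AE_ball_countable) auto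
    then have "AE \<omega> in M. (SUP t\<in>{0..\<delta>}. ennreal ((norm (Y t \<omega>))\<^sup>2)) = (SUP t\<in>{0..\<delta>}. ennreal ((norm (Y' t \<omega>))\<^sup>2))"
      using AE_space
    proof eventually_elim
      case (elim \<omega>)
      have "continuous_on {0..\<delta>} (\<lambda>t. ennreal ((norm (Y t \<omega>))\<^sup>2))" "continuous_on {0..\<delta>} (\<lambda>t. ennreal ((norm (Y' t \<omega>))\<^sup>2))"
        by (intro continuous_on_ennreal continuous_intros admissibleD(3)[OF A] admissibleD(3)[OF A'] elim)+
      then show ?case using elim(1) by (simp add: SUP_continuous_dyadic[OF _ delta_in(2)])
    qed
    then have "(\<integral>\<^sup>+\<omega>. (SUP t\<in>{0..\<delta>}. ennreal ((norm (Y t \<omega>))\<^sup>2)) \<partial>M) =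
        (\<integral>\<^sup>+\<omega>. (SUP t\<in>{0..\<delta>}. ennreal ((norm (Y' t \<omega>))\<^sup>2)) \<partial>M)"
      by (rule nn_integral_cong_AE)
    with picard_step_sup[OF A S]
    show "(\<integral>\<^sup>+\<omega>. (SUP t\<in>{0..\<delta>}. ennreal ((norm (Y t \<omega>))\<^sup>2)) \<partial>M) \<le> ennreal (3 * \<rho>\<^sup>2 + 1)" by simp
    fix t assume t: "t \<in> {0..\<delta>}"
    have [measurable]: "Y t \<in> borel_measurable M" "Y' t \<in> borel_measurable M" "\<xi> \<in> borel_measurable M"
      by (intro sq_integrableD(1) good(2)[OF t] admissibleD(5)[OF A' t] xi_sq)+
    have "mean_sq M (\<lambda>\<omega>. Y t \<omega> - \<xi> \<omega>) = mean_sq M (\<lambda>\<omega>. Y' t \<omega> - \<xi> \<omega>)"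
      unfolding mean_sq_def
    proof (rule integral_cong_AE)
      show "AE \<omega> in M. (norm (Y t \<omega> - \<xi> \<omega>))\<^sup>2 = (norm (Y' t \<omega> - \<xi> \<omega>))\<^sup>2"
        using YY[OF t] by eventually_elim simp
    qed measurable
    then have "mean_sq M (\<lambda>\<omega>. Y t \<omega> - \<xi> \<omega>) < \<eta>\<^sup>2" using picard_step_mean_sq_less[OF A S t] by simp
    then have "sqrt (mean_sq M (\<lambda>\<omega>. Y t \<omega> - \<xi> \<omega>)) < sqrt (\<eta>\<^sup>2)" by (rule real_sqrt_less_mono)
    then show "L2_norm M (\<lambda>\<omega>. Y t \<omega> - \<xi> \<omega>) < \<eta>" using eta_props(1) by (simp add: L2_norm_def mean_sq_def)
  qed
  with det solution U0 Y0 show ?thesis by blast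
qed

end

theorem theorem3p4:
  fixes M :: "'w measure" and F :: "real \<Rightarrow> 'w measure" and W :: "real \<Rightarrow> 'w \<Rightarrow> real ^ 'm"
    and a :: "real \<Rightarrow> real ^ 'd \<Rightarrow> real ^ 'd"
    and b :: "real \<Rightarrow> real ^ 'd \<Rightarrow> real ^ 'm ^ 'd"
    and \<phi> :: "real ^ 'd ^ 'R" and \<xi> :: "'w \<Rightarrow> real ^ 'R"
    and C\<^sub>L\<^sub>i\<^sub>p C\<^sub>l\<^sub>g\<^sub>b \<rho> \<gamma> \<eta> \<delta> :: real
  assumes bm: "brownian_motion M F W"
    and R_le_d: "CARD('R) \<le> CARD('d)"
    and a_meas: "(\<lambda>(s, x). a s x) \<in> borel_measurable (restrict_space borel {0..} \<Otimes>\<^sub>M borel)"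
    and b_meas: "(\<lambda>(s, x). b s x) \<in> borel_measurable (restrict_space borel {0..} \<Otimes>\<^sub>M borel)"
    and C_Lip_pos: "C\<^sub>L\<^sub>i\<^sub>p > 0"
    and a_Lip: "\<And>s x y. s \<ge> 0 \<Longrightarrow> norm (a s x - a s y) \<le> C\<^sub>L\<^sub>i\<^sub>p * norm (x - y)"
    and b_Lip: "\<And>s x y. s \<ge> 0 \<Longrightarrow> norm (b s x - b s y) \<le> C\<^sub>L\<^sub>i\<^sub>p * norm (x - y)"
    and C_lgb_pos: "C\<^sub>l\<^sub>g\<^sub>b > 0"
    and lgb: "\<And>s x. s \<ge> 0 \<Longrightarrow>
      (norm (a s x))\<^sup>2 + (norm (b s x))\<^sup>2 \<le> C\<^sub>l\<^sub>g\<^sub>b * (1 + (norm x)\<^sup>2)"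
    and phi: "orthonormal_rows \<phi>"
    and xi_meas: "\<xi> \<in> borel_measurable (F 0)"
    and xi_L2: "in_L2 M \<xi>"
    and rho: "L2_norm M \<xi> = \<rho>" "\<rho> > 0"
    and gram_inv: "invertible (gram M \<xi>)"
    and gamma: "norm (matrix_inv (gram M \<xi>)) = \<gamma>" "\<gamma> > 0"
    and eta: "\<eta> = DO_eta CARD('R) \<rho> \<gamma>"
    and delta: "\<delta> = DO_delta CARD('R) \<rho> \<gamma> C\<^sub>l\<^sub>g\<^sub>b"
  shows "\<exists>U Y. strong_DO_solution M F W a b \<delta> U Y \<and>
    U 0 = \<phi> \<and> (AE \<omega> in M. Y 0 \<omega> = \<xi> \<omega>) \<and>
    (U, Y) \<in> D_det \<delta> \<eta> \<phi> \<times> D_sto M F \<delta> \<eta> \<rho> \<xi>"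
proof -
  interpret bm: brownian_motion M F W by (rule bm)
  \<comment> \<open>The integral is built for a continuous version; since it agrees with
    \<open>W\<close> at all times off one null set, the result is also an integral against
    \<open>W\<close>.\<close>
  obtain B where B: "continuous_brownian_motion M F B" "AE \<omega> in M. \<forall>t. B t \<omega> = W t \<omega>"
    by (rule bm.continuous_version)
  interpret continuous_brownian_motion M F B by (rule B(1))
  interpret DO_setting M F B a b \<phi> \<xi> "C\<^sub>L\<^sub>i\<^sub>p" "C\<^sub>l\<^sub>g\<^sub>b" \<rho> \<gamma> \<eta> \<delta> "real CARD('R)"
    by unfold_locales (fact refl a_meas b_meas C_Lip_pos a_Lip b_Lip C_lgb_pos lgb phi xi_meas xi_L2 rho gram_inv gamma eta delta)+
  show ?thesis
    by (rule local_solution[OF bm.measurable_F_M[OF bm.W_adapted] B(2)])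
qed

end
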